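(* Let $G$ be a connected, locally finite graph, let $\Gamma\subseteq\mathrm{Aut}(G)$ be quasi-transitive and nonunimodular with edge-orbits $O_1,\ldots,O_k$, and consider anisotropic bond percolation on $G$. Suppose that $\mathbf{p}(t):[0,1]\to[0,1]^k$ is continuous and increasing with $\mathbf{p}(0)=(0,\ldots,0)$, $\mathbf{p}(1)=(1,\ldots,1)$, and with $\mathbf{p}(t)\in(0,1)^k$ for every $0<t<1$. Then there must exist a positive-length interval $I\subseteq(0,1)$ such that 1. $G[\mathbf{p}(t)]$ has an infinite cluster almost surely for each $t\in I$, and 2. $\chi_{\mathbf{p}(t),1/2}<\infty$ for every $t\in I$. In particular, $G[\mathbf{p}(t)]$ has infinitely many light infinite clusters almost surely for each $t\in I$.
   Context: Let $G=(V,E)$. A subgroup $\Gamma\subseteq\mathrm{Aut}(G)$ is quasi-transitive if its action on $V$ has only finitely many orbits. It is unimodular if $|\mathrm{Stab}_v u|=|\mathrm{Stab}_u v|$ for all $u,v\in V$ in the same $\Gamma$-orbit, where $\mathrm{Stab}_x$ is the stabilizer of $x$ in $\Gamma$ and $\mathrm{Stab}_x y$ is the orbit of $y$ under $\mathrm{Stab}_x$; otherwise it is nonunimodular. Anisotropic bond percolation: let $O_1,\ldots,O_k$ be the orbits of $\Gamma$ on the edge set $E$. For $\mathbf{p}=(p_1,\ldots,p_k)\in[0,1]^k$, $G[\mathbf{p}]$ is the random subgraph in which each edge in $O_i$ is retained with probability $p_i$, independently of all other edges. Clusters are connected components of $G[\mathbf{p}]$. "Increasing" for $\mathbf{p}(t)$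 refers to the coordinatewise order. Modular function: let $[v]$ denote the $\Gamma$-orbit of $v$. If $(X_n)$ is the lazy simple random walk on $G$ (stay put with probability $1/2$, otherwise cross a uniformly chosen incident edge), then $([X_n])$ is an irreducible Markov chain on the finite set of orbits; let $\tilde\mu$ be its stationary probability measure and let $\mu([v])=\tilde\mu([v])\deg(v)^{-1}/\sum_{[o]}\tilde\mu([o])\deg(o)^{-1}$, the sum being over all orbits. Define $\Delta(u,v)=\dfrac{\mu([v])\,|\mathrm{Stab}_v u|}{\mu([u])\,|\mathrm{Stab}_u v|}$ for $u,v\in V$. Tilted susceptibility: $\chi_{\mathbf{p},\lambda}(v)=\sum_{u\in V}\mathbf{P}_{\mathbf{p}}(u\leftrightarrow v)\Delta(v,u)^\lambda$, where $u\leftrightarrow v$ means that $u,v$ lie in the same cluster of $G[\mathbf{p}]$, and $\chi_{\mathbf{p},\lambda}=\sum_{[v]}\mu([v])\chi_{\mathbf{p},\lambda}(v)$, the sum being over orbits. A set $K\subseteq V$ is light if $\sum_{y\in K}\Delta(x,y)<\infty$ for some (equivalently, every) $x\in V$. *)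

theory Defs
  imports "HOL-Algebra.Group_Action" "HOL-Probability.Probability"
begin

section \<open>Graphs and their automorphisms\<close>

text \<open>Graphs are simple and undirected, with vertex set \<open>V\<close> and edge set \<open>E\<close> of two-element
  subsets of \<open>V\<close>.\<close>

definition simple_graph :: "'v set \<Rightarrow> 'v set set \<Rightarrow> bool" where
  "simple_graph V E \<longleftrightarrow> V \<noteq> {} \<and> E \<subseteq> {{u, v} |u v. u \<in> V \<and> v \<in> V \<and> u \<noteq> v}"

definition neighbours :: "'v set set \<Rightarrow> 'v \<Rightarrow> 'v set" where
  "neighbours E v = {u. {v, u} \<in> E}"

definition degree :: "'v set set \<Rightarrow> 'v \<Rightarrow> nat" where
  "degree E v = card (neighbours E v)"

definition locally_finite_graph :: "'v set \<Rightarrow> 'v set set \<Rightarrow> bool" where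
  "locally_finite_graph V E \<longleftrightarrow> (\<forall>v\<in>V. finite (neighbours E v))"

definition linked :: "'v set set \<Rightarrow> 'v \<Rightarrow> 'v \<Rightarrow> bool" where
  "linked F u v \<longleftrightarrow> (u, v) \<in> {(x, y). {x, y} \<in> F}\<^sup>*"

definition connected_graph :: "'v set \<Rightarrow> 'v set set \<Rightarrow> bool" where
  "connected_graph V E \<longleftrightarrow> (\<forall>u\<in>V. \<forall>v\<in>V. linked E u v)"

text \<open>Vertex sets of the connected components of the graph with vertex set \<open>V\<close> and edge set
  \<open>F\<close>; isolated vertices form singleton clusters.\<close>

definition clusters :: "'v set \<Rightarrow> 'v set set \<Rightarrow> 'v set set" where
  "clusters V F = {{u \<in> V. linked F v u} |v. v \<in> V}"

definition graph_aut :: "'v set \<Rightarrow> 'v set set \<Rightarrow> ('v \<Rightarrow> 'v) monoid" where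
  "graph_aut V E = BijGroup V
     \<lparr>carrier := {g \<in> Bij V. \<forall>u\<in>V. \<forall>v\<in>V. {g u, g v} \<in> E \<longleftrightarrow> {u, v} \<in> E}\<rparr>"

text \<open>A set \<open>\<Gamma>\<close> of permutations of \<open>V\<close>, regarded as a group.\<close>

abbreviation perm_group :: "'v set \<Rightarrow> ('v \<Rightarrow> 'v) set \<Rightarrow> ('v \<Rightarrow> 'v) monoid" where
  "perm_group V \<Gamma> \<equiv> BijGroup V \<lparr>carrier := \<Gamma>\<rparr>"

definition vertex_orbit :: "'v set \<Rightarrow> ('v \<Rightarrow> 'v) set \<Rightarrow> 'v \<Rightarrow> 'v set" where
  "vertex_orbit V \<Gamma> v = orbit (perm_group V \<Gamma>) (\<lambda>g. g) v"

definition vertex_orbits :: "'v set \<Rightarrow> ('v \<Rightarrow> 'v) set \<Rightarrow> 'v set set" where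
  "vertex_orbits V \<Gamma> = orbits (perm_group V \<Gamma>) V (\<lambda>g. g)"

definition edge_orbits :: "'v set \<Rightarrow> 'v set set \<Rightarrow> ('v \<Rightarrow> 'v) set \<Rightarrow> 'v set set set" where
  "edge_orbits V E \<Gamma> = orbits (perm_group V \<Gamma>) E (\<lambda>g e. g ` e)"

definition stab :: "'v set \<Rightarrow> ('v \<Rightarrow> 'v) set \<Rightarrow> 'v \<Rightarrow> ('v \<Rightarrow> 'v) set" where
  "stab V \<Gamma> v = stabilizer (perm_group V \<Gamma>) (\<lambda>g. g) v"

text \<open>\<open>stab_orbit_card V \<Gamma> v u\<close> is $|\mathrm{Stab}_v u|$.  In a connected, locally finite graph
  this orbit is finite, being contained in a sphere around \<open>v\<close>.\<close>

definition stab_orbit_card :: "'v set \<Rightarrow> ('v \<Rightarrow> 'v) set \<Rightarrow> 'v \<Rightarrow> 'v \<Rightarrow> nat" where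
  "stab_orbit_card V \<Gamma> v u = card (vertex_orbit V (stab V \<Gamma> v) u)"

definition quasi_transitive :: "'v set \<Rightarrow> ('v \<Rightarrow> 'v) set \<Rightarrow> bool" where
  "quasi_transitive V \<Gamma> \<longleftrightarrow> finite (vertex_orbits V \<Gamma>)"

definition unimodular :: "'v set \<Rightarrow> ('v \<Rightarrow> 'v) set \<Rightarrow> bool" where
  "unimodular V \<Gamma> \<longleftrightarrow>
     (\<forall>u\<in>V. \<forall>v\<in>V. vertex_orbit V \<Gamma> u = vertex_orbit V \<Gamma> v \<longrightarrow>
        stab_orbit_card V \<Gamma> v u = stab_orbit_card V \<Gamma> u v)"

section \<open>The modular function\<close>

definition lazy_srw :: "'v set set \<Rightarrow> 'v \<Rightarrow> 'v pmf" where
  "lazy_srw E v = bind_pmf (bernoulli_pmf (1 / 2))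
     (\<lambda>stay. if stay then return_pmf v else pmf_of_set (neighbours E v))"

text \<open>Functions of an orbit are evaluated at an arbitrary representative; wherever this is done
  below, the result does not depend on the choice, by invariance under \<open>\<Gamma>\<close>.\<close>

definition rep :: "'v set \<Rightarrow> 'v" where
  "rep C = (SOME v. v \<in> C)"

definition orbit_chain :: "'v set \<Rightarrow> 'v set set \<Rightarrow> ('v \<Rightarrow> 'v) set \<Rightarrow> 'v set \<Rightarrow> 'v set pmf" where
  "orbit_chain V E \<Gamma> C = map_pmf (vertex_orbit V \<Gamma>) (lazy_srw E (rep C))"

text \<open>For connected \<open>E\<close> and quasi-transitive \<open>\<Gamma>\<close> the orbit chain is irreducible on a finite
  state space, so its stationary distribution exists and is unique.\<close>

definition mu_tilde :: "'v set \<Rightarrow> 'v set set \<Rightarrow> ('v \<Rightarrow> 'v) set \<Rightarrow> 'v set pmf" where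
  "mu_tilde V E \<Gamma> = (THE \<nu>. set_pmf \<nu> \<subseteq> vertex_orbits V \<Gamma> \<and> bind_pmf \<nu> (orbit_chain V E \<Gamma>) = \<nu>)"

definition mu :: "'v set \<Rightarrow> 'v set set \<Rightarrow> ('v \<Rightarrow> 'v) set \<Rightarrow> 'v set \<Rightarrow> real" where
  "mu V E \<Gamma> C =
     (pmf (mu_tilde V E \<Gamma>) C / real (degree E (rep C))) /
     (\<Sum>D\<in>vertex_orbits V \<Gamma>. pmf (mu_tilde V E \<Gamma>) D / real (degree E (rep D)))"

definition modular :: "'v set \<Rightarrow> 'v set set \<Rightarrow> ('v \<Rightarrow> 'v) set \<Rightarrow> 'v \<Rightarrow> 'v \<Rightarrow> real" where
  "modular V E \<Gamma> u v =
     (mu V E \<Gamma> (vertex_orbit V \<Gamma> v) * real (stab_orbit_card V \<Gamma> v u)) /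
     (mu V E \<Gamma> (vertex_orbit V \<Gamma> u) * real (stab_orbit_card V \<Gamma> u v))"

definition light :: "'v set \<Rightarrow> 'v set set \<Rightarrow> ('v \<Rightarrow> 'v) set \<Rightarrow> 'v set \<Rightarrow> bool" where
  "light V E \<Gamma> K \<longleftrightarrow> (\<exists>x\<in>V. (\<lambda>y. modular V E \<Gamma> x y) summable_on K)"

section \<open>Anisotropic bond percolation\<close>

text \<open>The family \<open>Orb\<close>, indexed by the finite type \<open>'k\<close>, enumerates the edge orbits.  A
  configuration \<open>\<omega>\<close> maps each edge to \<open>True\<close> if it is retained.\<close>

definition bond_percolation ::
    "'v set set \<Rightarrow> ('k::finite \<Rightarrow> 'v set set) \<Rightarrow> real ^ 'k \<Rightarrow> ('v set \<Rightarrow> bool) measure" where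
  "bond_percolation E Orb p =
     (\<Pi>\<^sub>M e\<in>E. measure_pmf (bernoulli_pmf (p $ (THE i. e \<in> Orb i))))"

definition open_edges :: "'v set set \<Rightarrow> ('v set \<Rightarrow> bool) \<Rightarrow> 'v set set" where
  "open_edges E \<omega> = {e \<in> E. \<omega> e}"

definition connection_prob ::
    "'v set set \<Rightarrow> ('k::finite \<Rightarrow> 'v set set) \<Rightarrow> real ^ 'k \<Rightarrow> 'v \<Rightarrow> 'v \<Rightarrow> real" where
  "connection_prob E Orb p u v =
     measure (bond_percolation E Orb p)
       {\<omega> \<in> space (bond_percolation E Orb p). linked (open_edges E \<omega>) u v}"

definition tilted_susceptibility_at ::
    "'v set \<Rightarrow> 'v set set \<Rightarrow> ('v \<Rightarrow> 'v) set \<Rightarrow> ('k::finite \<Rightarrow> 'v set set) \<Rightarrow> real ^ 'k \<Rightarrow> real \<Rightarrow>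
     'v \<Rightarrow> ennreal" where
  "tilted_susceptibility_at V E \<Gamma> Orb p \<theta> v =
     (\<Sum>\<^sub>\<infinity>u\<in>V. ennreal (connection_prob E Orb p u v * modular V E \<Gamma> v u powr \<theta>))"

definition tilted_susceptibility ::
    "'v set \<Rightarrow> 'v set set \<Rightarrow> ('v \<Rightarrow> 'v) set \<Rightarrow> ('k::finite \<Rightarrow> 'v set set) \<Rightarrow> real ^ 'k \<Rightarrow> real \<Rightarrow>
     ennreal" where
  "tilted_susceptibility V E \<Gamma> Orb p \<theta> =
     (\<Sum>C\<in>vertex_orbits V \<Gamma>.
        ennreal (mu V E \<Gamma> C) * tilted_susceptibility_at V E \<Gamma> Orb p \<theta> (rep C))"

end

theory Submission
  imports Defs
begin

text \<open>Nonunimodularity yields a \<Gamma>-equivariant height \<open>L\<close> such that \<open>\<Delta>(x, y)\<close> is comparable to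
 \<open>exp (s (L y - L x))\<close> with \<open>s > 0\<close>. Weight the susceptibility by \<open>Th (L w - L v)\<close>, which dominates
 \<open>exp (s (L w - L v) / 2)\<close>, and let \<open>t*\<close> be the supremum of the parameters where it is finite. A
 finite-volume criterion in the manner of Simon and Lieb makes finiteness an open condition, so the
 weighted susceptibility is infinite at \<open>t*\<close>. Let \<open>\<alpha>\<close> and \<open>\<kappa>\<close> be the exponential rates of decay at
 \<open>t*\<close> of upward and downward connections. If there are no infinite clusters below \<open>t*\<close>, then, after
 reversing heights if necessary, \<open>0 \<le> \<kappa> + s \<le> \<alpha>\<close>: otherwise the sets of vertices reached grow at
 a rate that forces percolation. In this case a law of large numbers for downward exploration bounds
 the tail of the number of vertices reached in a layer; together with second moments and the BK
 inequality this bounds the weighted susceptibility by a power of itself with exponent less than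
 one, hence uniformly below \<open>t*\<close>, so that it would be finite at \<open>t*\<close>. Therefore infinite clusters
 occur on some interval \<open>(t\<^sub>1, t*)\<close>. There all clusters are light, and by Kolmogorov's zero-one law
 infinitely many terms of a sequence in one orbit with heights tending to infinity lie in infinite
 clusters; a light cluster contains only finitely many of them.\<close>

section \<open>Product measures\<close>

text \<open>A bare logarithm of the modular function does not separate heights well enough. It is
  corrected by a function of the vertex orbit, so that a walk climbs by 1 inside one orbit while its
  interior keeps distance \<open>g\<close> from both end levels. With this gap, what happens below
  and above a layer of width \<open>g\<close> depends on disjoint edge sets. \<open>Th\<close> mixes
  the exponents 1/4 and 3/4: mass transport exchanges them, the exponent 1/2 of the theorem lies
  between them, and exponent 1/2 up to a branch point with 1/4 on each branch afterwards makes the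
  branch point cancel in second moments. The main obstacle is that a large expected number of
  connections from a layer may end in few vertices. Therefore every vertex divides mass 1 among the
  lower vertices that it is joined to. Mass transport then turns the probability of a single descent
  into a lower bound for the expected number of distinct vertices reached upwards, and local
  dependence turns this expectation into high probability. The sign of \<open>s\<close> stays free
  in most of the work, because reversing heights replaces \<open>s\<close> by
  \<open>- s\<close>.\<close>

text \<open>Events are predicates on configurations, to avoid carrying the extensional sample space:
 \<open>ms\<close> is measurability, \<open>pp\<close> probability, and \<open>occ S\<close> says that some member of \<open>S\<close> is open.\<close>

definition PM :: "'e set \<Rightarrow> ('e \<Rightarrow> real) \<Rightarrow> ('e \<Rightarrow> bool) measure" where
 "PM E pe = (\<Pi>\<^sub>M e\<in>E. measure_pmf (bernoulli_pmf (pe e)))"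

definition occ :: "'e set set \<Rightarrow> ('e \<Rightarrow> bool) \<Rightarrow> bool" where
 "occ \<S> xi \<longleftrightarrow> (\<exists>S\<in>\<S>. \<forall>e\<in>S. xi e)"

definition pp :: "'e set \<Rightarrow> ('e \<Rightarrow> real) \<Rightarrow> (('e \<Rightarrow> bool) \<Rightarrow> bool) \<Rightarrow> real" where
 "pp E pe P = measure (PM E pe) {xi \<in> space (PM E pe). P xi}"

definition fam :: "'e set \<Rightarrow> 'e set set" where
 "fam E = {S. finite S & S \<subseteq> E}"

definition dep :: "'e set \<Rightarrow> (('e \<Rightarrow> bool) \<Rightarrow> bool) \<Rightarrow> bool" where
 "dep I P \<longleftrightarrow> (\<forall>xi xi'. (\<forall>e\<in>I. xi e = xi' e) --> P xi = P xi')"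

definition ms :: "'e set \<Rightarrow> (('e \<Rightarrow> bool) \<Rightarrow> bool) \<Rightarrow> bool" where
 "ms E P \<longleftrightarrow> {xi \<in> (\<Pi>\<^sub>E e\<in>E. UNIV). P xi} \<in> sets (\<Pi>\<^sub>M e\<in>E. count_space (UNIV :: bool set))"

lemma depD: "dep I P ==> (!!e. e \<in> I ==> xi e = xi' e) ==> P xi = P xi'"
 unfolding dep_def by simp

lemma dep_occ: "\<Union>\<S> \<subseteq> I ==> dep I (occ \<S>)"
 unfolding dep_def occ_def by (metis UnionI subsetD)

lemma sets_PM: "sets (PM E pe) = sets (\<Pi>\<^sub>M e\<in>E. count_space (UNIV :: bool set))"
 unfolding PM_def by (rule sets_PiM_cong) auto

lemma space_PM: "space (PM E pe) = (\<Pi>\<^sub>E e\<in>E. UNIV)"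
 unfolding PM_def by (simp add: space_PiM)

lemma space_PI: "space (\<Pi>\<^sub>M e\<in>E. count_space (UNIV :: bool set)) = (\<Pi>\<^sub>E e\<in>E. UNIV)"
 by (simp add: space_PiM)

lemma msD: "ms E P ==> {xi \<in> space (PM E pe). P xi} \<in> sets (PM E pe)"
 unfolding ms_def sets_PM space_PM .

lemma prob_space_PM [simp, intro]: "prob_space (PM E pe)"
 unfolding PM_def by (intro prob_space_PiM) (auto intro: measure_pmf.prob_space_axioms)

lemma ms_coord: assumes "e \<in> E" shows "ms E (%xi. xi e)"
proof -
 have "(%xi. xi e) -` {True} \<inter> space (\<Pi>\<^sub>M e\<in>E. count_space (UNIV :: bool set)) \<in> sets (\<Pi>\<^sub>M e\<in>E. count_space (UNIV :: bool set))"
  by (rule measurable_sets[OF measurable_component_singleton[OF assms]]) simp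
 moreover have "(%xi. xi e) -` {True} \<inter> space (\<Pi>\<^sub>M e\<in>E. count_space (UNIV :: bool set)) = {xi \<in> (\<Pi>\<^sub>E e\<in>E. UNIV). xi e}"
  unfolding space_PI by blast
 ultimately show ?thesis unfolding ms_def by simp
qed

lemma ms_const [simp]: "ms E (%xi. c)"
proof (cases c)
 case True
 have "space (\<Pi>\<^sub>M e\<in>E. count_space (UNIV :: bool set)) \<in> sets (\<Pi>\<^sub>M e\<in>E. count_space (UNIV :: bool set))" by (rule sets.top)
 then show ?thesis using True unfolding ms_def space_PI by simp
qed (simp add: ms_def)

lemma ms_conj: "ms E P ==> ms E Q ==> ms E (%xi. P xi & Q xi)"
 unfolding ms_def using sets.sets_Collect_conj[where M = "\<Pi>\<^sub>M e\<in>E. count_space (UNIV :: bool set)" and P = Q and Q = P]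
 unfolding space_PI by blast

lemma ms_disj: "ms E P ==> ms E Q ==> ms E (%xi. P xi \<or> Q xi)"
 unfolding ms_def using sets.sets_Collect_disj[where M = "\<Pi>\<^sub>M e\<in>E. count_space (UNIV :: bool set)" and P = Q and Q = P]
 unfolding space_PI by blast

lemma ms_not: "ms E P ==> ms E (%xi. \<not> P xi)"
 unfolding ms_def using sets.sets_Collect_neg[where M = "\<Pi>\<^sub>M e\<in>E. count_space (UNIV :: bool set)" and P = P]
 unfolding space_PI .

lemma ms_ex: "countable I ==> (!!i. i \<in> I ==> ms E (P i)) ==> ms E (%xi. \<exists>i\<in>I. P i xi)"
 unfolding ms_def using sets.sets_Collect_countable_Ex'[where M = "\<Pi>\<^sub>M e\<in>E. count_space (UNIV :: bool set)" and P = P and I = I]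
 unfolding space_PI by blast

lemma ms_all: "countable I ==> (!!i. i \<in> I ==> ms E (P i)) ==> ms E (%xi. \<forall>i\<in>I. P i xi)"
 using ms_not[OF ms_ex[of I E "%i xi. \<not> P i xi", OF _ ms_not]] by simp

lemma countable_fam: "countable E ==> countable (fam E)"
 unfolding fam_def by (rule countable_Collect_finite_subset)

lemma ms_occ: assumes "countable E" "\<S> \<subseteq> fam E" shows "ms E (occ \<S>)"
proof -
 have c: "countable \<S>" using assms countable_fam countable_subset by blast
 have "ms E (%xi. \<exists>S\<in>\<S>. \<forall>e\<in>S. xi e)"
 proof (rule ms_ex[OF c])
  fix S assume "S \<in> \<S>"
  then have "finite S" "S \<subseteq> E" using assms by (auto simp: fam_def)
  then show "ms E (%xi. \<forall>e\<in>S. xi e)"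
   by (intro ms_all ms_coord) (auto intro: countable_finite)
 qed
 then show ?thesis by (simp add: occ_def[abs_def])
qed

lemma pp_mono: assumes "ms E Q" "!!xi. P xi ==> Q xi" shows "pp E pe P <= pp E pe Q"
proof -
 interpret prob_space "PM E pe" by simp
 have "{xi \<in> space (PM E pe). P xi} \<subseteq> {xi \<in> space (PM E pe). Q xi}" using assms(2) by blast
 then show ?thesis unfolding pp_def using assms(1)[THEN msD] by (rule finite_measure_mono)
qed

lemma pp_nonneg [simp]: "0 <= pp E pe P" unfolding pp_def by simp

lemma pp_le_1 [simp]: "pp E pe P <= 1"
proof -
 interpret prob_space "PM E pe" by simp
 show ?thesis unfolding pp_def by simp
qed

lemma pp_True [simp]: "pp E pe (%xi. True) = 1"
proof -
 interpret prob_space "PM E pe" by simp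
 show ?thesis unfolding pp_def by (simp add: prob_space)
qed

lemma pp_False [simp]: "pp E pe (%xi. False) = 0"
 unfolding pp_def by simp

lemma pp_not: "ms E P ==> pp E pe (%xi. \<not> P xi) = 1 - pp E pe P"
proof -
 interpret prob_space "PM E pe" by simp
 assume "ms E P"
 then have "{xi \<in> space (PM E pe). P xi} \<in> events" by (rule msD)
 then have "prob (space (PM E pe) - {xi \<in> space (PM E pe). P xi}) = 1 - prob {xi \<in> space (PM E pe). P xi}" by (rule prob_compl)
 moreover have "space (PM E pe) - {xi \<in> space (PM E pe). P xi} = {xi \<in> space (PM E pe). \<not> P xi}" by blast
 ultimately show ?thesis unfolding pp_def by simp
qed

lemma pp_add: assumes "ms E P" "ms E Q" "!!xi. \<not> (P xi & Q xi)"
 shows "pp E pe (%xi. P xi \<or> Q xi) = pp E pe P + pp E pe Q"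
proof -
 interpret prob_space "PM E pe" by simp
 have "{xi \<in> space (PM E pe). P xi \<or> Q xi} = {xi \<in> space (PM E pe). P xi} \<union> {xi \<in> space (PM E pe). Q xi}" by blast
 moreover have "{xi \<in> space (PM E pe). P xi} \<inter> {xi \<in> space (PM E pe). Q xi} = {}" using assms(3) by blast
 ultimately show ?thesis unfolding pp_def
  using finite_measure_Union[OF assms(1)[THEN msD] assms(2)[THEN msD]] by simp
qed

lemma pp_sub: assumes "ms E P" "ms E Q"
 shows "pp E pe (%xi. P xi \<or> Q xi) <= pp E pe P + pp E pe Q"
proof -
 interpret prob_space "PM E pe" by simp
 have "{xi \<in> space (PM E pe). P xi \<or> Q xi} = {xi \<in> space (PM E pe). P xi} \<union> {xi \<in> space (PM E pe). Q xi}" by blast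
 then show ?thesis unfolding pp_def
  using measure_Un_le[OF assms(1)[THEN msD] assms(2)[THEN msD]] by simp
qed

text \<open>The joint map of the coordinates is the identity, so the criterion that the joint law be
  the product of the marginals holds by the construction of \<open>PM\<close>. The criterion speaks
  of a nonempty index set, hence the case distinction.\<close>

lemma indep_vars_PM: "prob_space.indep_vars (PM E pe) (%e. count_space UNIV) (%e xi. xi e) E"
proof (cases "E = {}")
 case True
 interpret prob_space "PM E pe" by simp
 show ?thesis unfolding True prob_space.indep_vars_def[OF prob_space_PM] prob_space.indep_sets_def[OF prob_space_PM] by auto
next
 case False
 interpret prob_space "PM E pe" by simp
 interpret product_prob_space "%e. measure_pmf (bernoulli_pmf (pe e))" E
  by unfold_locales
 have "distr (PM E pe) (\<Pi>\<^sub>M i\<in>E. count_space UNIV) (%x. \<lambda>i\<in>E. x i) = distr (PM E pe) (PM E pe) (%x. x)"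
 proof (rule distr_cong)
  show "sets (\<Pi>\<^sub>M i\<in>E. count_space UNIV) = sets (PM E pe)" by (rule sets_PM[symmetric])
  show "(\<lambda>i\<in>E. x i) = x" if "x \<in> space (PM E pe)" for x
   using that unfolding space_PM by (simp add: PiE_restrict)
 qed simp
 also have "... = PM E pe" by simp
 also have "... = (\<Pi>\<^sub>M i\<in>E. distr (PM E pe) (count_space UNIV) (%xi. xi i))"
  unfolding PM_def
 proof (rule PiM_cong)
  fix e assume "e \<in> E"
  have "distr (Pi\<^sub>M E (%e. measure_pmf (bernoulli_pmf (pe e)))) (count_space UNIV) (%xi. xi e)
   = distr (Pi\<^sub>M E (%e. measure_pmf (bernoulli_pmf (pe e)))) (measure_pmf (bernoulli_pmf (pe e))) (%xi. xi e)"
   by (rule distr_cong) auto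
  with PiM_component[OF \<open>e \<in> E\<close>]
  show "measure_pmf (bernoulli_pmf (pe e)) = distr (Pi\<^sub>M E (%e. measure_pmf (bernoulli_pmf (pe e)))) (count_space UNIV) (%xi. xi e)"
   by (simp only:)
 qed simp
 finally have *: "distr (PM E pe) (\<Pi>\<^sub>M i\<in>E. count_space UNIV) (%x. \<lambda>i\<in>E. x i) = (\<Pi>\<^sub>M i\<in>E. distr (PM E pe) (count_space UNIV) (%xi. xi i))" .
 have "(%xi. xi e) \<in> PM E pe \<rightarrow>\<^sub>M count_space UNIV" if "e \<in> E" for e
  using measurable_component_singleton[OF that, of "%_. count_space UNIV"]
   measurable_cong_sets[OF sets_PM[of E pe] refl, of "count_space (UNIV :: bool set)"] by simp
 then show ?thesis using * by (simp only: prob_space.indep_vars_iff_distr_eq_PiM'[OF prob_space_PM False])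
qed

text \<open>An event that depends on \<open>I\<close> only is the preimage, under restriction to
  \<open>I\<close>, of an event on the smaller product: extend a configuration on \<open>I\<close>
  by False and test the event there. Independence of disjoint blocks of coordinates then
  applies.\<close>

lemma pp_indep:
 assumes P: "ms E P" "dep I P" and Q: "ms E Q" "dep J Q" and IJ: "I \<inter> J = {}" "I \<subseteq> E" "J \<subseteq> E"
 shows "pp E pe (%xi. P xi & Q xi) = pp E pe P * pp E pe Q"
proof -
 interpret prob_space "PM E pe" by simp
 have *: "{x \<in> space (PiM K (%e. count_space UNIV)). R x} \<in> sets (PiM K (%e. count_space (UNIV :: bool set)))"
  "{xi \<in> space (PM E pe). R xi} = (%xi. restrict xi K) -` {x \<in> space (PiM K (%e. count_space UNIV)). R x} \<inter> space (PM E pe)"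
  if R: "ms E R" "dep K R" and K: "K \<subseteq> E" for K R
 proof -
  let ?f = "%x. \<lambda>e\<in>E. if e \<in> K then x e else False"
  have "?f \<in> PiM K (%e. count_space UNIV) \<rightarrow>\<^sub>M PiM E (%e. count_space UNIV)"
   by (rule measurable_restrict) (auto intro: measurable_component_singleton)
  from measurable_sets[OF this R(1)[unfolded ms_def]]
  have "?f -` {xi \<in> (\<Pi>\<^sub>E e\<in>E. UNIV). R xi} \<inter> space (PiM K (%e. count_space UNIV)) \<in> sets (PiM K (%e. count_space (UNIV :: bool set)))" .
  moreover have "R (?f x) = R x" for x
   by (rule depD[OF R(2)]) (use K in auto)
  then have "?f -` {xi \<in> (\<Pi>\<^sub>E e\<in>E. UNIV). R xi} \<inter> space (PiM K (%e. count_space UNIV)) = {x \<in> space (PiM K (%e. count_space UNIV)). R x}"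
   unfolding space_PI by auto
  ultimately show "{x \<in> space (PiM K (%e. count_space UNIV)). R x} \<in> sets (PiM K (%e. count_space (UNIV :: bool set)))"
   by (simp only:)
  have "R (restrict xi K) = R xi" for xi
   by (rule depD[OF R(2)]) simp
  then show "{xi \<in> space (PM E pe). R xi} = (%xi. restrict xi K) -` {x \<in> space (PiM K (%e. count_space UNIV)). R x} \<inter> space (PM E pe)"
   unfolding space_PiM space_PM by auto
 qed
 note P' = *[OF P IJ(2)] and Q' = *[OF Q IJ(3)]
 have "prob ((%x. (restrict x I, restrict x J)) -` ({x \<in> space (PiM I (%e. count_space UNIV)). P x} \<times> {x \<in> space (PiM J (%e. count_space UNIV)). Q x}) \<inter> space (PM E pe))
  = prob {xi \<in> space (PM E pe). P xi} * prob {xi \<in> space (PM E pe). Q xi}"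
  using indep_varD[OF indep_var_restrict[OF indep_vars_PM IJ] P'(1) Q'(1)]
  by (simp only: P'(2)[symmetric] Q'(2)[symmetric])
 moreover have "(%x. (restrict x I, restrict x J)) -` ({x \<in> space (PiM I (%e. count_space UNIV)). P x} \<times> {x \<in> space (PiM J (%e. count_space UNIV)). Q x}) \<inter> space (PM E pe)
  = {xi \<in> space (PM E pe). P xi & Q xi}"
  using P'(2) Q'(2) by auto
 ultimately show ?thesis unfolding pp_def by simp
qed

lemma pp_coord: assumes "e \<in> E" "0 <= pe e" "pe e <= 1" shows "pp E pe (%xi. xi e) = pe e"
proof -
 interpret product_prob_space "%e. measure_pmf (bernoulli_pmf (pe e))" E
  by unfold_locales
 have "emeasure (PM E pe) {x \<in> space (PM E pe). x e \<in> {True}} = emeasure (measure_pmf (bernoulli_pmf (pe e))) {True}"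
  unfolding PM_def by (rule emeasure_PiM_Collect_single) (use assms in auto)
 then show ?thesis using assms
  by (simp add: pp_def measure_def emeasure_pmf_single)
qed

lemma pp_not_coord: assumes "e \<in> E" "0 <= pe e" "pe e <= 1" shows "pp E pe (%xi. \<not> xi e) = 1 - pe e"
proof -
 have "pp E pe (%xi. \<not> xi e) = 1 - pp E pe (%xi. xi e)" using ms_coord[OF assms(1)] by (rule pp_not)
 then show ?thesis using pp_coord[of e E pe] assms by simp
qed

lemma pp_cong: "(!!xi. P xi = Q xi) ==> pp E pe P = pp E pe Q"
 by (simp add: pp_def)

lemma pp_incl_excl: assumes P: "ms E P" and Q: "ms E Q"
 shows "pp E pe (%xi. P xi \<or> Q xi) + pp E pe (%xi. P xi & Q xi) = pp E pe P + pp E pe Q"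
proof -
 have "pp E pe (%xi. P xi \<or> (Q xi & \<not> P xi)) = pp E pe P + pp E pe (%xi. Q xi & \<not> P xi)"
  by (rule pp_add) (use P Q in \<open>auto intro!: ms_conj ms_not\<close>)
 moreover have "pp E pe (%xi. (P xi & Q xi) \<or> (Q xi & \<not> P xi)) = pp E pe (%xi. P xi & Q xi) + pp E pe (%xi. Q xi & \<not> P xi)"
  by (rule pp_add) (use P Q in \<open>auto intro!: ms_conj ms_not\<close>)
 moreover have "pp E pe (%xi. P xi \<or> (Q xi & \<not> P xi)) = pp E pe (%xi. P xi \<or> Q xi)"
  "pp E pe (%xi. (P xi & Q xi) \<or> (Q xi & \<not> P xi)) = pp E pe Q" by (rule pp_cong; blast)+
 ultimately show ?thesis by simp
qed

text \<open>The coordinates in the image of an injection again form a product measure. This serves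
  both for automorphisms acting on the edges and for the two copies of the edges in the BK
  inequality.\<close>

lemma pp_reindex:
 assumes f: "inj_on f I" "f ` I \<subseteq> K" and P: "ms I P" "dep I P"
 shows "pp I (pe \<circ> f) P = pp K pe (%xi. P (%n. xi (f n)))"
proof -
 let ?t = "%xi. \<lambda>n\<in>I. xi (f n)"
 have eq: "distr (PM K pe) (PM I (pe \<circ> f)) ?t = PM I (pe \<circ> f)"
  using distr_PiM_reindex[of K "%e. measure_pmf (bernoulli_pmf (pe e))" f I] f
  by (auto simp: PM_def measure_pmf.prob_space_axioms comp_def)
 have "?t \<in> PM K pe \<rightarrow>\<^sub>M PM I (pe \<circ> f)"
 proof -
  have "?t \<in> PiM K (%e. measure_pmf (bernoulli_pmf (pe e))) \<rightarrow>\<^sub>M PiM I (%i. measure_pmf (bernoulli_pmf (pe (f i))))"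
   using f by (intro measurable_restrict measurable_component_singleton) auto
  then show ?thesis by (simp add: PM_def comp_def)
 qed
 from measure_distr[OF this msD[OF P(1)]]
 have "pp I (pe \<circ> f) P = measure (PM K pe) (?t -` {xi \<in> space (PM I (pe \<circ> f)). P xi} \<inter> space (PM K pe))"
  unfolding eq pp_def .
 moreover have Pt: "P (?t xi) = P (%n. xi (f n))" for xi
  by (rule depD[OF P(2)]) simp
 have "?t -` {xi \<in> space (PM I (pe \<circ> f)). P xi} \<inter> space (PM K pe) = {xi \<in> space (PM K pe). P (%n. xi (f n))}"
 proof (rule Set.set_eqI)
  fix xi :: "'b \<Rightarrow> bool"
  have "?t xi \<in> space (PM I (pe \<circ> f))" unfolding space_PM by simp
  then show "xi \<in> ?t -` {xi \<in> space (PM I (pe \<circ> f)). P xi} \<inter> space (PM K pe) \<longleftrightarrow> xi \<in> {xi \<in> space (PM K pe). P (%n. xi (f n))}"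
   using Pt[of xi] by (simp only: vimage_eq Int_iff mem_Collect_eq) blast
 qed
 ultimately show ?thesis unfolding pp_def by simp
qed

text \<open>Increasing events are encoded by families of finite witnesses. In this form disjoint
  occurrence becomes an operation on families, comparison of events becomes containment of
  witnesses, and finite subfamilies exhaust the probability.\<close>

abbreviation pr :: "'e set \<Rightarrow> ('e \<Rightarrow> real) \<Rightarrow> 'e set set \<Rightarrow> real" where
 "pr E pe \<S> \<equiv> pp E pe (occ \<S>)"

lemma occ_mono: "occ \<S> xi ==> (!!S. S \<in> \<S> ==> \<exists>T\<in>\<T>. T \<subseteq> S) ==> occ \<T> xi"
 unfolding occ_def by (meson subsetD)

lemma pr_mono: "countable E ==> \<T> \<subseteq> fam E ==> (!!S. S \<in> \<S> ==> \<exists>T\<in>\<T>. T \<subseteq> S) ==> pr E pe \<S> <= pr E pe \<T>"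
 by (rule pp_mono[OF ms_occ]) (auto intro: occ_mono)

lemma fam_subset: "\<S> \<subseteq> Pow F ==> finite F ==> F \<subseteq> E ==> \<S> \<subseteq> fam E"
 unfolding fam_def using finite_subset by blast

text \<open>Conditioning on the state of \<open>e\<close>: if it is open it may be deleted from
  every witness, if it is closed the witnesses containing it are lost. Induction on edges by this
  formula takes the place of couplings.\<close>

lemma pr_split:
 assumes E: "countable E" "\<S> \<subseteq> fam E" and e: "e \<in> E" "0 <= pe e" "pe e <= 1"
 shows "pr E pe \<S> = pe e * pr E pe ((%S. S - {e}) ` \<S>) + (1 - pe e) * pr E pe {S \<in> \<S>. e \<notin> S}"
proof -
 let ?A = "(%S. S - {e}) ` \<S>" and ?B = "{S \<in> \<S>. e \<notin> S}"
 have A: "?A \<subseteq> fam E" "\<Union>?A \<subseteq> E - {e}" and B: "?B \<subseteq> fam E" "\<Union>?B \<subseteq> E - {e}"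
  using E by (auto simp: fam_def)
 have "occ \<S> xi \<longleftrightarrow> (xi e & occ ?A xi) \<or> (\<not> xi e & occ ?B xi)" for xi
 proof (cases "xi e")
  case True
  then have "(\<forall>x\<in>S - {e}. xi x) = (\<forall>x\<in>S. xi x)" for S by blast
  then show ?thesis using True unfolding occ_def by simp
 next
  case False
  then show ?thesis unfolding occ_def by blast
 qed
 then have "pr E pe \<S> = pp E pe (%xi. (xi e & occ ?A xi) \<or> (\<not> xi e & occ ?B xi))" by (rule pp_cong)
 also have "... = pp E pe (%xi. xi e & occ ?A xi) + pp E pe (%xi. \<not> xi e & occ ?B xi)"
  by (rule pp_add) (use ms_coord[OF e(1)] ms_occ[OF E(1) A(1)] ms_occ[OF E(1) B(1)] in \<open>auto intro!: ms_conj ms_not\<close>)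
 also have "pp E pe (%xi. xi e & occ ?A xi) = pp E pe (%xi. xi e) * pr E pe ?A"
  by (rule pp_indep[OF ms_coord[OF e(1)] _ ms_occ[OF E(1) A(1)] dep_occ[OF A(2)], where I = "{e}"])
   (use e in \<open>auto simp: dep_def\<close>)
 also have "pp E pe (%xi. \<not> xi e & occ ?B xi) = pp E pe (%xi. \<not> xi e) * pr E pe ?B"
  by (rule pp_indep[OF ms_not[OF ms_coord[OF e(1)]] _ ms_occ[OF E(1) B(1)] dep_occ[OF B(2)], where I = "{e}"])
   (use e in \<open>auto simp: dep_def\<close>)
 finally show ?thesis using pp_coord[of e E pe] pp_not_coord[of e E pe] e by simp
qed

lemma pr_empty: "\<S> \<subseteq> {{}} ==> pr E pe \<S> = (if \<S> = {} then 0 else 1)"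
proof -
 assume "\<S> \<subseteq> {{}}"
 then consider "\<S> = {}" | "\<S> = {{}}" by blast
 then show ?thesis
 proof cases
  case 1
  then have "pr E pe \<S> = pp E pe (%xi. False)" by (intro pp_cong) (simp add: occ_def)
  then show ?thesis using 1 by simp
 next
  case 2
  then have "pr E pe \<S> = pp E pe (%xi. True)" by (intro pp_cong) (simp add: occ_def)
  then show ?thesis using 2 by simp
 qed
qed

text \<open>By \<open>pr_split\<close> the probability is affine in \<open>pe e\<close>; its slope
  is the difference of the two conditional probabilities, which is nonnegative because deleting
  \<open>e\<close> only makes witnesses smaller.\<close>

lemma pr_mono_pe_fin:
 assumes E: "countable E" and F: "finite F" and p: "!!e. e \<in> E ==> 0 <= pe e & pe e <= pe' e & pe' e <= 1"
 shows "F \<subseteq> E ==> \<S> \<subseteq> Pow F ==> pr E pe \<S> <= pr E pe' \<S>"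
 using F
proof (induction F arbitrary: \<S> rule: finite_induct)
 case empty
 then show ?case using pr_empty[of \<S> E] by simp
next
 case (insert e F)
 let ?A = "(%S. S - {e}) ` \<S>" and ?B = "{S \<in> \<S>. e \<notin> S}"
 have e: "e \<in> E" "F \<subseteq> E" and sub: "?A \<subseteq> Pow F" "?B \<subseteq> Pow F" using insert by auto
 have fm: "\<S> \<subseteq> fam E" using fam_subset[OF insert(5) _ insert(4)] insert by simp
 note s = pr_split[OF E fm e(1)]
 have 1: "pr E pe ?A <= pr E pe' ?A" "pr E pe ?B <= pr E pe' ?B" using insert.IH[OF e(2)] sub by blast+
 have 2: "pr E pe ?B <= pr E pe ?A"
  by (rule pr_mono[OF E fam_subset[OF sub(1) insert(1) e(2)]]) auto
 have "pe e * pr E pe ?A + (1 - pe e) * pr E pe ?B = pr E pe ?B + pe e * (pr E pe ?A - pr E pe ?B)" by algebra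
 also have "... <= pr E pe ?B + pe' e * (pr E pe ?A - pr E pe ?B)"
  using p[OF e(1)] 2 by (intro add_left_mono mult_right_mono) auto
 also have "... = pe' e * pr E pe ?A + (1 - pe' e) * pr E pe ?B" by algebra
 also have "... <= pe' e * pr E pe' ?A + (1 - pe' e) * pr E pe' ?B"
  using p[OF e(1)] 1 by (intro add_mono mult_left_mono) auto
 finally show ?case using s[of pe] s[of pe'] p[OF e(1)] by simp
qed

lemma pr_cont_fin:
 assumes E: "countable E" and F: "finite F" and p: "!!e t. e \<in> E ==> t \<in> T ==> 0 <= pe t e & pe t e <= 1"
  and c: "!!e. e \<in> E ==> continuous_on T (%t. pe t e)"
 shows "F \<subseteq> E ==> \<S> \<subseteq> Pow F ==> continuous_on T (%t. pr E (pe t) \<S>)"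
 using F
proof (induction F arbitrary: \<S> rule: finite_induct)
 case empty
 then show ?case using pr_empty[of \<S> E] by simp
next
 case (insert e F)
 let ?A = "(%S. S - {e}) ` \<S>" and ?B = "{S \<in> \<S>. e \<notin> S}"
 have e: "e \<in> E" "F \<subseteq> E" and sub: "?A \<subseteq> Pow F" "?B \<subseteq> Pow F" using insert by auto
 have fm: "\<S> \<subseteq> fam E" using fam_subset[OF insert(5) _ insert(4)] insert by simp
 have "continuous_on T (%t. pe t e * pr E (pe t) ?A + (1 - pe t e) * pr E (pe t) ?B)"
  using insert.IH[OF e(2) sub(1)] insert.IH[OF e(2) sub(2)] c[OF e(1)] by (intro continuous_intros)
 then show ?case using pr_split[OF E fm e(1)] p[OF e(1)] by (simp cong: continuous_on_cong)
qed

text \<open>The events of the initial segments of an enumeration increase to the whole event.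
  Through this lemma monotonicity, continuity and BK are reduced to finitely many edges.\<close>

lemma pr_fin_approx:
 assumes E: "countable E" "\<S> \<subseteq> fam E" and r: "r < pr E pe \<S>"
 shows "\<exists>\<T>\<subseteq>\<S>. finite \<T> & r < pr E pe \<T>"
proof (cases "\<S> = {}")
 case True
 then show ?thesis using r by (intro exI[of _ "{}"]) auto
next
 case False
 interpret P: prob_space "PM E pe" by simp
 have c: "countable \<S>" using E countable_fam countable_subset by blast
 define T where "T n = from_nat_into \<S> ` {..n}" for n :: nat
 define A where "A n = {xi \<in> space (PM E pe). occ (T n) xi}" for n
 have T: "T n \<subseteq> \<S>" for n unfolding T_def using False from_nat_into by blast
 have TT: "T m \<subseteq> T n" if "m <= n" for m n unfolding T_def using that by (intro image_mono) auto
 have "A n \<in> sets (PM E pe)" for n unfolding A_def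
  by (rule msD, rule ms_occ[OF E(1)], rule subset_trans[OF T E(2)])
 then have 1: "range A \<subseteq> sets (PM E pe)" by blast
 have 2: "incseq A" unfolding incseq_def
 proof (intro allI impI subsetI)
  fix m n xi assume "m <= n" "xi \<in> A m"
  then show "xi \<in> A n" using TT[of m n] unfolding A_def occ_def by blast
 qed
 have 3: "(\<Union>n. A n) = {xi \<in> space (PM E pe). occ \<S> xi}"
 proof (rule Set.set_eqI, rule iffI)
  fix xi assume "xi \<in> {xi \<in> space (PM E pe). occ \<S> xi}"
  then obtain S where S: "S \<in> \<S>" "\<forall>e\<in>S. xi e" "xi \<in> space (PM E pe)" unfolding occ_def by blast
  obtain n where "from_nat_into \<S> n = S" using from_nat_into_surj[OF c S(1)] by blast
  then have "S \<in> T n" unfolding T_def by blast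
  then have "xi \<in> A n" using S unfolding A_def occ_def by blast
  then show "xi \<in> (\<Union>n. A n)" by blast
 next
  fix xi assume "xi \<in> (\<Union>n. A n)"
  then obtain n where "xi \<in> A n" by blast
  then show "xi \<in> {xi \<in> space (PM E pe). occ \<S> xi}" using T[of n] unfolding A_def occ_def by blast
 qed
 have "(%n. pr E pe (T n)) \<longlonglongrightarrow> pr E pe \<S>"
  using P.finite_Lim_measure_incseq[OF 1 2] unfolding 3 unfolding A_def pp_def .
 from order_tendstoD(1)[OF this r] obtain n where "r < pr E pe (T n)"
  unfolding eventually_sequentially by blast
 moreover have "finite (T n)" unfolding T_def by simp
 ultimately show ?thesis using T by blast
qed

lemma fin_fam: "finite \<T> ==> \<T> \<subseteq> fam E ==> finite (\<Union>\<T>) & \<Union>\<T> \<subseteq> E & \<T> \<subseteq> Pow (\<Union>\<T>)"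
 unfolding fam_def by auto

lemma pr_mono_pe:
 assumes E: "countable E" "\<S> \<subseteq> fam E" and p: "!!e. e \<in> E ==> 0 <= pe e & pe e <= pe' e & pe' e <= 1"
 shows "pr E pe \<S> <= pr E pe' \<S>"
proof (rule ccontr)
 assume "\<not> ?thesis"
 then obtain \<T> where T: "\<T> \<subseteq> \<S>" "finite \<T>" "pr E pe' \<S> < pr E pe \<T>"
  using pr_fin_approx[OF E, of "pr E pe' \<S>" pe] by auto
 then have f: "finite (\<Union>\<T>)" "\<Union>\<T> \<subseteq> E" "\<T> \<subseteq> Pow (\<Union>\<T>)" using fin_fam[of \<T> E] E by auto
 have "pr E pe \<T> <= pr E pe' \<T>" by (rule pr_mono_pe_fin[OF E(1) f(1) p f(2,3)])
 also have "... <= pr E pe' \<S>" by (rule pr_mono[OF E]) (use T in auto)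
 finally show False using T by simp
qed

text \<open>Insertion tolerance for one edge: once \<open>e\<close> belongs to every witness, only
  the term of \<open>pr_split\<close> with \<open>e\<close> open survives.\<close>

lemma pr_insert1:
 assumes E: "countable E" "\<S> \<subseteq> fam E" and e: "e \<in> E" "0 <= pe e" "pe e <= 1"
 shows "pe e * pr E pe \<S> <= pr E pe ((%S. insert e S) ` \<S>)"
proof -
 let ?I = "(%S. insert e S) ` \<S>"
 have f: "?I \<subseteq> fam E" "(%S. S - {e}) ` \<S> \<subseteq> fam E" using E e by (auto simp: fam_def)
 have "pr E pe \<S> <= pr E pe ((%S. S - {e}) ` \<S>)" by (rule pr_mono[OF E(1) f(2)]) auto
 moreover have a: "(%S. S - {e}) ` ?I = (%S. S - {e}) ` \<S>" by (simp add: image_image)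
 have b: "{S \<in> ?I. e \<notin> S} = {}" by blast
 have "pr E pe {} = 0" using pr_empty[of "{}" E pe] by simp
 with pr_split[of E ?I e pe, OF E(1) f(1) e(1)] e
 have "pr E pe ?I = pe e * pr E pe ((%S. S - {e}) ` \<S>)" unfolding a b by simp
 ultimately show ?thesis using e by (simp add: mult_left_mono)
qed

lemma pr_insert:
 assumes E: "countable E" "\<S> \<subseteq> fam E" and p: "!!e. e \<in> E ==> c <= pe e & pe e <= 1" and c: "0 <= c"
  and S0: "finite S0" "S0 \<subseteq> E"
 shows "c ^ card S0 * pr E pe \<S> <= pr E pe ((%S. S0 \<union> S) ` \<S>)"
 using S0
proof (induction S0 rule: finite_induct)
 case empty then show ?case by simp
next
 case (insert e S0)
 have f: "(%S. S0 \<union> S) ` \<S> \<subseteq> fam E" using E insert by (auto simp: fam_def)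
 have e: "e \<in> E" using insert by simp
 have "c ^ card (insert e S0) * pr E pe \<S> = c * (c ^ card S0 * pr E pe \<S>)" using insert by simp
 also have "... <= pe e * pr E pe ((%S. S0 \<union> S) ` \<S>)"
  using insert p[OF e] c by (intro mult_mono) auto
 also have "... <= pr E pe ((%S. insert e S) ` (%S. S0 \<union> S) ` \<S>)"
  by (rule pr_insert1[OF E(1) f e]) (use p[OF e] c in auto)
 finally show ?case by (simp add: image_image)
qed

section \<open>The van den Berg--Kesten inequality\<close>

lemma pp_indep_families:
 assumes E: "countable E" "\<S> \<subseteq> fam E" "\<T> \<subseteq> fam E" and I: "\<Union>\<S> \<subseteq> I" "\<Union>\<T> \<subseteq> J" "I \<inter> J = {}"
 shows "pp E pe (%xi. occ \<S> xi & occ \<T> xi) = pr E pe \<S> * pr E pe \<T>"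
proof (rule pp_indep[OF ms_occ[OF E(1,2)] _ ms_occ[OF E(1,3)]])
 show "dep (I \<inter> E) (occ \<S>)" "dep (J \<inter> E) (occ \<T>)" using E I by (auto intro!: dep_occ simp: fam_def)
qed (use I in auto)

definition two_copy :: "'e set \<times> 'e set \<Rightarrow> ('e \<times> bool) set" where
 "two_copy x = fst x \<times> {True} \<union> snd x \<times> {False}"

abbreviation two_copies :: "('e set \<times> 'e set) set \<Rightarrow> ('e \<times> bool) set set" where
 "two_copies W \<equiv> two_copy ` W"

definition disj_unions :: "('e set \<times> 'e set) set \<Rightarrow> 'e set set" where
 "disj_unions W = {S \<union> T |S T. (S, T) \<in> W & S \<inter> T = {}}"

lemma two_copies_fam: "W \<subseteq> Pow F \<times> Pow F ==> finite F ==> F \<subseteq> E ==> two_copies W \<subseteq> fam (E \<times> UNIV)"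
proof -
 assume a: "W \<subseteq> Pow F \<times> Pow F" "finite F" "F \<subseteq> E"
 have "two_copies W \<subseteq> Pow (F \<times> UNIV)" using a(1) unfolding two_copy_def by fastforce
 then show ?thesis using a by (intro fam_subset) auto
qed

lemma occ_Un: "occ (\<S> \<union> \<T>) xi \<longleftrightarrow> occ \<S> xi \<or> occ \<T> xi"
 unfolding occ_def by blast

lemma occ_sub: "\<S> \<subseteq> \<T> ==> occ \<S> xi ==> occ \<T> xi"
 unfolding occ_def by blast

text \<open>Edge by edge, one shared edge is replaced by two independent copies. The induction needs
  an arbitrary set \<open>W\<close> of pairs, since removing \<open>e\<close> from one member of a
  pair leads out of products of two families. \<open>W0\<close>, \<open>WS\<close>,
  \<open>WT\<close> and \<open>W2\<close> hold what remains of the pairs when \<open>e\<close> is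
  available to neither member, to the first, to the second, to both.\<close>

lemma disjoint_occurrence_pairs:
 assumes E: "countable E" and p: "!!e. e \<in> E ==> 0 <= pe e & pe e <= 1" and F: "finite F"
 shows "F \<subseteq> E ==> W \<subseteq> Pow F \<times> Pow F ==> pr E pe (disj_unions W) <= pr (E \<times> UNIV) (pe \<circ> fst) (two_copies W)"
 using F
proof (induction F arbitrary: W rule: finite_induct)
 case empty
 have a: "disj_unions W \<subseteq> {{}}" "two_copies W \<subseteq> {{}}" "disj_unions W = {} \<longleftrightarrow> two_copies W = {}"
  using empty unfolding disj_unions_def two_copy_def by auto
 show ?case unfolding pr_empty[OF a(1)] pr_empty[OF a(2)] using a(3) by simp
next
 case (insert e F)
 let ?q = "pe e" and ?E = "E \<times> (UNIV :: bool set)" and ?p = "pe \<circ> fst"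
 have e: "e \<in> E" "F \<subseteq> E" using insert by auto
 have cE: "countable ?E" using E by auto
 define W0 where "W0 = {x \<in> W. e \<notin> fst x & e \<notin> snd x}"
 define WS where "WS = (%x. (fst x - {e}, snd x)) ` {x \<in> W. e \<notin> snd x}"
 define WT where "WT = (%x. (fst x, snd x - {e})) ` {x \<in> W. e \<notin> fst x}"
 define W2 where "W2 = (%x. (fst x - {e}, snd x - {e})) ` W"
 let ?W1 = "WS \<union> WT"
 have sub: "W0 \<subseteq> Pow F \<times> Pow F" "WS \<subseteq> Pow F \<times> Pow F" "WT \<subseteq> Pow F \<times> Pow F" "W2 \<subseteq> Pow F \<times> Pow F"
 proof -
  have w: "fst x \<subseteq> insert e F" "snd x \<subseteq> insert e F" if "x \<in> W" for x using subsetD[OF insert(5) that] by (auto simp: mem_Times_iff)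
  show "W0 \<subseteq> Pow F \<times> Pow F" unfolding W0_def using w by fastforce
  show "WS \<subseteq> Pow F \<times> Pow F" unfolding WS_def using w by fastforce
  show "WT \<subseteq> Pow F \<times> Pow F" unfolding WT_def using w by fastforce
  show "W2 \<subseteq> Pow F \<times> Pow F" unfolding W2_def using w by fastforce
 qed
 note fm = two_copies_fam[OF _ insert(1) e(2)]
 have Wsub: "W \<subseteq> Pow (insert e F) \<times> Pow (insert e F)" using insert by blast
 have fW: "two_copies W \<subseteq> fam ?E" "disj_unions W \<subseteq> fam E"
 proof -
  show "two_copies W \<subseteq> fam ?E" by (rule two_copies_fam[OF Wsub]) (use insert in auto)
  have "disj_unions W \<subseteq> Pow (insert e F)" using Wsub unfolding disj_unions_def by blast
  then show "disj_unions W \<subseteq> fam E" by (rule fam_subset) (use insert in auto)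
 qed
 have dA: "(%S. S - {e}) ` disj_unions W = disj_unions ?W1"
 proof (intro equalityI subsetI)
  fix D assume "D \<in> (%S. S - {e}) ` disj_unions W"
  then obtain S T where ST: "(S, T) \<in> W" "S \<inter> T = {}" "D = (S \<union> T) - {e}" unfolding disj_unions_def by blast
  show "D \<in> disj_unions ?W1"
  proof (cases "e \<in> T")
   case True
   then have "(S, T - {e}) \<in> WT" "S \<inter> (T - {e}) = {}" "D = S \<union> (T - {e})" using ST unfolding WT_def by force+
   then show ?thesis unfolding disj_unions_def by blast
  next
   case False
   then have "(S - {e}, T) \<in> WS" "(S - {e}) \<inter> T = {}" "D = (S - {e}) \<union> T" using ST unfolding WS_def by force+
   then show ?thesis unfolding disj_unions_def by blast
  qed
 next
  fix D assume "D \<in> disj_unions ?W1"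
  then obtain S T where ST: "(S, T) \<in> ?W1" "S \<inter> T = {}" "D = S \<union> T" unfolding disj_unions_def by blast
  then consider S' where "(S', T) \<in> W" "e \<notin> T" "S = S' - {e}" | T' where "(S, T') \<in> W" "e \<notin> S" "T = T' - {e}"
   unfolding WS_def WT_def by auto
  then show "D \<in> (%S. S - {e}) ` disj_unions W"
  proof cases
   case 1
   then have "S' \<union> T \<in> disj_unions W" "D = (S' \<union> T) - {e}" using ST unfolding disj_unions_def by blast+
   then show ?thesis by blast
  next
   case 2
   then have "S \<union> T' \<in> disj_unions W" "D = (S \<union> T') - {e}" using ST unfolding disj_unions_def by blast+
   then show ?thesis by blast
  qed
 qed
 have dB: "{D \<in> disj_unions W. e \<notin> D} = disj_unions W0"
  unfolding disj_unions_def W0_def by auto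
 have L: "pr E pe (disj_unions W) = ?q * pr E pe (disj_unions ?W1) + (1 - ?q) * pr E pe (disj_unions W0)"
  using pr_split[of E _ e pe, OF E fW(2) e(1)] p[OF e(1)] unfolding dA dB by simp
 let ?e1 = "(e, True)" and ?e2 = "(e, False)"
 let ?A = "(%S. S - {?e1}) ` two_copies W" and ?B = "{S \<in> two_copies W. ?e1 \<notin> S}"
 have e12: "?e1 \<in> ?E" "?e2 \<in> ?E" "?p ?e1 = ?q" "?p ?e2 = ?q" using e by auto
 have fAB: "?A \<subseteq> fam ?E" "?B \<subseteq> fam ?E" using fW(1) unfolding fam_def by blast+
 have c11: "(%S. S - {?e2}) ` ?A = two_copies W2"
  unfolding W2_def image_image by (rule image_cong) (auto simp: two_copy_def)
 have c10: "{S \<in> ?A. ?e2 \<notin> S} = two_copies WS"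
  unfolding WS_def image_image Compr_image_eq by (rule image_cong) (auto simp: two_copy_def)
 have c01: "(%S. S - {?e2}) ` ?B = two_copies WT"
  unfolding WT_def image_image Compr_image_eq by (rule image_cong) (auto simp: two_copy_def)
 have c00: "{S \<in> ?B. ?e2 \<notin> S} = two_copies W0"
  unfolding W0_def by (auto simp: two_copy_def image_iff)
 let ?R = "%W. pr ?E ?p (two_copies W)"
 have "?R W = ?q * pr ?E ?p ?A + (1 - ?q) * pr ?E ?p ?B"
  using pr_split[of ?E _ ?e1 ?p, OF cE fW(1) e12(1)] p[OF e(1)] by simp
 moreover have "pr ?E ?p ?A = ?q * ?R W2 + (1 - ?q) * ?R WS"
  using pr_split[of ?E _ ?e2 ?p, OF cE fAB(1) e12(2)] p[OF e(1)] unfolding c11 c10 by simp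
 moreover have "pr ?E ?p ?B = ?q * ?R WT + (1 - ?q) * ?R W0"
  using pr_split[of ?E _ ?e2 ?p, OF cE fAB(2) e12(2)] p[OF e(1)] unfolding c01 c00 by simp
 ultimately have R: "?R W = ?q * (?q * ?R W2 + (1 - ?q) * ?R WS) + (1 - ?q) * (?q * ?R WT + (1 - ?q) * ?R W0)" by simp
 \<comment> \<open>Inclusion-exclusion for \<open>WS\<close> and \<open>WT\<close>. Pairs that avoid
   \<open>e\<close> altogether lie in both sets, so \<open>W0\<close> is bounded by the
   intersection.\<close>
 have "?R ?W1 + pp ?E ?p (%xi. occ (two_copies WS) xi & occ (two_copies WT) xi) = ?R WS + ?R WT"
  using pp_incl_excl[OF ms_occ[OF cE fm[OF sub(2)]] ms_occ[OF cE fm[OF sub(3)]], of ?p]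
  unfolding image_Un occ_Un[abs_def] .
 moreover have "?R W0 <= pp ?E ?p (%xi. occ (two_copies WS) xi & occ (two_copies WT) xi)"
 proof (rule pp_mono[OF ms_conj[OF ms_occ[OF cE fm[OF sub(2)]] ms_occ[OF cE fm[OF sub(3)]]]])
  have "W0 \<subseteq> WS" "W0 \<subseteq> WT"
  proof -
   show "W0 \<subseteq> WS"
   proof
    fix x assume "x \<in> W0"
    then show "x \<in> WS" unfolding W0_def WS_def by (intro image_eqI[of _ _ x]) (auto simp: prod_eq_iff)
   qed
   show "W0 \<subseteq> WT"
   proof
    fix x assume "x \<in> W0"
    then show "x \<in> WT" unfolding W0_def WT_def by (intro image_eqI[of _ _ x]) (auto simp: prod_eq_iff)
   qed
  qed
  then have "two_copies W0 \<subseteq> two_copies WS" "two_copies W0 \<subseteq> two_copies WT" by blast+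
  then show "occ (two_copies W0) xi ==> occ (two_copies WS) xi & occ (two_copies WT) xi" for xi
   using occ_sub by metis
 qed
 ultimately have 1: "?R ?W1 + ?R W0 <= ?R WS + ?R WT" by simp
 have 2: "?R ?W1 <= ?R W2"
 proof (rule pp_mono[OF ms_occ[OF cE fm[OF sub(4)]]])
  have "?W1 \<subseteq> W2"
  proof
   fix x assume "x \<in> ?W1"
   then obtain y where y: "y \<in> W" "x = (fst y - {e}, snd y) & e \<notin> snd y \<or> x = (fst y, snd y - {e}) & e \<notin> fst y"
    unfolding WS_def WT_def by blast
   then have "x = (fst y - {e}, snd y - {e})" by auto
   then show "x \<in> W2" using y(1) unfolding W2_def by blast
  qed
  then have "two_copies ?W1 \<subseteq> two_copies W2" by blast
  then show "occ (two_copies ?W1) xi ==> occ (two_copies W2) xi" for xi by (rule occ_sub)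
 qed
 have q: "0 <= ?q" "?q <= 1" using p[OF e(1)] by auto
 have "pr E pe (disj_unions W) <= ?q * ?R ?W1 + (1 - ?q) * ?R W0"
  unfolding L using q sub by (intro add_mono mult_left_mono insert.IH[OF e(2)]) (auto simp del: comp_apply)
 \<comment> \<open>The weights q and 1 - q of the single edge are split along the four joint states
   of its two copies; now the comparison is term by term.\<close>
 also have "... = ?q * ?q * ?R ?W1 + ?q * (1 - ?q) * (?R ?W1 + ?R W0) + (1 - ?q) * (1 - ?q) * ?R W0" by algebra
 also have "... <= ?q * ?q * ?R W2 + ?q * (1 - ?q) * (?R WS + ?R WT) + (1 - ?q) * (1 - ?q) * ?R W0"
  using mult_left_mono[OF 2, of "?q * ?q"] mult_left_mono[OF 1, of "?q * (1 - ?q)"] q by (simp del: comp_apply)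
 also have "... = ?R W" unfolding R by algebra
 finally show ?case .
qed

lemma pr_copy:
 assumes E: "countable E" "\<S> \<subseteq> fam E"
 shows "pr (E \<times> UNIV) (pe \<circ> fst) ((%S. S \<times> {b}) ` \<S>) = pr E pe \<S>"
proof -
 have "pr E ((pe \<circ> fst) \<circ> (%e. (e, b))) \<S> = pp (E \<times> UNIV) (pe \<circ> fst) (%xi. occ \<S> (%e. xi (e, b)))"
  by (rule pp_reindex[OF _ _ ms_occ[OF E] dep_occ]) (use E in \<open>auto simp: inj_on_def fam_def\<close>)
 also have "... = pr (E \<times> UNIV) (pe \<circ> fst) ((%S. S \<times> {b}) ` \<S>)"
  by (rule pp_cong) (simp add: occ_def)
 finally show ?thesis by (simp add: comp_def)
qed

text \<open>A violation would already occur for finitely many disjoint unions. Their chosen halves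
  form two finite families, to which the two-copy bound applies; in separate copies the two events
  are independent.\<close>

theorem BK:
 assumes E: "countable E" "\<S> \<subseteq> fam E" "\<T> \<subseteq> fam E" and p: "!!e. e \<in> E ==> 0 <= pe e & pe e <= 1"
 shows "pr E pe (disj_unions (\<S> \<times> \<T>)) <= pr E pe \<S> * pr E pe \<T>"
proof (rule ccontr)
 let ?E = "E \<times> (UNIV :: bool set)" and ?p = "pe \<circ> fst"
 assume "\<not> ?thesis"
 moreover have "disj_unions (\<S> \<times> \<T>) \<subseteq> fam E" using E unfolding disj_unions_def fam_def by blast
 ultimately obtain \<D> where D: "\<D> \<subseteq> disj_unions (\<S> \<times> \<T>)" "finite \<D>" "pr E pe \<S> * pr E pe \<T> < pr E pe \<D>"
  using pr_fin_approx[OF E(1), of "disj_unions (\<S> \<times> \<T>)" "pr E pe \<S> * pr E pe \<T>" pe] by auto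
 have "\<forall>D\<in>\<D>. \<exists>S T. S \<in> \<S> & T \<in> \<T> & S \<inter> T = {} & D = S \<union> T"
  using D(1) unfolding disj_unions_def by blast
 then obtain f g where fg: "!!D. D \<in> \<D> ==> f D \<in> \<S> & g D \<in> \<T> & f D \<inter> g D = {} & D = f D \<union> g D" by metis
 let ?S = "f ` \<D>" and ?T = "g ` \<D>"
 let ?F = "\<Union>?S \<union> \<Union>?T"
 have S: "?S \<subseteq> fam E" "?T \<subseteq> fam E" "?S \<subseteq> \<S>" "?T \<subseteq> \<T>" using fg E by blast+
 have F: "finite ?F" "?F \<subseteq> E" using S fin_fam[of ?S E] fin_fam[of ?T E] D(2) by auto
 have cE: "countable ?E" using E by auto
 have "pr E pe \<D> <= pr E pe (disj_unions (?S \<times> ?T))"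
 proof (rule pr_mono[OF E(1)])
  show "disj_unions (?S \<times> ?T) \<subseteq> fam E" using S unfolding disj_unions_def fam_def by blast
  fix D assume "D \<in> \<D>"
  then have "D \<in> disj_unions (?S \<times> ?T)" using fg unfolding disj_unions_def by blast
  then show "\<exists>T\<in>disj_unions (?S \<times> ?T). T \<subseteq> D" by blast
 qed
 also have "... <= pr ?E ?p (two_copies (?S \<times> ?T))"
  by (rule disjoint_occurrence_pairs[OF E(1) p F]) auto
 also have "... = pp ?E ?p (%xi. occ ((%S. S \<times> {True}) ` ?S) xi & occ ((%S. S \<times> {False}) ` ?T) xi)"
 proof (rule pp_cong)
  fix xi :: "'a \<times> bool \<Rightarrow> bool"
  have "(\<forall>e\<in>two_copy (S, T). xi e) \<longleftrightarrow> (\<forall>e\<in>S \<times> {True}. xi e) & (\<forall>e\<in>T \<times> {False}. xi e)" for S T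
   by (auto simp: two_copy_def)
  then show "occ (two_copies (?S \<times> ?T)) xi \<longleftrightarrow> occ ((%S. S \<times> {True}) ` ?S) xi & occ ((%S. S \<times> {False}) ` ?T) xi"
   by (simp only: occ_def Set.bex_simps(7) split_paired_Bex_Sigma) blast
 qed
 also have "... = pr ?E ?p ((%S. S \<times> {True}) ` ?S) * pr ?E ?p ((%S. S \<times> {False}) ` ?T)"
 proof (rule pp_indep_families[OF cE, of _ _ "UNIV \<times> {True}" "UNIV \<times> {False}"])
  show "(%S. S \<times> {True}) ` ?S \<subseteq> fam ?E" "(%S. S \<times> {False}) ` ?T \<subseteq> fam ?E"
   using S unfolding fam_def by auto
 qed auto
 also have "... = pr E pe ?S * pr E pe ?T" unfolding pr_copy[OF E(1) S(1)] pr_copy[OF E(1) S(2)] ..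
 also have "... <= pr E pe \<S> * pr E pe \<T>"
  using S by (intro mult_mono pr_mono[OF E(1) E(2)] pr_mono[OF E(1) E(3)]) auto
 finally show False using D(3) by simp
qed

text \<open>The union bound. The sum is an integral over the counting measure, so it may be infinite
  and can later be interchanged without summability conditions.\<close>

lemma pp_ex_le_sum:
 assumes I: "countable I" and Q: "!!i. i \<in> I ==> ms E (Q i)" and P: "!!xi. P xi ==> \<exists>i\<in>I. Q i xi"
 shows "ennreal (pp E pe P) <= (\<integral>\<^sup>+i. ennreal (pp E pe (Q i)) \<partial>count_space I)"
proof -
 interpret P: prob_space "PM E pe" by simp
 let ?A = "%i. {xi \<in> space (PM E pe). Q i xi}"
 have A: "?A i \<in> sets (PM E pe)" if "i \<in> I" for i using msD[OF Q[OF that]] .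
 have "ennreal (pp E pe P) <= ennreal (pp E pe (%xi. \<exists>i\<in>I. Q i xi))"
  by (intro ennreal_leI pp_mono ms_ex I Q P)
 also have "... = emeasure (PM E pe) (\<Union>i\<in>I. ?A i)"
 proof -
  have "(\<Union>i\<in>I. ?A i) = {xi \<in> space (PM E pe). \<exists>i\<in>I. Q i xi}" by blast
  then show ?thesis unfolding P.emeasure_eq_measure pp_def by simp
 qed
 also have "... <= (\<integral>\<^sup>+i. emeasure (PM E pe) (?A i) \<partial>count_space I)"
 proof (cases "finite I")
  case True
  then show ?thesis using emeasure_subadditive_finite[of I ?A "PM E pe"] A
   by (auto simp: nn_integral_count_space_finite)
 next
  case False
  define f where "f = from_nat_into I"
  have f: "bij_betw f UNIV I" unfolding f_def using bij_betw_from_nat_into[OF I False] .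
  then have fI: "f n \<in> I" for n by (auto simp: bij_betw_def)
  have "(\<Union>i\<in>I. ?A i) = (\<Union>n. ?A (f n))" using f by (auto simp: bij_betw_def)
  also have "emeasure (PM E pe) ... <= (\<Sum>n. emeasure (PM E pe) (?A (f n)))"
   by (rule emeasure_subadditive_countably) (use A fI in auto)
  also have "... = (\<integral>\<^sup>+n. emeasure (PM E pe) (?A (f n)) \<partial>count_space UNIV)" by (simp add: nn_integral_count_space_nat)
  also have "... = (\<integral>\<^sup>+i. emeasure (PM E pe) (?A i) \<partial>count_space I)" by (rule nn_integral_bij_count_space[OF f])
  finally show ?thesis .
 qed
 also have "... = (\<integral>\<^sup>+i. ennreal (pp E pe (Q i)) \<partial>count_space I)" by (simp add: P.emeasure_eq_measure pp_def)
 finally show ?thesis .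
qed

section \<open>Paths\<close>

fun edgs :: "'v list \<Rightarrow> 'v set set" where
 "edgs (x # y # r) = insert {x, y} (edgs (y # r))"
| "edgs _ = {}"

lemma edgs_append: "edgs (p @ w # q) = edgs (p @ [w]) \<union> edgs (w # q)"
proof (induction p)
 case (Cons a p)
 then show ?case by (cases p) auto
qed simp

lemma edgs_sub: "e \<in> edgs p ==> e \<subseteq> set p"
 by (induction p rule: edgs.induct) auto

lemma finite_edgs [simp]: "finite (edgs p)"
 by (induction p rule: edgs.induct) auto

lemma card_edgs: "card (edgs p) <= length p"
proof (induction p rule: edgs.induct)
 case (1 x y r)
 then show ?case using card_insert_le_m1[of "length (x # y # r)" "edgs (y # r)" "{x, y}"] by simp
qed auto

text \<open>In \<open>pf_tree\<close> the branch \<open>z # q\<close> leaves another path for good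
  at \<open>z\<close>; an edge with an endpoint in \<open>q\<close> then cannot belong to that
  path.\<close>

lemma edgs_tail: "e \<in> edgs (z # q) ==> z \<notin> set q ==> distinct q ==> \<exists>x\<in>set q. x \<in> e"
 by (induction q arbitrary: z) auto

lemma edgs_not_single: "e \<in> edgs p ==> distinct p ==> \<exists>x y. e = {x, y} & x \<noteq> y"
 by (induction p rule: edgs.induct) auto

text \<open>A common edge would lie in the intersection of the two vertex sets, which is
  \<open>{w}\<close>, but an edge of a simple path has two endpoints.\<close>

lemma edgs_disjoint: assumes "distinct (p @ w # q)" shows "edgs (p @ [w]) \<inter> edgs (w # q) = {}"
proof (rule ccontr)
 assume "\<not> ?thesis"
 then obtain e where e: "e \<in> edgs (p @ [w])" "e \<in> edgs (w # q)" by blast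
 then have "e \<subseteq> set (p @ [w]) \<inter> set (w # q)" using edgs_sub by blast
 moreover have "set (p @ [w]) \<inter> set (w # q) = {w}" using assms by auto
 moreover obtain x y where "e = {x, y}" "x \<noteq> y" using edgs_not_single[OF e(2)] assms by auto
 ultimately show False by auto
qed

lemma edgs_rev: "edgs (rev p) = edgs p"
proof (induction p rule: edgs.induct)
 case (1 x y r)
 have "edgs (rev (x # y # r)) = edgs (rev r @ y # [x])" by simp
 also have "... = edgs (rev r @ [y]) \<union> edgs [y, x]" by (rule edgs_append)
 finally show ?case using 1 by (auto simp: insert_commute)
qed auto

lemma edgs_map: "edgs (map g p) = (`) g ` edgs p"
 by (induction p rule: edgs.induct) auto

definition walk :: "'v set set \<Rightarrow> 'v set \<Rightarrow> 'v \<Rightarrow> 'v \<Rightarrow> 'v list \<Rightarrow> bool" where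
 "walk E S u v p \<longleftrightarrow> p \<noteq> [] & hd p = u & last p = v & set p \<subseteq> S & edgs p \<subseteq> E"

definition pth :: "'v set set \<Rightarrow> 'v set \<Rightarrow> 'v \<Rightarrow> 'v \<Rightarrow> 'v list set" where
 "pth E S u v = {p. walk E S u v p & distinct p}"

text \<open>Witnesses are edge sets of simple paths: simplicity makes the two parts of a path at any
  of its vertices edge-disjoint, as BK requires.\<close>

definition pf :: "'v set set \<Rightarrow> 'v set \<Rightarrow> 'v \<Rightarrow> 'v \<Rightarrow> 'v set set set" where
 "pf E S u v = edgs ` pth E S u v"

text \<open>Loop erasure: the closed walk between two visits of a vertex is cut out.\<close>

lemma walk_distinct: "walk E S u v p ==> \<exists>q. walk E S u v q & distinct q & set q \<subseteq> set p & edgs q \<subseteq> edgs p & length q <= length p"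
proof (induction "length p" arbitrary: p rule: less_induct)
 case less
 show ?case
 proof (cases "distinct p")
  case False
  then obtain a x b c where p: "p = a @ [x] @ b @ [x] @ c" using not_distinct_decomp by blast
  let ?q = "a @ x # c"
  have e: "edgs p = edgs (a @ [x]) \<union> edgs (x # b @ [x]) \<union> edgs (x # c)"
   using edgs_append[of a x "b @ [x] @ c"] edgs_append[of "x # b" x c] unfolding p by auto
  have "edgs ?q \<subseteq> edgs p" unfolding e edgs_append[of a x c] by auto
  moreover have "walk E S u v ?q" using less(2) calculation unfolding walk_def p by (cases a; cases c) auto
  moreover have "length ?q < length p" unfolding p by simp
  ultimately obtain q where "walk E S u v q" "distinct q" "set q \<subseteq> set ?q" "edgs q \<subseteq> edgs ?q" "length q <= length ?q"
   using less(1)[of ?q] by blast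
  moreover have "set ?q \<subseteq> set p" unfolding p by auto
  ultimately show ?thesis using \<open>edgs ?q \<subseteq> edgs p\<close> \<open>length ?q < length p\<close> by (intro exI[of _ q]) auto
 qed (use less in auto)
qed

lemma walk_append: "walk E S u v p ==> walk E S v w q ==> walk E S u w (p @ tl q) & edgs (p @ tl q) = edgs p \<union> edgs q"
proof -
 assume p: "walk E S u v p" and q: "walk E S v w q"
 obtain p' where p': "p = p' @ [v]" using p unfolding walk_def by (metis append_butlast_last_id)
 obtain q' where q': "q = v # q'" using q unfolding walk_def by (metis list.collapse)
 have "edgs (p @ tl q) = edgs p \<union> edgs q" using edgs_append[of p' v q'] unfolding p' q' by simp
 then show ?thesis using p q unfolding walk_def p' q' by (auto simp: hd_append split: if_splits)
qed

lemma pth_fam: "pf E S u v \<subseteq> fam E"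
 unfolding pf_def pth_def walk_def fam_def by auto

lemma pf_trans: assumes "A \<in> pf E S u v" "B \<in> pf E S v w" shows "\<exists>C\<in>pf E S u w. C \<subseteq> A \<union> B"
proof -
 obtain p q where p: "walk E S u v p" "A = edgs p" and q: "walk E S v w q" "B = edgs q"
  using assms unfolding pf_def pth_def by blast
 from walk_append[OF p(1) q(1)] obtain r where "walk E S u w r" "edgs r = A \<union> B" using p q by blast
 with walk_distinct[of E S u w r] show ?thesis unfolding pf_def pth_def by blast
qed

lemma walk_split: assumes "walk E S u v (p @ w # q)" shows "walk E S u w (p @ [w])" "walk E S w v (w # q)"
 using assms unfolding walk_def edgs_append[of p w q] by (auto simp: hd_append split: if_splits)

lemma pth_split: assumes "p @ w # q \<in> pth E S u v"
 shows "p @ [w] \<in> pth E S u w" "w # q \<in> pth E S w v" "edgs (p @ [w]) \<inter> edgs (w # q) = {}"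
  "edgs (p @ w # q) = edgs (p @ [w]) \<union> edgs (w # q)"
 using assms walk_split[of E S u v p w q] edgs_disjoint[of p w q] edgs_append[of p w q] unfolding pth_def by auto

lemma pf_refl: "u \<in> S ==> {} \<in> pf E S u u"
 unfolding pf_def pth_def walk_def by (intro image_eqI[of _ _ "[u]"]) auto

lemma pth_rev: "p \<in> pth E S u v ==> rev p \<in> pth E S v u"
 unfolding pth_def walk_def by (auto simp: edgs_rev hd_rev last_rev)

lemma pf_sym: "pf E S u v = pf E S v u"
proof -
 have "pf E S u v \<subseteq> pf E S v u" for u v
 proof
  fix A assume "A \<in> pf E S u v"
  then obtain p where "p \<in> pth E S u v" "A = edgs p" unfolding pf_def by blast
  then show "A \<in> pf E S v u" using pth_rev[of p] edgs_rev[of p] unfolding pf_def by (metis image_eqI)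
 qed
 then show ?thesis by blast
qed

lemma pth_mono: assumes "S \<subseteq> T" shows "pth E S u v \<subseteq> pth E T u v"
proof
 fix p assume "p \<in> pth E S u v"
 then show "p \<in> pth E T u v" using subset_trans[OF _ assms, of "set p"] unfolding pth_def walk_def by simp
qed

lemma pf_mono: "S \<subseteq> T ==> pf E S u v \<subseteq> pf E T u v"
 unfolding pf_def by (intro image_mono pth_mono)

text \<open>The branch point is the last vertex of the second path that lies on the first one; after
  it the second path shares no edge with the first.\<close>

lemma pf_tree: assumes A: "A \<in> pf E S u x" and B: "B \<in> pf E S u y"
 shows "\<exists>z\<in>S. \<exists>a\<in>pf E S u z. \<exists>b\<in>pf E S z x. \<exists>c\<in>pf E S z y. a \<inter> b = {} & (a \<union> b) \<inter> c = {} & a \<union> b \<union> c \<subseteq> A \<union> B"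
proof -
 obtain p q where p: "p \<in> pth E S u x" "A = edgs p" and q: "q \<in> pth E S u y" "B = edgs q"
  using A B unfolding pf_def by blast
 have "u \<in> set q" "u \<in> set p" using p(1) q(1) hd_in_set[of p] hd_in_set[of q] unfolding pth_def walk_def by simp_all
 then obtain q1 z q2 where q': "q = q1 @ z # q2" "z \<in> set p" "\<forall>w\<in>set q2. w \<notin> set p"
  using split_list_last_prop[of q "%w. w \<in> set p"] by blast
 obtain p1 p2 where p': "p = p1 @ z # p2" using q'(2) split_list by metis
 note sp = pth_split[OF p(1)[unfolded p']] and sq = pth_split[OF q(1)[unfolded q'(1)]]
 have zS: "z \<in> S" using p q'(2) unfolding pth_def walk_def by auto
 have "distinct (z # q2)" using sq(2) unfolding pth_def by simp
 then have "e \<notin> edgs p" if "e \<in> edgs (z # q2)" for e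
  using edgs_tail[OF that] edgs_sub[of e p] q'(3) by auto
 then have "(edgs (p1 @ [z]) \<union> edgs (z # p2)) \<inter> edgs (z # q2) = {}" using sp(4) unfolding p' by blast
 moreover have "edgs (p1 @ [z]) \<union> edgs (z # p2) \<union> edgs (z # q2) \<subseteq> A \<union> B"
  using sp(4) sq(4) p(2) q(2) unfolding p' q'(1) by blast
 ultimately show ?thesis using zS sp(1,2,3) sq(2) unfolding pf_def
  by (intro bexI[of _ z] bexI[of _ "edgs (p1 @ [z])"] bexI[of _ "edgs (z # p2)"] bexI[of _ "edgs (z # q2)"]) auto
qed

lemma walk_rtrancl: "walk E S u v p ==> (\<forall>e\<in>edgs p. xi e) ==> (u, v) \<in> {(x, y). {x, y} \<in> E & xi {x, y} & x \<in> S & y \<in> S}\<^sup>*"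
proof (induction p arbitrary: u rule: edgs.induct)
 case (1 x y r)
 have "walk E S y v (y # r)" using 1(2) unfolding walk_def by auto
 then have "(y, v) \<in> {(x, y). {x, y} \<in> E & xi {x, y} & x \<in> S & y \<in> S}\<^sup>*" using 1 by auto
 moreover have "(u, y) \<in> {(x, y). {x, y} \<in> E & xi {x, y} & x \<in> S & y \<in> S}" using 1(2,3) unfolding walk_def by auto
 ultimately show ?case by (rule converse_rtrancl_into_rtrancl[rotated])
qed (auto simp: walk_def)

lemma rtrancl_walk: "(u, v) \<in> {(x, y). {x, y} \<in> E & xi {x, y} & x \<in> S & y \<in> S}\<^sup>* ==> v \<in> S ==>
 \<exists>p. walk E S u v p & (\<forall>e\<in>edgs p. xi e)"
proof (induction rule: converse_rtrancl_induct)
 case base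
 then show ?case by (intro exI[of _ "[v]"]) (auto simp: walk_def)
next
 case (step x y)
 then obtain p where p: "walk E S y v p" "\<forall>e\<in>edgs p. xi e" by blast
 then obtain r where r: "p = y # r" unfolding walk_def by (metis list.collapse)
 show ?case using p step(1) unfolding r by (intro exI[of _ "x # y # r"]) (auto simp: walk_def)
qed

text \<open>The assumption on \<open>v\<close> excludes the case \<open>u = v\<close> outside
  \<open>S\<close>, where the reflexive closure holds although there is no walk inside
  \<open>S\<close>.\<close>

lemma occ_pf: assumes "v \<in> S"
 shows "occ (pf E S u v) xi \<longleftrightarrow> (u, v) \<in> {(x, y). {x, y} \<in> E & xi {x, y} & x \<in> S & y \<in> S}\<^sup>*"
proof
 assume "occ (pf E S u v) xi"
 then obtain p where "walk E S u v p" "\<forall>e\<in>edgs p. xi e" unfolding occ_def pf_def pth_def by blast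
 then show "(u, v) \<in> {(x, y). {x, y} \<in> E & xi {x, y} & x \<in> S & y \<in> S}\<^sup>*" by (rule walk_rtrancl)
next
 assume "(u, v) \<in> {(x, y). {x, y} \<in> E & xi {x, y} & x \<in> S & y \<in> S}\<^sup>*"
 then obtain p where p: "walk E S u v p" "\<forall>e\<in>edgs p. xi e" using rtrancl_walk[OF _ assms] by blast
 from walk_distinct[OF p(1)] obtain q where "walk E S u v q" "distinct q" "edgs q \<subseteq> edgs p" by blast
 then show "occ (pf E S u v) xi" using p(2) unfolding occ_def pf_def pth_def by blast
qed

lemma occ_linked: assumes "v \<in> V" "!!e. e \<in> E ==> e \<subseteq> V"
 shows "occ (pf E V u v) xi \<longleftrightarrow> linked (open_edges E xi) u v"
proof -
 have "{(x, y). {x, y} \<in> E & xi {x, y} & x \<in> V & y \<in> V} = {(x, y). {x, y} \<in> open_edges E xi}"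
  using assms(2) unfolding open_edges_def by blast
 then show ?thesis unfolding occ_pf[OF assms(1)] linked_def by simp
qed

section \<open>Group actions and mass transport\<close>

text \<open>The elements of \<open>\<Gamma>\<close> are plain functions whose values outside
  \<open>V\<close> are irrelevant, so the group laws are required on \<open>V\<close> only.\<close>

locale gact =
 fixes V :: "'v set" and \<Gamma> :: "('v \<Rightarrow> 'v) set"
 assumes g_bij: "ga \<in> \<Gamma> ==> bij_betw ga V V"
  and g_id: "\<exists>ga\<in>\<Gamma>. \<forall>x\<in>V. ga x = x"
  and g_comp: "ga \<in> \<Gamma> ==> \<delta> \<in> \<Gamma> ==> \<exists>\<eta>\<in>\<Gamma>. \<forall>x\<in>V. \<eta> x = ga (\<delta> x)"
  and g_inv: "ga \<in> \<Gamma> ==> \<exists>\<eta>\<in>\<Gamma>. \<forall>x\<in>V. \<eta> (ga x) = x & ga (\<eta> x) = x"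
begin

definition orb :: "'v \<Rightarrow> 'v set" where "orb v = (%ga. ga v) ` \<Gamma>"

definition sorb :: "'v \<Rightarrow> 'v \<Rightarrow> 'v set" where "sorb v u = {ga u |ga. ga \<in> \<Gamma> & ga v = v}"

definition sc :: "'v \<Rightarrow> 'v \<Rightarrow> nat" where "sc v u = card (sorb v u)"

lemma gV: "ga \<in> \<Gamma> ==> x \<in> V ==> ga x \<in> V"
 using g_bij unfolding bij_betw_def by blast

lemma g_inj: "ga \<in> \<Gamma> ==> inj_on ga V"
 using g_bij unfolding bij_betw_def by blast

lemma orb_sub: "v \<in> V ==> orb v \<subseteq> V"
 unfolding orb_def using gV by blast

lemma orb_refl: assumes "v \<in> V" shows "v \<in> orb v"
proof -
 obtain ga where "ga \<in> \<Gamma>" "ga v = v" using g_id assms by blast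
 then show ?thesis unfolding orb_def by (intro image_eqI[of _ _ ga]) auto
qed

lemma orb_E: assumes "x \<in> orb v" "v \<in> V" obtains ga where "ga \<in> \<Gamma>" "ga x = v" "x \<in> V"
proof -
 obtain \<delta> where d: "\<delta> \<in> \<Gamma>" "x = \<delta> v" using assms unfolding orb_def by blast
 obtain \<eta> where "\<eta> \<in> \<Gamma>" "\<forall>x\<in>V. \<eta> (\<delta> x) = x" using g_inv[OF d(1)] by blast
 then show ?thesis using that[of \<eta>] d assms gV by auto
qed

lemma orb_step: assumes "x \<in> orb v" "v \<in> V" "ga \<in> \<Gamma>" shows "ga x \<in> orb v"
proof -
 obtain \<delta> where d: "\<delta> \<in> \<Gamma>" "x = \<delta> v" using assms unfolding orb_def by blast
 obtain \<eta> where "\<eta> \<in> \<Gamma>" "\<forall>x\<in>V. \<eta> x = ga (\<delta> x)" using g_comp[OF assms(3) d(1)] by blast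
 then show ?thesis using d assms unfolding orb_def by (intro image_eqI[of _ _ \<eta>]) auto
qed

lemma orb_sym: assumes "x \<in> orb v" "v \<in> V" shows "v \<in> orb x"
 using orb_E[OF assms] unfolding orb_def by (metis image_eqI)

lemma orb_eq: assumes "x \<in> orb v" "v \<in> V" shows "orb x = orb v"
proof -
 have *: "orb x \<subseteq> orb v" if "x \<in> orb v" "v \<in> V" for x v
  using orb_step[OF that] unfolding orb_def[of x] by blast
 have "x \<in> V" using assms orb_sub by blast
 then show ?thesis using *[OF assms] *[OF orb_sym[OF assms]] by blast
qed

lemma sorb_sub: "u \<in> V ==> sorb v u \<subseteq> V"
 unfolding sorb_def using gV by blast

text \<open>The elements taking \<open>x\<close> to \<open>v\<close> form a coset of the stabilizer
  of \<open>x\<close>, so their values at \<open>u\<close> are a translate of the stabilizer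
  orbit.\<close>

lemma coset_card:
 assumes x: "x \<in> V" "u \<in> V" and g0: "ga0 \<in> \<Gamma>" "ga0 x = v"
 shows "{ga u |ga. ga \<in> \<Gamma> & ga x = v} = ga0 ` sorb x u" "card {ga u |ga. ga \<in> \<Gamma> & ga x = v} = sc x u"
proof -
 obtain \<eta> where e: "\<eta> \<in> \<Gamma>" "!!x. x \<in> V ==> \<eta> (ga0 x) = x & ga0 (\<eta> x) = x" using g_inv[OF g0(1)] by blast
 show 1: "{ga u |ga. ga \<in> \<Gamma> & ga x = v} = ga0 ` sorb x u"
 proof (intro equalityI subsetI)
  fix y assume "y \<in> {ga u |ga. ga \<in> \<Gamma> & ga x = v}"
  then obtain ga where g: "y = ga u" "ga \<in> \<Gamma>" "ga x = v" by blast
  obtain \<delta> where d: "\<delta> \<in> \<Gamma>" "!!x. x \<in> V ==> \<delta> x = \<eta> (ga x)" using g_comp[OF e(1) g(2)] by blast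
  have "\<delta> x = x" using d(2)[OF x(1)] g(3) g0(2) e(2)[OF x(1)] by simp
  then have "\<delta> u \<in> sorb x u" unfolding sorb_def using d(1) by blast
  moreover have "ga0 (\<delta> u) = y" using d(2)[OF x(2)] e(2) gV[OF g(2) x(2)] g(1) by simp
  ultimately show "y \<in> ga0 ` sorb x u" by blast
 next
  fix y assume "y \<in> ga0 ` sorb x u"
  then obtain \<delta> where d: "\<delta> \<in> \<Gamma>" "\<delta> x = x" "y = ga0 (\<delta> u)" unfolding sorb_def by blast
  obtain ga where g: "ga \<in> \<Gamma>" "!!x. x \<in> V ==> ga x = ga0 (\<delta> x)" using g_comp[OF g0(1) d(1)] by blast
  then have "ga x = v" "ga u = y" using d x g0 by auto
  then show "y \<in> {ga u |ga. ga \<in> \<Gamma> & ga x = v}" using g(1) by blast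
 qed
 show "card {ga u |ga. ga \<in> \<Gamma> & ga x = v} = sc x u"
  unfolding 1 sc_def by (rule card_image[OF inj_on_subset[OF g_inj[OF g0(1)] sorb_sub[OF x(2)]]])
qed

lemma sorb_inv: assumes "ga \<in> \<Gamma>" "a \<in> V" "b \<in> V" shows "sc (ga a) (ga b) = sc a b"
proof -
 obtain \<eta> where e: "\<eta> \<in> \<Gamma>" "!!x. x \<in> V ==> \<eta> (ga x) = x & ga (\<eta> x) = x" using g_inv[OF assms(1)] by blast
 have "sorb (ga a) (ga b) = {\<delta> b |\<delta>. \<delta> \<in> \<Gamma> & \<delta> a = ga a}"
 proof (intro equalityI subsetI)
  fix y assume "y \<in> sorb (ga a) (ga b)"
  then obtain \<delta> where d: "\<delta> \<in> \<Gamma>" "\<delta> (ga a) = ga a" "y = \<delta> (ga b)" unfolding sorb_def by blast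
  obtain \<epsilon> where "\<epsilon> \<in> \<Gamma>" "!!x. x \<in> V ==> \<epsilon> x = \<delta> (ga x)" using g_comp[OF d(1) assms(1)] by blast
  then show "y \<in> {\<delta> b |\<delta>. \<delta> \<in> \<Gamma> & \<delta> a = ga a}" using d assms by (intro CollectI exI[of _ \<epsilon>]) auto
 next
  fix y assume "y \<in> {\<delta> b |\<delta>. \<delta> \<in> \<Gamma> & \<delta> a = ga a}"
  then obtain \<delta> where d: "\<delta> \<in> \<Gamma>" "\<delta> a = ga a" "y = \<delta> b" by blast
  obtain \<epsilon> where "\<epsilon> \<in> \<Gamma>" "!!x. x \<in> V ==> \<epsilon> x = \<delta> (\<eta> x)" using g_comp[OF d(1) e(1)] by blast
  then show "y \<in> sorb (ga a) (ga b)" using d assms e gV[OF assms(1)] unfolding sorb_def by (intro CollectI exI[of _ \<epsilon>]) auto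
 qed
 then show ?thesis unfolding sc_def using coset_card(2)[OF assms(2,3,1) refl] by (simp add: sc_def)
qed

end

locale fgact = gact V \<Gamma> for V :: "'v set" and \<Gamma> +
 assumes fin_sorb: "v \<in> V ==> u \<in> V ==> finite (sorb v u)"
begin

lemma sc_pos: "v \<in> V ==> u \<in> V ==> sc v u > 0"
proof -
 assume v: "v \<in> V" "u \<in> V"
 obtain ga where "ga \<in> \<Gamma>" "ga v = v" "ga u = u" using g_id v by blast
 then have "u \<in> sorb v u" unfolding sorb_def by (intro CollectI exI[of _ ga]) auto
 then show ?thesis unfolding sc_def using fin_sorb[OF v] card_gt_0_iff by blast
qed

text \<open>The modular function without its orbit weights: \<Delta>(v, y) is \<open>rho y v\<close>
  times the ratio of the weights \<open>mu\<close> of the orbits of \<open>y\<close> and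
  \<open>v\<close>.\<close>

definition rho :: "'v \<Rightarrow> 'v \<Rightarrow> real" where "rho y v = real (sc y v) / real (sc v y)"

lemma rho_pos: "y \<in> V ==> v \<in> V ==> rho y v > 0"
 unfolding rho_def using sc_pos by simp

lemma rho_inv: "ga \<in> \<Gamma> ==> a \<in> V ==> b \<in> V ==> rho (ga a) (ga b) = rho a b"
 unfolding rho_def by (simp add: sorb_inv)

definition tri :: "'v \<Rightarrow> 'v \<Rightarrow> 'v \<Rightarrow> nat" where
 "tri a b c = card {ga c |ga. ga \<in> \<Gamma> & ga a = a & ga b = b}"

lemma tri_sym: "tri a b c = tri b a c"
 unfolding tri_def by (rule arg_cong[where f = card]) auto

text \<open>Orbit-stabilizer counting: above each point of the stabilizer orbit of \<open>b\<close>,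
  the possible images of \<open>c\<close> are a translate of the orbit of \<open>c\<close> under the
  common stabilizer of \<open>a\<close> and \<open>b\<close>.\<close>

lemma pair_orbit: assumes V: "a \<in> V" "b \<in> V" "c \<in> V"
 shows "card {(ga b, ga c) |ga. ga \<in> \<Gamma> & ga a = a} = sc a b * tri a b c"
proof -
 define P where "P = {(ga b, ga c) |ga. ga \<in> \<Gamma> & ga a = a}"
 define Q where "Q b' = {ga c |ga. ga \<in> \<Gamma> & ga a = a & ga b = b'}" for b'
 have P: "P = Sigma (sorb a b) Q"
 proof (intro equalityI subsetI)
  fix x assume "x \<in> Sigma (sorb a b) Q"
  then obtain b' c' where x: "x = (b', c')" "c' \<in> Q b'" by blast
  then obtain ga where "ga \<in> \<Gamma>" "ga a = a" "ga b = b'" "c' = ga c" unfolding Q_def by blast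
  then show "x \<in> P" unfolding x P_def by blast
 qed (auto simp: P_def Q_def sorb_def)
 have "card (Q b') = tri a b c & finite (Q b')" if b': "b' \<in> sorb a b" for b'
 proof
  obtain \<delta> where d: "\<delta> \<in> \<Gamma>" "\<delta> a = a" "\<delta> b = b'" using b' unfolding sorb_def by blast
  obtain \<eta> where e: "\<eta> \<in> \<Gamma>" "!!x. x \<in> V ==> \<eta> (\<delta> x) = x & \<delta> (\<eta> x) = x" using g_inv[OF d(1)] by blast
  have "Q b' = \<delta> ` Q b"
  proof (intro equalityI subsetI)
   fix y assume "y \<in> Q b'"
   then obtain ga where g: "ga \<in> \<Gamma>" "ga a = a" "ga b = b'" "y = ga c" unfolding Q_def by blast
   obtain \<epsilon> where ep: "\<epsilon> \<in> \<Gamma>" "!!x. x \<in> V ==> \<epsilon> x = \<eta> (ga x)" using g_comp[OF e(1) g(1)] by blast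
   have "\<epsilon> a = a" "\<epsilon> b = b" using ep(2) V g d e(2)[OF V(1)] e(2)[OF V(2)] by auto
   then have "\<epsilon> c \<in> Q b" unfolding Q_def using ep(1) by blast
   moreover have "\<delta> (\<epsilon> c) = y" using ep(2)[OF V(3)] g e(2)[OF gV[OF g(1) V(3)]] by simp
   ultimately show "y \<in> \<delta> ` Q b" by blast
  next
   fix y assume "y \<in> \<delta> ` Q b"
   then obtain ga where g: "ga \<in> \<Gamma>" "ga a = a" "ga b = b" "y = \<delta> (ga c)" unfolding Q_def by blast
   obtain \<epsilon> where ep: "\<epsilon> \<in> \<Gamma>" "!!x. x \<in> V ==> \<epsilon> x = \<delta> (ga x)" using g_comp[OF d(1) g(1)] by blast
   then show "y \<in> Q b'" unfolding Q_def using g d V by (intro CollectI exI[of _ \<epsilon>]) auto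
  qed
  moreover have "Q b \<subseteq> V" unfolding Q_def using gV V by blast
  ultimately show "card (Q b') = tri a b c" unfolding tri_def using inj_on_subset[OF g_inj[OF d(1)], of "Q b"] by (simp add: card_image Q_def)
  have "Q b' \<subseteq> sorb a c" unfolding Q_def sorb_def by blast
  then show "finite (Q b')" using fin_sorb[OF V(1,3)] finite_subset by blast
 qed
 then have "card P = (\<Sum>b'\<in>sorb a b. tri a b c)" unfolding P using fin_sorb[OF V(1,2)] by (simp add: card_SigmaI)
 then show ?thesis unfolding P_def sc_def by simp
qed

lemma tri_swap: assumes V: "a \<in> V" "b \<in> V" "c \<in> V" shows "sc a b * tri a b c = sc a c * tri a c b"
proof -
 have "{(ga c, ga b) |ga. ga \<in> \<Gamma> & ga a = a} = prod.swap ` {(ga b, ga c) |ga. ga \<in> \<Gamma> & ga a = a}" by auto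
 then have "card {(ga c, ga b) |ga. ga \<in> \<Gamma> & ga a = a} = card {(ga b, ga c) |ga. ga \<in> \<Gamma> & ga a = a}"
  by (simp add: card_image)
 then show ?thesis unfolding pair_orbit[OF V] pair_orbit[OF V(1,3,2)] by (rule sym)
qed

lemma tri_pos: assumes V: "a \<in> V" "b \<in> V" "c \<in> V" shows "tri a b c > 0"
proof -
 obtain ga where "ga \<in> \<Gamma>" "ga a = a" "ga b = b" "ga c = c" using g_id V by blast
 then have "c \<in> {ga c |ga. ga \<in> \<Gamma> & ga a = a & ga b = b}" by (intro CollectI exI[of _ ga]) auto
 moreover have "{ga c |ga. ga \<in> \<Gamma> & ga a = a & ga b = b} \<subseteq> sorb a c" unfolding sorb_def by blast
 ultimately show ?thesis unfolding tri_def using finite_subset[OF _ fin_sorb[OF V(1,3)]] by (subst card_gt_0_iff) blast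
qed

text \<open>Counting the orbit of a pair in both orders relates one-point stabilizers to two-point
  stabilizers; in the product around the triangle the two-point terms \<open>tri\<close>
  cancel.\<close>

lemma rho_cocycle: assumes V: "a \<in> V" "b \<in> V" "c \<in> V" shows "rho a b * rho b c = rho a c"
proof -
 have e: "real (sc a b) * real (tri a b c) = real (sc a c) * real (tri a c b)"
  "real (sc b a) * real (tri a b c) = real (sc b c) * real (tri b c a)"
  "real (sc c a) * real (tri a c b) = real (sc c b) * real (tri b c a)"
  using tri_swap[OF V] tri_swap[OF V(2,1,3)] tri_swap[OF V(3,1,2)] tri_sym[of a b c] tri_sym[of a c b] tri_sym[of b c a]
  by (metis of_nat_mult)+
 have p: "real (sc a b) > 0" "real (sc b a) > 0" "real (sc b c) > 0" "real (sc c b) > 0" "real (sc a c) > 0" "real (sc c a) > 0"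
  "real (tri a b c) > 0" "real (tri a c b) > 0" "real (tri b c a) > 0"
  using sc_pos tri_pos V by auto
 have q: "y / z = y' / z'" if "y * t = y'" "z * t = z'" "t > 0" for y z y' z' t :: real
  using that(3) unfolding that(1)[symmetric] that(2)[symmetric] by simp
 note 1 = q[OF e(1,2) p(7)] and 2 = q[OF refl e(3) p(8), of "real (sc a c)"]
 show ?thesis unfolding rho_def 1 2 using p(3) by simp
qed

text \<open>Double counting of the pairs (x, y) for which some element takes (u, x) to (y, v). A
  given \<open>x\<close> has |Stab_x u| partners \<open>y\<close>, a given \<open>y\<close> has
  |Stab_y v| partners \<open>x\<close>, and \<open>F\<close> takes the same value on (u, x) and (y,
  v). The weight 1 / |Stab_x u| normalizes the first count.\<close>

theorem mass_transport:
 fixes F :: "'v \<Rightarrow> 'v \<Rightarrow> ennreal"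
 assumes inv: "!!ga a b. ga \<in> \<Gamma> ==> a \<in> V ==> b \<in> V ==> F (ga a) (ga b) = F a b" and u: "u \<in> V" and v: "v \<in> V"
 shows "(\<integral>\<^sup>+x. F u x \<partial>count_space (orb v)) = (\<integral>\<^sup>+y. F y v * ennreal (rho y v) \<partial>count_space (orb u))"
proof -
 define K where "K x y \<longleftrightarrow> (\<exists>ga\<in>\<Gamma>. ga u = y & ga x = v)" for x y
 have Kx: "{y \<in> orb u. K x y} = {ga u |ga. ga \<in> \<Gamma> & ga x = v}" for x
 proof (intro equalityI subsetI)
  fix y assume "y \<in> {ga u |ga. ga \<in> \<Gamma> & ga x = v}"
  then obtain ga where "ga \<in> \<Gamma>" "ga x = v" "y = ga u" by blast
  then show "y \<in> {y \<in> orb u. K x y}" unfolding K_def orb_def by simp blast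
 next
  fix y assume "y \<in> {y \<in> orb u. K x y}"
  then obtain ga where "ga \<in> \<Gamma>" "ga x = v" "ga u = y" unfolding K_def by blast
  then show "y \<in> {ga u |ga. ga \<in> \<Gamma> & ga x = v}" by (intro CollectI exI[of _ ga]) simp
 qed
 have Ky: "{x \<in> orb v. K x y} = {ga v |ga. ga \<in> \<Gamma> & ga y = u}" if y: "y \<in> orb u" for y
 proof (intro equalityI subsetI)
  fix x assume "x \<in> {x \<in> orb v. K x y}"
  then obtain ga where g: "ga \<in> \<Gamma>" "ga u = y" "ga x = v" "x \<in> V" using orb_sub[OF v] unfolding K_def by blast
  obtain \<eta> where "\<eta> \<in> \<Gamma>" "!!x. x \<in> V ==> \<eta> (ga x) = x" using g_inv[OF g(1)] by blast
  then show "x \<in> {ga v |ga. ga \<in> \<Gamma> & ga y = u}" using g u by (intro CollectI exI[of _ \<eta>]) auto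
 next
  fix x assume "x \<in> {ga v |ga. ga \<in> \<Gamma> & ga y = u}"
  then obtain ga where g: "ga \<in> \<Gamma>" "ga y = u" "x = ga v" by blast
  obtain \<eta> where e: "\<eta> \<in> \<Gamma>" "!!x. x \<in> V ==> \<eta> (ga x) = x" using g_inv[OF g(1)] by blast
  have "y \<in> V" using y orb_sub[OF u] by blast
  then have "\<eta> u = y" "\<eta> x = v" using g e v by auto
  then have "K x y" using e(1) unfolding K_def by blast
  then show "x \<in> {x \<in> orb v. K x y}" using g unfolding orb_def by blast
 qed
 have cx: "card {y \<in> orb u. K x y} = sc x u & finite {y \<in> orb u. K x y}" if x: "x \<in> orb v" for x
 proof -
  obtain ga0 where g: "ga0 \<in> \<Gamma>" "ga0 x = v" "x \<in> V" using orb_E[OF x v] by blast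
  show ?thesis unfolding Kx using coset_card[OF g(3) u g(1,2)] fin_sorb[OF g(3) u] by simp
 qed
 have cy: "card {x \<in> orb v. K x y} = sc y v & finite {x \<in> orb v. K x y}" if y: "y \<in> orb u" for y
 proof -
  obtain ga0 where g: "ga0 \<in> \<Gamma>" "ga0 y = u" "y \<in> V" using orb_E[OF y u] by blast
  show ?thesis unfolding Ky[OF y] using coset_card[OF g(3) v g(1,2)] fin_sorb[OF g(3) v] by simp
 qed
 have Kinv: "F u x = F y v & sc x u = sc v y" if K: "K x y" "x \<in> orb v" for x y
 proof -
  obtain ga where g: "ga \<in> \<Gamma>" "ga u = y" "ga x = v" using K unfolding K_def by blast
  have "x \<in> V" using K orb_sub[OF v] by blast
  then show ?thesis using inv[OF g(1) u, of x] sorb_inv[OF g(1) _ u, of x] g by simp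
 qed
 let ?h = "%x y. F u x * ennreal (1 / real (sc x u)) * indicator {y. K x y} y * indicator (orb v) x * indicator (orb u) y"
 have sum_ind: "(\<integral>\<^sup>+y. c * indicator {y \<in> A. Q y} y \<partial>count_space UNIV) = c * ennreal (real (card {y \<in> A. Q y}))"
  if "finite {y \<in> A. Q y}" for c :: ennreal and A :: "'v set" and Q
  using that by (simp add: nn_integral_cmult ennreal_of_nat_eq_real_of_nat)
 have 1: "(\<integral>\<^sup>+y. ?h x y \<partial>count_space UNIV) = F u x * indicator (orb v) x" for x
 proof (cases "x \<in> orb v")
  case True
  have "(\<integral>\<^sup>+y. ?h x y \<partial>count_space UNIV) = (\<integral>\<^sup>+y. (F u x * ennreal (1 / real (sc x u))) * indicator {y \<in> orb u. K x y} y \<partial>count_space UNIV)"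
   using True by (intro nn_integral_cong) (auto simp: indicator_def)
  also have "... = F u x * ennreal (1 / real (sc x u)) * ennreal (real (sc x u))"
   using cx[OF True] by (subst sum_ind) auto
  also have "... = F u x" using sc_pos[of x u] True orb_sub[OF v] u
   by (simp add: mult.assoc ennreal_mult'[symmetric] subset_eq)
  finally show ?thesis using True by simp
 qed simp
 have 2: "(\<integral>\<^sup>+x. ?h x y \<partial>count_space UNIV) = F y v * ennreal (rho y v) * indicator (orb u) y" for y
 proof (cases "y \<in> orb u")
  case True
  have "(\<integral>\<^sup>+x. ?h x y \<partial>count_space UNIV) = (\<integral>\<^sup>+x. (F y v * ennreal (1 / real (sc v y))) * indicator {x \<in> orb v. K x y} x \<partial>count_space UNIV)"
   using True Kinv by (intro nn_integral_cong) (auto simp: indicator_def)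
  also have "... = F y v * ennreal (1 / real (sc v y)) * ennreal (real (sc y v))"
   using cy[OF True] by (subst sum_ind) auto
  also have "... = F y v * ennreal (rho y v)"
   by (simp add: mult.assoc ennreal_mult'[symmetric] rho_def)
  finally show ?thesis using True by simp
 qed simp
 have "(\<integral>\<^sup>+x. F u x \<partial>count_space (orb v)) = (\<integral>\<^sup>+x. F u x * indicator (orb v) x \<partial>count_space UNIV)"
  by (rule nn_integral_count_space_indicator) (simp add: NO_MATCH_def)
 also have "... = (\<integral>\<^sup>+x. \<integral>\<^sup>+y. ?h x y \<partial>count_space UNIV \<partial>count_space UNIV)" unfolding 1 ..
 also have "... = (\<integral>\<^sup>+y. \<integral>\<^sup>+x. ?h x y \<partial>count_space UNIV \<partial>count_space UNIV)"
  using nn_integral_fst_count_space[of "%(x, y). ?h x y"] nn_integral_snd_count_space[of "%(x, y). ?h x y"] by simp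
 also have "... = (\<integral>\<^sup>+y. F y v * ennreal (rho y v) * indicator (orb u) y \<partial>count_space UNIV)" unfolding 2 ..
 also have "... = (\<integral>\<^sup>+y. F y v * ennreal (rho y v) \<partial>count_space (orb u))"
  by (rule nn_integral_count_space_indicator[symmetric]) (simp add: NO_MATCH_def)
 finally show ?thesis .
qed

end

section \<open>Heights\<close>

locale gr = fgact V \<Gamma> for V :: "'v set" and \<Gamma> +
 fixes E :: "'v set set"
 assumes E_edge: "e \<in> E ==> \<exists>u v. e = {u, v} & u \<in> V & v \<in> V & u \<noteq> v"
  and E_inv: "ga \<in> \<Gamma> ==> {u, v} \<in> E ==> {ga u, ga v} \<in> E"
  and E_conn: "u \<in> V ==> v \<in> V ==> \<exists>p. walk E V u v p"
  and nb_fin: "v \<in> V ==> finite {w. {v, w} \<in> E}"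
  and orb_fin: "finite (orb ` V)"
begin

lemma edge_V: assumes "{u, v} \<in> E" shows "u \<in> V" "v \<in> V" "u \<noteq> v"
 using E_edge[OF assms] by (auto simp: doubleton_eq_iff)

lemma edge_sub: "e \<in> E ==> e \<subseteq> V"
 using E_edge[of e] by auto

lemma img_E: "ga \<in> \<Gamma> ==> e \<in> E ==> ga ` e \<in> E"
 using E_edge[of e] E_inv[of ga] by auto

lemma walk_g: assumes g: "ga \<in> \<Gamma>" and p: "walk E S u v p"
 shows "walk E (ga ` S) (ga u) (ga v) (map ga p)"
 using p img_E[OF g] unfolding walk_def edgs_map by (auto simp: hd_map last_map)

lemma pth_g: assumes g: "ga \<in> \<Gamma>" and S: "S \<subseteq> V" and p: "p \<in> pth E S u v"
 shows "map ga p \<in> pth E (ga ` S) (ga u) (ga v)"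
proof -
 have "set p \<subseteq> V" using p S unfolding pth_def walk_def by blast
 then show ?thesis using p walk_g[OF g, of S u v p] inj_on_subset[OF g_inj[OF g]]
  unfolding pth_def by (simp add: distinct_map)
qed

lemma pf_g: assumes g: "ga \<in> \<Gamma>" and S: "S \<subseteq> V" and A: "A \<in> pf E S u v"
 shows "(`) ga ` A \<in> pf E (ga ` S) (ga u) (ga v)"
proof -
 obtain p where "p \<in> pth E S u v" "A = edgs p" using A unfolding pf_def by (rule imageE)
 then show ?thesis using pth_g[OF g S, of p u v] unfolding pf_def edgs_map[symmetric] by (metis imageI edgs_map)
qed

lemma region_g: assumes g: "ga \<in> \<Gamma>" and Q: "!!x. x \<in> V ==> Q' (ga x) \<longleftrightarrow> Q x"
 shows "ga ` {x \<in> V. Q x} = {x \<in> V. Q' x}"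
proof -
 obtain \<eta> where "\<eta> \<in> \<Gamma>" "!!x. x \<in> V ==> \<eta> (ga x) = x & ga (\<eta> x) = x" using g_inv[OF g] by blast
 note e = this
 show ?thesis
 proof (intro equalityI subsetI)
  fix y assume "y \<in> {x \<in> V. Q' x}"
  then have y: "y \<in> V" "Q' y" by auto
  then have "\<eta> y \<in> V" "ga (\<eta> y) = y" using gV[OF e(1)] e(2) by auto
  then show "y \<in> ga ` {x \<in> V. Q x}" using Q[of "\<eta> y"] y by (intro image_eqI[of _ _ "\<eta> y"]) auto
 qed (use Q gV[OF g] in auto)
qed

lemma reps_ex: "\<exists>R. finite R & R \<subseteq> V & (\<forall>v\<in>V. \<exists>r\<in>R. v \<in> orb r)"
proof -
 define f where "f C = (SOME v. v \<in> V & orb v = C)" for C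
 have f: "f (orb v) \<in> V & orb (f (orb v)) = orb v" if "v \<in> V" for v
  unfolding f_def by (rule someI[of _ v]) (use that in simp)
 show ?thesis
 proof (intro exI[of _ "f ` orb ` V"] conjI ballI)
  show "finite (f ` orb ` V)" using orb_fin by simp
  show "f ` orb ` V \<subseteq> V" using f by auto
  fix v assume v: "v \<in> V"
  show "\<exists>r\<in>f ` orb ` V. v \<in> orb r" using f[OF v] orb_refl[OF v] v by (intro bexI[of _ "f (orb v)"]) auto
 qed
qed

lemma deg_bound: "\<exists>d. \<forall>v\<in>V. card {w. {v, w} \<in> E} <= d"
proof -
 obtain R where R: "finite R" "R \<subseteq> V" "!!v. v \<in> V ==> \<exists>r\<in>R. v \<in> orb r" using reps_ex by blast
 have "card {w. {v, w} \<in> E} <= (\<Sum>r\<in>R. card {w. {r, w} \<in> E})" if v: "v \<in> V" for v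
 proof -
  obtain r where r: "r \<in> R" "v \<in> orb r" using R(3)[OF v] by blast
  have rV: "r \<in> V" using r R by blast
  obtain ga where g: "ga \<in> \<Gamma>" "ga v = r" using orb_E[OF r(2) rV] by blast
  have "ga ` {w. {v, w} \<in> E} \<subseteq> {w. {r, w} \<in> E}" using E_inv[OF g(1)] g(2) by auto
  moreover have "inj_on ga {w. {v, w} \<in> E}" using edge_V(2) by (intro inj_on_subset[OF g_inj[OF g(1)]]) auto
  ultimately have "card {w. {v, w} \<in> E} <= card {w. {r, w} \<in> E}" using nb_fin[OF rV] card_inj_on_le by blast
  also have "... <= (\<Sum>r\<in>R. card {w. {r, w} \<in> E})" using R(1) r(1) by (rule member_le_sum[rotated 2]) simp
  finally show ?thesis .
 qed
 then show ?thesis by blast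
qed

text \<open>The ball of radius \<open>n\<close> in the graph metric: a walk with \<open>n\<close>
  edges has \<open>Suc n\<close> vertices.\<close>

definition bl :: "'v \<Rightarrow> nat \<Rightarrow> 'v set" where "bl v n = {w. \<exists>p. walk E V v w p & length p <= Suc n}"

lemma bl_refl: "v \<in> V ==> v \<in> bl v n"
 unfolding bl_def walk_def by (intro CollectI exI[of _ "[v]"]) auto

lemma bl_V: "bl v n \<subseteq> V"
 unfolding bl_def walk_def by (auto dest: last_in_set)

lemma bl_sym: assumes "w \<in> bl v n" shows "v \<in> bl w n"
proof -
 obtain p where "walk E V v w p" "length p <= Suc n" using assms unfolding bl_def by blast
 then show ?thesis unfolding bl_def walk_def by (intro CollectI exI[of _ "rev p"]) (simp add: edgs_rev hd_rev last_rev)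
qed

lemma bl_Suc: "bl v (Suc n) \<subseteq> insert v (\<Union>x\<in>{w. {v, w} \<in> E}. bl x n)"
proof
 fix w assume "w \<in> bl v (Suc n)"
 then obtain p where p: "walk E V v w p" "length p <= Suc (Suc n)" unfolding bl_def by blast
 show "w \<in> insert v (\<Union>x\<in>{w. {v, w} \<in> E}. bl x n)"
 proof (cases "tl p")
  case Nil
  then have "w = v" using p(1) unfolding walk_def by (cases p) auto
  then show ?thesis by simp
 next
  case (Cons x q)
  then have q: "p = v # x # q" using p(1) unfolding walk_def by (cases p) auto
  have "walk E V x w (x # q)" "{v, x} \<in> E" using p(1) unfolding q walk_def by auto
  then have "w \<in> bl x n" using p(2) unfolding bl_def q by auto
  then show ?thesis using \<open>{v, x} \<in> E\<close> by blast
 qed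
qed

lemma bl_card: "\<exists>d. \<forall>n. \<forall>v\<in>V. finite (bl v n) & card (bl v n) <= (1 + d) ^ n"
proof -
 obtain d where d: "!!v. v \<in> V ==> card {w. {v, w} \<in> E} <= d" using deg_bound by blast
 have "finite (bl v n) & card (bl v n) <= (1 + d) ^ n" if "v \<in> V" for v n
  using that
 proof (induction n arbitrary: v)
  case 0
  have "bl v 0 \<subseteq> {v}"
  proof
   fix w assume "w \<in> bl v 0"
   then obtain p where "walk E V v w p" "length p <= 1" unfolding bl_def by auto
   then show "w \<in> {v}" unfolding walk_def by (cases p) auto
  qed
  then show ?case using finite_subset card_mono[of "{v}" "bl v 0"] by auto
 next
  case (Suc n)
  let ?N = "{w. {v, w} \<in> E}"
  have N: "finite ?N" "?N \<subseteq> V" using nb_fin[OF Suc.prems] edge_V(2) by auto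
  have IH: "finite (bl x n)" "card (bl x n) <= (1 + d) ^ n" if "x \<in> ?N" for x using Suc.IH[of x] that N(2) by auto
  let ?U = "\<Union>x\<in>?N. bl x n"
  have fU: "finite ?U" using N(1) IH(1) by blast
  have "card ?U <= (\<Sum>x\<in>?N. card (bl x n))" using card_UN_le[OF N(1)] .
  also have "... <= (\<Sum>x\<in>?N. (1 + d) ^ n)" using IH(2) by (rule sum_mono)
  also have "... <= d * (1 + d) ^ n" using d[OF Suc.prems] by simp
  finally have "card ?U <= d * (1 + d) ^ n" .
  then have "card (insert v ?U) <= 1 + d * (1 + d) ^ n" using card_insert_le_m1[of "Suc (card ?U)" ?U v] fU by (simp add: card_insert_if)
  also have "... <= (1 + d) ^ Suc n" by simp
  finally have "card (insert v ?U) <= (1 + d) ^ Suc n" .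
  moreover have "finite (insert v ?U)" using fU by simp
  ultimately show ?case using bl_Suc[of v n] card_mono[of "insert v ?U" "bl v (Suc n)"] finite_subset[of "bl v (Suc n)"]
   by (meson order_trans)
 qed
 then show ?thesis by blast
qed

lemma bl_fin: "v \<in> V ==> finite (bl v n)"
 using bl_card by blast

lemma countable_V: "countable V"
proof (cases "V = {}")
 case False
 then obtain v where v: "v \<in> V" by blast
 have "V \<subseteq> (\<Union>n. bl v n)"
 proof
  fix w assume "w \<in> V"
  then obtain p where "walk E V v w p" using E_conn[OF v] by blast
  then have "w \<in> bl v (length p)" unfolding bl_def by auto
  then show "w \<in> (\<Union>n. bl v n)" by blast
 qed
 moreover have "countable (\<Union>n. bl v n)" using bl_fin[OF v] by (intro countable_UN) (auto intro: countable_finite)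
 ultimately show ?thesis by (rule countable_subset)
qed simp

lemma countable_E: "countable E"
proof -
 have "E \<subseteq> (%(x, y). {x, y}) ` (V \<times> V)" using E_edge by fastforce
 then show ?thesis using countable_V by (meson countable_SIGMA countable_image countable_subset)
qed

text \<open>Mass transport for each of the finitely many target orbits; equality is lost only by
  enlarging the set of sources from the orbit of \<open>u\<close> to \<open>V\<close>.\<close>

lemma mtp_le:
 fixes F :: "'v \<Rightarrow> 'v \<Rightarrow> ennreal"
 assumes R: "finite R" "R \<subseteq> V" "!!v. v \<in> V ==> \<exists>r\<in>R. v \<in> orb r"
  and inv: "!!ga a b. ga \<in> \<Gamma> ==> a \<in> V ==> b \<in> V ==> F (ga a) (ga b) = F a b" and u: "u \<in> V"
 shows "(\<integral>\<^sup>+x. F u x \<partial>count_space V) <= (\<Sum>r\<in>R. \<integral>\<^sup>+y. F y r * ennreal (rho y r) \<partial>count_space V)"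
proof -
 have cs: "(\<integral>\<^sup>+x. f x \<partial>count_space A) = (\<integral>\<^sup>+x. f x * indicator A x \<partial>count_space UNIV)" for f :: "'v \<Rightarrow> ennreal" and A
  by (rule nn_integral_count_space_indicator) (simp add: NO_MATCH_def)
 have "(\<integral>\<^sup>+x. F u x \<partial>count_space V) <= (\<integral>\<^sup>+x. (\<Sum>r\<in>R. F u x * indicator (orb r) x) \<partial>count_space UNIV)"
  unfolding cs[of V]
 proof (rule nn_integral_mono)
  fix x
  show "F u x * indicator V x <= (\<Sum>r\<in>R. F u x * indicator (orb r) x)"
  proof (cases "x \<in> V")
   case True
   then obtain r where r: "r \<in> R" "x \<in> orb r" using R(3) by blast
   have "F u x * indicator V x = F u x * indicator (orb r) x" using True r by simp
   also have "... <= (\<Sum>r\<in>R. F u x * indicator (orb r) x)" using R(1) r(1) by (intro member_le_sum) auto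
   finally show ?thesis .
  qed simp
 qed
 also have "... = (\<Sum>r\<in>R. \<integral>\<^sup>+x. F u x * indicator (orb r) x \<partial>count_space UNIV)"
  by (rule nn_integral_sum) simp
 also have "... = (\<Sum>r\<in>R. \<integral>\<^sup>+x. F u x \<partial>count_space (orb r))" unfolding cs[symmetric] ..
 also have "... = (\<Sum>r\<in>R. \<integral>\<^sup>+y. F y r * ennreal (rho y r) \<partial>count_space (orb u))"
  using R(2) by (intro sum.cong refl mass_transport[OF inv u]) auto
 also have "... <= (\<Sum>r\<in>R. \<integral>\<^sup>+y. F y r * ennreal (rho y r) \<partial>count_space V)"
 proof (rule sum_mono)
  fix r
  show "(\<integral>\<^sup>+y. F y r * ennreal (rho y r) \<partial>count_space (orb u)) <= (\<integral>\<^sup>+y. F y r * ennreal (rho y r) \<partial>count_space V)"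
   unfolding cs[of V] cs[of "orb u"] using orb_sub[OF u] by (intro nn_integral_mono) (auto simp: indicator_def)
 qed
 finally show ?thesis .
qed

lemma walk_nth: assumes "walk E V u v p" "i < length p" shows "p ! i \<in> V" "walk E V u (p ! i) (take (Suc i) p)" "walk E V (p ! i) v (drop i p)"
proof -
 show "p ! i \<in> V" using assms unfolding walk_def by auto
 have p: "p = take i p @ p ! i # drop (Suc i) p" using assms(2) by (rule id_take_nth_drop)
 have w: "walk E V u v (take i p @ p ! i # drop (Suc i) p)" using assms(1) p by simp
 show "walk E V u (p ! i) (take (Suc i) p)" using walk_split(1)[OF w] assms(2) by (simp add: take_Suc_conv_app_nth)
 show "walk E V (p ! i) v (drop i p)" using walk_split(2)[OF w] assms(2) by (simp add: Cons_nth_drop_Suc)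
qed

lemma walk_rev: "walk E S u v p ==> walk E S v u (rev p)"
 unfolding walk_def by (simp add: edgs_rev hd_rev last_rev)

lemma walk_ends: "walk E S u v p ==> u \<in> S & v \<in> S"
 unfolding walk_def by (metis hd_in_set last_in_set subsetD)

lemma L0_inv: assumes o: "o0 \<in> V" and g: "ga \<in> \<Gamma>" and x: "x \<in> V" "y \<in> V"
 shows "ln (rho (ga x) o0) - ln (rho (ga y) o0) = ln (rho x o0) - ln (rho y o0)"
proof -
 have *: "ln (rho a o0) - ln (rho b o0) = ln (rho a b)" if "a \<in> V" "b \<in> V" for a b
  using rho_cocycle[OF that o] rho_pos[OF that] rho_pos[OF that(2) o] ln_mult[of "rho a b" "rho b o0"] by simp
 show ?thesis using *[OF x] *[of "ga x" "ga y"] gV[OF g] x rho_inv[OF g x] by simp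
qed

text \<open>Take a shortest walk that ends in the orbit where it started but at a larger value of
  \<open>ln rho\<close>. Its vertices before the last lie in distinct orbits, so adding a function
  of the orbit to \<open>ln rho\<close> can put them at any heights without spoiling equivariance.
  They are placed at equal distances, which produces the gap \<open>g\<close>.\<close>

lemma height_exists:
 assumes nu: "u0 \<in> V" "v0 \<in> orb u0" "sc v0 u0 \<noteq> sc u0 v0"
 shows "\<exists>(L :: 'v \<Rightarrow> real) s b g p. 0 < s & 0 < g & g <= 1 & b \<in> V &
  (\<forall>ga\<in>\<Gamma>. \<forall>x\<in>V. \<forall>y\<in>V. L (ga x) - L (ga y) = L x - L y) &
  (\<forall>x\<in>orb b. rho x b = exp (s * (L x - L b))) &
  walk E V b (last p) p & last p \<in> orb b & L (last p) = L b + 1 &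
  (\<forall>x\<in>set p. x = b \<or> x = last p \<or> L b + g <= L x & L x <= L b + 1 - g)"
proof -
 define M where "M x = ln (rho x u0)" for x
 have M_inv: "M (ga x) - M (ga y) = M x - M y" if "ga \<in> \<Gamma>" "x \<in> V" "y \<in> V" for ga x y
  unfolding M_def using L0_inv[OF nu(1) that] .
 have M_rho: "rho x y = exp (M x - M y)" if "x \<in> V" "y \<in> V" for x y
  unfolding M_def using rho_cocycle[OF that nu(1)] rho_pos[OF that(1) nu(1)] rho_pos[OF that(2) nu(1)]
  by (simp add: exp_diff field_simps)
 define good where "good p \<longleftrightarrow> (\<exists>x y. walk E V x y p & y \<in> orb x & M y > M x)" for p
 have v0: "v0 \<in> V" using nu orb_sub by blast
 have ne: "M v0 \<noteq> M u0"
 proof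
  assume "M v0 = M u0"
  then have "rho v0 u0 = 1" using M_rho[OF v0 nu(1)] by simp
  then show False using nu(3) sc_pos[OF nu(1) v0] unfolding rho_def by simp
 qed
 obtain p0 where p0: "walk E V u0 v0 p0" using E_conn[OF nu(1) v0] by blast
 have "\<exists>p. good p"
 proof (cases "M v0 > M u0")
  case True
  then show ?thesis unfolding good_def using p0 nu(2) by blast
 next
  case False
  then show ?thesis unfolding good_def using walk_rev[OF p0] orb_sym[OF nu(2,1)] ne
   by (intro exI[of _ "rev p0"] exI[of _ v0] exI[of _ u0]) auto
 qed
 then obtain p where p: "good p" and min: "!!q. length q < length p ==> \<not> good q"
  using exists_least_iff[of "%n. \<exists>p. good p & length p = n"] by (metis (no_types, lifting))
 obtain b c where w: "walk E V b c p" and c: "c \<in> orb b" "M c > M b" using p unfolding good_def by blast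
 have bV: "b \<in> V" "c \<in> V" using walk_ends[OF w] by auto
 have pne: "p \<noteq> []" and p0b: "p ! 0 = b" and last: "last p = c" using w unfolding walk_def by (auto simp: hd_conv_nth)
 define D where "D = length p - 1"
 have plen: "length p = Suc D" using pne unfolding D_def by (cases p) auto
 have pD: "p ! D = c" using last pne unfolding D_def by (simp add: last_conv_nth)
 have D: "D > 0" using c(2) p0b pD by (cases D) auto
 note wn = walk_nth[OF w]
 \<comment> \<open>If two vertices shared an orbit at different values of \<open>M\<close>, the
   piece between them or its reversal would be a shorter good walk. If the values agree, that piece
   can be cut out, by translating the rest of the walk.\<close>
 have dist: "p ! i \<notin> orb (p ! j)" if ij: "i < j" "j < D" for i j
 proof
  assume "p ! i \<in> orb (p ! j)"
  have il: "i < length p" "j < length p" using ij plen by auto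
  have iV: "p ! i \<in> V" "p ! j \<in> V" using wn(1) il by auto
  have o1: "p ! i \<in> orb (p ! j)" by fact
  have o2: "p ! j \<in> orb (p ! i)" using orb_sym[OF o1 iV(2)] .
  define q where "q = drop i (take (Suc j) p)"
  have wq: "walk E V (p ! i) (p ! j) q"
   using walk_nth(3)[OF wn(2)[OF il(2)], of i] ij il unfolding q_def by simp
  have lq: "length q < length p" using ij plen unfolding q_def by simp
  consider "M (p ! j) > M (p ! i)" | "M (p ! j) < M (p ! i)" | "M (p ! j) = M (p ! i)" by linarith
  then show False
  proof cases
   case 1
   then have "good q" unfolding good_def using wq o2 by blast
   then show False using min[OF lq] by blast
  next
   case 2
   then have "good (rev q)" unfolding good_def using walk_rev[OF wq] o1 by blast
   then show False using min[of "rev q"] lq by simp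
  next
   case 3
   obtain ga where g: "ga \<in> \<Gamma>" "ga (p ! j) = p ! i" using orb_E[OF o2 iV(1)] by blast
   have w2: "walk E V (p ! i) (ga c) (map ga (drop j p))"
   proof -
    have "walk E (ga ` V) (p ! i) (ga c) (map ga (drop j p))" using walk_g[OF g(1) wn(3)[OF il(2)]] g(2) by simp
    moreover have "ga ` V \<subseteq> V" using gV[OF g(1)] by blast
    ultimately show ?thesis unfolding walk_def by blast
   qed
   let ?q = "take (Suc i) p @ tl (map ga (drop j p))"
   have "walk E V b (ga c) ?q" using walk_append[OF wn(2)[OF il(1)] w2] by blast
   moreover have "ga c \<in> orb b" using orb_step[OF c(1) bV(1) g(1)] .
   moreover have "M (ga c) - M (p ! i) = M c - M (p ! j)" using M_inv[OF g(1) bV(2) iV(2)] g(2) by simp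
   ultimately have "good ?q" unfolding good_def using 3 c(2) by (intro exI[of _ b] exI[of _ "ga c"]) auto
   moreover have "length ?q < length p" using ij plen by simp
   ultimately show False using min by blast
  qed
 qed
 define k where "k = M c - M b"
 have k: "k > 0" unfolding k_def using c by simp
 \<comment> \<open>On the orbit of the i-th vertex the correction cancels \<open>M\<close> and puts
   the fraction i / D of the total rise \<open>k\<close> in its place; the remaining orbits keep
   \<open>M\<close>. The definite description is well defined by \<open>dist\<close>.\<close>
 define cc where "cc C = (if \<exists>i<D. C = orb (p ! i) then M b + real (THE i. i < D & C = orb (p ! i)) * k / D - M (p ! (THE i. i < D & C = orb (p ! i))) else 0)" for C
 have the: "(THE j. j < D & orb (p ! i) = orb (p ! j)) = i" if i: "i < D" for i
 proof (rule the_equality)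
  show "i < D & orb (p ! i) = orb (p ! i)" using i by simp
  fix j assume j: "j < D & orb (p ! i) = orb (p ! j)"
  have V: "p ! i \<in> V" "p ! j \<in> V" using wn(1) i j plen by auto
  have "p ! i \<in> orb (p ! j)" "p ! j \<in> orb (p ! i)" using orb_refl[OF V(1)] orb_refl[OF V(2)] j by auto
  then show "j = i" using dist[of i j] dist[of j i] i j by (metis linorder_neqE_nat)
 qed
 have cci: "cc (orb (p ! i)) = M b + real i * k / D - M (p ! i)" if i: "i < D" for i
  using i the[OF i] unfolding cc_def by auto
 define L where "L x = (M x + cc (orb x)) / k" for x
 have Li: "L (p ! i) = L b + i / D" if i: "i < D" for i
 proof -
  have "L (p ! i) = (M b + real i * k / D) / k" if "i < D" for i using cci[OF that] unfolding L_def by simp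
  from this[OF i] this[OF D] show ?thesis using k p0b by (simp add: add_divide_distrib)
 qed
 have orb_g: "orb (ga x) = orb x" if "ga \<in> \<Gamma>" "x \<in> V" for ga x
  by (rule orb_eq[OF _ that(2)]) (use that orb_def in blast)
 have L_inv: "L (ga x) - L (ga y) = L x - L y" if "ga \<in> \<Gamma>" "x \<in> V" "y \<in> V" for ga x y
  using M_inv[OF that] orb_g[OF that(1,2)] orb_g[OF that(1,3)] k unfolding L_def by (simp add: diff_divide_distrib[symmetric])
 have Lorb: "k * (L x - L b) = M x - M b" if "x \<in> orb b" for x
  using orb_eq[OF that bV(1)] k unfolding L_def by (simp add: field_simps)
 have Lc: "L c = L b + 1" using Lorb[OF c(1)] k unfolding k_def[symmetric] by simp
 show ?thesis
 proof (intro exI conjI ballI)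
  show "0 < k" "0 < 1 / real D" "1 / real D <= 1" using k D by auto
  show "b \<in> V" by fact
  show "walk E V b (last p) p" "last p \<in> orb b" using w c unfolding last by auto
  show "L (last p) = L b + 1" using Lc unfolding last .
 next
  fix ga x y assume "ga \<in> \<Gamma>" "x \<in> V" "y \<in> V"
  then show "L (ga x) - L (ga y) = L x - L y" by (rule L_inv)
 next
  fix x assume x: "x \<in> orb b"
  then have "x \<in> V" using orb_sub[OF bV(1)] by blast
  then show "rho x b = exp (k * (L x - L b))" using M_rho[OF _ bV(1)] Lorb[OF x] by simp
 next
  fix x assume "x \<in> set p"
  then obtain i where i: "i < length p" "x = p ! i" by (metis in_set_conv_nth)
  consider "i = 0" | "i = D" | "0 < i" "i < D" using i plen by linarith
  then show "x = b \<or> x = last p \<or> L b + 1 / real D <= L x & L x <= L b + 1 - 1 / real D"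
  proof cases
   case 3
   have "real i + 1 <= real D" using 3 by linarith
   then have "1 / real D <= real i / D" "real i / D + 1 / real D <= 1" using 3 D by (auto simp: field_simps)
   then show ?thesis using Li[OF 3(2)] i(2) by simp
  qed (use i p0b pD last in auto)
 qed
qed

end

text \<open>No sign is imposed on \<open>s\<close>, because the locale has to be closed under
  reversing heights. In \<open>up0\<close> the two ends are the only vertices of the walk closer
  than \<open>g\<close> to the end levels.\<close>

locale hg = gr V \<Gamma> E for V :: "'v set" and \<Gamma> and E +
 fixes L :: "'v \<Rightarrow> real" and s g :: real and ob :: 'v
 assumes L_inv: "ga \<in> \<Gamma> ==> x \<in> V ==> y \<in> V ==> L (ga x) - L (ga y) = L x - L y"
  and ob_V: "ob \<in> V"
  and rho_L: "x \<in> orb ob ==> rho x ob = exp (s * (L x - L ob))"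
  and g_pos: "0 < g" and g_le: "g <= 1"
  and up0: "\<exists>p. walk E V ob (last p) p & last p \<in> orb ob & L (last p) = L ob + 1 &
   (\<forall>x\<in>set p. x = ob \<or> x = last p \<or> L ob + g <= L x & L x <= L ob + 1 - g)"
begin

abbreviation "Ob \<equiv> orb ob"

lemma Ob_V: "x \<in> Ob ==> x \<in> V"
 using orb_sub[OF ob_V] by blast

lemma ob_Ob: "ob \<in> Ob"
 by (rule orb_refl[OF ob_V])

lemma Ob_g: "ga \<in> \<Gamma> ==> x \<in> Ob ==> ga x \<in> Ob"
 using orb_step[OF _ ob_V] by blast

lemma Ob_trans: assumes "x \<in> Ob" "y \<in> Ob" shows "\<exists>ga\<in>\<Gamma>. ga x = y"
proof -
 have "y \<in> orb x" using assms orb_eq[OF assms(1) ob_V] by simp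
 then show ?thesis unfolding orb_def by blast
qed

lemma walk_gV: assumes g: "ga \<in> \<Gamma>" and p: "walk E V u v p" shows "walk E V (ga u) (ga v) (map ga p)"
proof -
 have "ga ` V \<subseteq> V" using gV[OF g] by blast
 then show ?thesis using walk_g[OF g p] unfolding walk_def by blast
qed

lemma up_step: "\<exists>l. \<forall>a\<in>Ob. \<exists>b p. b \<in> Ob & L b = L a + 1 & walk E V a b p & length p <= l &
 (\<forall>x\<in>set p. x = a \<or> x = b \<or> L a + g <= L x & L x <= L b - g)"
proof -
 obtain p where p: "walk E V ob (last p) p" "last p \<in> Ob" "L (last p) = L ob + 1"
  "!!x. x \<in> set p ==> x = ob \<or> x = last p \<or> L ob + g <= L x & L x <= L ob + 1 - g" using up0 by blast
 show ?thesis
 proof (intro exI[of _ "length p"] ballI)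
  fix a assume a: "a \<in> Ob"
  obtain ga where g: "ga \<in> \<Gamma>" "ga ob = a" using Ob_trans[OF ob_Ob a] by blast
  have pV: "x \<in> V" if "x \<in> set p" for x using p(1) that unfolding walk_def by blast
  have Lg: "L (ga x) = L x + (L a - L ob)" if "x \<in> V" for x using L_inv[OF g(1) that ob_V] g(2) by simp
  show "\<exists>b q. b \<in> Ob & L b = L a + 1 & walk E V a b q & length q <= length p &
   (\<forall>x\<in>set q. x = a \<or> x = b \<or> L a + g <= L x & L x <= L b - g)"
  proof (intro exI[of _ "ga (last p)"] exI[of _ "map ga p"] conjI ballI)
   show "ga (last p) \<in> Ob" using Ob_g[OF g(1) p(2)] .
   show Lb: "L (ga (last p)) = L a + 1" using Lg[of "last p"] p(2,3) Ob_V by simp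
   show "walk E V a (ga (last p)) (map ga p)" using walk_gV[OF g(1) p(1)] g(2) by simp
   fix x assume "x \<in> set (map ga p)"
   then obtain y where y: "y \<in> set p" "x = ga y" by auto
   show "x = a \<or> x = ga (last p) \<or> L a + g <= L x & L x <= L (ga (last p)) - g"
    using p(4)[OF y(1)] Lg[OF pV[OF y(1)]] Lb y(2) g(2) by auto
  qed simp
 qed
qed

text \<open>The unit step is run backwards and translated so that it starts at the base vertex
  again.\<close>

lemma neg: "hg V \<Gamma> E (%x. - L x) (- s) g ob"
proof unfold_locales
 fix ga x y assume "ga \<in> \<Gamma>" "x \<in> V" "y \<in> V"
 from L_inv[OF this] show "- L (ga x) - - L (ga y) = - L x - - L y" by simp
next
 fix x assume "x \<in> orb ob" from rho_L[OF this] show "rho x ob = exp (- s * (- L x - - L ob))" by (simp add: algebra_simps)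
next
 obtain b p where p: "b \<in> Ob" "L b = L ob + 1" "walk E V ob b p"
  "!!x. x \<in> set p ==> x = ob \<or> x = b \<or> L ob + g <= L x & L x <= L b - g" using up_step ob_Ob by meson
 obtain ga where g: "ga \<in> \<Gamma>" "ga b = ob" using Ob_trans[OF p(1) ob_Ob] by blast
 have pV: "x \<in> V" if "x \<in> set p" for x using p(3) that unfolding walk_def by blast
 have Lg: "L (ga x) = L x - 1" if "x \<in> V" for x using L_inv[OF g(1) that Ob_V[OF p(1)]] g(2) p(2) by simp
 let ?q = "map ga (rev p)"
 have w: "walk E V ob (ga ob) ?q" using walk_gV[OF g(1) walk_rev[OF p(3)]] g(2) by simp
 then have l: "last ?q = ga ob" unfolding walk_def by simp
 show "\<exists>p. walk E V ob (last p) p & last p \<in> orb ob & - L (last p) = - L ob + 1 &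
   (\<forall>x\<in>set p. x = ob \<or> x = last p \<or> - L ob + g <= - L x & - L x <= - L ob + 1 - g)"
 proof (intro exI[of _ ?q] conjI ballI; (unfold l)?)
  show "walk E V ob (ga ob) ?q" "ga ob \<in> orb ob" using w Ob_g[OF g(1) ob_Ob] by auto
  show "- L (ga ob) = - L ob + 1" using Lg[OF ob_V] by simp
  fix x assume "x \<in> set ?q"
  then obtain y where y: "y \<in> set p" "x = ga y" by auto
  show "x = ob \<or> x = ga ob \<or> - L ob + g <= - L x & - L x <= - L ob + 1 - g"
   using p(4)[OF y(1)] Lg[OF pV[OF y(1)]] y(2) g(2) p(2) by auto
 qed
qed (use ob_V g_pos g_le in auto)

lemma lip: "\<exists>t\<ge>0. \<forall>x y. {x, y} \<in> E --> \<bar>L x - L y\<bar> <= t"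
proof -
 obtain R where R: "finite R" "R \<subseteq> V" "!!v. v \<in> V ==> \<exists>r\<in>R. v \<in> orb r" using reps_ex by blast
 let ?t = "\<Sum>r\<in>R. \<Sum>y\<in>{w. {r, w} \<in> E}. \<bar>L r - L y\<bar>"
 have "\<bar>L x - L y\<bar> <= ?t" if e: "{x, y} \<in> E" for x y
 proof -
  have V: "x \<in> V" "y \<in> V" using edge_V[OF e] by auto
  obtain r where r: "r \<in> R" "x \<in> orb r" using R(3)[OF V(1)] by blast
  have rV: "r \<in> V" using r R by blast
  obtain ga where g: "ga \<in> \<Gamma>" "ga x = r" using orb_E[OF r(2) rV] by blast
  have e': "{r, ga y} \<in> E" using E_inv[OF g(1) e] g(2) by simp
  have "\<bar>L x - L y\<bar> = \<bar>L r - L (ga y)\<bar>" using L_inv[OF g(1) V] g(2) by simp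
  also have "... <= (\<Sum>y\<in>{w. {r, w} \<in> E}. \<bar>L r - L y\<bar>)"
   using e' nb_fin[OF rV] by (intro member_le_sum[of "ga y" _ "%y. \<bar>L r - L y\<bar>"]) auto
  also have "... <= ?t" using R(1) r(1) by (intro member_le_sum[of r _ "%r. \<Sum>y\<in>{w. {r, w} \<in> E}. \<bar>L r - L y\<bar>"] sum_nonneg) auto
  finally show ?thesis .
 qed
 moreover have "?t \<ge> 0" by (intro sum_nonneg) auto
 ultimately show ?thesis by blast
qed

lemma walk_lip: assumes t: "!!x y. {x, y} \<in> E ==> \<bar>L x - L y\<bar> <= t" "t \<ge> 0"
 shows "walk E S u v p ==> x \<in> set p ==> \<bar>L x - L u\<bar> <= t * length p"
proof (induction p arbitrary: u)
 case (Cons a p)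
 have au: "a = u" using Cons(2) unfolding walk_def by simp
 show ?case
 proof (cases "x = u")
  case True
  then show ?thesis using t(2) by simp
 next
  case False
  then have xp: "x \<in> set p" using Cons(3) au by simp
  then obtain b q where p: "p = b # q" by (cases p) auto
  have "walk E S b v p" "{u, b} \<in> E" using Cons(2) au unfolding p walk_def by auto
  then have "\<bar>L x - L b\<bar> <= t * length p" "\<bar>L u - L b\<bar> <= t" using Cons.IH[OF _ xp] t(1) by auto
  then show ?thesis by (simp add: distrib_left)
 qed
qed (simp add: walk_def)

text \<open>Translates of the unit step are concatenated. The length is linear in the height, so the
  price of opening such a walk is exponential in the height.\<close>

lemma up_iter: "\<exists>l. \<forall>k. \<forall>a\<in>Ob. \<exists>b p. b \<in> Ob & L b = L a + real k & walk E V a b p & length p <= k * l + 1 &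
 (\<forall>x\<in>set p. L a <= L x & (x = b \<or> L x <= L b - g))"
proof -
 obtain l where l: "!!a. a \<in> Ob ==> \<exists>b p. b \<in> Ob & L b = L a + 1 & walk E V a b p & length p <= l &
 (\<forall>x\<in>set p. x = a \<or> x = b \<or> L a + g <= L x & L x <= L b - g)" using up_step by meson
 have "\<exists>b p. b \<in> Ob & L b = L a + real k & walk E V a b p & length p <= k * l + 1 &
 (\<forall>x\<in>set p. L a <= L x & (x = b \<or> L x <= L b - g))" if "a \<in> Ob" for a k
 proof (induction k)
  case 0
  then show ?case using that Ob_V[OF that] by (intro exI[of _ a] exI[of _ "[a]"]) (auto simp: walk_def)
 next
  case (Suc k)
  then obtain b p where b: "b \<in> Ob" "L b = L a + real k" "walk E V a b p" "length p <= k * l + 1"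
   "!!x. x \<in> set p ==> L a <= L x & (x = b \<or> L x <= L b - g)" by blast
  obtain c q where c: "c \<in> Ob" "L c = L b + 1" "walk E V b c q" "length q <= l"
   "!!x. x \<in> set q ==> x = b \<or> x = c \<or> L b + g <= L x & L x <= L c - g" using l[OF b(1)] by blast
  have w: "walk E V a c (p @ tl q)" using walk_append[OF b(3) c(3)] by blast
  have "length (p @ tl q) <= Suc k * l + 1" using b(4) c(4) by simp
  moreover have "L a <= L x & (x = c \<or> L x <= L c - g)" if "x \<in> set (p @ tl q)" for x
  proof -
   have "x \<in> set p \<or> x \<in> set q" using that by (cases q) auto
   then show ?thesis using b(5)[of x] c(5)[of x] b(2) c(2) g_pos g_le by auto
  qed
  ultimately show ?case using w c(1,2) b(2) by (intro exI[of _ c] exI[of _ "p @ tl q"]) auto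
 qed
 then show ?thesis by blast
qed

lemma near_Ob: "\<exists>l. \<forall>w\<in>V. \<exists>a\<in>Ob. \<exists>p. walk E V w a p & length p <= l"
proof -
 obtain R where R: "finite R" "R \<subseteq> V" "!!v. v \<in> V ==> \<exists>r\<in>R. v \<in> orb r" using reps_ex by blast
 have "\<forall>r\<in>R. \<exists>p. walk E V r ob p" using E_conn R(2) ob_V by blast
 then obtain q where q: "!!r. r \<in> R ==> walk E V r ob (q r)" by metis
 show ?thesis
 proof (intro exI[of _ "\<Sum>r\<in>R. length (q r)"] ballI)
  fix w assume w: "w \<in> V"
  obtain r where r: "r \<in> R" "w \<in> orb r" using R(3)[OF w] by blast
  then obtain ga where g: "ga \<in> \<Gamma>" "ga r = w" unfolding orb_def by blast
  show "\<exists>a\<in>Ob. \<exists>p. walk E V w a p & length p <= (\<Sum>r\<in>R. length (q r))"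
   using walk_gV[OF g(1) q[OF r(1)]] g Ob_g[OF g(1) ob_Ob] member_le_sum[OF r(1), of "%r. length (q r)"] R(1)
   by (intro bexI[of _ "ga ob"] exI[of _ "map ga (q r)"]) auto
 qed
qed

text \<open>Go to \<open>Ob\<close> within bounded distance, then climb. The dip \<open>h0\<close>
  below the start is fixed before the rise \<open>h\<close> is chosen; this order of quantifiers
  lets \<open>ins\<close> make the walks of \<open>top\<close> and \<open>bot\<close> clear each
  other's excursions.\<close>

lemma top: "\<exists>h0\<ge>0. \<forall>h\<ge>0. \<exists>l h1. \<forall>w\<in>V. \<exists>x\<in>Ob. \<exists>p. walk E V w x p & length p <= l & L w + h <= L x - g & L x <= L w + h1 &
 (\<forall>y\<in>set p. L w - h0 <= L y & (y = x \<or> L y <= L x - g))"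
proof -
 obtain t where t: "!!x y. {x, y} \<in> E ==> \<bar>L x - L y\<bar> <= t" "t \<ge> 0" using lip by blast
 obtain l1 where l1: "!!w. w \<in> V ==> \<exists>a\<in>Ob. \<exists>p. walk E V w a p & length p <= l1" using near_Ob by blast
 obtain l2 where l2: "!!k a. a \<in> Ob ==> \<exists>b p. b \<in> Ob & L b = L a + real k & walk E V a b p & length p <= k * l2 + 1 &
 (\<forall>x\<in>set p. L a <= L x & (x = b \<or> L x <= L b - g))" using up_iter by blast
 define h0 where "h0 = t * l1"
 have h0: "h0 \<ge> 0" unfolding h0_def using t(2) by simp
 show ?thesis
 proof (intro exI[of _ h0] conjI allI impI h0)
  fix h :: real assume h: "h \<ge> 0"
  define k where "k = nat \<lceil>h + 2 * h0 + 1\<rceil>"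
  have k: "real k \<ge> h + 2 * h0 + 1" unfolding k_def by linarith
  show "\<exists>l h1. \<forall>w\<in>V. \<exists>x\<in>Ob. \<exists>p. walk E V w x p & length p <= l & L w + h <= L x - g & L x <= L w + h1 &
   (\<forall>y\<in>set p. L w - h0 <= L y & (y = x \<or> L y <= L x - g))"
  proof (intro exI[of _ "l1 + (k * l2 + 1)"] exI[of _ "h0 + real k"] ballI)
   fix w assume w: "w \<in> V"
   obtain a p where a: "a \<in> Ob" "walk E V w a p" "length p <= l1" using l1[OF w] by blast
   have Lp: "\<bar>L y - L w\<bar> <= h0" if "y \<in> set p" for y
   proof -
    have "t * real (length p) <= t * real l1" using a(3) t(2) by (intro mult_left_mono) auto
    then show ?thesis using walk_lip[OF t a(2) that] unfolding h0_def by simp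
   qed
   have "a \<in> set p" using a(2) last_in_set unfolding walk_def by metis
   then have La: "\<bar>L a - L w\<bar> <= h0" by (rule Lp)
   obtain b q where b: "b \<in> Ob" "L b = L a + real k" "walk E V a b q" "length q <= k * l2 + 1"
    "!!x. x \<in> set q ==> L a <= L x & (x = b \<or> L x <= L b - g)" using l2[OF a(1), of k] by blast
   have "L w - h0 <= L y & (y = b \<or> L y <= L b - g)" if "y \<in> set (p @ tl q)" for y
   proof -
    have "y \<in> set p \<or> y \<in> set q" using that by (cases q) auto
    then show ?thesis using Lp[of y] b(2,5) La k g_le h by fastforce
   qed
   then show "\<exists>x\<in>Ob. \<exists>p. walk E V w x p & length p <= l1 + (k * l2 + 1) & L w + h <= L x - g & L x <= L w + (h0 + real k) &
   (\<forall>y\<in>set p. L w - h0 <= L y & (y = x \<or> L y <= L x - g))"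
    using walk_append[OF a(2) b(3)] a(3) b(1,2,4) La k g_le
    by (intro bexI[of _ b] exI[of _ "p @ tl q"]) auto
  qed
 qed
qed

lemma bot: "\<exists>h0\<ge>0. \<forall>h\<ge>0. \<exists>l h1. \<forall>w\<in>V. \<exists>x\<in>Ob. \<exists>p. walk E V w x p & length p <= l & L x + g <= L w - h & L w - h1 <= L x &
 (\<forall>y\<in>set p. L y <= L w + h0 & (y = x \<or> L x + g <= L y))"
proof -
 obtain h0 where h0: "h0 \<ge> 0" and *: "!!h. h \<ge> 0 ==> \<exists>l h1. \<forall>w\<in>V. \<exists>x\<in>Ob. \<exists>p. walk E V w x p & length p <= l & - L w + h <= - L x - g & - L x <= - L w + h1 &
 (\<forall>y\<in>set p. - L w - h0 <= - L y & (y = x \<or> - L y <= - L x - g))" using hg.top[OF neg] by blast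
 have e: "(- L w + h <= - L x - g) = (L x + g <= L w - h)" "(- L x <= - L w + h1) = (L w - h1 <= L x)"
  "(- L w - h0 <= - L y) = (L y <= L w + h0)" "(- L y <= - L x - g) = (L x + g <= L y)" for w x h h1 y by auto
 show ?thesis using h0 *[unfolded e] by blast
qed

text \<open>\<open>s * L\<close> and the logarithm of \<open>rho\<close> to a fixed vertex differ by
  a function of the orbit, which takes finitely many values.\<close>

lemma rho_bound: "\<exists>C>0. \<forall>y\<in>V. \<forall>v\<in>V. rho y v <= C * exp (s * (L y - L v))"
proof -
 obtain R where R: "finite R" "R \<subseteq> V" "!!v. v \<in> V ==> \<exists>r\<in>R. v \<in> orb r" using reps_ex by blast
 define K where "K r = rho r ob * exp (s * (L ob - L r))" for r
 have K: "K r > 0" if "r \<in> R" for r using that R(2) ob_V rho_pos unfolding K_def by auto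
 have x: "\<exists>r\<in>R. rho x ob = K r * exp (s * (L x - L ob))" if x: "x \<in> V" for x
 proof -
  obtain r where r: "r \<in> R" "x \<in> orb r" using R(3)[OF x] by blast
  have rV: "r \<in> V" using r R by blast
  obtain ga where g: "ga \<in> \<Gamma>" "ga r = x" using r(2) unfolding orb_def by blast
  have gb: "ga ob \<in> Ob" "ga ob \<in> V" using Ob_g[OF g(1) ob_Ob] Ob_V by auto
  have "rho x ob = rho x (ga ob) * rho (ga ob) ob" using rho_cocycle[OF x gb(2) ob_V] by simp
  also have "... = rho r ob * exp (s * (L (ga ob) - L ob))" using rho_inv[OF g(1) rV ob_V] g(2) rho_L[OF gb(1)] by simp
  also have "L (ga ob) - L ob = (L ob - L r) + (L x - L ob)" using L_inv[OF g(1) ob_V rV] g(2) by simp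
  finally have "rho x ob = K r * exp (s * (L x - L ob))" unfolding K_def distrib_left exp_add by (simp only: mult.assoc)
  then show ?thesis using r(1) by blast
 qed
 let ?C = "\<Sum>r\<in>R. \<Sum>r'\<in>R. K r / K r'"
 have C: "K r / K r' <= ?C" if "r \<in> R" "r' \<in> R" for r r'
 proof -
  have "K r / K r' <= (\<Sum>r'\<in>R. K r / K r')" using R(1) K that by (intro member_le_sum[of r' _ "%r'. K r / K r'"]) (auto simp: less_imp_le)
  also have "... <= ?C" using R(1) K that by (intro member_le_sum[of r _ "%r. \<Sum>r'\<in>R. K r / K r'"] sum_nonneg) (auto simp: less_imp_le)
  finally show ?thesis .
 qed
 have b: "rho y v <= ?C * exp (s * (L y - L v))" if V: "y \<in> V" "v \<in> V" for y v
 proof -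
  obtain r where r: "r \<in> R" "rho y ob = K r * exp (s * (L y - L ob))" using x[OF V(1)] by blast
  obtain r' where r': "r' \<in> R" "rho v ob = K r' * exp (s * (L v - L ob))" using x[OF V(2)] by blast
  have "rho y v = rho y ob / rho v ob" using rho_cocycle[OF V ob_V] rho_pos[OF V(2) ob_V] by (simp add: field_simps)
  also have "... = K r / K r' * (exp (s * (L y - L ob)) / exp (s * (L v - L ob)))" unfolding r(2) r'(2) by simp
  also have "exp (s * (L y - L ob)) / exp (s * (L v - L ob)) = exp (s * (L y - L v))" unfolding exp_diff[symmetric] by (simp add: algebra_simps)
  also have "K r / K r' * exp (s * (L y - L v)) <= ?C * exp (s * (L y - L v))" using C[OF r(1) r'(1)] by (intro mult_right_mono) auto
  finally show ?thesis .
 qed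
 have "0 < ?C * exp (s * (L ob - L ob))" using less_le_trans[OF rho_pos[OF ob_V ob_V] b[OF ob_V ob_V]] .
 then have "?C > 0" by simp
 then show ?thesis using b by blast
qed

text \<open>The form of mass transport used for susceptibilities: sums over end vertices are
  controlled by sums over start vertices weighted with the modular function, uniformly in
  \<open>F\<close>.\<close>

lemma mtp: "\<exists>C>0. \<forall>(F :: 'v \<Rightarrow> 'v \<Rightarrow> ennreal) K. (\<forall>ga\<in>\<Gamma>. \<forall>a\<in>V. \<forall>b\<in>V. F (ga a) (ga b) = F a b) -->
 (\<forall>v\<in>V. (\<integral>\<^sup>+y. F y v * ennreal (exp (s * (L y - L v))) \<partial>count_space V) <= K) -->
 (\<forall>u\<in>V. (\<integral>\<^sup>+x. F u x \<partial>count_space V) <= ennreal C * K)"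
proof -
 obtain R where R: "finite R" "R \<subseteq> V" "!!v. v \<in> V ==> \<exists>r\<in>R. v \<in> orb r" using reps_ex by blast
 obtain C where C: "C > 0" "!!y v. y \<in> V ==> v \<in> V ==> rho y v <= C * exp (s * (L y - L v))" using rho_bound by blast
 have Rne: "card R > 0" using R ob_V by (auto simp: card_gt_0_iff)
 show ?thesis
 proof (intro exI[of _ "real (card R) * C"] conjI allI impI ballI)
  show "0 < real (card R) * C" using Rne C by simp
  fix F :: "'v \<Rightarrow> 'v \<Rightarrow> ennreal" and K u
  assume inv: "\<forall>ga\<in>\<Gamma>. \<forall>a\<in>V. \<forall>b\<in>V. F (ga a) (ga b) = F a b"
   and K: "\<forall>v\<in>V. (\<integral>\<^sup>+y. F y v * ennreal (exp (s * (L y - L v))) \<partial>count_space V) <= K" and u: "u \<in> V"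
  have "(\<integral>\<^sup>+x. F u x \<partial>count_space V) <= (\<Sum>r\<in>R. \<integral>\<^sup>+y. F y r * ennreal (rho y r) \<partial>count_space V)"
   using mtp_le[OF R _ u, of F] inv by blast
  also have "... <= (\<Sum>r\<in>R. ennreal C * K)"
  proof (rule sum_mono)
   fix r assume "r \<in> R"
   then have r: "r \<in> V" using R by blast
   have "(\<integral>\<^sup>+y. F y r * ennreal (rho y r) \<partial>count_space V) <= (\<integral>\<^sup>+y. ennreal C * (F y r * ennreal (exp (s * (L y - L r)))) \<partial>count_space V)"
   proof (rule nn_integral_mono)
    fix y assume "y \<in> space (count_space V)"
    then have "ennreal (rho y r) <= ennreal C * ennreal (exp (s * (L y - L r)))"
     using C(2)[OF _ r, of y] C(1) by (simp add: ennreal_mult'[symmetric] ennreal_leI)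
    from mult_left_mono[OF this, of "F y r"]
    show "F y r * ennreal (rho y r) <= ennreal C * (F y r * ennreal (exp (s * (L y - L r))))" by (simp add: ac_simps)
   qed
   also have "... = ennreal C * (\<integral>\<^sup>+y. F y r * ennreal (exp (s * (L y - L r))) \<partial>count_space V)"
    by (rule nn_integral_cmult) simp
   also have "... <= ennreal C * K" using K r by (intro mult_left_mono) auto
   finally show "(\<integral>\<^sup>+y. F y r * ennreal (rho y r) \<partial>count_space V) <= ennreal C * K" .
  qed
  also have "... = ennreal (real (card R) * C) * K" using C(1) by (simp add: ennreal_mult' mult.assoc ennreal_of_nat_eq_real_of_nat)
  finally show "(\<integral>\<^sup>+x. F u x \<partial>count_space V) <= ennreal (real (card R) * C) * K" .
 qed
qed

lemma mtp_Ob: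
 fixes F :: "'v \<Rightarrow> 'v \<Rightarrow> ennreal"
 assumes inv: "!!ga a b. ga \<in> \<Gamma> ==> a \<in> V ==> b \<in> V ==> F (ga a) (ga b) = F a b" and u: "u \<in> Ob"
 shows "(\<integral>\<^sup>+x. F u x \<partial>count_space Ob) = (\<integral>\<^sup>+y. F y ob * ennreal (exp (s * (L y - L ob))) \<partial>count_space Ob)"
proof -
 have "(\<integral>\<^sup>+x. F u x \<partial>count_space Ob) = (\<integral>\<^sup>+y. F y ob * ennreal (rho y ob) \<partial>count_space (orb u))"
  by (rule mass_transport[OF inv Ob_V[OF u] ob_V])
 also have "orb u = Ob" by (rule orb_eq[OF u ob_V])
 also have "(\<integral>\<^sup>+y. F y ob * ennreal (rho y ob) \<partial>count_space Ob) = (\<integral>\<^sup>+y. F y ob * ennreal (exp (s * (L y - L ob))) \<partial>count_space Ob)"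
  using rho_L by (intro nn_integral_cong) simp
 finally show ?thesis .
qed

end

section \<open>Connection events: cutting paths, inserting edges, the tree-graph inequality\<close>

lemma pp_cong_pe: assumes "!!e. e \<in> E ==> pe e = pe' e" shows "pp E pe P = pp E pe' P"
proof -
 have "PM E pe = PM E pe'" unfolding PM_def by (rule PiM_cong) (auto simp: assms)
 then show ?thesis unfolding pp_def by simp
qed

lemma disj_unions_fam: "\<S> \<subseteq> fam E ==> \<T> \<subseteq> fam E ==> disj_unions (\<S> \<times> \<T>) \<subseteq> fam E"
 unfolding disj_unions_def fam_def by auto

lemma disj_unionsI: "S \<in> \<S> ==> T \<in> \<T> ==> S \<inter> T = {} ==> S \<union> T \<in> disj_unions (\<S> \<times> \<T>)"
 unfolding disj_unions_def by blast

lemma pp_le_sum_BK: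
 assumes E: "countable E" and p: "!!e. e \<in> E ==> 0 <= pe e & pe e <= 1" and M: "countable M"
  and F: "!!m. m \<in> M ==> \<A> m \<subseteq> fam E" "!!m. m \<in> M ==> \<B> m \<subseteq> fam E"
  and P: "!!xi. P xi ==> \<exists>m\<in>M. \<exists>A\<in>\<A> m. \<exists>B\<in>\<B> m. A \<inter> B = {} & (\<forall>e\<in>A \<union> B. xi e)"
 shows "ennreal (pp E pe P) <= (\<integral>\<^sup>+m. ennreal (pr E pe (\<A> m) * pr E pe (\<B> m)) \<partial>count_space M)"
proof -
 have "ennreal (pp E pe P) <= (\<integral>\<^sup>+m. ennreal (pr E pe (disj_unions (\<A> m \<times> \<B> m))) \<partial>count_space M)"
 proof (rule pp_ex_le_sum[OF M])
  show "ms E (occ (disj_unions (\<A> m \<times> \<B> m)))" if "m \<in> M" for m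
   by (rule ms_occ[OF E disj_unions_fam[OF F(1)[OF that] F(2)[OF that]]])
  fix xi assume "P xi"
  from P[OF this] obtain m A B where m: "m \<in> M" "A \<in> \<A> m" "B \<in> \<B> m" "A \<inter> B = {}" "\<forall>e\<in>A \<union> B. xi e" by blast
  show "\<exists>m\<in>M. occ (disj_unions (\<A> m \<times> \<B> m)) xi" unfolding occ_def
   by (rule bexI[OF _ m(1)], rule bexI[OF _ disj_unionsI[OF m(2-4)]], rule m(5))
 qed
 also have "... <= (\<integral>\<^sup>+m. ennreal (pr E pe (\<A> m) * pr E pe (\<B> m)) \<partial>count_space M)"
  using BK[OF E F p] by (intro nn_integral_mono ennreal_leI) auto
 finally show ?thesis .
qed

text \<open>Applied with the height as \<open>f\<close> it cuts a path at its top, with the negative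
  height at its bottom.\<close>

lemma pth_max_split:
 fixes f :: "'v \<Rightarrow> real"
 assumes p: "p \<in> pth E S u v"
 shows "\<exists>m\<in>S. \<exists>A\<in>pf E {x \<in> S. f x <= f m} u m. \<exists>B\<in>pf E {x \<in> S. f x <= f m} m v. A \<inter> B = {} & A \<union> B \<subseteq> edgs p"
proof -
 have pS: "p \<noteq> []" "set p \<subseteq> S" using p unfolding pth_def walk_def by auto
 have "Max (f ` set p) \<in> f ` set p" using pS by (intro Max_in) auto
 then obtain m where m: "m \<in> set p" "f m = Max (f ` set p)" by auto
 have mx: "f x <= f m" if "x \<in> set p" for x unfolding m(2) using that by (intro Max_ge) auto
 obtain p1 p2 where p12: "p = p1 @ m # p2" using m(1) split_list by metis
 note sp = pth_split[OF p[unfolded p12]]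
 have "p1 @ [m] \<in> pth E {x \<in> S. f x <= f m} u m" "m # p2 \<in> pth E {x \<in> S. f x <= f m} m v"
  using sp(1,2) mx unfolding p12 pth_def walk_def by auto
 then show ?thesis using sp(3,4) m(1) pS unfolding pf_def p12
  by (intro bexI[of _ m] bexI[of _ "edgs (p1 @ [m])"] bexI[of _ "edgs (m # p2)"]) auto
qed

text \<open>The cut at the first exit from \<open>B\<close>, as in the Simon-Lieb inequality. The
  exit edge belongs to neither piece.\<close>

lemma pth_exit_split:
 assumes p: "p \<in> pth E S u v" and u: "u \<in> B" and v: "v \<notin> B"
 shows "\<exists>x\<in>B \<inter> S. \<exists>y\<in>S - B. {x, y} \<in> E & (\<exists>A\<in>pf E (S \<inter> B) u x. \<exists>C\<in>pf E S y v. A \<inter> C = {} & A \<union> C \<subseteq> edgs p)"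
proof -
 have pS: "p \<noteq> []" "set p \<subseteq> S" "hd p = u" "last p = v" "edgs p \<subseteq> E" using p unfolding pth_def walk_def by auto
 have "v \<in> set p" using pS by auto
 then obtain p1 y p2 where p1: "p = p1 @ y # p2" "y \<notin> B" "\<forall>x\<in>set p1. \<not> x \<notin> B"
  using split_list_first_prop[of p "%x. x \<notin> B"] v by blast
 have "p1 \<noteq> []" using p1 pS(3) u by (cases p1) auto
 then obtain p0 x where p0: "p1 = p0 @ [x]" by (metis rev_exhaust)
 have px: "p = p0 @ x # y # p2" unfolding p1 p0 by simp
 note s1 = pth_split[OF p[unfolded px]] and s2 = pth_split[OF p[unfolded p1(1)]]
 have e: "edgs (x # y # p2) = insert {x, y} (edgs (y # p2))" by simp
 have "p0 @ [x] \<in> pth E (S \<inter> B) u x" using s1(1) p1(3) unfolding p0 pth_def walk_def by auto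
 moreover have "edgs (p0 @ [x]) \<inter> edgs (y # p2) = {}" using s1(3) unfolding e by blast
 moreover have "edgs (p0 @ [x]) \<union> edgs (y # p2) \<subseteq> edgs p" using s1(4) unfolding px e by blast
 moreover have "{x, y} \<in> E" using pS(5) s1(4) unfolding px e by blast
 moreover have "x \<in> B \<inter> S" "y \<in> S - B" using p1 pS(2) unfolding p0 by auto
 ultimately show ?thesis using s2(2) unfolding pf_def by blast
qed

lemma pf_ext:
 assumes A: "A \<in> pf E S u v" and p: "walk E S' u' u p" and q: "walk E S' v v' q" and S: "S \<subseteq> S'"
 shows "\<exists>T\<in>pf E S' u' v'. T \<subseteq> (edgs p \<union> edgs q) \<union> A"
proof -
 obtain r where r: "walk E S u v r" "A = edgs r" using A unfolding pf_def pth_def by blast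
 have r': "walk E S' u v r" using r(1) S unfolding walk_def by blast
 obtain w where w: "walk E S' u' v w" "edgs w = edgs p \<union> A" using walk_append[OF p r'] r(2) by blast
 obtain w' where w': "walk E S' u' v' w'" "edgs w' = edgs p \<union> A \<union> edgs q" using walk_append[OF w(1) q] w(2) by blast
 obtain t where "walk E S' u' v' t" "distinct t" "edgs t \<subseteq> edgs w'" using walk_distinct[OF w'(1)] by blast
 then show ?thesis using w'(2) unfolding pf_def pth_def by (intro bexI[of _ "edgs t"]) auto
qed

context gr
begin

definition inv_pe :: "('v set \<Rightarrow> real) \<Rightarrow> bool" where
 "inv_pe pe \<longleftrightarrow> (\<forall>e\<in>E. 0 <= pe e & pe e <= 1 & (\<forall>ga\<in>\<Gamma>. pe (ga ` e) = pe e))"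

definition cn :: "('v set \<Rightarrow> real) \<Rightarrow> 'v set \<Rightarrow> 'v \<Rightarrow> 'v \<Rightarrow> real" where
 "cn pe S u v = pr E pe (pf E S u v)"

lemma inv_pe01: "inv_pe pe ==> e \<in> E ==> 0 <= pe e & pe e <= 1"
 unfolding inv_pe_def by blast

lemma pp_g: assumes pe: "inv_pe pe" and g: "ga \<in> \<Gamma>" and P: "ms E P" "dep E P"
 shows "pp E pe (%xi. P (%e. xi (ga ` e))) = pp E pe P"
proof -
 have inj: "inj_on ((`) ga) E"
  using inj_on_image_eq_iff[OF g_inj[OF g] edge_sub edge_sub] by (intro inj_onI) blast
 have im: "(`) ga ` E \<subseteq> E" using img_E[OF g] by blast
 have "pp E (pe \<circ> (`) ga) P = pp E pe P" using pe g by (intro pp_cong_pe) (simp add: inv_pe_def)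
 then show ?thesis using pp_reindex[OF inj im P, of pe] by simp
qed

lemma pr_g_le: assumes pe: "inv_pe pe" and g: "ga \<in> \<Gamma>" and S: "\<S> \<subseteq> fam E" "\<T> \<subseteq> fam E"
  and ST: "!!S. S \<in> \<S> ==> \<exists>T\<in>\<T>. T \<subseteq> (`) ga ` S"
 shows "pr E pe \<S> <= pr E pe \<T>"
proof -
 have "\<Union>\<S> \<subseteq> E" using S(1) unfolding fam_def by blast
 then have "pr E pe \<S> = pp E pe (%xi. occ \<S> (%e. xi (ga ` e)))"
  using pp_g[OF pe g ms_occ[OF countable_E S(1)] dep_occ] by simp
 also have "... <= pr E pe \<T>"
 proof (rule pp_mono[OF ms_occ[OF countable_E S(2)]])
  fix xi assume "occ \<S> (%e. xi (ga ` e))"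
  then obtain S where s: "S \<in> \<S>" "\<forall>e\<in>S. xi (ga ` e)" unfolding occ_def by blast
  obtain T where "T \<in> \<T>" "T \<subseteq> (`) ga ` S" using ST[OF s(1)] by blast
  then show "occ \<T> xi" using s(2) unfolding occ_def by (intro bexI[of _ T]) auto
 qed
 finally show ?thesis .
qed

text \<open>Translating the witnesses gives one inequality, and the inverse element gives the
  other.\<close>

lemma cn_g: assumes pe: "inv_pe pe" and g: "ga \<in> \<Gamma>" and Q: "!!x. x \<in> V ==> Q' (ga x) \<longleftrightarrow> Q x" and u: "u \<in> V" "v \<in> V"
 shows "cn pe {x \<in> V. Q' x} (ga u) (ga v) = cn pe {x \<in> V. Q x} u v"
proof -
 have *: "cn pe {x \<in> V. Q x} u v <= cn pe {x \<in> V. Q' x} (ga u) (ga v)" if g: "ga \<in> \<Gamma>" and Q: "!!x. x \<in> V ==> Q' (ga x) \<longleftrightarrow> Q x" for ga Q Q' u v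
  unfolding cn_def
 proof (rule pr_g_le[OF pe g pth_fam pth_fam])
  fix S assume "S \<in> pf E {x \<in> V. Q x} u v"
  from pf_g[OF g _ this] have "(`) ga ` S \<in> pf E (ga ` {x \<in> V. Q x}) (ga u) (ga v)" by simp
  also have "ga ` {x \<in> V. Q x} = {x \<in> V. Q' x}" by (rule region_g[OF g]) (rule Q)
  finally have "(`) ga ` S \<in> pf E {x \<in> V. Q' x} (ga u) (ga v)" .
  then show "\<exists>T\<in>pf E {x \<in> V. Q' x} (ga u) (ga v). T \<subseteq> (`) ga ` S" by blast
 qed
 obtain \<eta> where e: "\<eta> \<in> \<Gamma>" "!!x. x \<in> V ==> \<eta> (ga x) = x & ga (\<eta> x) = x" using g_inv[OF g] by blast
 have "Q (\<eta> x) \<longleftrightarrow> Q' x" if "x \<in> V" for x using Q[OF gV[OF e(1) that]] e(2)[OF that] by simp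
 then have "cn pe {x \<in> V. Q' x} (ga u) (ga v) <= cn pe {x \<in> V. Q x} (\<eta> (ga u)) (\<eta> (ga v))" by (rule *[OF e(1)])
 moreover have "cn pe {x \<in> V. Q x} u v <= cn pe {x \<in> V. Q' x} (ga u) (ga v)" by (rule *[OF g]) (rule Q)
 ultimately show ?thesis using e(2) u by (simp add: order_antisym)
qed

lemma cn_nonneg [simp]: "0 <= cn pe S u v"
 unfolding cn_def by (rule pp_nonneg)

lemma cn_le1 [simp]: "cn pe S u v <= 1"
 unfolding cn_def by (rule pp_le_1)

lemma cn_sym: "cn pe S u v = cn pe S v u"
 unfolding cn_def by (simp add: pf_sym)

lemma cn_mono: assumes "S \<subseteq> T" shows "cn pe S u v <= cn pe T u v"
 unfolding cn_def
proof (rule pr_mono[OF countable_E pth_fam])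
 fix A assume "A \<in> pf E S u v"
 then have "A \<in> pf E T u v" using pf_mono[OF assms, of E u v] by (rule subsetD[rotated])
 then show "\<exists>B\<in>pf E T u v. B \<subseteq> A" by (rule bexI[rotated]) simp
qed

lemma cn_mono_pe: "(!!e. e \<in> E ==> 0 <= pe e & pe e <= pe' e & pe' e <= 1) ==> cn pe S u v <= cn pe' S u v"
 unfolding cn_def by (rule pr_mono_pe[OF countable_E pth_fam])

lemma cn_zero: assumes "u \<notin> S \<or> v \<notin> S" shows "cn pe S u v = 0"
proof -
 have "\<not> walk E S u v p" for p using assms walk_ends[of S u v p] by blast
 then have "pf E S u v = {}" unfolding pf_def pth_def by simp
 then show ?thesis unfolding cn_def by (simp add: pr_empty)
qed

text \<open>Each edge of \<open>S0\<close> can be opened at the price of a factor \<open>c\<close>;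
  together with any old witness these edges contain a new one.\<close>

lemma pr_ins:
 assumes c: "0 <= c" "c <= 1" "!!e. e \<in> E ==> c <= pe e & pe e <= 1"
  and F: "\<S> \<subseteq> fam E" "\<T> \<subseteq> fam E" and S0: "finite S0" "S0 \<subseteq> E" "card S0 <= n"
  and T: "!!S. S \<in> \<S> ==> \<exists>T\<in>\<T>. T \<subseteq> S0 \<union> S"
 shows "c ^ n * pr E pe \<S> <= pr E pe \<T>"
proof -
 have "c ^ n * pr E pe \<S> <= c ^ card S0 * pr E pe \<S>" using c(1,2) S0(3) by (intro mult_right_mono power_decreasing pp_nonneg)
 also have "... <= pr E pe ((\<union>) S0 ` \<S>)" using pr_insert[OF countable_E F(1) c(3) c(1) S0(1,2)] .
 also have "... <= pr E pe \<T>"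
 proof (rule pr_mono[OF countable_E F(2)])
  fix A assume "A \<in> (\<union>) S0 ` \<S>"
  then obtain S where "S \<in> \<S>" "A = S0 \<union> S" by (rule imageE)
  then show "\<exists>T\<in>\<T>. T \<subseteq> A" using T[of S] by simp
 qed
 finally show ?thesis .
qed

lemma card_edgs2: assumes "length p + length q <= n" shows "card (edgs p \<union> edgs q) <= n"
 using card_Un_le[of "edgs p" "edgs q"] card_edgs[of p] card_edgs[of q] assms by linarith

lemma cn_ins:
 assumes c: "0 <= c" "c <= 1" "!!e. e \<in> E ==> c <= pe e & pe e <= 1"
  and p: "walk E S' u' u p" and q: "walk E S' v v' q" and S: "S \<subseteq> S'" and n: "length p + length q <= n"
 shows "c ^ n * cn pe S u v <= cn pe S' u' v'"
 unfolding cn_def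
proof (rule pr_ins[OF c pth_fam pth_fam _ _ card_edgs2[OF n]])
 show "edgs p \<union> edgs q \<subseteq> E" using p q unfolding walk_def by blast
 show "\<exists>T\<in>pf E S' u' v'. T \<subseteq> (edgs p \<union> edgs q) \<union> A" if "A \<in> pf E S u v" for A using pf_ext[OF that p q S] .
 show "finite (edgs p \<union> edgs q)" by (rule finite_UnI[OF finite_edgs finite_edgs])
qed

lemma cn_dec_max:
 fixes f :: "'v \<Rightarrow> real"
 assumes pe: "!!e. e \<in> E ==> 0 <= pe e & pe e <= 1" and S: "S \<subseteq> V"
 shows "ennreal (cn pe S u v) <= (\<integral>\<^sup>+m. ennreal (cn pe {x \<in> S. f x <= f m} u m * cn pe {x \<in> S. f x <= f m} m v) \<partial>count_space V)"
 unfolding cn_def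
proof (rule pp_le_sum_BK[OF countable_E pe countable_V pth_fam pth_fam])
 fix xi assume "occ (pf E S u v) xi"
 then obtain p where p: "p \<in> pth E S u v" "\<forall>e\<in>edgs p. xi e" unfolding occ_def pf_def by blast
 show "\<exists>m\<in>V. \<exists>A\<in>pf E {x \<in> S. f x <= f m} u m. \<exists>B\<in>pf E {x \<in> S. f x <= f m} m v. A \<inter> B = {} & (\<forall>e\<in>A \<union> B. xi e)"
  using pth_max_split[OF p(1), of f] p(2) S by (meson subsetD)
qed

text \<open>The three branches found by \<open>pf_tree\<close> occur disjointly, so BK applies
  twice.\<close>

lemma tree_graph:
 assumes pe: "!!e. e \<in> E ==> 0 <= pe e & pe e <= 1"
 shows "ennreal (pp E pe (%xi. occ (pf E V u x) xi & occ (pf E V u y) xi)) <=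
  (\<integral>\<^sup>+z. ennreal (cn pe V u z * cn pe V z x * cn pe V z y) \<partial>count_space V)"
proof -
 have "ennreal (pp E pe (%xi. occ (pf E V u x) xi & occ (pf E V u y) xi)) <=
  (\<integral>\<^sup>+z. ennreal (pr E pe (disj_unions (pf E V u z \<times> pf E V z x)) * cn pe V z y) \<partial>count_space V)"
  unfolding cn_def
 proof (rule pp_le_sum_BK[OF countable_E pe countable_V disj_unions_fam[OF pth_fam pth_fam] pth_fam])
  fix xi assume "occ (pf E V u x) xi & occ (pf E V u y) xi"
  then obtain A B where A: "A \<in> pf E V u x" "B \<in> pf E V u y" "\<forall>e\<in>A \<union> B. xi e" unfolding occ_def by blast
  from pf_tree[OF A(1,2)] obtain z a b c where z: "z \<in> V" "a \<in> pf E V u z" "b \<in> pf E V z x" "c \<in> pf E V z y"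
   "a \<inter> b = {}" "(a \<union> b) \<inter> c = {}" "a \<union> b \<union> c \<subseteq> A \<union> B" by blast
  show "\<exists>m\<in>V. \<exists>A\<in>disj_unions (pf E V u m \<times> pf E V m x). \<exists>B\<in>pf E V m y. A \<inter> B = {} & (\<forall>e\<in>A \<union> B. xi e)"
   using z A(3) disj_unionsI[OF z(2,3,5)] by (intro bexI[of _ z] bexI[of _ "a \<union> b"] bexI[of _ c]) auto
 qed
 also have "... <= (\<integral>\<^sup>+z. ennreal (cn pe V u z * cn pe V z x * cn pe V z y) \<partial>count_space V)"
  using BK[OF countable_E pth_fam pth_fam pe] unfolding cn_def
  by (intro nn_integral_mono ennreal_leI mult_right_mono pp_nonneg) auto
 finally show ?thesis .
qed

end

section \<open>Interchange of sums, and a truncated moment inequality\<close>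

lemma cs_swap:
 fixes f :: "'a \<Rightarrow> 'b \<Rightarrow> ennreal"
 shows "(\<integral>\<^sup>+x. \<integral>\<^sup>+y. f x y \<partial>count_space B \<partial>count_space A) = (\<integral>\<^sup>+y. \<integral>\<^sup>+x. f x y \<partial>count_space A \<partial>count_space B)"
proof -
 have cs: "(\<integral>\<^sup>+x. h x \<partial>count_space A) = (\<integral>\<^sup>+x. h x * indicator A x \<partial>count_space UNIV)" for h :: "'c \<Rightarrow> ennreal" and A
  by (rule nn_integral_count_space_indicator) (simp add: NO_MATCH_def)
 have cs1: "(\<integral>\<^sup>+x. h x * indicator B x \<partial>count_space UNIV) * c = (\<integral>\<^sup>+x. h x * indicator B x * c \<partial>count_space UNIV)" for h :: "'c \<Rightarrow> ennreal" and B c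
  by (rule nn_integral_multc[symmetric]) simp
 have "(\<integral>\<^sup>+x. \<integral>\<^sup>+y. f x y \<partial>count_space B \<partial>count_space A) = (\<integral>\<^sup>+x. \<integral>\<^sup>+y. f x y * indicator B y * indicator A x \<partial>count_space UNIV \<partial>count_space UNIV)"
  unfolding cs[of A] cs[of B] cs1 ..
 also have "... = (\<integral>\<^sup>+y. \<integral>\<^sup>+x. f x y * indicator B y * indicator A x \<partial>count_space UNIV \<partial>count_space UNIV)"
  using nn_integral_fst_count_space[of "%(x, y). f x y * indicator B y * indicator A x"]
   nn_integral_snd_count_space[of "%(x, y). f x y * indicator B y * indicator A x"] by simp
 also have "... = (\<integral>\<^sup>+y. \<integral>\<^sup>+x. f x y \<partial>count_space A \<partial>count_space B)"
  unfolding cs[of A] cs[of B] cs1 by (simp add: ac_simps)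
 finally show ?thesis .
qed

lemma ms_card_ge:
 assumes X: "finite X" and G: "!!x. x \<in> X ==> ms E (G x)"
 shows "ms E (%xi. k <= card {x \<in> X. G x xi})"
proof -
 have *: "(k <= card {x \<in> X. G x xi}) \<longleftrightarrow> (\<exists>Y\<in>{Y. Y \<subseteq> X & card Y = k}. \<forall>x\<in>Y. G x xi)" for xi
 proof
  assume "k <= card {x \<in> X. G x xi}"
  then obtain Y where "Y \<subseteq> {x \<in> X. G x xi}" "card Y = k" using obtain_subset_with_card_n by metis
  then show "\<exists>Y\<in>{Y. Y \<subseteq> X & card Y = k}. \<forall>x\<in>Y. G x xi" by (intro bexI[of _ Y]) auto
 next
  assume "\<exists>Y\<in>{Y. Y \<subseteq> X & card Y = k}. \<forall>x\<in>Y. G x xi"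
  then obtain Y where "Y \<subseteq> {x \<in> X. G x xi}" "card Y = k" by auto
  then show "k <= card {x \<in> X. G x xi}" using card_mono[of "{x \<in> X. G x xi}" Y] X by simp
 qed
 have "ms E (%xi. \<exists>Y\<in>{Y. Y \<subseteq> X & card Y = k}. \<forall>x\<in>Y. G x xi)"
 proof (rule ms_ex)
  show "countable {Y. Y \<subseteq> X & card Y = k}"
   using X by (intro countable_finite finite_subset[of "{Y. Y \<subseteq> X & card Y = k}" "Pow X"]) auto
  fix Y assume "Y \<in> {Y. Y \<subseteq> X & card Y = k}"
  then have Y: "Y \<subseteq> X" "finite Y" using X finite_subset by auto
  show "ms E (%xi. \<forall>x\<in>Y. G x xi)" using Y G by (intro ms_all countable_finite) auto
 qed
 then show ?thesis unfolding * .
qed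

lemma pp_int: "ms E P ==> integrable (PM E pe) (indicat_real {xi \<in> space (PM E pe). P xi})"
 "(\<integral>xi. indicat_real {xi \<in> space (PM E pe). P xi} xi \<partial>PM E pe) = pp E pe P"
proof -
 interpret prob_space "PM E pe" by simp
 show "ms E P ==> integrable (PM E pe) (indicat_real {xi \<in> space (PM E pe). P xi})"
  using msD[of E P pe] by (simp add: integrable_real_indicator emeasure_eq_measure)
 show "(\<integral>xi. indicat_real {xi \<in> space (PM E pe). P xi} xi \<partial>PM E pe) = pp E pe P"
  unfolding pp_def Bochner_Integration.integral_indicator by (rule arg_cong[where f = "measure (PM E pe)"]) auto
qed

text \<open>The number n of successes satisfies n <= min N n + n^2 / N, and min N n is the number of
  k in 1..N with k <= n. The level \<open>N\<close> is free, to be balanced later between a heavy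
  tail and a large second moment.\<close>

lemma first_moment_le:
 assumes X: "finite X" and G: "!!x. x \<in> X ==> ms E (G x)" and N: "N > 0"
 shows "(\<Sum>x\<in>X. pp E pe (G x)) <= (\<Sum>k=1..N. pp E pe (%xi. k <= card {x \<in> X. G x xi})) +
  (\<Sum>x\<in>X. \<Sum>y\<in>X. pp E pe (%xi. G x xi & G y xi)) / N"
proof -
 let ?I = "%P. indicat_real {xi \<in> space (PM E pe). P xi}"
 have i1: "integrable (PM E pe) (?I (G x))" if "x \<in> X" for x using G[OF that] by (rule pp_int)
 have i2: "integrable (PM E pe) (?I (%xi. k <= card {x \<in> X. G x xi}))" for k using ms_card_ge[OF X G] by (intro pp_int) auto
 have i3: "integrable (PM E pe) (?I (%xi. G x xi & G y xi))" if "x \<in> X" "y \<in> X" for x y using G that by (intro pp_int ms_conj) auto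
 have "(\<integral>xi. (\<Sum>x\<in>X. ?I (G x) xi) \<partial>PM E pe) <= (\<integral>xi. (\<Sum>k=1..N. ?I (%xi. k <= card {x \<in> X. G x xi}) xi) +
  (\<Sum>x\<in>X. \<Sum>y\<in>X. ?I (%xi. G x xi & G y xi) xi) / N \<partial>PM E pe)"
 proof (rule integral_mono)
  show "integrable (PM E pe) (%xi. \<Sum>x\<in>X. ?I (G x) xi)" using i1 by (intro Bochner_Integration.integrable_sum) auto
  show "integrable (PM E pe) (%xi. (\<Sum>k=1..N. ?I (%xi. k <= card {x \<in> X. G x xi}) xi) +
  (\<Sum>x\<in>X. \<Sum>y\<in>X. ?I (%xi. G x xi & G y xi) xi) / N)"
   using i2 i3 by (intro Bochner_Integration.integrable_add Bochner_Integration.integrable_divide Bochner_Integration.integrable_sum) auto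
  fix xi assume w: "xi \<in> space (PM E pe)"
  let ?n = "card {x \<in> X. G x xi}"
  have a: "(\<Sum>x\<in>X. ?I (G x) xi) = ?n"
   using w X by (simp add: indicator_def sum.If_cases Int_def)
  have b: "(\<Sum>x\<in>X. \<Sum>y\<in>X. ?I (%xi. G x xi & G y xi) xi) = real ?n * real ?n"
  proof -
   have "?I (%xi. G x xi & G y xi) xi = ?I (G x) xi * ?I (G y) xi" for x y by (simp add: indicator_def)
   then have "(\<Sum>x\<in>X. \<Sum>y\<in>X. ?I (%xi. G x xi & G y xi) xi) = (\<Sum>x\<in>X. ?I (G x) xi) * (\<Sum>y\<in>X. ?I (G y) xi)"
    by (simp add: sum_product)
   then show ?thesis unfolding a .
  qed
  have c: "(\<Sum>k=1..N. ?I (%xi. k <= card {x \<in> X. G x xi}) xi) = real (min N ?n)"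
  proof -
   have "(\<Sum>k=1..N. ?I (%xi. k <= card {x \<in> X. G x xi}) xi) = real (card ({1..N} \<inter> {k. k <= ?n}))"
    using w by (simp add: indicator_def sum.If_cases)
   also have "{1..N} \<inter> {k. k <= ?n} = {1..min N ?n}" by auto
   finally show ?thesis by simp
  qed
  have "real ?n <= real (min N ?n) + real ?n * real ?n / N"
  proof (cases "?n <= N")
   case False
   then have "real ?n * real N <= real ?n * real ?n" by (intro mult_left_mono) auto
   then have "real ?n <= real ?n * real ?n / N" using N by (simp add: pos_le_divide_eq)
   then show ?thesis by linarith
  qed simp
  then show "(\<Sum>x\<in>X. ?I (G x) xi) <= (\<Sum>k=1..N. ?I (%xi. k <= card {x \<in> X. G x xi}) xi) +
  (\<Sum>x\<in>X. \<Sum>y\<in>X. ?I (%xi. G x xi & G y xi) xi) / N" unfolding a b c .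
 qed
 moreover have "(\<integral>xi. (\<Sum>x\<in>X. ?I (G x) xi) \<partial>PM E pe) = (\<Sum>x\<in>X. pp E pe (G x))"
  using i1 by (subst Bochner_Integration.integral_sum) (auto simp only: pp_int(2))
 moreover have "(\<integral>xi. (\<Sum>k=1..N. ?I (%xi. k <= card {x \<in> X. G x xi}) xi) +
  (\<Sum>x\<in>X. \<Sum>y\<in>X. ?I (%xi. G x xi & G y xi) xi) / N \<partial>PM E pe)
  = (\<Sum>k=1..N. pp E pe (%xi. k <= card {x \<in> X. G x xi})) + (\<Sum>x\<in>X. \<Sum>y\<in>X. pp E pe (%xi. G x xi & G y xi)) / N"
 proof -
  have i4: "integrable (PM E pe) (%xi. \<Sum>y\<in>X. ?I (%xi. G x xi & G y xi) xi)" if x: "x \<in> X" for x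
   by (rule Bochner_Integration.integrable_sum) (rule i3[OF x])
  have i5: "integrable (PM E pe) (%xi. \<Sum>x\<in>X. \<Sum>y\<in>X. ?I (%xi. G x xi & G y xi) xi)"
   by (rule Bochner_Integration.integrable_sum) (rule i4)
  have i6: "integrable (PM E pe) (%xi. \<Sum>k=1..N. ?I (%xi. k <= card {x \<in> X. G x xi}) xi)"
   by (rule Bochner_Integration.integrable_sum) (rule i2)
  have i7: "integrable (PM E pe) (%xi. (\<Sum>x\<in>X. \<Sum>y\<in>X. ?I (%xi. G x xi & G y xi) xi) / N)"
   by (rule Bochner_Integration.integrable_divide) (rule i5)
  have e4: "(\<integral>xi. (\<Sum>y\<in>X. ?I (%xi. G x xi & G y xi) xi) \<partial>PM E pe) = (\<Sum>y\<in>X. pp E pe (%xi. G x xi & G y xi))" if x: "x \<in> X" for x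
   by (rule trans[OF Bochner_Integration.integral_sum[OF i3[OF x]]]) (assumption, rule sum.cong[OF refl pp_int(2)])
  have e5: "(\<integral>xi. (\<Sum>x\<in>X. \<Sum>y\<in>X. ?I (%xi. G x xi & G y xi) xi) \<partial>PM E pe) = (\<Sum>x\<in>X. \<Sum>y\<in>X. pp E pe (%xi. G x xi & G y xi))"
   by (rule trans[OF Bochner_Integration.integral_sum[OF i4]]) (assumption, rule sum.cong[OF refl e4])
  have e6: "(\<integral>xi. (\<Sum>k=1..N. ?I (%xi. k <= card {x \<in> X. G x xi}) xi) \<partial>PM E pe) = (\<Sum>k=1..N. pp E pe (%xi. k <= card {x \<in> X. G x xi}))"
   by (rule trans[OF Bochner_Integration.integral_sum[OF i2]]) (rule sum.cong[OF refl pp_int(2)])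
  show ?thesis unfolding Bochner_Integration.integral_add[OF i6 i7] Bochner_Integration.integral_divide_zero e5 e6 ..
 qed
 ultimately show ?thesis by simp
qed

section \<open>The weighted susceptibility and its decomposition at the top of a path\<close>

context hg
begin

text \<open>\<open>Th\<close> is self-dual: mass transport turns \<open>Th t\<close> into \<open>Th (- t) * exp (s * t)\<close>.\<close>

definition Th :: "real \<Rightarrow> real" where "Th t = exp (s * t / 4) + exp (3 * s * t / 4)"

text \<open>Paths from \<open>v\<close> to \<open>w\<close> in \<open>reg P v w\<close> obey a height constraint relative to both endpoints.\<close>

definition reg :: "(real \<Rightarrow> real \<Rightarrow> bool) \<Rightarrow> 'v \<Rightarrow> 'v \<Rightarrow> 'v set" where
 "reg P v w = {x \<in> V. P (L x - L v) (L w - L x)}"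

definition SM :: "('v set \<Rightarrow> real) \<Rightarrow> (real \<Rightarrow> real \<Rightarrow> bool) \<Rightarrow> 'v \<Rightarrow> ennreal" where
 "SM pe P v = (\<integral>\<^sup>+w. ennreal (cn pe (reg P v w) v w * Th (L w - L v)) \<partial>count_space V)"

definition MM :: "('v set \<Rightarrow> real) \<Rightarrow> (real \<Rightarrow> real \<Rightarrow> bool) \<Rightarrow> ennreal" where
 "MM pe P = (SUP v\<in>V. SM pe P v)"

lemma Th_pos [simp]: "0 < Th t" "0 <= Th t"
 unfolding Th_def by (auto intro: add_pos_pos add_nonneg_nonneg)

lemma Th_submult: "Th (a + b) <= Th a * Th b"
proof -
 have "Th a * Th b = Th (a + b) + (exp (s * a / 4) * exp (3 * s * b / 4) + exp (3 * s * a / 4) * exp (s * b / 4))"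
  unfolding Th_def by (simp add: algebra_simps exp_add[symmetric] add_divide_distrib)
 then show ?thesis by (simp add: add_nonneg_nonneg)
qed

lemma Th_dual: "Th (- t) * exp (s * t) = Th t"
 unfolding Th_def by (simp add: algebra_simps exp_add[symmetric])

lemma Th_0 [simp]: "Th 0 = 2" unfolding Th_def by simp

text \<open>The exponent \<open>l\<close> lies between 1/4 and 3/4, so one of the two summands of
  \<open>Th\<close> dominates, depending on the sign of \<open>s * t\<close>. The values used later
  are 1/4, 1/2 and 3/4.\<close>

lemma Th_ge: assumes "1/4 <= l" "l <= 3/4" shows "exp (l * s * t) <= Th t"
proof -
 have "l * (s * t) <= s * t / 4 \<or> l * (s * t) <= 3 * (s * t) / 4"
 proof (cases "s * t \<ge> 0")
  case True
  then have "l * (s * t) <= 3 / 4 * (s * t)" using assms by (intro mult_right_mono) auto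
  then show ?thesis by simp
 next
  case False
  then have "l * (s * t) <= 1 / 4 * (s * t)" using assms by (intro mult_right_mono_neg) auto
  then show ?thesis by simp
 qed
 then have "exp (l * (s * t)) <= exp (s * t / 4) \<or> exp (l * (s * t)) <= exp (3 * (s * t) / 4)" by simp
 moreover have "exp (s * t / 4) > 0" "exp (3 * (s * t) / 4) > 0" by simp_all
 ultimately show ?thesis unfolding Th_def mult.assoc by linarith
qed

lemma Th_lip: "Th (t + d) <= exp (\<bar>s\<bar> * \<bar>d\<bar>) * Th t"
proof -
 have "s * d <= \<bar>s\<bar> * \<bar>d\<bar>" by (metis abs_mult abs_ge_self)
 moreover have "0 <= \<bar>s\<bar> * \<bar>d\<bar>" by simp
 ultimately have a: "s * d / 4 <= \<bar>s\<bar> * \<bar>d\<bar>" "3 * s * d / 4 <= \<bar>s\<bar> * \<bar>d\<bar>" by linarith+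
 have "Th (t + d) = exp (s * d / 4) * exp (s * t / 4) + exp (3 * s * d / 4) * exp (3 * s * t / 4)"
  unfolding Th_def exp_add[symmetric] by (simp add: algebra_simps add_divide_distrib)
 also have "... <= exp (\<bar>s\<bar> * \<bar>d\<bar>) * exp (s * t / 4) + exp (\<bar>s\<bar> * \<bar>d\<bar>) * exp (3 * s * t / 4)"
  using a by (intro add_mono mult_right_mono) auto
 finally show ?thesis unfolding Th_def by (simp add: distrib_left)
qed

text \<open>The exponential growth rate of \<open>Th\<close> upwards: 3s/4 for positive
  \<open>s\<close>, and s/4, which is negative, for negative \<open>s\<close>.\<close>

definition om :: real where "om = max (s / 4) (3 * s / 4)"

lemma Th_le_om: assumes "t \<ge> 0" shows "Th t <= 2 * exp (om * t)"
proof -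
 have "s / 4 * t <= om * t" "3 * s / 4 * t <= om * t"
  unfolding om_def by (rule mult_right_mono[OF max.cobounded1 assms], rule mult_right_mono[OF max.cobounded2 assms])
 then have "exp (s * t / 4) <= exp (om * t)" "exp (3 * s * t / 4) <= exp (om * t)" by auto
 from add_mono[OF this] show ?thesis unfolding Th_def mult_2 .
qed

lemma Th_ge_om: "exp (om * t) <= Th t"
 using Th_ge[of "1/4" t] Th_ge[of "3/4" t] unfolding om_def max_def by (auto simp: mult.commute split: if_splits)

lemma reg_V: "reg P v w \<subseteq> V" unfolding reg_def by blast

lemma SM_le_MM: "v \<in> V ==> SM pe P v <= MM pe P"
 unfolding MM_def by (rule SUP_upper)

lemma MM_mono: assumes "!!a b. P a b ==> Q a b" shows "MM pe P <= MM pe Q"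
 unfolding MM_def SM_def
proof (intro SUP_mono' nn_integral_mono ennreal_leI mult_right_mono)
 fix v w
 show "cn pe (reg P v w) v w <= cn pe (reg Q v w) v w"
  by (rule cn_mono) (use assms in \<open>auto simp: reg_def\<close>)
qed simp

lemma cn_reg_g: assumes pe: "inv_pe pe" and g: "ga \<in> \<Gamma>" and V: "v \<in> V" "w \<in> V"
 shows "cn pe (reg P (ga v) (ga w)) (ga v) (ga w) = cn pe (reg P v w) v w"
 unfolding reg_def
proof (rule cn_g[OF pe g _ V])
 fix x assume x: "x \<in> V"
 show "P (L (ga x) - L (ga v)) (L (ga w) - L (ga x)) = P (L x - L v) (L w - L x)"
  unfolding L_inv[OF g x V(1)] L_inv[OF g V(2) x] ..
qed

lemma reg_swap: "reg P v w = reg (%a b. P (- b) (- a)) w v"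
 unfolding reg_def by simp

text \<open>Mass transport exchanges the ends of a path. The modular weight turns \<open>Th\<close>
  of the reversed height difference back into \<open>Th\<close>, and the constraint \<open>P\<close>
  is read from the other end.\<close>

lemma MM_dual: "\<exists>C>0. \<forall>pe P. inv_pe pe --> MM pe P <= ennreal C * MM pe (%a b. P (- b) (- a))"
proof -
 obtain C where C: "C > 0" "!!(F :: 'v \<Rightarrow> 'v \<Rightarrow> ennreal) K u. (\<forall>ga\<in>\<Gamma>. \<forall>a\<in>V. \<forall>b\<in>V. F (ga a) (ga b) = F a b) ==>
 (\<forall>v\<in>V. (\<integral>\<^sup>+y. F y v * ennreal (exp (s * (L y - L v))) \<partial>count_space V) <= K) ==> u \<in> V ==>
 (\<integral>\<^sup>+x. F u x \<partial>count_space V) <= ennreal C * K" using mtp by blast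
 show ?thesis
 proof (intro exI[of _ C] conjI allI impI C(1))
  fix pe P assume pe: "inv_pe pe"
  let ?F = "%u x. ennreal (cn pe (reg P u x) u x * Th (L x - L u))"
  show "MM pe P <= ennreal C * MM pe (%a b. P (- b) (- a))"
   unfolding MM_def[of pe P] SM_def
  proof (rule SUP_least, rule C(2))
   show "\<forall>ga\<in>\<Gamma>. \<forall>a\<in>V. \<forall>b\<in>V. ?F (ga a) (ga b) = ?F a b" using cn_reg_g[OF pe] L_inv by simp
   show "\<forall>v\<in>V. (\<integral>\<^sup>+y. ?F y v * ennreal (exp (s * (L y - L v))) \<partial>count_space V) <= MM pe (%a b. P (- b) (- a))"
   proof
    fix v assume v: "v \<in> V"
    have "?F y v * ennreal (exp (s * (L y - L v))) = ennreal (cn pe (reg (%a b. P (- b) (- a)) v y) v y * Th (L y - L v))" for y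
    proof -
     have "?F y v * ennreal (exp (s * (L y - L v))) = ennreal (cn pe (reg P y v) y v * (Th (- (L y - L v)) * exp (s * (L y - L v))))"
      by (simp add: ennreal_mult'[symmetric] mult.assoc)
     then show ?thesis unfolding Th_dual reg_swap[of P] by (simp add: cn_sym)
    qed
    then have "(\<integral>\<^sup>+y. ?F y v * ennreal (exp (s * (L y - L v))) \<partial>count_space V) = SM pe (%a b. P (- b) (- a)) v"
     unfolding SM_def by simp
    then show "(\<integral>\<^sup>+y. ?F y v * ennreal (exp (s * (L y - L v))) \<partial>count_space V) <= MM pe (%a b. P (- b) (- a))"
     using SM_le_MM[OF v] by simp
   qed
  qed
 qed
qed

text \<open>Cut at a highest vertex; BK separates the pieces and submultiplicativity of
  \<open>Th\<close> distributes the weight. The first piece ends at a top, so the second argument of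
  its constraint is nonnegative; the second piece starts at a top, so the first argument of its
  constraint is nonpositive.\<close>

lemma MM_dec:
 assumes pe: "inv_pe pe" and P1: "!!a b c. P a b ==> 0 <= c ==> P1 a c" and P2: "!!a b c. P a b ==> c <= 0 ==> P2 c b"
 shows "MM pe P <= MM pe P1 * MM pe P2"
 unfolding MM_def[of pe P]
proof (rule SUP_least)
 fix v assume v: "v \<in> V"
 let ?a = "%m. ennreal (cn pe (reg P1 v m) v m * Th (L m - L v))"
 let ?b = "%m w. ennreal (cn pe (reg P2 m w) m w * Th (L w - L m))"
 have "SM pe P v <= (\<integral>\<^sup>+w. \<integral>\<^sup>+m. ?a m * ?b m w \<partial>count_space V \<partial>count_space V)"
  unfolding SM_def
 proof (rule nn_integral_mono)
  fix w assume "w \<in> space (count_space V)"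
  let ?c = "%m. cn pe {x \<in> reg P v w. L x <= L m} v m * cn pe {x \<in> reg P v w. L x <= L m} m w"
  have "ennreal (cn pe (reg P v w) v w * Th (L w - L v)) = ennreal (cn pe (reg P v w) v w) * ennreal (Th (L w - L v))"
   by (simp add: ennreal_mult')
  also have "... <= (\<integral>\<^sup>+m. ennreal (?c m) \<partial>count_space V) * ennreal (Th (L w - L v))"
   by (intro mult_right_mono cn_dec_max[OF inv_pe01[OF pe] reg_V]) auto
  also have "... = (\<integral>\<^sup>+m. ennreal (?c m) * ennreal (Th (L w - L v)) \<partial>count_space V)"
   by (rule nn_integral_multc[symmetric]) simp
  also have "... <= (\<integral>\<^sup>+m. ?a m * ?b m w \<partial>count_space V)"
  proof (rule nn_integral_mono)
   fix m
   have 1: "cn pe {x \<in> reg P v w. L x <= L m} v m <= cn pe (reg P1 v m) v m"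
    by (rule cn_mono) (auto simp: reg_def intro!: P1)
   have 2: "cn pe {x \<in> reg P v w. L x <= L m} m w <= cn pe (reg P2 m w) m w"
    by (rule cn_mono) (auto simp: reg_def intro!: P2)
   have "?c m * Th (L w - L v) <= (cn pe (reg P1 v m) v m * cn pe (reg P2 m w) m w) * (Th (L m - L v) * Th (L w - L m))"
    using Th_submult[of "L m - L v" "L w - L m"] 1 2 by (intro mult_mono) auto
   then show "ennreal (?c m) * ennreal (Th (L w - L v)) <= ?a m * ?b m w"
    by (simp add: ennreal_mult'[symmetric] ennreal_leI ac_simps)
  qed
  finally show "ennreal (cn pe (reg P v w) v w * Th (L w - L v)) <= (\<integral>\<^sup>+m. ?a m * ?b m w \<partial>count_space V)" .
 qed
 also have "... = (\<integral>\<^sup>+m. \<integral>\<^sup>+w. ?a m * ?b m w \<partial>count_space V \<partial>count_space V)" by (rule cs_swap)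
 also have "... = (\<integral>\<^sup>+m. ?a m * SM pe P2 m \<partial>count_space V)" unfolding SM_def by (simp add: nn_integral_cmult)
 also have "... <= (\<integral>\<^sup>+m. ?a m * MM pe P2 \<partial>count_space V)" by (intro nn_integral_mono mult_left_mono SM_le_MM) auto
 also have "... = SM pe P1 v * MM pe P2" unfolding SM_def by (rule nn_integral_multc) simp
 also have "... <= MM pe P1 * MM pe P2" by (intro mult_right_mono SM_le_MM v) simp
 finally show "SM pe P v <= MM pe P1 * MM pe P2" .
qed

abbreviation "Pfull \<equiv> %(a::real) (b::real). True"
abbreviation "Pabove \<equiv> %(a::real) (b::real). 0 <= a"
text \<open>Read through \<open>reg\<close>: the end of the path is a top, and with the flag its
  start is a bottom.\<close>

definition Pb :: "bool \<Rightarrow> real \<Rightarrow> real \<Rightarrow> bool" where "Pb fl a b \<longleftrightarrow> (fl --> 0 <= a) & 0 <= b"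

text \<open>The first two bounds cut at the top and then use duality, which turns a descent from a
  top into an ascent to a top. The third is duality alone.\<close>

lemma MM_ineqs: "\<exists>C>0. \<forall>pe. inv_pe pe --> MM pe Pfull <= ennreal C * (MM pe (Pb False) * MM pe (Pb False)) &
 MM pe Pabove <= ennreal C * (MM pe (Pb True) * MM pe (Pb False)) & MM pe (%a b. b <= 0) <= ennreal C * MM pe Pabove"
proof -
 obtain C where C: "C > 0" "!!pe P. inv_pe pe ==> MM pe P <= ennreal C * MM pe (%a b. P (- b) (- a))" using MM_dual by blast
 show ?thesis
 proof (intro exI[of _ C] conjI allI impI C(1))
  fix pe assume pe: "inv_pe pe"
  have z': "MM pe (%a b. a <= 0) <= ennreal C * MM pe (Pb False)" using C(2)[OF pe, of "%a b. a <= 0"] by (simp add: Pb_def[abs_def])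
  have "MM pe Pfull <= MM pe (Pb False) * MM pe (%a b. a <= 0)" by (rule MM_dec[OF pe]) (auto simp: Pb_def)
  also have "... <= MM pe (Pb False) * (ennreal C * MM pe (Pb False))" using z' by (intro mult_left_mono) auto
  finally show "MM pe Pfull <= ennreal C * (MM pe (Pb False) * MM pe (Pb False))" by (simp add: ac_simps)
  have "MM pe Pabove <= MM pe (Pb True) * MM pe (%a b. a <= 0)" by (rule MM_dec[OF pe]) (auto simp: Pb_def)
  also have "... <= MM pe (Pb True) * (ennreal C * MM pe (Pb False))" using z' by (intro mult_left_mono) auto
  finally show "MM pe Pabove <= ennreal C * (MM pe (Pb True) * MM pe (Pb False))" by (simp add: ac_simps)
  show "MM pe (%a b. b <= 0) <= ennreal C * MM pe Pabove" using C(2)[OF pe, of "%a b. b <= 0"] by simp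
 qed
qed

end

lemma cs_indicator:
 fixes f :: "'a \<Rightarrow> ennreal"
 shows "(\<integral>\<^sup>+x. f x \<partial>count_space A) = (\<integral>\<^sup>+x. f x * indicator A x \<partial>count_space UNIV)"
 by (rule nn_integral_count_space_indicator) (simp add: NO_MATCH_def)

lemma cs_mono_set:
 fixes f :: "'a \<Rightarrow> ennreal"
 assumes "A \<subseteq> B" shows "(\<integral>\<^sup>+x. f x \<partial>count_space A) <= (\<integral>\<^sup>+x. f x \<partial>count_space B)"
 unfolding cs_indicator[of A f] cs_indicator[of B f] using assms by (intro nn_integral_mono) (auto simp: indicator_def)

lemma sum_le_nn:
 fixes f :: "'a \<Rightarrow> ennreal"
 assumes "finite X" "X \<subseteq> A" shows "(\<Sum>x\<in>X. f x) <= (\<integral>\<^sup>+x. f x \<partial>count_space A)"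
 using cs_mono_set[OF assms(2), of f] nn_integral_count_space_finite[OF assms(1), of f] by simp

lemma nn_le_fin:
 fixes f :: "'a \<Rightarrow> ennreal"
 assumes A: "countable A" and K: "!!X. finite X ==> X \<subseteq> A ==> (\<Sum>x\<in>X. f x) <= K"
 shows "(\<integral>\<^sup>+x. f x \<partial>count_space A) <= K"
proof (cases "finite A")
 case True
 then show ?thesis using K[OF True] by (simp add: nn_integral_count_space_finite)
next
 case False
 have b: "bij_betw (from_nat_into A) UNIV A" using bij_betw_from_nat_into[OF A False] .
 have "(\<integral>\<^sup>+x. f x \<partial>count_space A) = (\<integral>\<^sup>+n. f (from_nat_into A n) \<partial>count_space UNIV)"
  by (rule nn_integral_bij_count_space[OF b, symmetric])
 also have "... = (\<Sum>n. f (from_nat_into A n))" by (rule nn_integral_count_space_nat)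
 also have "... <= K"
 proof (rule suminf_le_const[OF summableI])
  fix n
  have inj: "inj_on (from_nat_into A) {..<n}" using b unfolding bij_betw_def by (meson inj_on_subset subset_UNIV)
  have "(\<Sum>i<n. f (from_nat_into A i)) = (\<Sum>x\<in>from_nat_into A ` {..<n}. f x)" using sum.reindex[OF inj, of f] by simp
  also have "... <= K" using b unfolding bij_betw_def by (intro K) auto
  finally show "(\<Sum>i<n. f (from_nat_into A i)) <= K" .
 qed
 finally show ?thesis .
qed

text \<open>A change of variables along a map with bounded fibres; in \<open>ins\<close> it pays for
  replacing every end vertex by a nearby vertex of \<open>Ob\<close>.\<close>

lemma nn_fibre:
 fixes h :: "'b \<Rightarrow> ennreal"
 assumes t: "!!w. w \<in> A ==> t w \<in> B" and N: "!!x. x \<in> B ==> finite {w \<in> A. t w = x} & card {w \<in> A. t w = x} <= N"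
 shows "(\<integral>\<^sup>+w. h (t w) \<partial>count_space A) <= ennreal (real N) * (\<integral>\<^sup>+x. h x \<partial>count_space B)"
proof -
 have "(\<integral>\<^sup>+w. h (t w) \<partial>count_space A) = (\<integral>\<^sup>+w. \<integral>\<^sup>+x. h x * indicator {t w} x \<partial>count_space B \<partial>count_space A)"
 proof (rule nn_integral_cong)
  fix w assume "w \<in> space (count_space A)"
  then have w: "t w \<in> B" using t by simp
  have "(\<integral>\<^sup>+x. h x * indicator {t w} x \<partial>count_space B) = (\<integral>\<^sup>+x. h (t w) * indicator {t w} x \<partial>count_space B)"
   by (intro nn_integral_cong) (simp add: indicator_def)
  also have "... = h (t w)" using w by (simp add: nn_integral_cmult)
  finally show "h (t w) = (\<integral>\<^sup>+x. h x * indicator {t w} x \<partial>count_space B)" by simp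
 qed
 also have "... = (\<integral>\<^sup>+x. \<integral>\<^sup>+w. h x * indicator {t w} x \<partial>count_space A \<partial>count_space B)" by (rule cs_swap)
 also have "... <= (\<integral>\<^sup>+x. ennreal (real N) * h x \<partial>count_space B)"
 proof (rule nn_integral_mono)
  fix x assume "x \<in> space (count_space B)"
  then have x: "finite {w \<in> A. t w = x}" "card {w \<in> A. t w = x} <= N" using N by auto
  have "(\<integral>\<^sup>+w. h x * indicator {t w} x \<partial>count_space A) = (\<integral>\<^sup>+w. h x * indicator {w \<in> A. t w = x} w \<partial>count_space A)"
   by (intro nn_integral_cong) (auto simp: indicator_def)
  also have "... = h x * ennreal (real (card {w \<in> A. t w = x}))"
   using x(1) by (simp add: nn_integral_cmult ennreal_of_nat_eq_real_of_nat)
  also have "... <= h x * ennreal (real N)" using x(2) by (intro mult_left_mono ennreal_leI) auto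
  finally show "(\<integral>\<^sup>+w. h x * indicator {t w} x \<partial>count_space A) <= ennreal (real N) * h x" by (simp add: mult.commute)
 qed
 also have "... = ennreal (real N) * (\<integral>\<^sup>+x. h x \<partial>count_space B)" by (rule nn_integral_cmult) simp
 finally show ?thesis .
qed

section \<open>Layers of the base orbit: from a tail bound to a weighted sum\<close>

context hg
begin

text \<open>The end \<open>x\<close> exceeds all other vertices by \<open>g\<close>. As a layer has
  width \<open>g\<close>, the other vertices lie below the layer of \<open>x\<close>, so every edge
  of such a connection has an endpoint below that layer.\<close>

definition Rg :: "bool \<Rightarrow> 'v \<Rightarrow> 'v set" where
 "Rg fl x = {y \<in> V. (fl --> L ob <= L y) & (L y <= L x - g \<or> y = x)}"

definition Tfam :: "bool \<Rightarrow> 'v \<Rightarrow> real \<Rightarrow> 'v set set set" where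
 "Tfam fl a n = (\<Union>b\<in>{b \<in> Ob. L a + n <= L b}. pf E {y \<in> V. (fl --> L a <= L y) & L y <= L b} a b)"

definition TT :: "bool \<Rightarrow> ('v set \<Rightarrow> real) \<Rightarrow> real \<Rightarrow> real" where
 "TT fl pe n = pr E pe (Tfam fl ob n)"

definition layer :: "nat \<Rightarrow> 'v set" where
 "layer i = {x \<in> Ob. L ob + real i * g <= L x & L x < L ob + (real i + 1) * g}"

definition tl :: "bool \<Rightarrow> ('v set \<Rightarrow> real) \<Rightarrow> 'v set \<Rightarrow> nat \<Rightarrow> real" where
 "tl fl pe X k = pp E pe (%xi. k <= card {x \<in> X. occ (pf E (Rg fl x) ob x) xi})"

lemma Tfam_fam: "Tfam fl a n \<subseteq> fam E"
 unfolding Tfam_def by (rule UN_least) (rule pth_fam)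

lemma ms_pf: "ms E (occ (pf E S u v))"
 by (rule ms_occ[OF countable_E pth_fam])

text \<open>The tree-graph bound with exponent 1/2 from the base to the branch point and 1/4 on each
  of the two branches: the height of the branch point cancels and only that of the layer remains.
  Each of the three sums contributes a factor \<open>A\<close>.\<close>

lemma second_moment:
 assumes pe: "inv_pe pe" and A: "MM pe Pfull <= ennreal A" "0 <= A" and X: "finite X" "X \<subseteq> layer i"
 shows "(\<Sum>x\<in>X. \<Sum>y\<in>X. pp E pe (%xi. occ (pf E (Rg fl x) ob x) xi & occ (pf E (Rg fl y) ob y) xi)) <= A ^ 3 * exp (\<bar>s\<bar> * (real i + 1) * g / 2)"
proof -
 let ?W = "exp (\<bar>s\<bar> * (real i + 1) * g / 2)"
 let ?a = "%z. ennreal (cn pe V ob z * Th (L z - L ob))" and ?b = "%z x. ennreal (cn pe V z x * Th (L x - L z))"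
 have XV: "X \<subseteq> V" using X(2) Ob_V unfolding layer_def by blast
 have regf: "reg Pfull v w = V" for v w unfolding reg_def by simp
 have SM: "SM pe Pfull v <= ennreal A" if "v \<in> V" for v using SM_le_MM[OF that, of pe Pfull] A(1) by simp
 have xy: "ennreal (pp E pe (%xi. occ (pf E (Rg fl x) ob x) xi & occ (pf E (Rg fl y) ob y) xi)) <= (\<integral>\<^sup>+z. ennreal ?W * ?a z * (?b z x * ?b z y) \<partial>count_space V)"
  if x: "x \<in> X" "y \<in> X" for x y
 proof -
  have sub: "pf E (Rg fl x) ob x \<subseteq> pf E V ob x" for x by (rule pf_mono) (auto simp: Rg_def)
  have "pp E pe (%xi. occ (pf E (Rg fl x) ob x) xi & occ (pf E (Rg fl y) ob y) xi) <= pp E pe (%xi. occ (pf E V ob x) xi & occ (pf E V ob y) xi)"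
   by (rule pp_mono[OF ms_conj[OF ms_pf ms_pf]]) (use occ_sub[OF sub] in blast)
  then have "ennreal (pp E pe (%xi. occ (pf E (Rg fl x) ob x) xi & occ (pf E (Rg fl y) ob y) xi)) <= ennreal (pp E pe (%xi. occ (pf E V ob x) xi & occ (pf E V ob y) xi))"
   by (rule ennreal_leI)
  also have "... <= (\<integral>\<^sup>+z. ennreal (cn pe V ob z * cn pe V z x * cn pe V z y) \<partial>count_space V)"
   by (rule tree_graph[OF inv_pe01[OF pe]])
  also have "... <= (\<integral>\<^sup>+z. ennreal ?W * ?a z * (?b z x * ?b z y) \<partial>count_space V)"
  proof (rule nn_integral_mono)
   fix z
   let ?t = "Th (L z - L ob) * (Th (L x - L z) * Th (L y - L z))"
   have d: "0 <= L x - L ob" "L x - L ob <= (real i + 1) * g" "0 <= L y - L ob" "L y - L ob <= (real i + 1) * g"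
    using x X(2) g_pos unfolding layer_def by (auto intro: order_trans[rotated])
   have sb: "- (\<bar>s\<bar> * ((real i + 1) * g)) <= s * t" if "0 <= t" "t <= (real i + 1) * g" for t
   proof -
    have "\<bar>s * t\<bar> <= \<bar>s\<bar> * ((real i + 1) * g)" unfolding abs_mult using that by (intro mult_left_mono) auto
    then show ?thesis by linarith
   qed
   have "exp (1/2 * s * (L z - L ob)) * (exp (1/4 * s * (L x - L z)) * exp (1/4 * s * (L y - L z))) <= ?t"
    by (intro mult_mono Th_ge) auto
   moreover have "exp (1/2 * s * (L z - L ob)) * (exp (1/4 * s * (L x - L z)) * exp (1/4 * s * (L y - L z))) = exp (s * (L x - L ob) / 4 + s * (L y - L ob) / 4)"
    unfolding exp_add[symmetric] by (simp add: field_simps)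
   moreover have "exp (- (\<bar>s\<bar> * (real i + 1) * g / 2)) <= exp (s * (L x - L ob) / 4 + s * (L y - L ob) / 4)"
    using sb[OF d(1,2)] sb[OF d(3,4)] by (simp add: mult.assoc)
   ultimately have "exp (- (\<bar>s\<bar> * (real i + 1) * g / 2)) <= ?t" by linarith
   then have "?W * exp (- (\<bar>s\<bar> * (real i + 1) * g / 2)) <= ?W * ?t" by (intro mult_left_mono) auto
   then have 1: "1 <= ?W * ?t" by (simp add: exp_minus)
   have "cn pe V ob z * cn pe V z x * cn pe V z y * 1 <= cn pe V ob z * cn pe V z x * cn pe V z y * (?W * ?t)"
    by (rule mult_left_mono[OF 1]) simp
   then show "ennreal (cn pe V ob z * cn pe V z x * cn pe V z y) <= ennreal ?W * ?a z * (?b z x * ?b z y)"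
    by (simp add: ennreal_mult'[symmetric] ennreal_leI ac_simps)
  qed
  finally show ?thesis .
 qed
 have "ennreal (\<Sum>x\<in>X. \<Sum>y\<in>X. pp E pe (%xi. occ (pf E (Rg fl x) ob x) xi & occ (pf E (Rg fl y) ob y) xi))
  = (\<Sum>x\<in>X. \<Sum>y\<in>X. ennreal (pp E pe (%xi. occ (pf E (Rg fl x) ob x) xi & occ (pf E (Rg fl y) ob y) xi)))"
  by (simp add: sum_nonneg pp_nonneg)
 also have "... <= (\<Sum>x\<in>X. \<Sum>y\<in>X. \<integral>\<^sup>+z. ennreal ?W * ?a z * (?b z x * ?b z y) \<partial>count_space V)"
  by (intro sum_mono xy)
 also have "... = (\<integral>\<^sup>+z. (\<Sum>x\<in>X. \<Sum>y\<in>X. ennreal ?W * ?a z * (?b z x * ?b z y)) \<partial>count_space V)"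
  by (simp add: nn_integral_sum)
 also have "... = (\<integral>\<^sup>+z. ennreal ?W * ?a z * ((\<Sum>x\<in>X. ?b z x) * (\<Sum>y\<in>X. ?b z y)) \<partial>count_space V)"
  unfolding sum_product by (simp only: sum_distrib_left)
 also have "... <= (\<integral>\<^sup>+z. ennreal ?W * ?a z * (ennreal A * ennreal A) \<partial>count_space V)"
 proof (rule nn_integral_mono)
  fix z assume "z \<in> space (count_space V)"
  then have "(\<Sum>x\<in>X. ?b z x) <= ennreal A"
   using order_trans[OF sum_le_nn[OF X(1) XV, of "?b z"]] SM[of z] unfolding SM_def regf by simp
  then show "ennreal ?W * ?a z * ((\<Sum>x\<in>X. ?b z x) * (\<Sum>y\<in>X. ?b z y)) <= ennreal ?W * ?a z * (ennreal A * ennreal A)"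
   by (intro mult_left_mono mult_mono) auto
 qed
 also have "... = ennreal ?W * SM pe Pfull ob * (ennreal A * ennreal A)"
  unfolding SM_def regf by (simp add: nn_integral_multc nn_integral_cmult)
 also have "... <= ennreal ?W * ennreal A * (ennreal A * ennreal A)" by (intro mult_mono SM ob_V) auto
 also have "... = ennreal (A ^ 3 * ?W)" using A(2) by (simp add: ennreal_mult'[symmetric] power3_eq_cube ac_simps)
 finally show ?thesis using A(2) by (subst (asm) ennreal_le_iff) auto
qed

text \<open>Giving up a factor N^(2 \<epsilon>) leaves the convergent series with terms
  k^(-1-\<epsilon>).\<close>

lemma powr_sum_bound: assumes "0 < \<epsilon>" shows "\<exists>S>0. \<forall>N::nat. (\<Sum>k=1..N. real k powr (- (1 - \<epsilon>))) <= S * real N powr (2 * \<epsilon>)"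
proof -
 have sm: "summable (%n. real n powr (- 1 - \<epsilon>))" using assms by (subst summable_real_powr_iff) simp
 show ?thesis
 proof (intro exI[of _ "1 + (\<Sum>n. real n powr (- 1 - \<epsilon>))"] conjI allI)
  have "0 <= (\<Sum>n. real n powr (- 1 - \<epsilon>))" by (rule suminf_nonneg[OF sm]) simp
  then show "0 < 1 + (\<Sum>n. real n powr (- 1 - \<epsilon>))" by simp
  fix N :: nat
  have "(\<Sum>k=1..N. real k powr (- (1 - \<epsilon>))) <= (\<Sum>k=1..N. real N powr (2 * \<epsilon>) * real k powr (- 1 - \<epsilon>))"
  proof (rule sum_mono)
   fix k assume k: "k \<in> {1..N}"
   have "real k powr (- (1 - \<epsilon>)) = real k powr (2 * \<epsilon>) * real k powr (- 1 - \<epsilon>)" by (simp add: powr_add[symmetric])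
   also have "... <= real N powr (2 * \<epsilon>) * real k powr (- 1 - \<epsilon>)" using k assms by (intro mult_right_mono powr_mono2) auto
   finally show "real k powr (- (1 - \<epsilon>)) <= real N powr (2 * \<epsilon>) * real k powr (- 1 - \<epsilon>)" .
  qed
  also have "... = real N powr (2 * \<epsilon>) * (\<Sum>k=1..N. real k powr (- 1 - \<epsilon>))" by (simp add: sum_distrib_left)
  also have "... <= real N powr (2 * \<epsilon>) * (1 + (\<Sum>n. real n powr (- 1 - \<epsilon>)))"
   using sum_le_suminf[OF sm, of "{1..N}"] by (intro mult_left_mono) auto
  finally show "(\<Sum>k=1..N. real k powr (- (1 - \<epsilon>))) <= (1 + (\<Sum>n. real n powr (- 1 - \<epsilon>))) * real N powr (2 * \<epsilon>)" by (simp add: mult.commute)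
 qed
qed

text \<open>\<open>first_moment_le\<close> is applied in every layer. A tail exponent just below 1
  makes the truncated first moment grow only like N^(2 \<epsilon>), and the truncation level is
  about \<open>A ^ 3\<close> times an exponential in the layer number. Hence \<open>A\<close> enters
  with the small exponent 6 \<epsilon>.\<close>

lemma fm:
 assumes e: "0 < \<epsilon>" "\<epsilon> < 1" and f: "0 < f'" "2 * \<epsilon> * (\<bar>s\<bar> / 2 + f') < f' - om"
 shows "\<exists>C>0. \<forall>pe A K fl. inv_pe pe --> 1 <= A --> 1 <= K --> MM pe Pfull <= ennreal A -->
  (\<forall>i X k. finite X --> X \<subseteq> layer i --> 1 <= k --> tl fl pe X k <= K * exp (- f' * g * real i) * real k powr (- (1 - \<epsilon>))) -->
  (\<integral>\<^sup>+x. ennreal (cn pe (Rg fl x) ob x * Th (L x - L ob)) \<partial>count_space Ob) <= ennreal (C * K * A powr (6 * \<epsilon>))"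
proof -
 obtain S where S: "S > 0" "!!N::nat. (\<Sum>k=1..N. real k powr (- (1 - \<epsilon>))) <= S * real N powr (2 * \<epsilon>)" using powr_sum_bound[OF e(1)] by blast
 \<comment> \<open>With N growing at rate \<open>B\<close> the second moment divided by N decays
   like the tail bound. The rate \<open>\<tau>\<close> is what remains of (f' - om) g after the loss
   N^(2 \<epsilon>); it is positive by the second part of the assumption \<open>f\<close>.\<close>
 define B where "B = \<bar>s\<bar> * g / 2 + f' * g"
 define C1 where "C1 = 4 * S + exp (\<bar>s\<bar> * g / 2)"
 define C2 where "C2 = C1 * (2 * exp (\<bar>om\<bar> * g))"
 define \<tau> where "\<tau> = (f' - om) * g - 2 * \<epsilon> * B"
 have B: "B > 0" unfolding B_def using f(1) g_pos by (intro add_nonneg_pos) auto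
 have tau: "\<tau> > 0"
 proof -
  have "2 * \<epsilon> * B = (2 * \<epsilon> * (\<bar>s\<bar> / 2 + f')) * g" unfolding B_def by (simp add: algebra_simps)
  also have "... < (f' - om) * g" using f(2) g_pos by (intro mult_strict_right_mono)
  finally show ?thesis unfolding \<tau>_def by simp
 qed
 have C1: "C1 > 0" unfolding C1_def using S(1) by (intro add_pos_pos) auto
 have C2: "C2 > 0" unfolding C2_def using C1 by simp
 let ?G = "\<Sum>i. exp (- \<tau>) ^ i"
 have Gs: "summable (%i. exp (- \<tau>) ^ i)" using tau by (intro summable_geometric) simp
 have G: "?G > 0" using tau by (subst suminf_geometric) auto
 show ?thesis
 proof (intro exI[of _ "C2 * ?G"] conjI allI impI)
  show "0 < C2 * ?G" using C2 G by simp
  fix pe :: "'v set \<Rightarrow> real" and A K :: real and fl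
  assume pe: "inv_pe pe" and A: "1 <= A" and K: "1 <= K" and MA: "MM pe Pfull <= ennreal A"
   and tail: "\<forall>i X k. finite X --> X \<subseteq> layer i --> 1 <= k --> tl fl pe X k <= K * exp (- f' * g * real i) * real k powr (- (1 - \<epsilon>))"
  let ?KA = "K * A powr (6 * \<epsilon>)"
  have A1: "1 <= A powr (6 * \<epsilon>)" using A e(1) by (simp add: ge_one_powr_ge_zero)
  have lay: "(\<Sum>x\<in>X. cn pe (Rg fl x) ob x * Th (L x - L ob)) <= C2 * ?KA * exp (- \<tau>) ^ i"
   if X: "finite X" "X \<subseteq> layer i" for X i
  proof -
   define R where "R = A ^ 3 * exp (B * real i)"
   have R1: "1 <= R" unfolding R_def using mult_mono[of 1 "A ^ 3" 1 "exp (B * real i)"] one_le_power[OF A, of 3] A B by simp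
   define N where "N = nat \<lceil>R\<rceil>"
   have N: "R <= real N" "real N <= 2 * R" "N > 0" unfolding N_def using R1 by linarith+
   have "(\<Sum>x\<in>X. cn pe (Rg fl x) ob x) <= (\<Sum>k=1..N. tl fl pe X k) +
    (\<Sum>x\<in>X. \<Sum>y\<in>X. pp E pe (%xi. occ (pf E (Rg fl x) ob x) xi & occ (pf E (Rg fl y) ob y) xi)) / N"
    unfolding cn_def tl_def by (rule first_moment_le[OF X(1) ms_pf N(3)])
   also have "... <= (\<Sum>k=1..N. K * exp (- f' * g * real i) * real k powr (- (1 - \<epsilon>))) + A ^ 3 * exp (\<bar>s\<bar> * (real i + 1) * g / 2) / R"
   proof (intro add_mono sum_mono frac_le)
    show "tl fl pe X k <= K * exp (- f' * g * real i) * real k powr (- (1 - \<epsilon>))" if "k \<in> {1..N}" for k using tail X that by auto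
    show "(\<Sum>x\<in>X. \<Sum>y\<in>X. pp E pe (%xi. occ (pf E (Rg fl x) ob x) xi & occ (pf E (Rg fl y) ob y) xi)) <= A ^ 3 * exp (\<bar>s\<bar> * (real i + 1) * g / 2)"
     by (rule second_moment[OF pe MA _ X]) (use A in simp)
   qed (use N R1 A in auto)
   also have "(\<Sum>k=1..N. K * exp (- f' * g * real i) * real k powr (- (1 - \<epsilon>))) = K * exp (- f' * g * real i) * (\<Sum>k=1..N. real k powr (- (1 - \<epsilon>)))"
    by (simp add: sum_distrib_left)
   also have "... <= K * exp (- f' * g * real i) * (S * (4 * A powr (6 * \<epsilon>) * exp (2 * \<epsilon> * B * real i)))"
   proof (rule mult_left_mono)
    have "real N powr (2 * \<epsilon>) <= (2 * R) powr (2 * \<epsilon>)" using N e(1) by (intro powr_mono2) auto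
    also have "... = 2 powr (2 * \<epsilon>) * (A ^ 3) powr (2 * \<epsilon>) * exp (B * real i) powr (2 * \<epsilon>)" unfolding R_def using A by (simp add: powr_mult)
    also have "(A ^ 3) powr (2 * \<epsilon>) = A powr (6 * \<epsilon>)" 
    proof -
     have "A ^ 3 = A powr 3" using powr_realpow[of A 3] A by simp
     then show ?thesis by (simp add: powr_powr)
    qed
    also have "exp (B * real i) powr (2 * \<epsilon>) = exp (2 * \<epsilon> * B * real i)" by (simp add: powr_def ac_simps)
    also have "2 powr (2 * \<epsilon>) * A powr (6 * \<epsilon>) * exp (2 * \<epsilon> * B * real i) <= 4 * A powr (6 * \<epsilon>) * exp (2 * \<epsilon> * B * real i)"
    proof (intro mult_right_mono)
     have "2 powr (2 * \<epsilon>) <= 2 powr (2 :: real)" using e by (intro powr_mono) auto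
     then show "2 powr (2 * \<epsilon>) <= (4 :: real)" by simp
    qed auto
    finally show "(\<Sum>k=1..N. real k powr (- (1 - \<epsilon>))) <= S * (4 * A powr (6 * \<epsilon>) * exp (2 * \<epsilon> * B * real i))"
     using order_trans[OF S(2)[of N]] S(1) by (meson less_imp_le mult_left_mono)
   qed (use K in auto)
   also have "A ^ 3 * exp (\<bar>s\<bar> * (real i + 1) * g / 2) / R = exp (\<bar>s\<bar> * g / 2) * exp (- f' * g * real i)"
   proof -
    have "exp (\<bar>s\<bar> * (real i + 1) * g / 2) = exp (\<bar>s\<bar> * g / 2) * exp (- f' * g * real i) * exp (B * real i)"
     unfolding B_def exp_add[symmetric] by (simp add: algebra_simps add_divide_distrib)
    then show ?thesis unfolding R_def using A by simp
   qed
   also have "... <= exp (\<bar>s\<bar> * g / 2) * (?KA * exp (- f' * g * real i) * exp (2 * \<epsilon> * B * real i))"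
   proof (rule mult_left_mono)
    have "1 * 1 <= ?KA * exp (2 * \<epsilon> * B * real i)"
    proof (intro mult_mono)
     show "1 <= ?KA" using mult_mono[OF K A1] K by simp
    qed (use e B K in auto)
    from mult_right_mono[OF this, of "exp (- f' * g * real i)"]
    show "exp (- f' * g * real i) <= ?KA * exp (- f' * g * real i) * exp (2 * \<epsilon> * B * real i)" by (simp add: ac_simps)
   qed simp
   finally have "(\<Sum>x\<in>X. cn pe (Rg fl x) ob x) <= C1 * ?KA * (exp (- f' * g * real i) * exp (2 * \<epsilon> * B * real i))"
    unfolding C1_def by (simp add: algebra_simps)
   then have cnX: "(\<Sum>x\<in>X. cn pe (Rg fl x) ob x) * (2 * exp (\<bar>om\<bar> * g) * exp (om * (real i * g))) <=
    C1 * ?KA * (exp (- f' * g * real i) * exp (2 * \<epsilon> * B * real i)) * (2 * exp (\<bar>om\<bar> * g) * exp (om * (real i * g)))"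
    by (intro mult_right_mono) auto
   have "(\<Sum>x\<in>X. cn pe (Rg fl x) ob x * Th (L x - L ob)) <= (\<Sum>x\<in>X. cn pe (Rg fl x) ob x * (2 * exp (\<bar>om\<bar> * g) * exp (om * (real i * g))))"
   proof (intro sum_mono mult_left_mono)
    fix x assume "x \<in> X"
    then have x: "real i * g <= L x - L ob" "L x - L ob <= real i * g + g" using X(2) unfolding layer_def by (auto simp: algebra_simps)
    define d where "d = L x - L ob - real i * g"
    have d: "0 <= d" "d <= g" using x unfolding d_def by auto
    have "0 <= L x - L ob" using x g_pos by (meson less_imp_le mult_nonneg_nonneg of_nat_0_le_iff order_trans)
    then have "Th (L x - L ob) <= 2 * exp (om * (L x - L ob))" by (rule Th_le_om)
    also have "om * (L x - L ob) = om * d + om * (real i * g)" unfolding d_def by (simp add: algebra_simps)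
    also have "om * d <= \<bar>om\<bar> * g" using d by (intro mult_mono) auto
    finally show "Th (L x - L ob) <= 2 * exp (\<bar>om\<bar> * g) * exp (om * (real i * g))" by (simp add: exp_add)
   qed simp
   also have "... = (\<Sum>x\<in>X. cn pe (Rg fl x) ob x) * (2 * exp (\<bar>om\<bar> * g) * exp (om * (real i * g)))" by (simp add: sum_distrib_right)
   also note cnX
   also have "C1 * ?KA * (exp (- f' * g * real i) * exp (2 * \<epsilon> * B * real i)) * (2 * exp (\<bar>om\<bar> * g) * exp (om * (real i * g)))
    = C2 * ?KA * (exp (- f' * g * real i) * exp (2 * \<epsilon> * B * real i) * exp (om * (real i * g)))" unfolding C2_def by (simp add: ac_simps)
   also have "exp (- f' * g * real i) * exp (2 * \<epsilon> * B * real i) * exp (om * (real i * g)) = exp (- \<tau>) ^ i"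
    unfolding exp_add[symmetric] exp_of_nat_mult[symmetric] \<tau>_def by (simp add: algebra_simps)
   finally show ?thesis .
  qed
  show "(\<integral>\<^sup>+x. ennreal (cn pe (Rg fl x) ob x * Th (L x - L ob)) \<partial>count_space Ob) <= ennreal (C2 * ?G * K * A powr (6 * \<epsilon>))"
  proof (rule nn_le_fin)
   show "countable Ob" using countable_V orb_sub[OF ob_V] by (rule countable_subset[rotated])
   fix X assume X: "finite X" "X \<subseteq> Ob"
   let ?h = "%x. cn pe (Rg fl x) ob x * Th (L x - L ob)"
   define Y where "Y = {x \<in> X. L ob <= L x}"
   define ix where "ix x = nat \<lfloor>(L x - L ob) / g\<rfloor>" for x
   have fY: "finite Y" unfolding Y_def using X by simp
   have z: "?h x = 0" if "x \<in> X - Y" for x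
   proof -
    have "L x < L ob" using that unfolding Y_def by auto
    then have "ob \<notin> Rg fl x" unfolding Rg_def using g_pos by auto
    then show ?thesis by (simp add: cn_zero)
   qed
   have "(\<Sum>x\<in>X. ?h x) = (\<Sum>x\<in>Y. ?h x)" by (rule sum.mono_neutral_right[OF X(1)]) (use z in \<open>auto simp: Y_def\<close>)
   also have "... = (\<Sum>i\<in>ix ` Y. \<Sum>x\<in>{x \<in> Y. ix x = i}. ?h x)" by (rule sum.image_gen[OF fY])
   also have "... <= (\<Sum>i\<in>ix ` Y. C2 * ?KA * exp (- \<tau>) ^ i)"
   proof (intro sum_mono lay)
    fix i
    show "finite {x \<in> Y. ix x = i}" using fY by simp
    show "{x \<in> Y. ix x = i} \<subseteq> layer i"
    proof
     fix x assume "x \<in> {x \<in> Y. ix x = i}"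
     then have x: "x \<in> Ob" "L ob <= L x" "ix x = i" using X unfolding Y_def by auto
     have nn: "0 <= (L x - L ob) / g" using x g_pos by simp
     then have "real i <= (L x - L ob) / g" "(L x - L ob) / g < real i + 1" using x(3) unfolding ix_def by linarith+
     then show "x \<in> layer i" using x(1) g_pos unfolding layer_def by (simp add: pos_le_divide_eq pos_divide_less_eq algebra_simps)
    qed
   qed
   also have "... = C2 * ?KA * (\<Sum>i\<in>ix ` Y. exp (- \<tau>) ^ i)" by (simp add: sum_distrib_left)
   also have "... <= C2 * ?KA * ?G" using C2 K by (intro mult_left_mono sum_le_suminf[OF Gs]) (auto simp: fY)
   finally have "(\<Sum>x\<in>X. ?h x) <= C2 * ?G * K * A powr (6 * \<epsilon>)" by (simp add: ac_simps)
   then show "(\<Sum>x\<in>X. ennreal (?h x)) <= ennreal (C2 * ?G * K * A powr (6 * \<epsilon>))" by (simp add: ennreal_leI)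
  qed
 qed
qed

end

section \<open>The self-consistent bound on the weighted susceptibility\<close>

context hg
begin

text \<open>At bounded cost a path from \<open>v\<close> to \<open>w\<close> is prolonged to one
  from a vertex of \<open>Ob\<close> below \<open>v\<close> to a strict top in \<open>Ob\<close>
  above \<open>w\<close>. Translating the new start to \<open>ob\<close> compares all start vertices
  with the base vertex, and each new end arises from boundedly many \<open>w\<close>.\<close>

lemma ins:
 assumes c: "0 < c" "c <= 1"
 shows "\<exists>C>0. \<forall>fl pe K. inv_pe pe --> (\<forall>e\<in>E. c <= pe e) -->
  (\<integral>\<^sup>+x. ennreal (cn pe (Rg fl x) ob x * Th (L x - L ob)) \<partial>count_space Ob) <= K --> MM pe (Pb fl) <= ennreal C * K"
proof -
 obtain ht where ht: "ht \<ge> 0" and top': "!!h. h \<ge> 0 ==> \<exists>l h1. \<forall>w\<in>V. \<exists>x\<in>Ob. \<exists>p. walk E V w x p & length p <= l & L w + h <= L x - g & L x <= L w + h1 &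
 (\<forall>y\<in>set p. L w - ht <= L y & (y = x \<or> L y <= L x - g))" using top by blast
 obtain hb where hb: "hb \<ge> 0" and bot': "!!h. h \<ge> 0 ==> \<exists>l h1. \<forall>w\<in>V. \<exists>x\<in>Ob. \<exists>p. walk E V w x p & length p <= l & L x + g <= L w - h & L w - h1 <= L x &
 (\<forall>y\<in>set p. L y <= L w + hb & (y = x \<or> L x + g <= L y))" using bot by blast
 \<comment> \<open>The walk upwards rises at least by the excursion \<open>hb\<close> of the walk
   downwards, and the walk downwards descends at least by the dip \<open>ht\<close> of the other, so
   neither prolongation passes the opposite new end.\<close>
 obtain lt h1t where T: "\<forall>w\<in>V. \<exists>x\<in>Ob. \<exists>p. walk E V w x p & length p <= lt & L w + hb <= L x - g & L x <= L w + h1t &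
 (\<forall>y\<in>set p. L w - ht <= L y & (y = x \<or> L y <= L x - g))" using top'[OF hb] by blast
 obtain lb h1b where Bt: "\<forall>w\<in>V. \<exists>x\<in>Ob. \<exists>p. walk E V w x p & length p <= lb & L x + g <= L w - ht & L w - h1b <= L x &
 (\<forall>y\<in>set p. L y <= L w + hb & (y = x \<or> L x + g <= L y))" using bot'[OF ht] by blast
 obtain xw where "\<forall>w\<in>V. xw w \<in> Ob & (\<exists>p. walk E V w (xw w) p & length p <= lt & L w + hb <= L (xw w) - g & L (xw w) <= L w + h1t &
 (\<forall>y\<in>set p. L w - ht <= L y & (y = xw w \<or> L y <= L (xw w) - g)))" using bchoice[OF T[unfolded Bex_def]] by blast
 note xw = bspec[OF this]
 obtain d where d: "!!n v. v \<in> V ==> finite (bl v n) & card (bl v n) <= (1 + d) ^ n" using bl_card by blast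
 define N where "N = (1 + d) ^ lt"
 define n where "n = lb + lt"
 define C0 where "C0 = exp (\<bar>s\<bar> * (h1t + h1b)) / c ^ n"
 have C0: "C0 > 0" unfolding C0_def using c by simp
 have N0: "real N > 0" unfolding N_def by simp
 show ?thesis
 proof (intro exI[of _ "C0 * real N"] conjI allI impI)
  show "0 < C0 * real N" using C0 N0 by simp
  fix fl pe K assume pe: "inv_pe pe" and pc: "\<forall>e\<in>E. c <= pe e"
   and K: "(\<integral>\<^sup>+x. ennreal (cn pe (Rg fl x) ob x * Th (L x - L ob)) \<partial>count_space Ob) <= K"
  have pc': "c <= pe e & pe e <= 1" if "e \<in> E" for e using pc inv_pe01[OF pe that] that by blast
  show "MM pe (Pb fl) <= ennreal (C0 * real N) * K"
   unfolding MM_def SM_def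
  proof (rule SUP_least)
   fix v assume v: "v \<in> V"
   obtain o' p where o': "o' \<in> Ob" "walk E V v o' p" "length p <= lb" "L o' + g <= L v - ht" "L v - h1b <= L o'"
    and p: "!!y. y \<in> set p ==> L y <= L v + hb & (y = o' \<or> L o' + g <= L y)" using bspec[OF Bt v] by blast
   obtain ga where g: "ga \<in> \<Gamma>" "ga o' = ob" using Ob_trans[OF o'(1) ob_Ob] by blast
   have o'V: "o' \<in> V" by (rule Ob_V[OF o'(1)])
   define h where "h x = ennreal (cn pe (Rg fl x) ob x * Th (L x - L ob))" for x
   have key: "ennreal (cn pe (reg (Pb fl) v w) v w * Th (L w - L v)) <= ennreal C0 * h (ga (xw w))" if w: "w \<in> V" for w
   proof (cases "L v <= L w")
    case False
    then have "v \<notin> reg (Pb fl) v w" unfolding reg_def Pb_def by auto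
    then show ?thesis by (simp add: cn_zero)
   next
    case True
    define x where "x = xw w"
    obtain q where x: "x \<in> Ob" "walk E V w x q" "length q <= lt" "L w + hb <= L x - g" "L x <= L w + h1t"
     and q: "!!y. y \<in> set q ==> L w - ht <= L y & (y = x \<or> L y <= L x - g)" using xw[OF w] unfolding x_def by blast
    have xV: "x \<in> V" by (rule Ob_V[OF x(1)])
    define S' where "S' = {y \<in> V. (fl --> L o' <= L y) & (L y <= L x - g \<or> y = x)}"
    have setV: "set p \<subseteq> V" "set q \<subseteq> V" using o'(2) x(2) unfolding walk_def by auto
    have w1: "walk E S' o' v (rev p)"
    proof -
     have "set p \<subseteq> S'"
     proof
      fix y assume y: "y \<in> set p"
      show "y \<in> S'" unfolding S'_def using p[OF y] setV(1) y x(4) True g_pos by auto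
     qed
     then show ?thesis using walk_rev[OF o'(2)] unfolding walk_def by simp
    qed
    have w2: "walk E S' w x q"
    proof -
     have "set q \<subseteq> S'"
     proof
      fix y assume y: "y \<in> set q"
      show "y \<in> S'" unfolding S'_def using q[OF y] setV(2) y o'(4) True g_pos by auto
     qed
     then show ?thesis using x(2) unfolding walk_def by simp
    qed
    have sub: "reg (Pb fl) v w \<subseteq> S'"
    proof
     fix y assume "y \<in> reg (Pb fl) v w"
     then show "y \<in> S'" unfolding S'_def reg_def Pb_def using o'(4) x(4) g_pos ht hb by auto
    qed
    have "c ^ n * cn pe (reg (Pb fl) v w) v w <= cn pe S' o' x"
     by (rule cn_ins[OF _ c(2) pc' w1 w2 sub]) (use c(1) o'(3) x(3) n_def in auto)
    also have "cn pe S' o' x = cn pe (Rg fl (ga x)) (ga o') (ga x)"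
     unfolding S'_def Rg_def
    proof (rule cn_g[OF pe g(1) _ o'V xV, symmetric])
     fix y assume y: "y \<in> V"
     have "L (ga y) - L ob = L y - L o'" using L_inv[OF g(1) y o'V] g(2) by simp
     moreover have "L (ga x) - L ob = L x - L o'" using L_inv[OF g(1) xV o'V] g(2) by simp
     moreover have "ga y = ga x \<longleftrightarrow> y = x" using g_inj[OF g(1)] y xV by (meson inj_on_eq_iff)
     ultimately show "((fl --> L ob <= L (ga y)) & (L (ga y) <= L (ga x) - g \<or> ga y = ga x)) = ((fl --> L o' <= L y) & (L y <= L x - g \<or> y = x))"
      by (smt (verit))
    qed
    finally have 1: "cn pe (reg (Pb fl) v w) v w <= cn pe (Rg fl (ga x)) ob (ga x) / c ^ n"
     using c(1) g(2) by (simp add: pos_le_divide_eq mult.commute)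
    have Lx: "L (ga x) - L ob = L x - L o'" using L_inv[OF g(1) xV o'V] g(2) by simp
    have "Th (L w - L v) = Th ((L x - L o') + ((L w - L v) - (L x - L o')))" by simp
    also have "... <= exp (\<bar>s\<bar> * \<bar>(L w - L v) - (L x - L o')\<bar>) * Th (L x - L o')" by (rule Th_lip)
    also have "... <= exp (\<bar>s\<bar> * (h1t + h1b)) * Th (L x - L o')"
     using x(4,5) o'(4,5) ht hb g_pos by (intro mult_right_mono iffD2[OF exp_le_cancel_iff] mult_left_mono) auto
    finally have 2: "Th (L w - L v) <= exp (\<bar>s\<bar> * (h1t + h1b)) * Th (L (ga x) - L ob)" unfolding Lx .
    have "cn pe (reg (Pb fl) v w) v w * Th (L w - L v) <= (cn pe (Rg fl (ga x)) ob (ga x) / c ^ n) * (exp (\<bar>s\<bar> * (h1t + h1b)) * Th (L (ga x) - L ob))"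
     using 1 2 c(1) by (intro mult_mono) auto
    also have "... = C0 * (cn pe (Rg fl (ga x)) ob (ga x) * Th (L (ga x) - L ob))" unfolding C0_def by simp
    finally show ?thesis unfolding h_def x_def[symmetric] using C0 by (simp add: ennreal_mult'[symmetric] ennreal_leI)
   qed
   have "(\<integral>\<^sup>+w. ennreal (cn pe (reg (Pb fl) v w) v w * Th (L w - L v)) \<partial>count_space V) <= (\<integral>\<^sup>+w. ennreal C0 * h (ga (xw w)) \<partial>count_space V)"
    using key by (intro nn_integral_mono) simp
   also have "... = ennreal C0 * (\<integral>\<^sup>+w. h (ga (xw w)) \<partial>count_space V)" by (rule nn_integral_cmult) simp
   also have "(\<integral>\<^sup>+w. h (ga (xw w)) \<partial>count_space V) <= ennreal (real N) * (\<integral>\<^sup>+x. h x \<partial>count_space Ob)"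
   proof (rule nn_fibre)
    show "ga (xw w) \<in> Ob" if "w \<in> V" for w using Ob_g[OF g(1)] xw[OF that] by blast
    fix x assume "x \<in> Ob"
    then have xV: "x \<in> V" by (rule Ob_V)
    obtain \<eta> where e: "\<eta> \<in> \<Gamma>" "!!x. x \<in> V ==> \<eta> (ga x) = x & ga (\<eta> x) = x" using g_inv[OF g(1)] by blast
    have eV: "\<eta> x \<in> V" by (rule gV[OF e(1) xV])
    have "{w \<in> V. ga (xw w) = x} \<subseteq> bl (\<eta> x) lt"
    proof
     fix w assume "w \<in> {w \<in> V. ga (xw w) = x}"
     then have w: "w \<in> V" "ga (xw w) = x" by auto
     have xe: "xw w = \<eta> x" using w(2) e(2)[OF Ob_V, of "xw w"] xw[OF w(1)] by auto
     obtain q where "walk E V w (xw w) q" "length q <= lt" using xw[OF w(1)] by blast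
     then have "xw w \<in> bl w lt" unfolding bl_def by auto
     then show "w \<in> bl (\<eta> x) lt" using bl_sym unfolding xe by blast
    qed
    then show "finite {w \<in> V. ga (xw w) = x} & card {w \<in> V. ga (xw w) = x} <= N"
     using d[OF eV, of lt] finite_subset card_mono order_trans unfolding N_def by metis
   qed
   also have "(\<integral>\<^sup>+x. h x \<partial>count_space Ob) <= K" using K unfolding h_def .
   finally show "(\<integral>\<^sup>+w. ennreal (cn pe (reg (Pb fl) v w) v w * Th (L w - L v)) \<partial>count_space V) <= ennreal (C0 * real N) * K"
    using C0 by (simp add: ennreal_mult' mult.assoc mult_left_mono)
  qed
 qed
qed

lemma T_shift:
 assumes pe: "inv_pe pe" and a: "a \<in> Ob"
 shows "pr E pe (Tfam fl a n) <= TT fl pe n"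
proof -
 obtain ga where g: "ga \<in> \<Gamma>" "ga a = ob" using Ob_trans[OF a ob_Ob] by blast
 have aV: "a \<in> V" by (rule Ob_V[OF a])
 have Lg: "L (ga y) - L ob = L y - L a" if "y \<in> V" for y using L_inv[OF g(1) that aV] g(2) by simp
 show ?thesis unfolding TT_def
 proof (rule pr_g_le[OF pe g(1) Tfam_fam Tfam_fam])
  fix S assume "S \<in> Tfam fl a n"
  then obtain b where b: "b \<in> Ob" "L a + n <= L b" "S \<in> pf E {y \<in> V. (fl --> L a <= L y) & L y <= L b} a b"
   unfolding Tfam_def by blast
  have bV: "b \<in> V" by (rule Ob_V[OF b(1)])
  have "(`) ga ` S \<in> pf E (ga ` {y \<in> V. (fl --> L a <= L y) & L y <= L b}) (ga a) (ga b)"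
   by (rule pf_g[OF g(1) _ b(3)]) blast
  also have "ga ` {y \<in> V. (fl --> L a <= L y) & L y <= L b} = {y \<in> V. (fl --> L ob <= L y) & L y <= L (ga b)}"
  proof (rule region_g[OF g(1)])
   fix y assume "y \<in> V"
   then show "((fl --> L ob <= L (ga y)) & L (ga y) <= L (ga b)) = ((fl --> L a <= L y) & L y <= L b)"
    using Lg[of y] Lg[OF bV] by (smt (verit))
  qed
  finally have "(`) ga ` S \<in> pf E {y \<in> V. (fl --> L ob <= L y) & L y <= L (ga b)} ob (ga b)" unfolding g(2) .
  moreover have "ga b \<in> {b \<in> Ob. L ob + n <= L b}" using Ob_g[OF g(1) b(1)] Lg[OF bV] b(2) by simp
  ultimately have "(`) ga ` S \<in> Tfam fl ob n" unfolding Tfam_def by blast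
  then show "\<exists>T\<in>Tfam fl ob n. T \<subseteq> (`) ga ` S" by blast
 qed
qed

text \<open>Cut an ascent at its lowest vertex m. If m is at most k below the start, prepending a
  descent of height k at cost exp (lam k), up to constants, makes the start a bottom. Otherwise BK
  and the sum over paths that end at a bottom give at most a multiple of Y exp (- \<nu> k). With k
  near \<theta> ln Y both are of order Y^\<eta>. The exponent \<eta> depends on \<open>f1\<close>
  but not on \<open>f'\<close> or \<open>K0\<close>, so that \<open>bootstrap\<close> can choose its
  \<epsilon> first.\<close>

lemma T_bound:
 assumes c: "0 < c" "c <= 1" and f1: "0 < f1" "om < f1"
 shows "\<exists>\<eta>. 0 <= \<eta> & \<eta> < 1 & (\<forall>f' K0. f1 <= f' --> 0 < K0 --> (\<exists>C>0. \<forall>pe Y. inv_pe pe --> (\<forall>e\<in>E. c <= pe e) --> 1 <= Y -->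
  MM pe Pabove <= ennreal Y --> (\<forall>n\<ge>0. TT True pe n <= K0 * exp (- f' * n)) --> (\<forall>n\<ge>0. TT False pe n <= C * Y powr \<eta> * exp (- f' * n))))"
proof -
 obtain C3 where C3: "C3 > 0" "!!pe. inv_pe pe ==> MM pe (%a b. b <= 0) <= ennreal C3 * MM pe Pabove" using MM_ineqs by blast
 obtain l where dn: "!!k a. a \<in> Ob ==> \<exists>b p. b \<in> Ob & - L b = - L a + real k & walk E V a b p & length p <= k * l + 1 &
 (\<forall>x\<in>set p. - L a <= - L x & (x = b \<or> - L x <= - L b - g))" using hg.up_iter[OF neg] by blast
 obtain hb where hb: "hb \<ge> 0" and bot': "!!h. h \<ge> 0 ==> \<exists>l h1. \<forall>w\<in>V. \<exists>x\<in>Ob. \<exists>p. walk E V w x p & length p <= l & L x + g <= L w - h & L w - h1 <= L x &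
 (\<forall>y\<in>set p. L y <= L w + hb & (y = x \<or> L x + g <= L y))" using bot by blast
 obtain l' h1 where bt: "!!w. w \<in> V ==> \<exists>x\<in>Ob. \<exists>p. walk E V w x p & length p <= l' & L x + g <= L w - 0 & L w - h1 <= L x &
 (\<forall>y\<in>set p. L y <= L w + hb & (y = x \<or> L x + g <= L y))" using bot'[of 0] by blast
 define \<nu> where "\<nu> = f1 - om"
 define lam where "lam = ln (1 / c) * real l"
 define \<theta> where "\<theta> = 1 / (lam + \<nu>)"
 define \<eta> where "\<eta> = lam * \<theta>"
 have nu: "\<nu> > 0" unfolding \<nu>_def using f1 by simp
 have lc: "ln (1 / c) \<ge> 0" using c by simp
 have la: "lam \<ge> 0" unfolding lam_def using lc by simp
 have th: "\<theta> > 0" unfolding \<theta>_def using nu la by simp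
 have eta: "0 <= \<eta>" "\<eta> < 1" "\<eta> = 1 - \<nu> * \<theta>" unfolding \<eta>_def \<theta>_def using nu la by (auto simp: field_simps)
 show ?thesis
 proof (rule exI[of _ \<eta>], intro conjI eta(1,2) allI impI)
  fix f' K0 :: real assume f': "f1 <= f'" and K0: "0 < K0"
  define C where "C = K0 * (1 / c * exp (lam * (hb + 1)) + C3 / c ^ l')"
  have C: "C > 0" unfolding C_def using K0 c C3(1) by (intro mult_pos_pos add_pos_pos) auto
  show "\<exists>C>0. \<forall>pe Y. inv_pe pe --> (\<forall>e\<in>E. c <= pe e) --> 1 <= Y -->
  MM pe Pabove <= ennreal Y --> (\<forall>n\<ge>0. TT True pe n <= K0 * exp (- f' * n)) --> (\<forall>n\<ge>0. TT False pe n <= C * Y powr \<eta> * exp (- f' * n))"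
  proof (intro exI[of _ C] conjI C allI impI)
   fix pe :: "'v set \<Rightarrow> real" and Y n :: real
   assume pe: "inv_pe pe" and pc: "\<forall>e\<in>E. c <= pe e" and Y: "1 <= Y" and MY: "MM pe Pabove <= ennreal Y"
    and R: "\<forall>n\<ge>0. TT True pe n <= K0 * exp (- f' * n)" and n: "0 <= n"
   have pc': "c <= pe e & pe e <= 1" if "e \<in> E" for e using pc inv_pe01[OF pe that] that by blast
   \<comment> \<open>The additional \<open>hb\<close> keeps the walk from m down to
     \<open>Ob\<close> below the height of \<open>ob\<close>, hence below the end of the
     ascent.\<close>
   define k where "k = nat \<lceil>hb + \<theta> * ln Y\<rceil>"
   have lY: "\<theta> * ln Y \<ge> 0" using th Y by simp
   have k: "hb + \<theta> * ln Y <= real k" "real k <= hb + \<theta> * ln Y + 1" unfolding k_def using hb lY by linarith+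
   define S1 where "S1 = (\<Union>b\<in>{b \<in> Ob. L ob + n <= L b}. pf E {y \<in> V. L ob - real k <= L y & L y <= L b} ob b)"
   define M where "M = {m \<in> V. L m < L ob - real k}"
   define \<A> where "\<A> m = pf E {y \<in> V. L m <= L y} ob m" for m
   define \<B> where "\<B> m = (\<Union>b\<in>{b \<in> Ob. L ob + n <= L b}. pf E {y \<in> V. L m <= L y & L y <= L b} m b)" for m
   define S2 where "S2 = (\<Union>m\<in>M. disj_unions (\<A> m \<times> \<B> m))"
   have Af: "\<A> m \<subseteq> fam E" for m unfolding \<A>_def by (rule pth_fam)
   have Bf: "\<B> m \<subseteq> fam E" for m unfolding \<B>_def by (rule UN_least) (rule pth_fam)
   have S1f: "S1 \<subseteq> fam E" unfolding S1_def by (rule UN_least) (rule pth_fam)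
   have S2f: "S2 \<subseteq> fam E" unfolding S2_def by (rule UN_least) (rule disj_unions_fam[OF Af Bf])
   have "TT False pe n <= pp E pe (%xi. occ S1 xi \<or> occ S2 xi)"
    unfolding TT_def
   proof (rule pp_mono[OF ms_disj[OF ms_occ[OF countable_E S1f] ms_occ[OF countable_E S2f]]])
    fix xi assume "occ (Tfam False ob n) xi"
    then obtain b p where b: "b \<in> Ob" "L ob + n <= L b" and p: "p \<in> pth E {y \<in> V. L y <= L b} ob b" "\<forall>e\<in>edgs p. xi e"
     unfolding occ_def Tfam_def pf_def by auto
    from pth_max_split[OF p(1), of "%x. - L x"] obtain m A B where m: "m \<in> {y \<in> V. L y <= L b}"
     "A \<in> pf E {x \<in> {y \<in> V. L y <= L b}. - L x <= - L m} ob m" "B \<in> pf E {x \<in> {y \<in> V. L y <= L b}. - L x <= - L m} m b"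
     "A \<inter> B = {}" "A \<union> B \<subseteq> edgs p" by blast
    have op: "\<forall>e\<in>A \<union> B. xi e" using m(5) p(2) by blast
    have A: "A \<in> pf E {y \<in> V. L m <= L y & L y <= L b} ob m" by (rule subsetD[OF pf_mono m(2)]) auto
    have B: "B \<in> pf E {y \<in> V. L m <= L y & L y <= L b} m b" by (rule subsetD[OF pf_mono m(3)]) auto
    show "occ S1 xi \<or> occ S2 xi"
    proof (cases "L m < L ob - real k")
     case True
     have "A \<in> \<A> m" unfolding \<A>_def by (rule subsetD[OF pf_mono A]) auto
     moreover have "B \<in> \<B> m" unfolding \<B>_def using B b by blast
     ultimately have "A \<union> B \<in> disj_unions (\<A> m \<times> \<B> m)" using m(4) by (rule disj_unionsI)
     then have "A \<union> B \<in> S2" unfolding S2_def M_def using True m(1) by blast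
     then show ?thesis using op unfolding occ_def by blast
    next
     case False
     obtain T where T: "T \<in> pf E {y \<in> V. L m <= L y & L y <= L b} ob b" "T \<subseteq> A \<union> B" using pf_trans[OF A B] by blast
     have "T \<in> pf E {y \<in> V. L ob - real k <= L y & L y <= L b} ob b" by (rule subsetD[OF pf_mono T(1)]) (use False in auto)
     then have "T \<in> S1" unfolding S1_def using b by blast
     then show ?thesis using op T(2) unfolding occ_def by blast
    qed
   qed
   also have "... <= pr E pe S1 + pr E pe S2" by (rule pp_sub[OF ms_occ[OF countable_E S1f] ms_occ[OF countable_E S2f]])
   finally have T12: "TT False pe n <= pr E pe S1 + pr E pe S2" .
   have P1: "pr E pe S1 <= K0 * exp (- f' * n) * (1 / c) ^ (k * l + 1)"
   proof -
    obtain a p where a: "a \<in> Ob" "- L a = - L ob + real k" "walk E V ob a p" "length p <= k * l + 1"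
     "!!x. x \<in> set p ==> - L ob <= - L x & (x = a \<or> - L x <= - L a - g)" using dn[OF ob_Ob, of k] by blast
    have "c ^ (k * l + 1) * pr E pe S1 <= pr E pe (Tfam True a (n + real k))"
    proof (rule pr_ins[OF _ c(2) pc' S1f Tfam_fam])
     show "edgs p \<subseteq> E" using a(3) unfolding walk_def by blast
     show "card (edgs p) <= k * l + 1" using card_edgs[of p] a(4) by linarith
     fix S assume "S \<in> S1"
     then obtain b where b: "b \<in> Ob" "L ob + n <= L b" "S \<in> pf E {y \<in> V. L ob - real k <= L y & L y <= L b} ob b" unfolding S1_def by blast
     have La: "L a = L ob - real k" using a(2) by simp
     let ?S' = "{y \<in> V. (True --> L a <= L y) & L y <= L b}"
     have pV: "set p \<subseteq> V" using a(3) unfolding walk_def by blast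
     have "set p \<subseteq> ?S'"
     proof
      fix y assume y: "y \<in> set p"
      show "y \<in> ?S'" using a(5)[OF y] pV y La b(2) n g_pos by auto
     qed
     then have w1: "walk E ?S' a ob (rev p)" using walk_rev[OF a(3)] unfolding walk_def by simp
     have w2: "walk E ?S' b b [b]" using Ob_V[OF b(1)] La b(2) n unfolding walk_def by auto
     have sub: "{y \<in> V. L ob - real k <= L y & L y <= L b} \<subseteq> ?S'" using La by auto
     obtain T where "T \<in> pf E ?S' a b" "T \<subseteq> (edgs (rev p) \<union> edgs [b]) \<union> S" using pf_ext[OF b(3) w1 w2 sub] by blast
     moreover have "L a + (n + real k) <= L b" using La b(2) by simp
     ultimately show "\<exists>T\<in>Tfam True a (n + real k). T \<subseteq> edgs p \<union> S" unfolding Tfam_def edgs_rev using b(1)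
      by (intro bexI[of _ T] UN_I[of b]) auto
    qed (use c in auto)
    also have "... <= TT True pe (n + real k)" by (rule T_shift[OF pe a(1)])
    also have "... <= K0 * exp (- f' * (n + real k))" using R n by simp
    also have "... <= K0 * exp (- f' * n)" using K0 f' f1 by (intro mult_left_mono) (auto intro!: mult_left_mono)
    finally show ?thesis using c by (simp add: power_divide pos_le_divide_eq mult.commute)
   qed
   have PB: "pr E pe (\<B> m) <= K0 / c ^ l' * exp (- f' * n) * exp (- \<nu> * real k) * Th (L m - L ob)" if m: "m \<in> M" for m
   proof -
    have mV: "m \<in> V" "L m < L ob - real k" using m unfolding M_def by auto
    obtain a p where a: "a \<in> Ob" "walk E V m a p" "length p <= l'" "L a + g <= L m"
     "!!y. y \<in> set p ==> L y <= L m + hb & (y = a \<or> L a + g <= L y)" using bt[OF mV(1)] by auto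
    have "c ^ l' * pr E pe (\<B> m) <= pr E pe (Tfam True a (n + L ob - L m))"
    proof (rule pr_ins[OF _ c(2) pc' Bf Tfam_fam])
     show "edgs p \<subseteq> E" using a(2) unfolding walk_def by blast
     show "card (edgs p) <= l'" using card_edgs[of p] a(3) by linarith
     fix S assume "S \<in> \<B> m"
     then obtain b where b: "b \<in> Ob" "L ob + n <= L b" "S \<in> pf E {y \<in> V. L m <= L y & L y <= L b} m b" unfolding \<B>_def by blast
     let ?S' = "{y \<in> V. (True --> L a <= L y) & L y <= L b}"
     have pV: "set p \<subseteq> V" using a(2) unfolding walk_def by blast
     have "set p \<subseteq> ?S'"
     proof
      fix y assume y: "y \<in> set p"
      show "y \<in> ?S'" using a(5)[OF y] pV y mV(2) b(2) n g_pos k(1) lY by auto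
     qed
     then have w1: "walk E ?S' a m (rev p)" using walk_rev[OF a(2)] unfolding walk_def by simp
     have w2: "walk E ?S' b b [b]" using Ob_V[OF b(1)] a(4) mV(2) b(2) n g_pos unfolding walk_def by auto
     have sub: "{y \<in> V. L m <= L y & L y <= L b} \<subseteq> ?S'" using a(4) g_pos by auto
     obtain T where "T \<in> pf E ?S' a b" "T \<subseteq> (edgs (rev p) \<union> edgs [b]) \<union> S" using pf_ext[OF b(3) w1 w2 sub] by blast
     moreover have "L a + (n + L ob - L m) <= L b" using a(4) b(2) g_pos by simp
     ultimately show "\<exists>T\<in>Tfam True a (n + L ob - L m). T \<subseteq> edgs p \<union> S" unfolding Tfam_def edgs_rev using b(1)
      by (intro bexI[of _ T] UN_I[of b]) auto
    qed (use c in auto)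
    also have "... <= TT True pe (n + L ob - L m)" by (rule T_shift[OF pe a(1)])
    also have "... <= K0 * exp (- f' * (n + L ob - L m))" using R n mV(2) by simp
    \<comment> \<open>The decay gained from the depth of m is divided: the rate \<open>om\<close>
      pays for the weight \<open>Th\<close>, and the remaining rate, at least \<open>\<nu>\<close>,
      gives exp (- \<nu> k).\<close>
    also have "exp (- f' * (n + L ob - L m)) = exp (- f' * n) * (exp ((f' - om) * (L m - L ob)) * exp (om * (L m - L ob)))"
     unfolding exp_add[symmetric] by (simp add: algebra_simps)
    also have "... <= exp (- f' * n) * (exp (- \<nu> * real k) * Th (L m - L ob))"
    proof (intro mult_left_mono mult_mono)
     have "(f' - om) * (L m - L ob) <= (f' - om) * (- real k)" using mV(2) f' f1 by (intro mult_left_mono) auto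
     also have "... <= - \<nu> * real k" using f' unfolding \<nu>_def by (simp add: algebra_simps mult_right_mono)
     finally show "exp ((f' - om) * (L m - L ob)) <= exp (- \<nu> * real k)" by simp
     show "exp (om * (L m - L ob)) <= Th (L m - L ob)" by (rule Th_ge_om)
    qed auto
    finally have "c ^ l' * pr E pe (\<B> m) <= K0 * (exp (- f' * n) * (exp (- \<nu> * real k) * Th (L m - L ob)))" using K0 by simp
    then show ?thesis using c by (simp add: pos_le_divide_eq mult.commute ac_simps)
   qed
   define W where "W = K0 / c ^ l' * exp (- f' * n) * exp (- \<nu> * real k)"
   have W: "W \<ge> 0" unfolding W_def using K0 c by simp
   have "ennreal (pr E pe S2) <= (\<integral>\<^sup>+m. ennreal (pr E pe (\<A> m) * pr E pe (\<B> m)) \<partial>count_space M)"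
   proof (rule pp_le_sum_BK[OF countable_E inv_pe01[OF pe] _ Af Bf])
    show "countable M" using countable_V unfolding M_def by (rule countable_subset[rotated]) blast
    fix xi assume "occ S2 xi"
    then obtain S m where S: "m \<in> M" "S \<in> disj_unions (\<A> m \<times> \<B> m)" "\<forall>e\<in>S. xi e" unfolding occ_def S2_def by blast
    then obtain A B where "A \<in> \<A> m" "B \<in> \<B> m" "A \<inter> B = {}" "S = A \<union> B" unfolding disj_unions_def by blast
    then show "\<exists>m\<in>M. \<exists>A\<in>\<A> m. \<exists>B\<in>\<B> m. A \<inter> B = {} & (\<forall>e\<in>A \<union> B. xi e)" using S(1,3) by blast
   qed
   also have "... <= (\<integral>\<^sup>+m. ennreal (cn pe (reg (%a b. b <= 0) ob m) ob m * Th (L m - L ob)) * ennreal W \<partial>count_space M)"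
   proof (rule nn_integral_mono)
    fix m assume "m \<in> space (count_space M)"
    then have m: "m \<in> M" by simp
    have "pr E pe (\<A> m) = cn pe (reg (%a b. b <= 0) ob m) ob m" unfolding cn_def \<A>_def reg_def by simp
    then have "pr E pe (\<A> m) * pr E pe (\<B> m) <= cn pe (reg (%a b. b <= 0) ob m) ob m * (W * Th (L m - L ob))"
     by (simp only: mult_left_mono[OF PB[OF m, folded W_def] cn_nonneg])
    also have "... = (cn pe (reg (%a b. b <= 0) ob m) ob m * Th (L m - L ob)) * W" by simp
    finally show "ennreal (pr E pe (\<A> m) * pr E pe (\<B> m)) <= ennreal (cn pe (reg (%a b. b <= 0) ob m) ob m * Th (L m - L ob)) * ennreal W"
     using W by (simp add: ennreal_mult''[symmetric] ennreal_leI)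
   qed
   also have "... <= (\<integral>\<^sup>+m. ennreal (cn pe (reg (%a b. b <= 0) ob m) ob m * Th (L m - L ob)) * ennreal W \<partial>count_space V)"
    by (rule cs_mono_set) (auto simp: M_def)
   also have "... = SM pe (%a b. b <= 0) ob * ennreal W" unfolding SM_def by (rule nn_integral_multc) simp
   also have "... <= (ennreal C3 * ennreal Y) * ennreal W"
    using order_trans[OF SM_le_MM[OF ob_V] order_trans[OF C3(2)[OF pe] mult_left_mono[OF MY]]] by (intro mult_right_mono) auto
   also have "... = ennreal (C3 * Y * W)" using C3(1) Y W by (simp add: ennreal_mult)
   finally have P2: "pr E pe S2 <= C3 * Y * W" using C3(1) Y W by (subst (asm) ennreal_le_iff) auto
   have e1: "(1 / c) ^ (k * l + 1) <= 1 / c * exp (lam * (hb + 1)) * Y powr \<eta>"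
   proof -
    have "(1 / c) ^ (k * l + 1) = 1 / c * exp (ln (1 / c) * (real k * real l))"
     using c by (simp add: exp_of_nat_mult[symmetric] mult.commute powr_realpow[symmetric] powr_def)
    also have "ln (1 / c) * (real k * real l) = lam * real k" unfolding lam_def by simp
    finally have p: "(1 / c) ^ (k * l + 1) = 1 / c * exp (lam * real k)" .
    have "lam * real k <= lam * (hb + 1 + \<theta> * ln Y)" using k(2) la by (intro mult_left_mono) auto
    then have "exp (lam * real k) <= exp (lam * (hb + 1 + \<theta> * ln Y))" by simp
    also have "... = exp (lam * (hb + 1)) * Y powr \<eta>"
     unfolding \<eta>_def powr_def using Y by (simp add: exp_add[symmetric] algebra_simps)
    finally have "1 / c * exp (lam * real k) <= 1 / c * (exp (lam * (hb + 1)) * Y powr \<eta>)" using c by (intro mult_left_mono) auto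
    then show ?thesis unfolding p by (simp only: mult.assoc)
   qed
   have e2: "Y * exp (- \<nu> * real k) <= Y powr \<eta>"
   proof -
    have "\<nu> * (\<theta> * ln Y) <= \<nu> * real k" using k(1) hb nu by (intro mult_left_mono) auto
    then have "exp (- \<nu> * real k) <= exp (- (\<nu> * (\<theta> * ln Y)))" by simp
    also have "... = Y powr (- (\<nu> * \<theta>))" unfolding powr_def using Y by simp
    finally have "Y * exp (- \<nu> * real k) <= Y powr 1 * Y powr (- (\<nu> * \<theta>))" using Y by (simp add: mult_left_mono)
    also have "... = Y powr \<eta>" unfolding eta(3) powr_add[symmetric] by simp
    finally show ?thesis .
   qed
   have "TT False pe n <= K0 * exp (- f' * n) * (1 / c) ^ (k * l + 1) + C3 * Y * W" using T12 P1 P2 by linarith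
   also have "C3 * Y * W = K0 * exp (- f' * n) * (C3 / c ^ l' * (Y * exp (- \<nu> * real k)))" unfolding W_def by simp
   also have "K0 * exp (- f' * n) * (1 / c) ^ (k * l + 1) + K0 * exp (- f' * n) * (C3 / c ^ l' * (Y * exp (- \<nu> * real k)))
    <= K0 * exp (- f' * n) * (1 / c * exp (lam * (hb + 1)) * Y powr \<eta>) + K0 * exp (- f' * n) * (C3 / c ^ l' * Y powr \<eta>)"
    using e1 e2 K0 C3(1) c by (intro add_mono mult_left_mono) auto
   also have "... = C * Y powr \<eta> * exp (- f' * n)" unfolding C_def by (simp add: algebra_simps)
   finally show "TT False pe n <= C * Y powr \<eta> * exp (- f' * n)" .
  qed
 qed
qed

lemma powr_absorb: fixes z C k :: real assumes "1 <= z" "z <= C * z powr k" "k < 1" "0 < C" shows "z <= C powr (1 / (1 - k))"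
proof -
 have "z powr (1 - k) * z powr k <= C * z powr k" using assms by (simp add: powr_add[symmetric])
 then have "z powr (1 - k) <= C" using assms by (simp add: mult_le_cancel_right)
 then have "(z powr (1 - k)) powr (1 / (1 - k)) <= C powr (1 / (1 - k))" using assms by (intro powr_mono2) auto
 then show ?thesis using assms by (simp add: powr_powr)
qed

text \<open>Bounds of at least 1 make powers monotone in the exponent; minimality lets each
  inequality for \<open>MM\<close> be read as one between the chosen numbers.\<close>

lemma real_MM: assumes "MM pe P < \<top>" shows "\<exists>r\<ge>1. MM pe P <= ennreal r & (\<forall>x\<ge>1. MM pe P <= ennreal x --> r <= x)"
proof (intro exI[of _ "max 1 (enn2real (MM pe P))"] conjI allI impI)
 show "MM pe P <= ennreal (max 1 (enn2real (MM pe P)))"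
  using assms by (metis ennreal_enn2real ennreal_leI max.cobounded2)
 show "max 1 (enn2real (MM pe P)) <= x" if "1 <= x" "MM pe P <= ennreal x" for x
  using that enn2real_mono[OF that(2)] by simp
qed simp

text \<open>Let z bound \<open>MM pe (Pb False)\<close>. The full sum is at most of order z^2, so
  the loss A^(6 \<epsilon>) becomes z^(12 \<epsilon>). Going once around the bounds yields z <= G^20
  z^(\<eta> + 24 \<epsilon>); since z is finite and the exponent is below 1, z is bounded by a
  constant that does not depend on \<open>pe\<close>.\<close>

lemma bootstrap:
 assumes c: "0 < c" "c <= 1" and f1: "0 < f1" "om < f1"
 shows "\<exists>\<epsilon>. 0 < \<epsilon> & \<epsilon> < 1 & (\<forall>f' K0 Ct. f1 <= f' --> f' <= f2 --> 1 <= K0 --> 1 <= Ct --> (\<exists>D. \<forall>pe. inv_pe pe --> (\<forall>e\<in>E. c <= pe e) -->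
  MM pe Pfull < \<top> --> (\<forall>n\<ge>0. TT True pe n <= K0 * exp (- f' * n)) -->
  (\<forall>fl K i X k. 1 <= K --> (\<forall>n\<ge>0. TT fl pe n <= K * exp (- f' * n)) --> finite X --> X \<subseteq> layer i --> 1 <= k -->
   tl fl pe X k <= Ct * K * exp (- f' * g * real i) * real k powr (- (1 - \<epsilon>))) -->
  MM pe Pfull <= ennreal D))"
proof -
 obtain \<eta> where eta: "0 <= \<eta>" "\<eta> < 1" and TB: "!!f' K0. f1 <= f' ==> 0 < K0 ==> (\<exists>C>0. \<forall>pe Y. inv_pe pe --> (\<forall>e\<in>E. c <= pe e) --> 1 <= Y -->
  MM pe Pabove <= ennreal Y --> (\<forall>n\<ge>0. TT True pe n <= K0 * exp (- f' * n)) --> (\<forall>n\<ge>0. TT False pe n <= C * Y powr \<eta> * exp (- f' * n)))"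
  using T_bound[OF c f1] by blast
 obtain Ci where Ci: "Ci > 0" "!!fl pe K. inv_pe pe ==> (\<forall>e\<in>E. c <= pe e) ==>
  (\<integral>\<^sup>+x. ennreal (cn pe (Rg fl x) ob x * Th (L x - L ob)) \<partial>count_space Ob) <= K ==> MM pe (Pb fl) <= ennreal Ci * K" using ins[OF c] by blast
 obtain Cm where Cm: "Cm > 0" "!!pe. inv_pe pe ==> MM pe Pfull <= ennreal Cm * (MM pe (Pb False) * MM pe (Pb False))"
  "!!pe. inv_pe pe ==> MM pe Pabove <= ennreal Cm * (MM pe (Pb True) * MM pe (Pb False))" using MM_ineqs by blast
 define q where "q = \<bar>s\<bar> / 2 + max f2 f1"
 have q: "q > 0" unfolding q_def using f1 by auto
 \<comment> \<open>The first entry keeps \<eta> + 24 \<epsilon> below 1. The second guarantees the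
   hypothesis of \<open>fm\<close> for every \<open>f'\<close> between \<open>f1\<close> and
   \<open>f2\<close>.\<close>
 define \<epsilon> where "\<epsilon> = min ((1 - \<eta>) / 48) ((f1 - om) / (4 * q)) / 2"
 have m: "0 < (1 - \<eta>) / 48" "(1 - \<eta>) / 48 < 1" "0 < (f1 - om) / (4 * q)" using eta f1 q by auto
 have e: "0 < \<epsilon>" "\<epsilon> < 1" "\<epsilon> <= (1 - \<eta>) / 48" "\<epsilon> <= (f1 - om) / (4 * q)"
 proof -
  have *: "0 < min a b / 2" "min a b / 2 < 1" "min a b / 2 <= a" "min a b / 2 <= b" if "0 < a" "a < 1" "0 < b" for a b :: real using that by auto
  from *[OF m] show "0 < \<epsilon>" "\<epsilon> < 1" "\<epsilon> <= (1 - \<eta>) / 48" "\<epsilon> <= (f1 - om) / (4 * q)" unfolding \<epsilon>_def .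
 qed
 have e2: "2 * \<epsilon> * q < f1 - om"
 proof -
  from e(4) have "4 * (\<epsilon> * q) <= f1 - om" using q by (simp add: pos_le_divide_eq mult.commute mult.left_commute)
  moreover have "\<epsilon> * q > 0" using e q by simp
  ultimately show ?thesis by linarith
 qed
 show ?thesis
 proof (rule exI[of _ \<epsilon>], intro conjI e(1,2) allI impI)
  fix f' K0 Ct :: real assume f': "f1 <= f'" "f' <= f2" and K0: "1 <= K0" and Ct: "1 <= Ct"
  have "2 * \<epsilon> * (\<bar>s\<bar> / 2 + f') <= 2 * \<epsilon> * q" unfolding q_def using e f' by (intro mult_left_mono) auto
  then have ee: "2 * \<epsilon> * (\<bar>s\<bar> / 2 + f') < f' - om" using e2 f' by linarith
  obtain Cf where Cf: "Cf > 0" "!!pe A K fl. inv_pe pe ==> 1 <= A ==> 1 <= K ==> MM pe Pfull <= ennreal A ==>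
  (\<forall>i X k. finite X --> X \<subseteq> layer i --> 1 <= k --> tl fl pe X k <= K * exp (- f' * g * real i) * real k powr (- (1 - \<epsilon>))) ==>
  (\<integral>\<^sup>+x. ennreal (cn pe (Rg fl x) ob x * Th (L x - L ob)) \<partial>count_space Ob) <= ennreal (Cf * K * A powr (6 * \<epsilon>))"
   using fm[OF e(1,2) less_le_trans[OF f1(1) f'(1)] ee] by blast
  obtain CT where CT: "CT > 0" "!!pe Y. inv_pe pe ==> (\<forall>e\<in>E. c <= pe e) ==> 1 <= Y ==>
  MM pe Pabove <= ennreal Y ==> (\<forall>n\<ge>0. TT True pe n <= K0 * exp (- f' * n)) ==> (\<forall>n\<ge>0. TT False pe n <= CT * Y powr \<eta> * exp (- f' * n))"
   using TB[OF f'(1), of K0] K0 by auto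
  \<comment> \<open>One constant above all the others, so that in the cycle of inequalities only its
    powers have to be counted.\<close>
  define G where "G = 1 + Ci + Cm + Cf + CT + K0 + Ct"
  have G: "1 <= G" "Ci <= G" "Cm <= G" "Cf <= G" "CT <= G" "K0 <= G" "Ct <= G" unfolding G_def using Ci(1) Cm(1) Cf(1) CT(1) K0 Ct by auto
  define kk where "kk = \<eta> + 24 * \<epsilon>"
  have kk: "kk < 1" unfolding kk_def using e(3) eta by (simp add: field_simps)
  define D where "D = G * ((G ^ 20) powr (1 / (1 - kk)) * (G ^ 20) powr (1 / (1 - kk)))"
  have step: "MM pe Pfull <= ennreal D" if pe: "inv_pe pe" and pc: "\<forall>e\<in>E. c <= pe e" and fin: "MM pe Pfull < \<top>"
   and R: "\<forall>n\<ge>0. TT True pe n <= K0 * exp (- f' * n)"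
   and tail: "\<forall>fl K i X k. 1 <= K --> (\<forall>n\<ge>0. TT fl pe n <= K * exp (- f' * n)) --> finite X --> X \<subseteq> layer i --> 1 <= k -->
   tl fl pe X k <= Ct * K * exp (- f' * g * real i) * real k powr (- (1 - \<epsilon>))" for pe
  proof -
   have finP: "MM pe P < \<top>" for P using MM_mono[of P Pfull pe] fin by (simp add: le_less_trans)
   obtain A where A: "A \<ge> 1" "MM pe Pfull <= ennreal A" "!!x. x \<ge> 1 ==> MM pe Pfull <= ennreal x ==> A <= x" using real_MM[OF fin] by blast
   obtain u where u: "u \<ge> 1" "MM pe (Pb True) <= ennreal u" "!!x. x \<ge> 1 ==> MM pe (Pb True) <= ennreal x ==> u <= x" using real_MM[OF finP] by blast
   obtain z where z: "z \<ge> 1" "MM pe (Pb False) <= ennreal z" "!!x. x \<ge> 1 ==> MM pe (Pb False) <= ennreal x ==> z <= x" using real_MM[OF finP] by blast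
   obtain Y where Y: "Y \<ge> 1" "MM pe Pabove <= ennreal Y" "!!x. x \<ge> 1 ==> MM pe Pabove <= ennreal x ==> Y <= x" using real_MM[OF finP] by blast
   define a where "a = A powr (6 * \<epsilon>)"
   have a: "a \<ge> 1" unfolding a_def using A(1) e by (simp add: ge_one_powr_ge_zero)
   have ge1: "1 <= x * y" if "1 <= x" "1 <= y" for x y :: real using mult_mono[OF that] that by simp
   \<comment> \<open>One passage from a bound on ascents to a bound on \<open>Pb fl\<close>: the
     tail estimate, then \<open>fm\<close>, then \<open>ins\<close>.\<close>
   have mom: "MM pe (Pb fl) <= ennreal (G * (G * (G * K) * a))" if K: "1 <= K" and TK: "\<forall>n\<ge>0. TT fl pe n <= K * exp (- f' * n)" for fl K
   proof -
    have K1: "1 <= Ct * K" using ge1[OF Ct K] .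
    have "(\<integral>\<^sup>+x. ennreal (cn pe (Rg fl x) ob x * Th (L x - L ob)) \<partial>count_space Ob) <= ennreal (Cf * (Ct * K) * A powr (6 * \<epsilon>))"
     by (rule Cf(2)[OF pe A(1) K1 A(2)]) (use tail K TK in blast)
    from Ci(2)[OF pe pc this] have "MM pe (Pb fl) <= ennreal (Ci * (Cf * (Ct * K) * a))" using Ci(1) unfolding a_def by (simp add: ennreal_mult'[symmetric])
    also have "... <= ennreal (G * (G * (G * K) * a))"
     using G K a Ci(1) Cf(1) Ct K1 by (intro ennreal_leI mult_mono) auto
    finally show ?thesis .
   qed
   have "MM pe (Pb True) <= ennreal (G * (G * (G * G) * a))"
   proof (rule mom[OF G(1)], intro allI impI)
    fix n :: real assume "0 <= n"
    then have "TT True pe n <= K0 * exp (- f' * n)" using R by blast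
    also have "... <= G * exp (- f' * n)" using G(6) by (intro mult_right_mono) auto
    finally show "TT True pe n <= G * exp (- f' * n)" .
   qed
   then have "u <= G * (G * (G * G) * a)" by (rule u(3)[rotated]) (intro ge1 G(1) a)
   then have ub: "u <= G ^ 4 * a" by (simp add: power4_eq_xxxx ac_simps)
   have "MM pe Pabove <= ennreal Cm * (ennreal u * ennreal z)" using order_trans[OF Cm(3)[OF pe] mult_left_mono[OF mult_mono[OF u(2) z(2)]]] by simp
   also have "... = ennreal (Cm * (u * z))" using Cm(1) u(1) z(1) by (simp add: ennreal_mult)
   also have "... <= ennreal (G * (G ^ 4 * a * z))" using ub G Cm(1) u(1) z(1) a by (intro ennreal_leI mult_mono) auto
   finally have "Y <= G * (G ^ 4 * a * z)" by (rule Y(3)[rotated]) (intro ge1 G(1) one_le_power a z(1))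
   then have Yb: "Y <= G ^ 5 * (a * z)" by (simp add: power_numeral_reduce ac_simps)
   have TY: "\<forall>n\<ge>0. TT False pe n <= (G * Y powr \<eta>) * exp (- f' * n)"
   proof (intro allI impI)
    fix n :: real assume "0 <= n"
    then have "TT False pe n <= CT * Y powr \<eta> * exp (- f' * n)" using CT(2)[OF pe pc Y(1,2) R] by blast
    also have "... <= (G * Y powr \<eta>) * exp (- f' * n)" using G(5) by (intro mult_right_mono) auto
    finally show "TT False pe n <= (G * Y powr \<eta>) * exp (- f' * n)" .
   qed
   have Ye: "1 <= Y powr \<eta>" using Y(1) eta by (simp add: ge_one_powr_ge_zero)
   have zb: "z <= G * (G * (G * (G * Y powr \<eta>)) * a)"
    by (rule z(3)[OF _ mom[OF ge1[OF G(1) Ye] TY]]) (intro ge1 G(1) Ye a)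
   have "MM pe Pfull <= ennreal Cm * (ennreal z * ennreal z)" using order_trans[OF Cm(2)[OF pe] mult_left_mono[OF mult_mono[OF z(2) z(2)]]] by simp
   also have "... = ennreal (Cm * (z * z))" using Cm(1) z(1) by (simp add: ennreal_mult)
   also have "... <= ennreal (G * (z * z))" using G z(1) by (intro ennreal_leI mult_right_mono) auto
   finally have MMz: "MM pe Pfull <= ennreal (G * (z * z))" .
   then have Ab: "A <= G * (z * z)" by (rule A(3)[rotated]) (intro ge1 G(1) z(1))
   have G0: "G > 0" and z0: "z > 0" and a0: "a > 0" using G(1) z(1) a by auto
   have ab: "a <= G * z powr (12 * \<epsilon>)"
   proof -
    have "a <= (G * (z * z)) powr (6 * \<epsilon>)" unfolding a_def using Ab A(1) e by (intro powr_mono2) auto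
    also have "... = G powr (6 * \<epsilon>) * z powr (12 * \<epsilon>)" using G0 z0 by (simp add: powr_mult powr_add[symmetric])
    also have "G powr (6 * \<epsilon>) <= G powr 1"
     using G(1) e eta by (intro powr_mono) (auto simp: field_simps)
    finally show ?thesis using G0 by (simp add: mult_right_mono)
   qed
   have "Y powr \<eta> <= (G ^ 5 * (a * z)) powr \<eta>" using Yb Y(1) eta by (intro powr_mono2) auto
   also have "... = (G ^ 5) powr \<eta> * (a powr \<eta> * z powr \<eta>)" using G0 z0 a0 by (simp add: powr_mult)
   also have "... <= (G ^ 5) powr 1 * (a powr 1 * z powr \<eta>)"
    using one_le_power[OF G(1), of 5] a eta z(1) by (intro mult_mono powr_mono) auto
   also have "... = G ^ 5 * (a * z powr \<eta>)" using G0 a0 by simp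
   finally have Yp: "Y powr \<eta> <= G ^ 5 * (a * z powr \<eta>)" .
   have "z <= G ^ 4 * Y powr \<eta> * a" using zb by (simp add: power4_eq_xxxx ac_simps)
   also have "... <= G ^ 4 * (G ^ 5 * (a * z powr \<eta>)) * a" using Yp a G0 by (intro mult_right_mono mult_left_mono) auto
   also have "... = G ^ 9 * z powr \<eta> * (a * a)" 
   proof -
    have "G ^ 9 = G ^ 4 * G ^ 5" by (simp add: power_add[symmetric])
    then show ?thesis by (simp only: ac_simps)
   qed
   also have "... <= G ^ 9 * z powr \<eta> * ((G * z powr (12 * \<epsilon>)) * (G * z powr (12 * \<epsilon>)))"
    using ab a G0 by (intro mult_left_mono mult_mono) auto
   also have "... = G ^ 11 * (z powr \<eta> * (z powr (12 * \<epsilon>) * z powr (12 * \<epsilon>)))"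
   proof -
    have "G ^ 11 = G ^ 9 * (G * G)" by (simp add: eval_nat_numeral ac_simps)
    then show ?thesis by (simp only: ac_simps)
   qed
   also have "z powr \<eta> * (z powr (12 * \<epsilon>) * z powr (12 * \<epsilon>)) = z powr kk" unfolding kk_def by (simp add: powr_add[symmetric])
   also have "G ^ 11 * z powr kk <= G ^ 20 * z powr kk" using G(1) by (intro mult_right_mono power_increasing) auto
   finally have "z <= (G ^ 20) powr (1 / (1 - kk))" using G0 by (intro powr_absorb[OF z(1) _ kk]) auto
   then have "G * (z * z) <= D" unfolding D_def using G0 z0 by (intro mult_left_mono mult_mono) auto
   then show ?thesis using MMz by (meson ennreal_leI order_trans)
  qed
  show "\<exists>D. \<forall>pe. inv_pe pe --> (\<forall>e\<in>E. c <= pe e) -->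
  MM pe Pfull < \<top> --> (\<forall>n\<ge>0. TT True pe n <= K0 * exp (- f' * n)) -->
  (\<forall>fl K i X k. 1 <= K --> (\<forall>n\<ge>0. TT fl pe n <= K * exp (- f' * n)) --> finite X --> X \<subseteq> layer i --> 1 <= k -->
   tl fl pe X k <= Ct * K * exp (- f' * g * real i) * real k powr (- (1 - \<epsilon>))) -->
  MM pe Pfull <= ennreal D"
   by (intro exI[of _ D] allI impI) (rule step)
 qed
qed

end

section \<open>A law of large numbers for one step of growth\<close>

lemma pp_sum_mono:
 fixes c :: "'i \<Rightarrow> real" and d :: "'j \<Rightarrow> real"
 assumes I: "finite I" and J: "finite J" and P: "!!i. i \<in> I ==> ms E (P i)" and Q: "!!j. j \<in> J ==> ms E (Q j)"
  and le: "!!xi. (\<Sum>i\<in>I. c i * of_bool (P i xi)) <= (\<Sum>j\<in>J. d j * of_bool (Q j xi))"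
 shows "(\<Sum>i\<in>I. c i * pp E pe (P i)) <= (\<Sum>j\<in>J. d j * pp E pe (Q j))"
proof -
 let ?M = "PM E pe"
 let ?I = "%P. indicat_real {xi \<in> space ?M. P xi}"
 have i1: "integrable ?M (%xi. c i * ?I (P i) xi)" if "i \<in> I" for i
  by (rule Bochner_Integration.integrable_mult_right) (rule pp_int(1)[OF P[OF that]])
 have i2: "integrable ?M (%xi. d j * ?I (Q j) xi)" if "j \<in> J" for j
  by (rule Bochner_Integration.integrable_mult_right) (rule pp_int(1)[OF Q[OF that]])
 have e1: "(\<integral>xi. c i * ?I (P i) xi \<partial>?M) = c i * pp E pe (P i)" for i
  unfolding Bochner_Integration.integral_mult_right_zero pp_int(2) ..
 have e2: "(\<integral>xi. d j * ?I (Q j) xi \<partial>?M) = d j * pp E pe (Q j)" for j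
  unfolding Bochner_Integration.integral_mult_right_zero pp_int(2) ..
 have s1: "(\<integral>xi. (\<Sum>i\<in>I. c i * ?I (P i) xi) \<partial>?M) = (\<Sum>i\<in>I. c i * pp E pe (P i))"
  by (rule trans[OF Bochner_Integration.integral_sum[OF i1]]) (assumption, rule sum.cong[OF refl e1])
 have s2: "(\<integral>xi. (\<Sum>j\<in>J. d j * ?I (Q j) xi) \<partial>?M) = (\<Sum>j\<in>J. d j * pp E pe (Q j))"
  by (rule trans[OF Bochner_Integration.integral_sum[OF i2]]) (assumption, rule sum.cong[OF refl e2])
 have "(\<integral>xi. (\<Sum>i\<in>I. c i * ?I (P i) xi) \<partial>?M) <= (\<integral>xi. (\<Sum>j\<in>J. d j * ?I (Q j) xi) \<partial>?M)"
 proof (rule integral_mono)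
  show "integrable ?M (%xi. \<Sum>i\<in>I. c i * ?I (P i) xi)" by (rule Bochner_Integration.integrable_sum) (rule i1)
  show "integrable ?M (%xi. \<Sum>j\<in>J. d j * ?I (Q j) xi)" by (rule Bochner_Integration.integrable_sum) (rule i2)
  fix xi assume "xi \<in> space ?M"
  then have "?I P xi = of_bool (P xi)" for P by (simp add: indicator_def)
  then show "(\<Sum>i\<in>I. c i * ?I (P i) xi) <= (\<Sum>j\<in>J. d j * ?I (Q j) xi)" using le[of xi] by simp
 qed
 then show ?thesis unfolding s1 s2 .
qed

lemma sum_of_bool_card: "finite X ==> (\<Sum>x\<in>X. of_bool (G x)) = real (card {x \<in> X. G x})"
 by (simp add: of_bool_def sum.If_cases Int_def)

lemma sum_UNIV_bool: "(\<Sum>i\<in>(UNIV :: bool set). f i) = f True + f False" for f :: "bool \<Rightarrow> real"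
 by (simp add: UNIV_bool)

text \<open>Only pairs whose edge sets meet contribute to the covariances, so the variance is at
  most \<open>B\<close> times the mean, and Chebyshev's inequality applies.\<close>

lemma chebyshev_local:
 assumes X: "finite X" and G: "!!x. x \<in> X ==> ms E (G x) & dep (I x) (G x) & I x \<subseteq> E"
  and B: "!!x. x \<in> X ==> card {y \<in> X. I x \<inter> I y \<noteq> {}} <= B" and mu: "0 < \<mu>" "\<mu> = (\<Sum>x\<in>X. pp E pe (G x))"
 shows "pp E pe (%xi. real (card {x \<in> X. G x xi}) < \<mu> / 2) <= 4 * real B / \<mu>"
proof -
 let ?Y = "%xi. real (card {x \<in> X. G x xi})"
 let ?p = "%x. pp E pe (G x)" and ?q = "%x y. pp E pe (%xi. G x xi & G y xi)"
 have msY: "ms E (%xi. ?Y xi < \<mu> / 2)"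
 proof -
  have *: "(?Y xi < \<mu> / 2) \<longleftrightarrow> \<not> nat \<lceil>\<mu> / 2\<rceil> <= card {x \<in> X. G x xi}" for xi using mu(1) by linarith
  show ?thesis unfolding * by (intro ms_not ms_card_ge X) (use G in blast)
 qed
 have "(\<Sum>i\<in>(UNIV :: bool set). (if i then \<mu>\<^sup>2 / 4 else - \<mu>\<^sup>2) * pp E pe (if i then (%xi. ?Y xi < \<mu> / 2) else (%xi. True)))
  <= (\<Sum>z\<in>X \<times> X. (1 - 2 * \<mu> * of_bool (fst z = snd z)) * pp E pe (%xi. G (fst z) xi & G (snd z) xi))"
 proof (rule pp_sum_mono)
  show "ms E (if i then (%xi. ?Y xi < \<mu> / 2) else (%xi. True))" for i using msY by simp
  show "ms E (%xi. G (fst z) xi & G (snd z) xi)" if "z \<in> X \<times> X" for z using G that by (intro ms_conj) auto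
  fix xi
  have "(\<Sum>z\<in>X \<times> X. (1 - 2 * \<mu> * of_bool (fst z = snd z)) * of_bool (G (fst z) xi & G (snd z) xi))
   = (\<Sum>x\<in>X. \<Sum>y\<in>X. (1 - 2 * \<mu> * of_bool (x = y)) * of_bool (G x xi & G y xi))"
   by (simp add: sum.cartesian_product split_def)
  also have "... = (\<Sum>x\<in>X. \<Sum>y\<in>X. of_bool (G x xi) * of_bool (G y xi)) - (\<Sum>x\<in>X. \<Sum>y\<in>X. 2 * \<mu> * (of_bool (x = y) * of_bool (G x xi & G y xi)))"
   unfolding sum_subtractf[symmetric] by (intro sum.cong refl) (simp add: of_bool_def)
  also have "(\<Sum>x\<in>X. \<Sum>y\<in>X. of_bool (G x xi) * of_bool (G y xi)) = ?Y xi * ?Y xi"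
   unfolding sum_product[symmetric] sum_of_bool_card[OF X] ..
  also have "(\<Sum>x\<in>X. \<Sum>y\<in>X. 2 * \<mu> * (of_bool (x = y) * of_bool (G x xi & G y xi))) = (\<Sum>x\<in>X. 2 * \<mu> * of_bool (G x xi))"
  proof (rule sum.cong[OF refl])
   fix x assume "x \<in> X"
   have "(\<Sum>y\<in>X. 2 * \<mu> * (of_bool (x = y) * of_bool (G x xi & G y xi))) = (\<Sum>y\<in>X. if x = y then 2 * \<mu> * of_bool (G x xi) else 0)"
    by (intro sum.cong refl) auto
   then show "(\<Sum>y\<in>X. 2 * \<mu> * (of_bool (x = y) * of_bool (G x xi & G y xi))) = 2 * \<mu> * of_bool (G x xi)"
    using X \<open>x \<in> X\<close> by simp
  qed
  also have "... = 2 * \<mu> * ?Y xi" unfolding sum_distrib_left[symmetric] sum_of_bool_card[OF X] ..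
  finally have r: "(\<Sum>z\<in>X \<times> X. (1 - 2 * \<mu> * of_bool (fst z = snd z)) * of_bool (G (fst z) xi & G (snd z) xi)) = ?Y xi * ?Y xi - 2 * \<mu> * ?Y xi" .
  \<comment> \<open>The pointwise form of Chebyshev: (Y - \<mu>)^2 is at least \<mu>^2 / 4 on the
    event, with the square expanded.\<close>
  have l: "\<mu>\<^sup>2 / 4 * of_bool (?Y xi < \<mu> / 2) - \<mu>\<^sup>2 <= ?Y xi * ?Y xi - 2 * \<mu> * ?Y xi"
  proof (cases "?Y xi < \<mu> / 2")
   case True
   then have "(\<mu> / 2)\<^sup>2 <= (\<mu> - ?Y xi)\<^sup>2" using mu(1) by (intro power_mono) auto
   then show ?thesis using True by (simp add: power2_eq_square algebra_simps)
  next
   case False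
   then show ?thesis using zero_le_power2[of "\<mu> - ?Y xi"] by (simp add: power2_eq_square algebra_simps)
  qed
  show "(\<Sum>i\<in>(UNIV :: bool set). (if i then \<mu>\<^sup>2 / 4 else - \<mu>\<^sup>2) * of_bool ((if i then (%xi. ?Y xi < \<mu> / 2) else (%xi. True)) xi))
   <= (\<Sum>z\<in>X \<times> X. (1 - 2 * \<mu> * of_bool (fst z = snd z)) * of_bool (G (fst z) xi & G (snd z) xi))"
   unfolding r sum_UNIV_bool using l by simp
 qed (use X in auto)
 also have "... = (\<Sum>x\<in>X. \<Sum>y\<in>X. (1 - 2 * \<mu> * of_bool (x = y)) * ?q x y)"
  by (simp add: sum.cartesian_product split_def)
 also have "... <= (\<Sum>x\<in>X. \<Sum>y\<in>X. ?p x * ?p y + (of_bool (I x \<inter> I y \<noteq> {}) * ?p x - (if x = y then 2 * \<mu> * ?p x else 0)))"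
 proof (intro sum_mono)
  fix x y assume xy: "x \<in> X" "y \<in> X"
  have "?q x y <= ?p x * ?p y + of_bool (I x \<inter> I y \<noteq> {}) * ?p x"
  proof (cases "I x \<inter> I y = {}")
   case True
   have "?q x y = ?p x * ?p y" using pp_indep[of E "G x" "I x" "G y" "I y" pe] G[OF xy(1)] G[OF xy(2)] True by simp
   then show ?thesis using True by simp
  next
   case False
   have "?q x y <= ?p x" using G[OF xy(1)] by (intro pp_mono) auto
   then show ?thesis using False by (simp add: pp_nonneg add_increasing)
  qed
  moreover have "?q x x = ?p x" by simp
  ultimately show "(1 - 2 * \<mu> * of_bool (x = y)) * ?q x y <= ?p x * ?p y + (of_bool (I x \<inter> I y \<noteq> {}) * ?p x - (if x = y then 2 * \<mu> * ?p x else 0))"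
   by (cases "x = y") (simp_all add: algebra_simps)
 qed
 also have "... = (\<Sum>x\<in>X. \<Sum>y\<in>X. ?p x * ?p y) + ((\<Sum>x\<in>X. \<Sum>y\<in>X. of_bool (I x \<inter> I y \<noteq> {}) * ?p x) - (\<Sum>x\<in>X. \<Sum>y\<in>X. if x = y then 2 * \<mu> * ?p x else 0))"
  by (simp add: sum.distrib sum_subtractf)
 also have "(\<Sum>x\<in>X. \<Sum>y\<in>X. ?p x * ?p y) = \<mu> * \<mu>" unfolding sum_product[symmetric] mu(2)[symmetric] ..
 also have "(\<Sum>x\<in>X. \<Sum>y\<in>X. if x = y then 2 * \<mu> * ?p x else 0) = 2 * \<mu> * \<mu>"
  using X by (simp add: mu(2) sum_distrib_left)
 also have "(\<Sum>x\<in>X. \<Sum>y\<in>X. of_bool (I x \<inter> I y \<noteq> {}) * ?p x) <= (\<Sum>x\<in>X. real B * ?p x)"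
 proof (rule sum_mono)
  fix x assume x: "x \<in> X"
  have "(\<Sum>y\<in>X. of_bool (I x \<inter> I y \<noteq> {}) * ?p x) = real (card {y \<in> X. I x \<inter> I y \<noteq> {}}) * ?p x"
   unfolding sum_distrib_right[symmetric] sum_of_bool_card[OF X] ..
  also have "... <= real B * ?p x" using B[OF x] by (intro mult_right_mono pp_nonneg) simp
  finally show "(\<Sum>y\<in>X. of_bool (I x \<inter> I y \<noteq> {}) * ?p x) <= real B * ?p x" .
 qed
 also have "(\<Sum>x\<in>X. real B * ?p x) = real B * \<mu>" unfolding sum_distrib_left[symmetric] mu(2)[symmetric] ..
 finally have "\<mu>\<^sup>2 / 4 * pp E pe (%xi. ?Y xi < \<mu> / 2) - \<mu>\<^sup>2 <= \<mu> * \<mu> + (real B * \<mu> - 2 * \<mu> * \<mu>)"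
  unfolding sum_UNIV_bool by simp
 then have "\<mu> * (\<mu> * pp E pe (%xi. ?Y xi < \<mu> / 2)) <= \<mu> * (4 * real B)" by (simp add: power2_eq_square algebra_simps)
 then have "\<mu> * pp E pe (%xi. ?Y xi < \<mu> / 2) <= 4 * real B" using mu(1) by simp
 then show ?thesis using mu(1) by (simp add: pos_le_divide_eq mult.commute)
qed

text \<open>Decompose according to the first index for which \<open>G\<close> holds. That index is
  determined by the coordinates in \<open>I\<close> and is thus independent of each
  \<open>H\<close>, although it decides which \<open>H\<close> is asked for.\<close>

lemma cond_step:
 assumes A: "countable \<A>" and G: "!!i. i \<in> \<A> ==> ms E (G i) & dep I (G i)" and H: "!!i. i \<in> \<A> ==> ms E (H i) & dep J (H i)"
  and IJ: "I \<inter> J = {}" "I \<subseteq> E" "J \<subseteq> E" and h: "0 <= h" "!!i. i \<in> \<A> ==> h <= pp E pe (H i)"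
 shows "h * pp E pe (%xi. \<exists>i\<in>\<A>. G i xi) <= pp E pe (%xi. \<exists>i\<in>\<A>. G i xi & H i xi)"
proof (cases "\<A> = {}")
 case False
 let ?f = "from_nat_into \<A>"
 have f: "?f n \<in> \<A>" for n using from_nat_into[OF False] .
 have rf: "range ?f = \<A>" by (rule range_from_nat_into[OF False A])
 define G' where "G' n xi \<longleftrightarrow> G (?f n) xi & (\<forall>m\<in>{..<n}. \<not> G (?f m) xi)" for n xi
 have mG': "ms E (G' n)" for n unfolding G'_def[abs_def] using G f by (intro ms_conj ms_all ms_not) auto
 have dG': "dep I (G' n)" for n
  unfolding dep_def
 proof (intro allI impI)
  fix xi xi' :: "'b \<Rightarrow> bool" assume e: "\<forall>e\<in>I. xi e = xi' e"
  have "G (?f m) xi = G (?f m) xi'" for m using depD[of I "G (?f m)" xi xi'] G[OF f] e by blast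
  then show "G' n xi = G' n xi'" unfolding G'_def by simp
 qed
 interpret prob_space "PM E pe" by simp
 have sm: "(%n. pp E pe (P n)) sums pp E pe (%xi. \<exists>n. P n xi)" if P: "!!n. ms E (P n)" "!!n m xi. P n xi ==> P m xi ==> n = m" for P
 proof -
  have "(%n. prob {xi \<in> space (PM E pe). P n xi}) sums prob (\<Union>n. {xi \<in> space (PM E pe). P n xi})"
   using P by (intro finite_measure_UNION) (auto simp: disjoint_family_on_def intro: msD)
  moreover have "(\<Union>n. {xi \<in> space (PM E pe). P n xi}) = {xi \<in> space (PM E pe). \<exists>n. P n xi}" by blast
  ultimately show ?thesis unfolding pp_def by simp
 qed
 have disj: "n = m" if "G' n xi" "G' m xi" for n m xi
  using that unfolding G'_def by (metis lessThan_iff linorder_neqE_nat)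
 have ex: "(\<exists>n. G' n xi) \<longleftrightarrow> (\<exists>i\<in>\<A>. G i xi)" for xi
 proof
  assume "\<exists>i\<in>\<A>. G i xi"
  then have "\<exists>n. G (?f n) xi" using rf by (metis rangeE)
  then obtain n where "G (?f n) xi" "!!m. m < n ==> \<not> G (?f m) xi" using exists_least_iff[of "%n. G (?f n) xi"] by auto
  then show "\<exists>n. G' n xi" unfolding G'_def by (intro exI[of _ n]) simp
 qed (use f in \<open>auto simp: G'_def\<close>)
 have s1: "(%n. h * pp E pe (G' n)) sums (h * pp E pe (%xi. \<exists>i\<in>\<A>. G i xi))"
 proof -
  have "(%n. pp E pe (G' n)) sums pp E pe (%xi. \<exists>n. G' n xi)" by (rule sm[OF mG']) (rule disj)
  then show ?thesis unfolding ex by (rule sums_mult)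
 qed
 have mGH: "ms E (%xi. G' n xi & H (?f n) xi)" for n using mG' H[OF f] by (intro ms_conj) auto
 have s2: "(%n. pp E pe (%xi. G' n xi & H (?f n) xi)) sums pp E pe (%xi. \<exists>n. G' n xi & H (?f n) xi)"
  by (rule sm[OF mGH]) (use disj in blast)
 have "h * pp E pe (G' n) <= pp E pe (%xi. G' n xi & H (?f n) xi)" for n
 proof -
  have "pp E pe (%xi. G' n xi & H (?f n) xi) = pp E pe (G' n) * pp E pe (H (?f n))"
   using H[OF f] by (intro pp_indep[OF mG' dG' _ _ IJ]) auto
  then show ?thesis using mult_left_mono[OF h(2)[OF f, of n] pp_nonneg[of E pe "G' n"]] by (simp add: mult.commute)
 qed
 then have "h * pp E pe (%xi. \<exists>i\<in>\<A>. G i xi) <= pp E pe (%xi. \<exists>n. G' n xi & H (?f n) xi)" by (rule sums_le[OF _ s1 s2])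
 also have "... <= pp E pe (%xi. \<exists>i\<in>\<A>. G i xi & H i xi)"
 proof (rule pp_mono)
  show "ms E (%xi. \<exists>i\<in>\<A>. G i xi & H i xi)" using G H by (intro ms_ex A ms_conj) auto
 qed (use f in \<open>auto simp: G'_def\<close>)
 finally show ?thesis .
qed simp

context gr
begin

lemma pf_g_eq: assumes g: "ga \<in> \<Gamma>" and S: "S \<subseteq> V" and V: "u \<in> V" "v \<in> V"
 shows "pf E (ga ` S) (ga u) (ga v) = (`) ((`) ga) ` pf E S u v"
proof
 obtain \<eta> where e: "\<eta> \<in> \<Gamma>" "!!x. x \<in> V ==> \<eta> (ga x) = x & ga (\<eta> x) = x" using g_inv[OF g] by blast
 show "(`) ((`) ga) ` pf E S u v \<subseteq> pf E (ga ` S) (ga u) (ga v)" using pf_g[OF g S] by blast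
 show "pf E (ga ` S) (ga u) (ga v) \<subseteq> (`) ((`) ga) ` pf E S u v"
 proof
  fix T assume T: "T \<in> pf E (ga ` S) (ga u) (ga v)"
  have gS: "ga ` S \<subseteq> V" using gV[OF g] S by blast
  have "\<eta> ` ga ` S = S" unfolding image_image using e(2) S by (simp add: subset_iff cong: image_cong)
  then have "(`) \<eta> ` T \<in> pf E S u v" using pf_g[OF e(1) gS T] e(2) V by simp
  moreover have "(`) ga ` (`) \<eta> ` T = T"
  proof -
   have "ga ` \<eta> ` x = x" if "x \<in> T" for x
   proof -
    have "x \<subseteq> V" using T pth_fam[of E "ga ` S" "ga u" "ga v"] edge_sub that unfolding fam_def by blast
    then show ?thesis unfolding image_image using e(2) by (simp add: subset_iff cong: image_cong)
   qed
   then show ?thesis unfolding image_image[of "(`) ga"] by (simp cong: image_cong)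
  qed
  ultimately show "T \<in> (`) ((`) ga) ` pf E S u v" by (metis imageI)
 qed
qed

lemma occ_g: "occ ((`) ((`) ga) ` \<S>) xi \<longleftrightarrow> occ \<S> (%e. xi (ga ` e))"
 unfolding occ_def by simp

lemma bl_g: assumes g: "ga \<in> \<Gamma>" and V: "v \<in> V" "x \<in> V" shows "ga x \<in> bl (ga v) n \<longleftrightarrow> x \<in> bl v n"
proof -
 have *: "ga x \<in> bl (ga v) n" if g: "ga \<in> \<Gamma>" and x: "x \<in> bl v n" for ga x v
 proof -
  obtain p where p: "walk E V v x p" "length p <= Suc n" using x unfolding bl_def by blast
  have "ga ` V \<subseteq> V" using gV[OF g] by blast
  then have "walk E V (ga v) (ga x) (map ga p)" using walk_g[OF g p(1)] unfolding walk_def by blast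
  then show ?thesis unfolding bl_def using p(2) by (intro CollectI exI[of _ "map ga p"]) simp
 qed
 obtain \<eta> where e: "\<eta> \<in> \<Gamma>" "!!x. x \<in> V ==> \<eta> (ga x) = x & ga (\<eta> x) = x" using g_inv[OF g] by blast
 show ?thesis using *[OF g, of x v] *[OF e(1), of "ga x" "ga v"] e(2)[OF V(1)] e(2)[OF V(2)] by auto
qed

end

context hg
begin

text \<open>Ascents from \<open>a\<close> to a strict top \<open>b\<close>, confined to a ball
  around \<open>b\<close> so that the events for distant \<open>b\<close> are independent.\<close>

definition Kr :: "nat \<Rightarrow> 'v \<Rightarrow> 'v \<Rightarrow> 'v set" where
 "Kr \<rho> a b = {y \<in> V. y \<in> bl b \<rho> & L a <= L y & (L y <= L b - g \<or> y = b)}"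

definition Kf :: "nat \<Rightarrow> 'v \<Rightarrow> 'v \<Rightarrow> 'v set set set" where
 "Kf \<rho> a b = pf E (Kr \<rho> a b) a b"

definition Ns :: "nat \<Rightarrow> real \<Rightarrow> 'v \<Rightarrow> 'v set" where
 "Ns \<rho> r b = {a \<in> Ob. a \<in> bl b \<rho> & r <= L b - L a & L b - L a < r + 1}"

definition nn :: "nat \<Rightarrow> real \<Rightarrow> 'v \<Rightarrow> ('v set \<Rightarrow> bool) \<Rightarrow> nat" where
 "nn \<rho> r b xi = card {a \<in> Ns \<rho> r b. occ (Kf \<rho> a b) xi}"

definition Dr :: "('v set \<Rightarrow> real) \<Rightarrow> nat \<Rightarrow> real \<Rightarrow> real" where
 "Dr pe \<rho> r = pp E pe (%xi. \<exists>a\<in>Ns \<rho> r ob. occ (Kf \<rho> a ob) xi)"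

definition Ev :: "'v set \<Rightarrow> real \<Rightarrow> real \<Rightarrow> 'v set set set" where
 "Ev A c h = (\<Union>a\<in>A. \<Union>b\<in>{b \<in> Ob. c + h <= L b}. pf E {y \<in> V. c <= L y & L y <= L b} a b)"

lemma Ev_fam: "Ev A c h \<subseteq> fam E"
 unfolding Ev_def by (intro UN_least) (rule pth_fam)

lemma Ns_fin: "b \<in> V ==> finite (Ns \<rho> r b)"
 unfolding Ns_def by (rule finite_subset[OF _ bl_fin[of b \<rho>]]) auto

lemma Kr_V: "Kr \<rho> a b \<subseteq> V" unfolding Kr_def by blast

lemma Ns_g: assumes g: "ga \<in> \<Gamma>" and b: "b \<in> V" shows "Ns \<rho> r (ga b) = ga ` Ns \<rho> r b"
proof -
 have "Ns \<rho> r b = {a \<in> V. a \<in> Ob & a \<in> bl b \<rho> & r <= L b - L a & L b - L a < r + 1}" for b unfolding Ns_def using Ob_V by blast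
 note e = this
 obtain \<eta> where eta: "\<eta> \<in> \<Gamma>" "!!x. x \<in> V ==> \<eta> (ga x) = x & ga (\<eta> x) = x" using g_inv[OF g] by blast
 show ?thesis unfolding e
 proof (rule region_g[OF g, symmetric])
  fix x assume x: "x \<in> V"
  have "ga x \<in> Ob \<longleftrightarrow> x \<in> Ob" using Ob_g[OF g] Ob_g[OF eta(1), of "ga x"] eta(2)[OF x] by auto
  then show "(ga x \<in> Ob & ga x \<in> bl (ga b) \<rho> & r <= L (ga b) - L (ga x) & L (ga b) - L (ga x) < r + 1)
   = (x \<in> Ob & x \<in> bl b \<rho> & r <= L b - L x & L b - L x < r + 1)"
   unfolding bl_g[OF g b x] L_inv[OF g b x] by simp
 qed
qed

lemma Kf_g: assumes g: "ga \<in> \<Gamma>" and V: "a \<in> V" "b \<in> V" shows "Kf \<rho> (ga a) (ga b) = (`) ((`) ga) ` Kf \<rho> a b"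
proof -
 have "Kr \<rho> (ga a) (ga b) = ga ` Kr \<rho> a b"
  unfolding Kr_def
 proof (rule region_g[OF g, symmetric])
  fix y assume y: "y \<in> V"
  have "ga y = ga b \<longleftrightarrow> y = b" using g_inj[OF g] y V by (meson inj_on_eq_iff)
  then show "(ga y \<in> bl (ga b) \<rho> & L (ga a) <= L (ga y) & (L (ga y) <= L (ga b) - g \<or> ga y = ga b))
   = (y \<in> bl b \<rho> & L a <= L y & (L y <= L b - g \<or> y = b))"
   using bl_g[OF g V(2) y, of \<rho>] L_inv[OF g y V(1)] L_inv[OF g y V(2)] by (smt (verit))
 qed
 then show ?thesis unfolding Kf_def using pf_g_eq[OF g Kr_V V] by simp
qed

lemma ms_Kf: "ms E (occ (Kf \<rho> a b))"
 unfolding Kf_def by (rule ms_pf)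

lemma ms_nn: assumes "b \<in> V" shows "ms E (%xi. nn \<rho> r b xi = k)"
proof -
 have *: "nn \<rho> r b xi = k \<longleftrightarrow> k <= card {a \<in> Ns \<rho> r b. occ (Kf \<rho> a b) xi} & \<not> Suc k <= card {a \<in> Ns \<rho> r b. occ (Kf \<rho> a b) xi}" for xi
  unfolding nn_def by linarith
 show ?thesis unfolding * by (intro ms_conj ms_not ms_card_ge Ns_fin assms ms_Kf)
qed

definition Bd :: "nat \<Rightarrow> nat" where "Bd \<rho> = (SOME B. \<forall>v\<in>V. card (bl v \<rho>) <= B)"

lemma Bd: "v \<in> V ==> card (bl v \<rho>) <= Bd \<rho>"
proof -
 obtain d where "\<forall>v\<in>V. card (bl v \<rho>) <= (1 + d) ^ \<rho>" using bl_card by blast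
 then have "\<exists>B. \<forall>v\<in>V. card (bl v \<rho>) <= B" by blast
 from someI_ex[OF this] show "v \<in> V ==> card (bl v \<rho>) <= Bd \<rho>" unfolding Bd_def by blast
qed

text \<open>The expected mass that \<open>b\<close> sends to \<open>a\<close> when \<open>b\<close>
  divides mass 1 equally among the vertices of \<open>Ns\<close> joined to it, expanded over the
  number k of these vertices.\<close>

definition wt :: "('v set \<Rightarrow> real) \<Rightarrow> nat \<Rightarrow> real \<Rightarrow> 'v \<Rightarrow> 'v \<Rightarrow> real" where
 "wt pe \<rho> r a b = (if a \<in> Ns \<rho> r b then \<Sum>k=1..Bd \<rho>. 1 / real k * pp E pe (%xi. occ (Kf \<rho> a b) xi & nn \<rho> r b xi = k) else 0)"

lemma wt_nonneg: "0 <= wt pe \<rho> r a b"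
 unfolding wt_def by (auto intro!: sum_nonneg simp: pp_nonneg)

lemma wt_g: assumes pe: "inv_pe pe" and g: "ga \<in> \<Gamma>" and V: "a \<in> V" "b \<in> V" shows "wt pe \<rho> r (ga a) (ga b) = wt pe \<rho> r a b"
proof -
 have inj: "inj_on ga V" by (rule g_inj[OF g])
 have NV: "Ns \<rho> r b \<subseteq> V" unfolding Ns_def using Ob_V by blast
 have N: "ga a \<in> Ns \<rho> r (ga b) \<longleftrightarrow> a \<in> Ns \<rho> r b" unfolding Ns_g[OF g V(2)] using inj NV V(1) by (meson inj_on_image_mem_iff)
 have oc: "occ (Kf \<rho> (ga a) (ga b)) xi = occ (Kf \<rho> a b) (%e. xi (ga ` e))" if "a \<in> V" for a xi
  unfolding Kf_g[OF g that V(2)] occ_g ..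
 have nn: "nn \<rho> r (ga b) xi = nn \<rho> r b (%e. xi (ga ` e))" for xi
 proof -
  have "{x \<in> Ns \<rho> r (ga b). occ (Kf \<rho> x (ga b)) xi} = ga ` {a \<in> Ns \<rho> r b. occ (Kf \<rho> a b) (%e. xi (ga ` e))}"
   (is "?A = ga ` ?B")
  proof
   show "ga ` ?B \<subseteq> ?A" 
   proof (rule image_subsetI)
    fix a assume "a \<in> ?B"
    then have a: "a \<in> Ns \<rho> r b" "occ (Kf \<rho> a b) (%e. xi (ga ` e))" by auto
    then show "ga a \<in> ?A" unfolding Ns_g[OF g V(2)] mem_Collect_eq using oc[of a] NV by (intro conjI imageI) auto
   qed
   show "?A \<subseteq> ga ` ?B"
   proof
    fix x assume x: "x \<in> ?A"
    then obtain a where a: "a \<in> Ns \<rho> r b" "x = ga a" unfolding Ns_g[OF g V(2)] by blast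
    have "occ (Kf \<rho> a b) (%e. xi (ga ` e))" using x oc[OF subsetD[OF NV a(1)]] unfolding a(2) by auto
    then show "x \<in> ga ` ?B" using a by blast
   qed
  qed
  moreover have "inj_on ga ?B" using NV by (intro inj_on_subset[OF inj]) blast
  ultimately show ?thesis unfolding nn_def by (simp add: card_image)
 qed
 have "pp E pe (%xi. occ (Kf \<rho> (ga a) (ga b)) xi & nn \<rho> r (ga b) xi = k) = pp E pe (%xi. occ (Kf \<rho> a b) xi & nn \<rho> r b xi = k)" for k
 proof -
  let ?P = "%xi. occ (Kf \<rho> a b) xi & nn \<rho> r b xi = k"
  have KE: "\<Union>(Kf \<rho> a b) \<subseteq> E" for a b unfolding Kf_def using pth_fam[of E] unfolding fam_def by blast
  have "dep E ?P" unfolding dep_def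
  proof (intro allI impI)
   fix xi xi' :: "'v set \<Rightarrow> bool" assume e: "\<forall>e\<in>E. xi e = xi' e"
   have "occ (Kf \<rho> a b) xi = occ (Kf \<rho> a b) xi'" for a b using depD[OF dep_occ[OF KE], of xi xi'] e by blast
   then show "?P xi = ?P xi'" unfolding nn_def by simp
  qed
  from pp_g[OF pe g ms_conj[OF ms_Kf ms_nn[OF V(2)]] this] show ?thesis
   unfolding Kf_g[OF g V] occ_g nn by simp
 qed
 then show ?thesis unfolding wt_def N by simp
qed

text \<open>The masses sent by \<open>b\<close> add up to 1 as soon as \<open>b\<close> is joined to
  some vertex of \<open>Ns\<close>, and the masses into a part \<open>C\<close> never exceed the
  indicator of being joined to \<open>C\<close>. So a vertex reached from many places is counted
  only once.\<close>

lemma wt_sum_le: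
 assumes b: "b \<in> V" and C: "C \<subseteq> Ns \<rho> r b"
 shows "(\<Sum>a\<in>C. wt pe \<rho> r a b) <= pp E pe (%xi. \<exists>a\<in>C. occ (Kf \<rho> a b) xi)"
  and "C = Ns \<rho> r b ==> pp E pe (%xi. \<exists>a\<in>C. occ (Kf \<rho> a b) xi) <= (\<Sum>a\<in>C. wt pe \<rho> r a b)"
proof -
 let ?S = "C \<times> {1..Bd \<rho>}"
 let ?P = "%z xi. occ (Kf \<rho> (fst z) b) xi & nn \<rho> r b xi = snd z"
 let ?Q = "%(_::unit) xi. \<exists>a\<in>C. occ (Kf \<rho> a b) xi"
 have fN: "finite (Ns \<rho> r b)" by (rule Ns_fin[OF b])
 have fC: "finite C" using C fN by (rule finite_subset)
 have wt: "(\<Sum>a\<in>C. wt pe \<rho> r a b) = (\<Sum>z\<in>?S. 1 / real (snd z) * pp E pe (?P z))"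

 proof -
  have "(\<Sum>a\<in>C. wt pe \<rho> r a b) = (\<Sum>a\<in>C. \<Sum>k=1..Bd \<rho>. 1 / real k * pp E pe (%xi. occ (Kf \<rho> a b) xi & nn \<rho> r b xi = k))"
   by (rule sum.cong[OF refl]) (simp only: wt_def subsetD[OF C] if_True)
  then show ?thesis unfolding sum.cartesian_product split_def .
 qed
 have pt: "(\<Sum>z\<in>?S. 1 / real (snd z) * of_bool (?P z xi)) = real (card {a \<in> C. occ (Kf \<rho> a b) xi}) / real (nn \<rho> r b xi)" for xi
 proof -
  have nB: "nn \<rho> r b xi <= Bd \<rho>"
  proof -
   have "nn \<rho> r b xi <= card (bl b \<rho>)" unfolding nn_def using bl_fin[OF b] by (intro card_mono) (auto simp: Ns_def)
   then show ?thesis using Bd[OF b, of \<rho>] by simp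
  qed
  have "(\<Sum>z\<in>?S. 1 / real (snd z) * of_bool (?P z xi)) = (\<Sum>a\<in>C. \<Sum>k=1..Bd \<rho>. 1 / real k * of_bool (occ (Kf \<rho> a b) xi & nn \<rho> r b xi = k))"
   by (simp add: sum.cartesian_product split_def)
  also have "... = (\<Sum>a\<in>C. of_bool (occ (Kf \<rho> a b) xi) / real (nn \<rho> r b xi))"
  proof (rule sum.cong[OF refl])
   fix a assume a: "a \<in> C"
   have "(\<Sum>k=1..Bd \<rho>. 1 / real k * of_bool (occ (Kf \<rho> a b) xi & nn \<rho> r b xi = k)) = (\<Sum>k=1..Bd \<rho>. if k = nn \<rho> r b xi then of_bool (occ (Kf \<rho> a b) xi) / real (nn \<rho> r b xi) else 0)"
    by (intro sum.cong refl) auto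
   also have "... = of_bool (occ (Kf \<rho> a b) xi) / real (nn \<rho> r b xi)"
    using nB by (auto simp: Suc_le_eq)
   finally show "(\<Sum>k=1..Bd \<rho>. 1 / real k * of_bool (occ (Kf \<rho> a b) xi & nn \<rho> r b xi = k)) = of_bool (occ (Kf \<rho> a b) xi) / real (nn \<rho> r b xi)" .
  qed
  also have "... = real (card {a \<in> C. occ (Kf \<rho> a b) xi}) / real (nn \<rho> r b xi)"
   unfolding sum_divide_distrib[symmetric] sum_of_bool_card[OF fC] ..
  finally show ?thesis .
 qed
 have msP: "ms E (?P z)" for z by (intro ms_conj ms_Kf ms_nn b)
 have msQ: "ms E (?Q j)" for j by (intro ms_ex ms_Kf countable_finite fC)
 have "(\<Sum>z\<in>?S. 1 / real (snd z) * pp E pe (?P z)) <= (\<Sum>j\<in>{()}. 1 * pp E pe (?Q j))"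
 proof (rule pp_sum_mono[OF _ _ msP msQ])
  fix xi
  have "card {a \<in> C. occ (Kf \<rho> a b) xi} <= nn \<rho> r b xi" unfolding nn_def using C fN by (intro card_mono) auto
  moreover have "card {a \<in> C. occ (Kf \<rho> a b) xi} = 0" if "\<not> ?Q () xi"
  proof -
   have "{a \<in> C. occ (Kf \<rho> a b) xi} = {}" using that by blast
   then show ?thesis by (simp only: card.empty)
  qed
  ultimately show "(\<Sum>z\<in>?S. 1 / real (snd z) * of_bool (?P z xi)) <= (\<Sum>j\<in>{()}. 1 * of_bool (?Q j xi))"
   unfolding pt by (cases "?Q () xi") (auto simp: divide_le_eq_1)
 qed (use fC in auto)
 then show "(\<Sum>a\<in>C. wt pe \<rho> r a b) <= pp E pe (%xi. \<exists>a\<in>C. occ (Kf \<rho> a b) xi)" unfolding wt by simp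
 assume CN: "C = Ns \<rho> r b"
 have "(\<Sum>j\<in>{()}. 1 * pp E pe (?Q j)) <= (\<Sum>z\<in>?S. 1 / real (snd z) * pp E pe (?P z))"
 proof (rule pp_sum_mono[OF _ _ msQ msP])
  fix xi
  have e: "card {a \<in> C. occ (Kf \<rho> a b) xi} = nn \<rho> r b xi" unfolding nn_def CN ..
  have "nn \<rho> r b xi > 0" if "?Q () xi" unfolding e[symmetric] using that fC by (auto simp: card_gt_0_iff)
  then show "(\<Sum>j\<in>{()}. 1 * of_bool (?Q j xi)) <= (\<Sum>z\<in>?S. 1 / real (snd z) * of_bool (?P z xi))"
   unfolding pt e by (cases "?Q () xi") auto
 qed (use fC in auto)
 then show "pp E pe (%xi. \<exists>a\<in>C. occ (Kf \<rho> a b) xi) <= (\<Sum>a\<in>C. wt pe \<rho> r a b)" unfolding wt by simp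
qed

text \<open>By mass transport \<open>a\<close> receives what \<open>ob\<close> sends, weighted with
  exp (s (L y - L ob)). The height differences in \<open>Ns\<close> lie between -r-1 and -r, which
  costs at most a factor exp (|s|).\<close>

lemma wt_out:
 assumes pe: "inv_pe pe" and a: "a \<in> Ob" and D: "D0 <= Dr pe \<rho> r" "0 <= D0"
 shows "exp (- s * r - \<bar>s\<bar>) * D0 <= (\<Sum>b\<in>{b \<in> Ob. a \<in> Ns \<rho> r b}. wt pe \<rho> r a b)" "finite {b \<in> Ob. a \<in> Ns \<rho> r b}"
proof -
 let ?X = "{b \<in> Ob. a \<in> Ns \<rho> r b}"
 have aV: "a \<in> V" by (rule Ob_V[OF a])
 have "?X \<subseteq> bl a \<rho>" unfolding Ns_def using bl_sym by auto
 then show fX: "finite ?X" using bl_fin[OF aV] by (rule finite_subset)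
 let ?F = "%a b. ennreal (wt pe \<rho> r a b)"
 have "ennreal (exp (- s * r - \<bar>s\<bar>) * D0) <= ennreal (\<Sum>y\<in>Ns \<rho> r ob. wt pe \<rho> r y ob * exp (s * (L y - L ob)))"
 proof (rule ennreal_leI)
  have "exp (- s * r - \<bar>s\<bar>) * D0 <= exp (- s * r - \<bar>s\<bar>) * (\<Sum>y\<in>Ns \<rho> r ob. wt pe \<rho> r y ob)"
   using wt_sum_le(2)[OF ob_V subset_refl refl] D unfolding Dr_def by (intro mult_left_mono) (auto intro: order_trans)
  also have "... <= (\<Sum>y\<in>Ns \<rho> r ob. wt pe \<rho> r y ob * exp (s * (L y - L ob)))"
   unfolding sum_distrib_left
  proof (rule sum_mono)
   fix y assume "y \<in> Ns \<rho> r ob"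
   then have y: "0 <= L ob - L y - r" "L ob - L y - r <= 1" unfolding Ns_def by auto
   have "s * (L ob - L y - r) <= \<bar>s\<bar> * (L ob - L y - r)" by (rule mult_right_mono[OF abs_ge_self y(1)])
   also have "... <= \<bar>s\<bar> * 1" by (rule mult_left_mono[OF y(2) abs_ge_zero])
   finally have "s * (L ob - L y - r) <= \<bar>s\<bar> * 1" .
   then have "- s * r - \<bar>s\<bar> <= s * (L y - L ob)" by (simp add: algebra_simps)
   then show "exp (- s * r - \<bar>s\<bar>) * wt pe \<rho> r y ob <= wt pe \<rho> r y ob * exp (s * (L y - L ob))"
    unfolding mult.commute[of "wt pe \<rho> r y ob"] by (intro mult_right_mono[OF _ wt_nonneg] iffD2[OF exp_le_cancel_iff])
  qed
  finally show "exp (- s * r - \<bar>s\<bar>) * D0 <= (\<Sum>y\<in>Ns \<rho> r ob. wt pe \<rho> r y ob * exp (s * (L y - L ob)))" .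
 qed
 also have "... = (\<Sum>y\<in>Ns \<rho> r ob. ?F y ob * ennreal (exp (s * (L y - L ob))))"
  using wt_nonneg by (subst sum_ennreal[symmetric]) (auto simp: ennreal_mult)
 also have "... <= (\<integral>\<^sup>+y. ?F y ob * ennreal (exp (s * (L y - L ob))) \<partial>count_space Ob)"
  by (rule sum_le_nn[OF Ns_fin[OF ob_V]]) (auto simp: Ns_def)
 also have "... = (\<integral>\<^sup>+b. ?F a b \<partial>count_space Ob)"
  by (rule mtp_Ob[OF _ a, symmetric]) (simp add: wt_g[OF pe])
 also have "... <= (\<integral>\<^sup>+b. ?F a b \<partial>count_space ?X)"
 proof -
  have "(\<integral>\<^sup>+b. ?F a b \<partial>count_space Ob) = (\<integral>\<^sup>+b. ?F a b * indicator ?X b \<partial>count_space UNIV)"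
   unfolding cs_indicator[of Ob] by (intro nn_integral_cong) (auto simp: indicator_def wt_def)
  then show ?thesis unfolding cs_indicator[of ?X] by simp
 qed
 also have "... = (\<Sum>b\<in>?X. ?F a b)" by (rule nn_integral_count_space_finite[OF fX])
 also have "... = ennreal (\<Sum>b\<in>?X. wt pe \<rho> r a b)" using wt_nonneg by (intro sum_ennreal) auto
 finally show "exp (- s * r - \<bar>s\<bar>) * D0 <= (\<Sum>b\<in>?X. wt pe \<rho> r a b)"
  using wt_nonneg by (subst (asm) ennreal_le_iff) (auto intro!: sum_nonneg)
qed

text \<open>One low endpoint suffices: then even the last edge of a path to a strict top slightly
  above the level counts as low.\<close>

definition Elow :: "real \<Rightarrow> 'v set set" where "Elow c = {e \<in> E. \<exists>y\<in>e. L y < c}"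
definition Ehigh :: "real \<Rightarrow> 'v set set" where "Ehigh c = {e \<in> E. \<forall>y\<in>e. c <= L y}"

lemma Elow_high: "Elow c \<inter> Ehigh c = {}" "Elow c \<subseteq> E" "Ehigh c \<subseteq> E"
 unfolding Elow_def Ehigh_def by force+

lemma pf_edge: assumes "S \<in> pf E R u v" "e \<in> S" shows "e \<in> E" "e \<subseteq> R"
proof -
 obtain p where p: "walk E R u v p" "S = edgs p" using assms(1) unfolding pf_def pth_def by blast
 show "e \<in> E" using p assms(2) unfolding walk_def by blast
 have "set p \<subseteq> R" using p(1) unfolding walk_def by simp
 then show "e \<subseteq> R" using edgs_sub[of e p] assms(2) unfolding p(2) by blast
qed

lemma dep_Ev: "dep (Ehigh c) (occ (Ev A c h))"
proof (rule dep_occ, rule Union_least)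
 fix S assume "S \<in> Ev A c h"
 then obtain a b where "S \<in> pf E {y \<in> V. c <= L y & L y <= L b} a b" unfolding Ev_def by blast
 note * = pf_edge[OF this]
 show "S \<subseteq> Ehigh c" unfolding Ehigh_def using * by blast
qed

text \<open>Every edge has an endpoint other than \<open>b\<close>, and that endpoint is below
  \<open>c\<close>.\<close>

lemma dep_low:
 assumes "!!y. y \<in> R ==> L y < c \<or> y = b" shows "dep (Elow c) (occ (pf E R a b))"
proof (rule dep_occ, rule Union_least, rule subsetI)
 fix S e assume S: "S \<in> pf E R a b" and e: "e \<in> S"
 note * = pf_edge[OF S e]
 obtain u v where "e = {u, v}" "u \<noteq> v" using E_edge[OF *(1)] by blast
 then obtain y where "y \<in> e" "y \<noteq> b" by blast
 then show "e \<in> Elow c" unfolding Elow_def using * assms by blast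
qed

text \<open>By \<open>wt_out\<close> the expected number of distinct vertices reached is at least
  the size of \<open>A\<close> times the mass received by each of its vertices. The reached vertices
  have heights between c + r and c + r + 2; one of the sublayers of width \<open>g\<close> covering
  this range contains a proportional share, whence the divisor in \<open>\<kappa>\<close>.\<close>

lemma LLN_step:
 assumes pe: "inv_pe pe" and D: "0 < D0" "D0 <= Dr pe \<rho> r" and r: "0 <= r"
  and A: "finite A" "A \<subseteq> {x \<in> Ob. c <= L x & L x < c + 1}" "A \<noteq> {}"
  and kap: "\<kappa> = exp (- s * r - \<bar>s\<bar>) * D0 / real (nat \<lceil>2 / g\<rceil>)"
 shows "\<exists>c' X. c + r <= c' & finite X & X \<subseteq> {x \<in> Ob. c' <= L x & L x < c' + g} &
  pp E pe (%xi. real (card {b \<in> X. \<exists>a\<in>A. a \<in> Ns \<rho> r b & occ (Kf \<rho> a b) xi}) < \<kappa> * card A / 2) <= 4 * real ((Bd \<rho>)\<^sup>2) / (\<kappa> * card A)"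
proof -
 define m where "m = nat \<lceil>2 / g\<rceil>"
 have m: "2 / g <= real m" "0 < m" unfolding m_def using g_pos by (auto intro: of_nat_ceiling)
 let ?Y = "\<Union>a\<in>A. {b \<in> Ob. a \<in> Ns \<rho> r b}"
 have AO: "a \<in> Ob" if "a \<in> A" for a using that A by blast
 have fY: "finite ?Y" using A(1) wt_out(2)[OF pe AO order_refl] by (auto simp: Dr_def pp_nonneg)
 define G where "G b xi \<longleftrightarrow> (\<exists>a\<in>A \<inter> Ns \<rho> r b. occ (Kf \<rho> a b) xi)" for b xi
 define X where "X i = {b \<in> ?Y. c + r + real i * g <= L b & L b < c + r + (real i + 1) * g}" for i
 have YX: "?Y \<subseteq> (\<Union>i<m. X i)"
 proof
  fix b assume b: "b \<in> ?Y"
  then obtain a where a: "a \<in> A" "a \<in> Ns \<rho> r b" by blast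
  then have Lb: "0 <= L b - (c + r)" "L b - (c + r) < 2" using A(2) unfolding Ns_def by force+
  define i where "i = nat \<lfloor>(L b - (c + r)) / g\<rfloor>"
  have q: "0 <= (L b - (c + r)) / g" "(L b - (c + r)) / g < 2 / g" using Lb g_pos by (auto simp: divide_strict_right_mono)
  then have i: "real i <= (L b - (c + r)) / g" "(L b - (c + r)) / g < real i + 1" unfolding i_def by linarith+
  then have "i < m" using q m(1) by linarith
  moreover have "b \<in> X i" unfolding X_def using b i g_pos by (simp add: pos_le_divide_eq pos_divide_less_eq algebra_simps)
  ultimately show "b \<in> (\<Union>i<m. X i)" by blast
 qed
 have fX: "finite (X i)" for i unfolding X_def by (rule finite_subset[OF _ fY]) blast
 have tot: "exp (- s * r - \<bar>s\<bar>) * D0 * card A <= (\<Sum>i<m. \<Sum>b\<in>X i. pp E pe (G b))"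
 proof -
  have "exp (- s * r - \<bar>s\<bar>) * D0 * card A = (\<Sum>a\<in>A. exp (- s * r - \<bar>s\<bar>) * D0)" by simp
  also have "... <= (\<Sum>a\<in>A. \<Sum>b\<in>{b \<in> Ob. a \<in> Ns \<rho> r b}. wt pe \<rho> r a b)"
   using wt_out(1)[OF pe AO D(2)] D(1) by (intro sum_mono) auto
  also have "... = (\<Sum>a\<in>A. \<Sum>b\<in>?Y. wt pe \<rho> r a b)"
   using fY by (intro sum.cong refl sum.mono_neutral_left) (auto simp: wt_def)
  also have "... = (\<Sum>b\<in>?Y. \<Sum>a\<in>A. wt pe \<rho> r a b)" by (rule sum.swap)
  also have "... <= (\<Sum>b\<in>?Y. pp E pe (G b))"
  proof (rule sum_mono)
   fix b assume "b \<in> ?Y"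
   then have b: "b \<in> V" using Ob_V by blast
   have "(\<Sum>a\<in>A. wt pe \<rho> r a b) = (\<Sum>a\<in>A \<inter> Ns \<rho> r b. wt pe \<rho> r a b)" using A(1) by (intro sum.mono_neutral_right) (auto simp: wt_def)
   also have "... <= pp E pe (G b)" unfolding G_def[abs_def] by (rule wt_sum_le(1)[OF b]) blast
   finally show "(\<Sum>a\<in>A. wt pe \<rho> r a b) <= pp E pe (G b)" .
  qed
  also have "... <= (\<Sum>b\<in>?Y. \<Sum>i<m. if b \<in> X i then pp E pe (G b) else 0)"
  proof (rule sum_mono)
   fix b assume "b \<in> ?Y"
   then obtain i where i: "i < m" "b \<in> X i" using YX by blast
   have "pp E pe (G b) = (if b \<in> X i then pp E pe (G b) else 0)" using i(2) by simp
   also have "... <= (\<Sum>i<m. if b \<in> X i then pp E pe (G b) else 0)"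
    by (rule member_le_sum) (use i(1) in \<open>auto simp: pp_nonneg\<close>)
   finally show "pp E pe (G b) <= (\<Sum>i<m. if b \<in> X i then pp E pe (G b) else 0)" .
  qed
  also have "... = (\<Sum>i<m. \<Sum>b\<in>?Y. if b \<in> X i then pp E pe (G b) else 0)" by (rule sum.swap)
  also have "... = (\<Sum>i<m. \<Sum>b\<in>X i. pp E pe (G b))"
  proof (rule sum.cong[OF refl])
   fix i
   show "(\<Sum>b\<in>?Y. if b \<in> X i then pp E pe (G b) else 0) = (\<Sum>b\<in>X i. pp E pe (G b))"
    by (rule sum.mono_neutral_cong_right[OF fY]) (auto simp: X_def)
  qed
  finally show ?thesis .
 qed
 have cA: "card A > 0" using A by (simp add: card_gt_0_iff)
 have kap': "\<kappa> * real m = exp (- s * r - \<bar>s\<bar>) * D0" unfolding kap m_def[symmetric] using m(2) by simp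
 have kpos: "\<kappa> > 0" unfolding kap m_def[symmetric] using D(1) m(2) by simp
 have "\<exists>i<m. \<kappa> * card A <= (\<Sum>b\<in>X i. pp E pe (G b))"
 proof (rule ccontr)
  assume "\<not> ?thesis"
  then have "(\<Sum>i<m. \<Sum>b\<in>X i. pp E pe (G b)) < (\<Sum>i<m. \<kappa> * card A)" using m(2) by (intro sum_strict_mono) (auto simp: not_le)
  also have "... = exp (- s * r - \<bar>s\<bar>) * D0 * card A" unfolding kap'[symmetric] by simp
  finally show False using tot by simp
 qed
 then obtain i where i: "\<kappa> * card A <= (\<Sum>b\<in>X i. pp E pe (G b))" by blast
 define \<mu> where "\<mu> = (\<Sum>b\<in>X i. pp E pe (G b))"
 have kA: "0 < \<kappa> * card A" using kpos cA by simp
 have mu: "0 < \<mu>" "\<kappa> * card A <= \<mu>" unfolding \<mu>_def using i kA by linarith+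
 have XV: "b \<in> V" if "b \<in> X i" for b using that Ob_V unfolding X_def by blast
 have msG: "ms E (G b)" for b unfolding G_def[abs_def] using A(1) by (intro ms_ex ms_Kf countable_finite) auto
 let ?I = "%b. {e \<in> E. e \<subseteq> bl b \<rho>}"
 have "pp E pe (%xi. real (card {b \<in> X i. G b xi}) < \<mu> / 2) <= 4 * real ((Bd \<rho>)\<^sup>2) / \<mu>"
 proof (rule chebyshev_local[OF fX _ _ mu(1) \<mu>_def])
  fix b assume b: "b \<in> X i"
  have "dep (?I b) (G b)" unfolding dep_def
  proof (intro allI impI)
   fix xi xi' :: "'v set \<Rightarrow> bool" assume e: "\<forall>e\<in>?I b. xi e = xi' e"
   have "occ (Kf \<rho> a b) xi = occ (Kf \<rho> a b) xi'" for a
   proof (rule depD[OF dep_occ])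
    show "\<Union>(Kf \<rho> a b) \<subseteq> ?I b" unfolding Kf_def using pf_edge[of _ "Kr \<rho> a b" a b] unfolding Kr_def by blast
   qed (use e in blast)
   then show "G b xi = G b xi'" unfolding G_def by simp
  qed
  then show "ms E (G b) & dep (?I b) (G b) & ?I b \<subseteq> E" using msG by blast
  have bV: "b \<in> V" by (rule XV[OF b])
  \<comment> \<open>Balls around \<open>b\<close> and \<open>y\<close> that share an edge share a
    vertex v, so \<open>y\<close> is in a ball around a vertex of the ball around
    \<open>b\<close>.\<close>
  have "{y \<in> X i. ?I b \<inter> ?I y \<noteq> {}} \<subseteq> (\<Union>v\<in>bl b \<rho>. bl v \<rho>)"
  proof
   fix y assume "y \<in> {y \<in> X i. ?I b \<inter> ?I y \<noteq> {}}"
   then obtain e where e: "e \<in> E" "e \<subseteq> bl b \<rho>" "e \<subseteq> bl y \<rho>" by blast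
   obtain v where "v \<in> e" using E_edge[OF e(1)] by blast
   then show "y \<in> (\<Union>v\<in>bl b \<rho>. bl v \<rho>)" using e bl_sym by blast
  qed
  moreover have "finite (\<Union>v\<in>bl b \<rho>. bl v \<rho>)" using bl_fin bV bl_V by blast
  ultimately have "card {y \<in> X i. ?I b \<inter> ?I y \<noteq> {}} <= card (\<Union>v\<in>bl b \<rho>. bl v \<rho>)" by (intro card_mono)
  also have "... <= (\<Sum>v\<in>bl b \<rho>. card (bl v \<rho>))" by (rule card_UN_le[OF bl_fin[OF bV]])
  also have "... <= (\<Sum>v\<in>bl b \<rho>. Bd \<rho>)" using bl_V Bd by (intro sum_mono) blast
  also have "... <= (Bd \<rho>)\<^sup>2" using Bd[OF bV, of \<rho>] by (simp add: power2_eq_square)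
  finally show "card {y \<in> X i. ?I b \<inter> ?I y \<noteq> {}} <= (Bd \<rho>)\<^sup>2" .
 qed
 also have "... <= 4 * real ((Bd \<rho>)\<^sup>2) / (\<kappa> * card A)" using mu kA by (intro divide_left_mono) auto
 finally have 1: "pp E pe (%xi. real (card {b \<in> X i. G b xi}) < \<mu> / 2) <= 4 * real ((Bd \<rho>)\<^sup>2) / (\<kappa> * card A)" .
 have "pp E pe (%xi. real (card {b \<in> X i. G b xi}) < \<kappa> * card A / 2) <= pp E pe (%xi. real (card {b \<in> X i. G b xi}) < \<mu> / 2)"
 proof (rule pp_mono)
  have *: "(real (card {b \<in> X i. G b xi}) < \<mu> / 2) \<longleftrightarrow> \<not> nat \<lceil>\<mu> / 2\<rceil> <= card {b \<in> X i. G b xi}" for xi using mu(1) by linarith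
  show "ms E (%xi. real (card {b \<in> X i. G b xi}) < \<mu> / 2)" unfolding * by (intro ms_not ms_card_ge fX msG)
 qed (use mu(2) in linarith)
 with 1 have "pp E pe (%xi. real (card {b \<in> X i. G b xi}) < \<kappa> * card A / 2) <= 4 * real ((Bd \<rho>)\<^sup>2) / (\<kappa> * card A)" by linarith
 moreover have "G b xi \<longleftrightarrow> (\<exists>a\<in>A. a \<in> Ns \<rho> r b & occ (Kf \<rho> a b) xi)" for b xi unfolding G_def by blast
 moreover have "X i \<subseteq> {x \<in> Ob. c + r + real i * g <= L x & L x < (c + r + real i * g) + g}" unfolding X_def by (auto simp: algebra_simps)
 moreover have "c + r <= c + r + real i * g" using g_pos by simp
 ultimately show ?thesis using fX[of i] by (intro exI[of _ "c + r + real i * g"] exI[of _ "X i"]) simp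
qed

end

section \<open>Iterated growth, and the tail of the number of vertices reached in a layer\<close>

context hg
begin

lemma glue:
 assumes S: "S \<in> pf E R a b'" and R: "!!y. y \<in> R ==> y \<in> V & (fl --> c0 <= L y) & L y <= L b'"
  and T: "T \<in> pf E {y \<in> V. c <= L y & L y <= L b} b' b" and c: "c0 <= c"
 shows "\<exists>U\<in>pf E {y \<in> V. (fl --> c0 <= L y) & L y <= L b} a b. U \<subseteq> S \<union> T"
proof -
 let ?R = "{y \<in> V. (fl --> c0 <= L y) & L y <= L b}"
 obtain p where "walk E {y \<in> V. c <= L y & L y <= L b} b' b p" using T unfolding pf_def pth_def by blast
 then have "L b' <= L b" using walk_ends by blast
 then have "R \<subseteq> ?R" using R by force
 then have "S \<in> pf E ?R a b'" by (rule subsetD[OF pf_mono S])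
 moreover have "T \<in> pf E ?R b' b" by (rule subsetD[OF pf_mono T]) (use c in auto)
 ultimately show ?thesis by (rule pf_trans)
qed

text \<open>Each step multiplies the number of reached vertices by at least \<kappa> / 2, except
  with probability inversely proportional to that number; the sum collects these failures. Further
  growth uses only edges above the new base level, so \<open>cond_step\<close> can condition on the
  set reached so far.\<close>

lemma LLN_psi:
 assumes pe: "inv_pe pe" and D: "0 < D0" "D0 <= Dr pe \<rho> r" and r: "0 <= r"
  and kap: "\<kappa> = exp (- s * r - \<bar>s\<bar>) * D0 / real (nat \<lceil>2 / g\<rceil>)"
 shows "0 < M ==> finite A ==> A \<subseteq> {x \<in> Ob. c <= L x & L x < c + 1} ==> M <= real (card A) ==>
  1 - (\<Sum>i<j. (4 * real ((Bd \<rho>)\<^sup>2) / \<kappa>) / ((\<kappa> / 2) ^ i * M)) <= pr E pe (Ev A c (real j * r))"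
proof (induction j arbitrary: c A M)
 case 0
 then obtain a where a: "a \<in> A" using card_gt_0_iff[of A] by (metis all_not_in_conv card.empty less_le_not_le of_nat_0)
 then have "{} \<in> pf E {y \<in> V. c <= L y & L y <= L a} a a" using 0(3) Ob_V by (intro pf_refl) auto
 then have "{} \<in> Ev A c 0" unfolding Ev_def using a 0(3) by auto
 then have "occ (Ev A c 0) xi" for xi unfolding occ_def by (intro bexI[of _ "{}"]) auto
 then have "pr E pe (Ev A c 0) = pp E pe (%xi. True)" by (intro pp_cong) simp
 then show ?case by simp
next
 case (Suc j)
 define q where "q = \<kappa> / 2"
 define C where "C = 4 * real ((Bd \<rho>)\<^sup>2) / \<kappa>"
 have gm: "0 < real (nat \<lceil>2 / g\<rceil>)" using g_pos by simp
 have kpos: "\<kappa> > 0" unfolding kap using D(1) gm by (intro divide_pos_pos mult_pos_pos) auto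
 have q0: "q > 0" and C0: "C \<ge> 0" unfolding q_def C_def using kpos by auto
 have Ane: "A \<noteq> {}" and cA: "real (card A) > 0" using Suc.prems by auto
 obtain c' X where X: "c + r <= c'" "finite X" "X \<subseteq> {x \<in> Ob. c' <= L x & L x < c' + g}"
  and LLN: "pp E pe (%xi. real (card {b \<in> X. \<exists>a\<in>A. a \<in> Ns \<rho> r b & occ (Kf \<rho> a b) xi}) < \<kappa> * card A / 2) <= 4 * real ((Bd \<rho>)\<^sup>2) / (\<kappa> * card A)"
  using LLN_step[OF pe D r Suc.prems(2,3) Ane kap] by blast
 define Rb where "Rb b xi \<longleftrightarrow> (\<exists>a\<in>A \<inter> Ns \<rho> r b. occ (Kf \<rho> a b) xi)" for b xi
 have Rb: "(\<exists>a\<in>A. a \<in> Ns \<rho> r b & occ (Kf \<rho> a b) xi) \<longleftrightarrow> Rb b xi" for b xi unfolding Rb_def by blast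
 define \<A> where "\<A> = {A'. A' \<subseteq> X & q * card A <= card A'}"
 define G where "G A' xi \<longleftrightarrow> (\<forall>b\<in>A'. Rb b xi)" for A' xi
 \<comment> \<open>Truncation at 0 keeps this a nonnegative lower bound, as \<open>cond_step\<close>
   demands, also when the failures sum to more than 1.\<close>
 define h where "h = max 0 (1 - (\<Sum>i<j. C / (q ^ i * (q * M))))"
 have cA': "countable \<A>" unfolding \<A>_def by (rule countable_finite, rule finite_subset[of _ "Pow X"]) (auto simp: X(2))
 have msR: "ms E (Rb b)" for b unfolding Rb_def[abs_def] using Suc.prems(2) by (intro ms_ex ms_Kf countable_finite) auto
 have depR: "Rb b xi = Rb b xi'" if b: "b \<in> X" and e: "!!e. e \<in> Elow c' ==> xi e = xi' e" for b xi xi'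
 proof -
  have "occ (Kf \<rho> a b) xi = occ (Kf \<rho> a b) xi'" for a
  proof (rule depD[of "Elow c'" "occ (Kf \<rho> a b)"])
   show "dep (Elow c') (occ (Kf \<rho> a b))" unfolding Kf_def by (rule dep_low) (use b X(3) in \<open>auto simp: Kr_def\<close>)
  qed (rule e)
  then show ?thesis unfolding Rb_def by simp
 qed
 have GG: "ms E (G A') & dep (Elow c') (G A')" if "A' \<in> \<A>" for A'
 proof
  have A': "A' \<subseteq> X" "finite A'" using that X(2) finite_subset unfolding \<A>_def by auto
  show "ms E (G A')" unfolding G_def[abs_def] by (intro ms_all msR countable_finite A')
  show "dep (Elow c') (G A')" unfolding dep_def G_def using depR A'(1) by (metis subsetD)
 qed
 have HH: "ms E (occ (Ev A' c' (real j * r))) & dep (Ehigh c') (occ (Ev A' c' (real j * r)))" for A'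
  using ms_occ[OF countable_E Ev_fam] dep_Ev by blast
 have hH: "h <= pr E pe (Ev A' c' (real j * r))" if "A' \<in> \<A>" for A'
 proof -
  have A': "A' \<subseteq> X" "q * card A <= card A'" using that unfolding \<A>_def by auto
  have "1 - (\<Sum>i<j. C / (q ^ i * (q * M))) <= pr E pe (Ev A' c' (real j * r))"
   unfolding C_def q_def
  proof (rule Suc.IH)
   show "0 < \<kappa> / 2 * M" using kpos Suc.prems(1) by simp
   show "finite A'" using A'(1) X(2) by (rule finite_subset)
   show "A' \<subseteq> {x \<in> Ob. c' <= L x & L x < c' + 1}" using A'(1) X(3) g_le by force
   have "q * M <= q * card A" using q0 Suc.prems(4) by (intro mult_left_mono) auto
   then show "\<kappa> / 2 * M <= real (card A')" using A'(2) unfolding q_def by linarith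
  qed
  then show ?thesis unfolding h_def by (simp add: pp_nonneg)
 qed
 have PG: "1 - C / M <= pp E pe (%xi. \<exists>A'\<in>\<A>. G A' xi)"
 proof -
  have msE: "ms E (%xi. \<exists>A'\<in>\<A>. G A' xi)" using GG by (intro ms_ex cA') blast
  have "pp E pe (%xi. \<not> (\<exists>A'\<in>\<A>. G A' xi)) <= pp E pe (%xi. real (card {b \<in> X. Rb b xi}) < \<kappa> * card A / 2)"
  proof (rule pp_mono)
   have pos: "\<kappa> * card A / 2 > 0" using kpos cA by simp
   have *: "(real (card {b \<in> X. Rb b xi}) < \<kappa> * card A / 2) \<longleftrightarrow> \<not> nat \<lceil>\<kappa> * card A / 2\<rceil> <= card {b \<in> X. Rb b xi}" for xi using pos by linarith
   show "ms E (%xi. real (card {b \<in> X. Rb b xi}) < \<kappa> * card A / 2)" unfolding * by (intro ms_not ms_card_ge X msR)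
   fix xi assume n: "\<not> (\<exists>A'\<in>\<A>. G A' xi)"
   show "real (card {b \<in> X. Rb b xi}) < \<kappa> * card A / 2"
   proof (rule ccontr)
    assume "\<not> ?thesis"
    then have "{b \<in> X. Rb b xi} \<in> \<A>" unfolding \<A>_def q_def by auto
    moreover have "G {b \<in> X. Rb b xi} xi" unfolding G_def by blast
    ultimately show False using n by blast
   qed
  qed
  also have "... <= 4 * real ((Bd \<rho>)\<^sup>2) / (\<kappa> * card A)" using LLN unfolding Rb .
  also have "... = C / card A" unfolding C_def by simp
  also have "... <= C / M" using C0 Suc.prems(1,4) by (intro divide_left_mono) auto
  finally show ?thesis unfolding pp_not[OF msE] by linarith
 qed
 have "h * pp E pe (%xi. \<exists>A'\<in>\<A>. G A' xi) <= pp E pe (%xi. \<exists>A'\<in>\<A>. G A' xi & occ (Ev A' c' (real j * r)) xi)"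
  by (rule cond_step[OF cA' GG HH Elow_high]) (auto simp: h_def[symmetric] hH, simp add: h_def)
 also have "... <= pr E pe (Ev A c (real (Suc j) * r))"
 proof (rule pp_mono[OF ms_occ[OF countable_E Ev_fam]])
  fix xi assume "\<exists>A'\<in>\<A>. G A' xi & occ (Ev A' c' (real j * r)) xi"
  then obtain A' T where A': "A' \<in> \<A>" "G A' xi" "T \<in> Ev A' c' (real j * r)" "\<forall>e\<in>T. xi e" unfolding occ_def by blast
  then obtain b' b where b: "b' \<in> A'" "b \<in> Ob" "c' + real j * r <= L b" "T \<in> pf E {y \<in> V. c' <= L y & L y <= L b} b' b" unfolding Ev_def by blast
  obtain a S where a: "a \<in> A" "S \<in> pf E (Kr \<rho> a b') a b'" "\<forall>e\<in>S. xi e"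
   using A'(2) b(1) unfolding G_def Rb_def Kf_def occ_def by blast
  have "\<exists>U\<in>pf E {y \<in> V. (True --> c <= L y) & L y <= L b} a b. U \<subseteq> S \<union> T"
  proof (rule glue[OF a(2) _ b(4)])
   fix y assume "y \<in> Kr \<rho> a b'"
   then show "y \<in> V & (True --> c <= L y) & L y <= L b'" unfolding Kr_def using a(1) Suc.prems(3) g_pos by auto
  qed (use X(1) r in linarith)
  then obtain U where U: "U \<in> pf E {y \<in> V. c <= L y & L y <= L b} a b" "U \<subseteq> S \<union> T" by auto
  have "c + real (Suc j) * r <= L b" using b(3) X(1) by (simp add: distrib_right)
  then have "U \<in> Ev A c (real (Suc j) * r)" unfolding Ev_def using a(1) b(2) U(1) by blast
  then show "occ (Ev A c (real (Suc j) * r)) xi" unfolding occ_def using U(2) a(3) A'(4) by (intro bexI[of _ U]) auto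
 qed
 finally have fin: "h * pp E pe (%xi. \<exists>A'\<in>\<A>. G A' xi) <= pr E pe (Ev A c (real (Suc j) * r))" .
 have h: "0 <= h" "h <= 1" "1 - (\<Sum>i<j. C / (q ^ i * (q * M))) <= h"
  unfolding h_def using C0 q0 Suc.prems(1) by (auto intro!: sum_nonneg)
 have CM: "0 <= C / M" using C0 Suc.prems(1) by simp
 have "h - C / M <= h * (1 - C / M)" using h CM mult_left_le_one_le[of "C / M" h] by (simp add: algebra_simps)
 also have "... <= h * pp E pe (%xi. \<exists>A'\<in>\<A>. G A' xi)" using PG h(1) by (rule mult_left_mono)
 finally have "1 - (\<Sum>i<j. C / (q ^ i * (q * M))) - C / M <= pr E pe (Ev A c (real (Suc j) * r))" using fin h(3) by linarith
 moreover have "(\<Sum>i<Suc j. C / (q ^ i * M)) = C / M + (\<Sum>i<j. C / (q ^ i * (q * M)))"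
  unfolding sum.lessThan_Suc_shift by (simp add: ac_simps)
 ultimately show ?case unfolding C_def q_def by linarith
qed

text \<open>Once \<open>k\<close> vertices of the layer are reached, the ascent goes on with
  conditional probability at least \<open>v\<close>, through edges above the layer's base that are
  still unexamined. So a heavy tail would make high ascents from \<open>ob\<close> likely.\<close>

lemma tail_le:
 assumes X: "finite X" "X \<subseteq> layer i" and v: "0 <= v" "!!A. A \<subseteq> X ==> card A = k ==> v <= pr E pe (Ev A (L ob + real i * g) h)"
 shows "v * tl fl pe X k <= TT fl pe (real i * g + h)"
proof -
 let ?c = "L ob + real i * g"
 define \<A> where "\<A> = {A. A \<subseteq> X & card A = k}"
 define G where "G A xi \<longleftrightarrow> (\<forall>x\<in>A. occ (pf E (Rg fl x) ob x) xi)" for A xi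
 have cA: "countable \<A>" unfolding \<A>_def by (rule countable_finite, rule finite_subset[of _ "Pow X"]) (auto simp: X(1))
 have Rlow: "dep (Elow ?c) (occ (pf E (Rg fl x) ob x))" if "x \<in> X" for x
  by (rule dep_low) (use that X(2) in \<open>auto simp: Rg_def layer_def algebra_simps\<close>)
 have GG: "ms E (G A) & dep (Elow ?c) (G A)" if "A \<in> \<A>" for A
 proof
  have A: "A \<subseteq> X" "finite A" using that X(1) finite_subset unfolding \<A>_def by auto
  show "ms E (G A)" unfolding G_def[abs_def] by (intro ms_all ms_pf countable_finite A)
  show "dep (Elow ?c) (G A)" unfolding dep_def G_def using depD[OF Rlow] A(1) by (metis subsetD)
 qed
 have HH: "ms E (occ (Ev A ?c h)) & dep (Ehigh ?c) (occ (Ev A ?c h))" for A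
  using ms_occ[OF countable_E Ev_fam] dep_Ev by blast
 have msE: "ms E (%xi. \<exists>A\<in>\<A>. G A xi)" using GG by (intro ms_ex cA) blast
 have "tl fl pe X k <= pp E pe (%xi. \<exists>A\<in>\<A>. G A xi)"
  unfolding tl_def
 proof (rule pp_mono[OF msE])
  fix xi assume "k <= card {x \<in> X. occ (pf E (Rg fl x) ob x) xi}"
  then obtain A where A: "A \<subseteq> {x \<in> X. occ (pf E (Rg fl x) ob x) xi}" "card A = k" by (rule obtain_subset_with_card_n)
  have "A \<in> \<A>" unfolding \<A>_def using A by blast
  moreover have "G A xi" unfolding G_def using A(1) by blast
  ultimately show "\<exists>A\<in>\<A>. G A xi" by (rule bexI[rotated])
 qed
 then have "v * tl fl pe X k <= v * pp E pe (%xi. \<exists>A\<in>\<A>. G A xi)" using v(1) by (rule mult_left_mono)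
 also have "... <= pp E pe (%xi. \<exists>A\<in>\<A>. G A xi & occ (Ev A ?c h) xi)"
  by (rule cond_step[OF cA GG HH Elow_high v(1)]) (use v(2) in \<open>auto simp: \<A>_def\<close>)
 also have "... <= TT fl pe (real i * g + h)"
  unfolding TT_def
 proof (rule pp_mono[OF ms_occ[OF countable_E Tfam_fam]])
  fix xi assume "\<exists>A\<in>\<A>. G A xi & occ (Ev A ?c h) xi"
  then obtain A T where A: "A \<in> \<A>" "G A xi" "T \<in> Ev A ?c h" "\<forall>e\<in>T. xi e" unfolding occ_def by blast
  then obtain x b where b: "x \<in> A" "b \<in> Ob" "?c + h <= L b" "T \<in> pf E {y \<in> V. ?c <= L y & L y <= L b} x b" unfolding Ev_def by blast
  obtain S where S: "S \<in> pf E (Rg fl x) ob x" "\<forall>e\<in>S. xi e" using A(2) b(1) unfolding G_def occ_def by blast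
  have "\<exists>U\<in>pf E {y \<in> V. (fl --> L ob <= L y) & L y <= L b} ob b. U \<subseteq> S \<union> T"
  proof (rule glue[OF S(1) _ b(4)])
   fix y assume "y \<in> Rg fl x"
   then show "y \<in> V & (fl --> L ob <= L y) & L y <= L x" unfolding Rg_def using g_pos by auto
  qed (use g_pos in simp)
  then obtain U where U: "U \<in> pf E {y \<in> V. (fl --> L ob <= L y) & L y <= L b} ob b" "U \<subseteq> S \<union> T" by blast
  have "U \<in> Tfam fl ob (real i * g + h)" unfolding Tfam_def using b(2,3) U(1) by auto
  then show "occ (Tfam fl ob (real i * g + h)) xi" unfolding occ_def using U(2) S(2) A(4) by (intro bexI[of _ U]) auto
 qed
 finally show ?thesis .
qed

lemma Dr_mono:
 assumes "!!e. e \<in> E ==> 0 <= pe e & pe e <= pe' e & pe' e <= 1" shows "Dr pe \<rho> r <= Dr pe' \<rho> r"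
proof -
 have e: "(\<exists>a\<in>Ns \<rho> r ob. occ (Kf \<rho> a ob) xi) \<longleftrightarrow> occ (\<Union>a\<in>Ns \<rho> r ob. Kf \<rho> a ob) xi" for xi unfolding occ_def by blast
 have "(\<Union>a\<in>Ns \<rho> r ob. Kf \<rho> a ob) \<subseteq> fam E" unfolding Kf_def by (rule UN_least) (rule pth_fam)
 then show ?thesis unfolding Dr_def e by (rule pr_mono_pe[OF countable_E _ assms])
qed

text \<open>From k vertices the growth can be continued for about ln k / ln (1 / Q) steps with
  probability at least 1/2, as long as about \<open>M1\<close> vertices are left. The ascent so
  obtained has probability at most of order exp (- f' j r), and the hypothesis on
  \<open>f' * r\<close> turns this into the power of k.\<close>

lemma tail:
 assumes pe0: "inv_pe pe0" and D: "0 < D0" "D0 <= Dr pe0 \<rho> r" and r: "0 <= r"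
  and kap: "\<kappa> = exp (- s * r - \<bar>s\<bar>) * D0 / real (nat \<lceil>2 / g\<rceil>)" and q: "\<kappa> / 2 < 1"
  and f': "0 <= f'" "(1 - \<epsilon>) * ln (1 / (\<kappa> / 2)) <= f' * r" and e: "0 <= \<epsilon>" "\<epsilon> < 1"
 shows "\<exists>Ct\<ge>1. \<forall>pe. inv_pe pe --> (\<forall>e\<in>E. pe0 e <= pe e) -->
  (\<forall>fl K i X k. 1 <= K --> (\<forall>n\<ge>0. TT fl pe n <= K * exp (- f' * n)) --> finite X --> X \<subseteq> layer i --> 1 <= k -->
   tl fl pe X k <= Ct * K * exp (- f' * g * real i) * real k powr (- (1 - \<epsilon>)))"
proof -
 define Q where "Q = \<kappa> / 2"
 define C where "C = 4 * real ((Bd \<rho>)\<^sup>2) / \<kappa>"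
 define l where "l = ln (1 / Q)"
 \<comment> \<open>If the final size is at least this, the failures form a geometric series with
   ratio Q whose sum is at most 1/2.\<close>
 define M1 where "M1 = max 1 (2 * C / (1 - Q))"
 have gm: "0 < real (nat \<lceil>2 / g\<rceil>)" using g_pos by simp
 have kpos: "\<kappa> > 0" unfolding kap using D(1) gm by (intro divide_pos_pos mult_pos_pos) auto
 have Q: "0 < Q" "Q < 1" unfolding Q_def using kpos q by auto
 have C0: "C \<ge> 0" unfolding C_def using kpos by auto
 have l: "l > 0" unfolding l_def using Q by simp
 have M1: "1 <= M1" "2 * C / (1 - Q) <= M1" unfolding M1_def by auto
 have CM: "2 * C <= M1 * (1 - Q)" using M1(2) Q by (simp add: pos_divide_le_eq)
 have geo: "(\<Sum>i<j. Q ^ j / Q ^ i) <= Q / (1 - Q)" for j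
 proof (induction j)
  case (Suc j)
  have "(\<Sum>i<Suc j. Q ^ Suc j / Q ^ i) = Q * ((\<Sum>i<j. Q ^ j / Q ^ i) + 1)"
   using Q by (simp add: sum_distrib_left distrib_left)
  also have "... <= Q * (Q / (1 - Q) + 1)" using Suc Q by (intro mult_left_mono) auto
  also have "... = Q / (1 - Q)" using Q by (simp add: field_simps)
  finally show ?case .
 qed (use Q in simp)
 define Ct where "Ct = 2 * exp (f' * r) * M1"
 have er: "1 <= exp (f' * r)" using f'(1) r by simp
 have "1 * M1 <= 2 * exp (f' * r) * M1" by (rule mult_right_mono) (use er M1(1) in linarith)+
 then have Ct: "1 <= Ct" "M1 <= Ct" unfolding Ct_def using M1(1) by linarith+
 show ?thesis
 proof (rule exI[of _ Ct], intro conjI Ct(1) allI impI)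
  fix pe fl K i X and k :: nat
  assume pe: "inv_pe pe" and p0: "\<forall>e\<in>E. pe0 e <= pe e" and K: "1 <= K" and T: "\<forall>n\<ge>0. TT fl pe n <= K * exp (- f' * n)"
   and X: "finite X" "X \<subseteq> layer i" and k: "1 <= k"
  have D': "D0 <= Dr pe \<rho> r" using D(2) Dr_mono[of pe0 pe \<rho> r] p0 inv_pe01[OF pe0] inv_pe01[OF pe] by (meson order_trans)
  let ?c = "L ob + real i * g"
  have XA: "A \<subseteq> {x \<in> Ob. ?c <= L x & L x < ?c + 1}" if "A \<subseteq> X" for A
   using that X(2) g_le unfolding layer_def by (force simp: algebra_simps)
  note psi = LLN_psi[OF pe D(1) D' r kap]
  have kp: "0 < real k" using k by simp
  show "tl fl pe X k <= Ct * K * exp (- f' * g * real i) * real k powr (- (1 - \<epsilon>))"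
  proof (cases "real k < M1")
   case True
   have "1 * tl fl pe X k <= TT fl pe (real i * g + 0)"
   proof (rule tail_le[OF X])
    fix A assume A: "A \<subseteq> X" "card A = k"
    have "1 - (\<Sum>i<0. (4 * real ((Bd \<rho>)\<^sup>2) / \<kappa>) / ((\<kappa> / 2) ^ i * real k)) <= pr E pe (Ev A ?c (real 0 * r))"
     by (rule psi[OF kp _ XA[OF A(1)]]) (use A X(1) finite_subset in auto)
    then show "1 <= pr E pe (Ev A ?c 0)" by simp
   qed simp
   also have "... <= K * exp (- f' * (real i * g + 0))" using T g_pos by (meson add_nonneg_nonneg less_imp_le mult_nonneg_nonneg of_nat_0_le_iff order_refl)
   finally have 1: "tl fl pe X k <= K * exp (- f' * g * real i)" by (simp add: ac_simps)
   have "real k powr (1 - \<epsilon>) <= M1 powr (1 - \<epsilon>)" using True e kp by (intro powr_mono2) auto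
   also have "... <= M1 powr 1" using M1(1) e by (intro powr_mono) auto
   finally have "real k powr (1 - \<epsilon>) <= Ct" using M1(1) Ct(2) by simp
   then have "real k powr (1 - \<epsilon>) * real k powr (- (1 - \<epsilon>)) <= Ct * real k powr (- (1 - \<epsilon>))" by (rule mult_right_mono) simp
   then have 2: "1 <= Ct * real k powr (- (1 - \<epsilon>))" unfolding powr_add[symmetric] using kp by simp
   have "K * exp (- f' * g * real i) * 1 <= K * exp (- f' * g * real i) * (Ct * real k powr (- (1 - \<epsilon>)))"
    using 2 K by (intro mult_left_mono) auto
   then show ?thesis using 1 by (simp add: ac_simps)
  next
   case False
   define x where "x = ln (real k / M1) / l"
   have kM: "1 <= real k / M1" using False M1(1) by simp
   have x0: "x \<ge> 0" unfolding x_def using l kM by simp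
   define j where "j = nat \<lfloor>x\<rfloor>"
   have j: "real j <= x" "x < real j + 1" unfolding j_def using x0 by linarith+
   have lx: "l * x = ln (real k / M1)" unfolding x_def using l by simp
   have Qj: "Q ^ j = exp (- (l * real j))"
   proof -
    have "Q = exp (- l)" unfolding l_def using Q by (simp add: ln_div)
    then show ?thesis by (simp add: exp_of_nat_mult[symmetric] mult.commute)
   qed
   define M where "M = M1 / Q ^ j"
   have M0: "0 < M" unfolding M_def using M1(1) Q by simp
   have Mle: "M <= real k"
   proof -
    have "1 / Q ^ j = exp (l * real j)" unfolding Qj by (simp add: exp_minus field_simps)
    also have "... <= exp (l * x)" using j(1) l by simp
    also have "... = real k / M1" unfolding lx using kM by simp
    finally have "M1 * (1 / Q ^ j) <= M1 * (real k / M1)" using M1(1) by (intro mult_left_mono) auto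
    then show ?thesis unfolding M_def using M1(1) by simp
   qed
   have half: "(\<Sum>i<j. C / (Q ^ i * M)) <= 1 / 2"
   proof -
    have "(\<Sum>i<j. C / (Q ^ i * M)) = C / M1 * (\<Sum>i<j. Q ^ j / Q ^ i)"
     unfolding M_def sum_distrib_left using Q M1(1) by (intro sum.cong refl) (simp add: field_simps)
    also have "... <= C / M1 * (Q / (1 - Q))" using geo C0 M1(1) by (intro mult_left_mono) auto
    also have "... <= C / M1 * (1 / (1 - Q))" using Q C0 M1(1) by (intro mult_left_mono divide_right_mono) auto
    also have "... <= 1 / 2" using CM Q M1(1) by (simp add: field_simps)
    finally show ?thesis .
   qed
   have "1 / 2 * tl fl pe X k <= TT fl pe (real i * g + real j * r)"
   proof (rule tail_le[OF X])
    fix A assume A: "A \<subseteq> X" "card A = k"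
    have "1 - (\<Sum>i<j. (4 * real ((Bd \<rho>)\<^sup>2) / \<kappa>) / ((\<kappa> / 2) ^ i * M)) <= pr E pe (Ev A ?c (real j * r))"
     by (rule psi[OF M0 _ XA[OF A(1)]]) (use A X(1) finite_subset Mle in auto)
    then show "1 / 2 <= pr E pe (Ev A ?c (real j * r))" using half unfolding C_def Q_def by linarith
   qed simp
   also have "... <= K * exp (- f' * (real i * g + real j * r))"
   proof -
    have "0 <= real i * g + real j * r" using g_pos r by simp
    then show ?thesis using T by blast
   qed
   also have "... = K * exp (- f' * g * real i) * exp (- (f' * (real j * r)))"
    by (simp add: exp_add[symmetric] algebra_simps)
   also have "... <= K * exp (- f' * g * real i) * (exp (f' * r) * (M1 * real k powr (- (1 - \<epsilon>))))"
   proof (rule mult_left_mono)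
    have "f' * r * x <= f' * r * (real j + 1)" using j(2) f'(1) r by (intro mult_left_mono) auto
    moreover have "(1 - \<epsilon>) * l * x <= f' * r * x" using f'(2) x0 unfolding l_def Q_def by (intro mult_right_mono) auto
    ultimately have "- (f' * (real j * r)) <= f' * r + (- (1 - \<epsilon>)) * ln (real k / M1)" unfolding lx[symmetric] by (simp add: algebra_simps)
    then have "exp (- (f' * (real j * r))) <= exp (f' * r) * exp ((- (1 - \<epsilon>)) * ln (real k / M1))" unfolding exp_add[symmetric] by simp
    also have "exp ((- (1 - \<epsilon>)) * ln (real k / M1)) = (real k / M1) powr (- (1 - \<epsilon>))" unfolding powr_def using kM kp M1(1) by auto
    also have "... = real k powr (- (1 - \<epsilon>)) * M1 powr (1 - \<epsilon>)" 
    proof -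
     have i: "inverse (M1 powr (- (1 - \<epsilon>))) = M1 powr (1 - \<epsilon>)" unfolding powr_minus[symmetric] by simp
     have d: "(real k / M1) powr (- (1 - \<epsilon>)) = real k powr (- (1 - \<epsilon>)) / M1 powr (- (1 - \<epsilon>))"
      by (rule powr_divide)
     show ?thesis unfolding d unfolding divide_inverse i ..
    qed
    finally have 1: "exp (- (f' * (real j * r))) <= exp (f' * r) * (real k powr (- (1 - \<epsilon>)) * M1 powr (1 - \<epsilon>))" .
    have "M1 powr (1 - \<epsilon>) <= M1" using powr_mono[of "1 - \<epsilon>" 1 M1] M1(1) e by simp
    then have "real k powr (- (1 - \<epsilon>)) * M1 powr (1 - \<epsilon>) <= M1 * real k powr (- (1 - \<epsilon>))"
     unfolding mult.commute[of M1] by (rule mult_left_mono) simp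
    then have "exp (f' * r) * (real k powr (- (1 - \<epsilon>)) * M1 powr (1 - \<epsilon>)) <= exp (f' * r) * (M1 * real k powr (- (1 - \<epsilon>)))"
     by (rule mult_left_mono) simp
    with 1 show "exp (- (f' * (real j * r))) <= exp (f' * r) * (M1 * real k powr (- (1 - \<epsilon>)))" by linarith
   qed (use K in auto)
   finally show ?thesis unfolding Ct_def by (simp add: algebra_simps)
  qed
 qed
qed

end

section \<open>Exponential rates, and percolation by growth\<close>

lemma rate_exists:
 fixes R :: "nat \<Rightarrow> real"
 assumes R: "!!n. 0 <= R n" "!!n. R n <= 1" and lo: "0 < c" "!!n. c * exp (- (k * real n)) <= R n"
 shows "\<exists>f\<ge>0. (\<forall>f'<f. \<exists>K>0. \<forall>n. R n <= K * exp (- f' * real n)) & (\<forall>f'>f. \<forall>K. \<exists>n. R n > K * exp (- f' * real n))"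
proof -
 \<comment> \<open>The rate is the supremum of the exponents of exponential upper bounds; the
   assumed lower bound keeps it finite.\<close>
 define F where "F = {f. 0 <= f & (\<exists>K>0. \<forall>n. R n <= K * exp (- f * real n))}"
 have F0: "0 \<in> F" unfolding F_def using R(2) by (auto intro!: exI[of _ 1])
 have bd: "f <= k" if fF: "f \<in> F" for f
 proof (rule ccontr)
  assume n: "\<not> f <= k"
  obtain K where K: "K > 0" "!!n. R n <= K * exp (- f * real n)" using fF unfolding F_def by blast
  have le: "c * exp ((f - k) * real n) <= K" for n
  proof -
   have "c * exp (- (k * real n)) <= K * exp (- f * real n)" using order_trans[OF lo(2) K(2)] .
   then have "c * exp (- (k * real n)) * exp (f * real n) <= K * exp (- f * real n) * exp (f * real n)" by (rule mult_right_mono) simp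
   then show ?thesis by (simp add: mult.assoc exp_add[symmetric] algebra_simps)
  qed
  obtain n :: nat where "K / (c * (f - k)) < real n" using reals_Archimedean2 by blast
  then have "K < c * ((f - k) * real n)" using lo(1) n by (simp add: pos_divide_less_eq ac_simps)
  also have "... <= c * exp ((f - k) * real n)" using lo(1) by (intro mult_left_mono order_trans[OF _ exp_ge_add_one_self]) auto
  also have "... <= K" by (rule le)
  finally show False by simp
 qed
 have bF: "bdd_above F" using bd by (intro bdd_aboveI[of _ k]) auto
 define f where "f = Sup F"
 have f0: "0 <= f" unfolding f_def using F0 bF by (rule cSup_upper)
 show ?thesis
 proof (rule exI[of _ f], intro conjI f0 allI impI)
  fix f' assume "f' < f"
  then obtain x where x: "x \<in> F" "f' < x" unfolding f_def using less_cSup_iff[of F f'] F0 bF by blast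
  then obtain K where K: "K > 0" "!!n. R n <= K * exp (- x * real n)" unfolding F_def by blast
  have "R n <= K * exp (- f' * real n)" for n
  proof -
   have "K * exp (- x * real n) <= K * exp (- f' * real n)" using K(1) x(2) by (simp add: mult_right_mono)
   then show ?thesis using K(2)[of n] by linarith
  qed
  then show "\<exists>K>0. \<forall>n. R n <= K * exp (- f' * real n)" using K(1) by blast
 next
  fix f' K assume f': "f < f'"
  show "\<exists>n. R n > K * exp (- f' * real n)"
  proof (rule ccontr)
   assume "\<not> ?thesis"
   then have n: "R n <= K * exp (- f' * real n)" for n by (simp add: not_less)
   have "R n <= max K 1 * exp (- f' * real n)" for n
    by (rule order_trans[OF n[of n]], rule mult_right_mono) auto
   then have "f' \<in> F" unfolding F_def using f0 f' by (auto intro!: exI[of _ "max K 1"])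
   then have "f' <= f" unfolding f_def using bF by (rule cSup_upper)
   then show False using f' by simp
  qed
 qed
qed

context gr
begin

definition infc :: "'v \<Rightarrow> ('v set \<Rightarrow> bool) \<Rightarrow> bool" where
 "infc a xi \<longleftrightarrow> infinite {w \<in> V. occ (pf E V a w) xi}"

text \<open>Balls are finite and exhaust \<open>V\<close>. The right-hand side is a countable
  combination of connection events, from which measurability follows.\<close>

lemma infc_iff: assumes a: "a \<in> V" shows "infc a xi \<longleftrightarrow> (\<forall>n\<in>(UNIV :: nat set). \<exists>w\<in>V - bl a n. occ (pf E V a w) xi)"
proof
 assume i: "infc a xi"
 show "\<forall>n\<in>(UNIV :: nat set). \<exists>w\<in>V - bl a n. occ (pf E V a w) xi"
 proof (rule ballI, rule ccontr)
  fix n assume "\<not> (\<exists>w\<in>V - bl a n. occ (pf E V a w) xi)"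
  then have "{w \<in> V. occ (pf E V a w) xi} \<subseteq> bl a n" by blast
  then show False using i bl_fin[OF a] finite_subset unfolding infc_def by blast
 qed
next
 assume *: "\<forall>n\<in>(UNIV :: nat set). \<exists>w\<in>V - bl a n. occ (pf E V a w) xi"
 show "infc a xi" unfolding infc_def
 proof
  let ?F = "{w \<in> V. occ (pf E V a w) xi}"
  assume F: "finite ?F"
  have "\<forall>w\<in>?F. \<exists>n. w \<in> bl a n"
  proof
   fix w assume "w \<in> ?F"
   then obtain p where "walk E V a w p" using E_conn[OF a] by blast
   then have "w \<in> bl a (length p)" unfolding bl_def by auto
   then show "\<exists>n. w \<in> bl a n" by blast
  qed
  then obtain N where N: "!!w. w \<in> ?F ==> w \<in> bl a (N w)" by metis
  obtain w where w: "w \<in> V" "w \<notin> bl a (\<Sum>x\<in>?F. N x)" "occ (pf E V a w) xi" using * by blast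
  then have wF: "w \<in> ?F" by simp
  have "N w <= (\<Sum>x\<in>?F. N x)" by (rule member_le_sum[OF wF _ F]) simp
  then have "bl a (N w) \<subseteq> bl a (\<Sum>x\<in>?F. N x)" unfolding bl_def by auto
  then show False using N[OF wF] w(2) by blast
 qed
qed

lemma ms_infc: assumes "a \<in> V" shows "ms E (infc a)"
proof -
 have "infc a = (%xi. \<forall>n\<in>(UNIV :: nat set). \<exists>w\<in>V - bl a n. occ (pf E V a w) xi)" by (rule ext) (rule infc_iff[OF assms])
 moreover have "ms E (%xi. \<forall>n\<in>(UNIV :: nat set). \<exists>w\<in>V - bl a n. occ (pf E V a w) xi)"
 proof (rule ms_all)
  fix n :: nat
  show "ms E (%xi. \<exists>w\<in>V - bl a n. occ (pf E V a w) xi)"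
   by (rule ms_ex[OF countable_Diff[OF countable_V]]) (rule ms_occ[OF countable_E pth_fam])
 qed simp
 ultimately show ?thesis by (simp only:)
qed

end

context hg
begin

text \<open>When every step multiplies by more than 1, the failures in \<open>LLN_psi\<close> sum to
  at most 1/2 for a large initial set, whatever the number of steps. Ascents of all heights from a
  finite set are impossible if all its clusters are finite.\<close>

lemma growth:
 assumes pe: "inv_pe pe" and D: "0 < D0" "D0 <= Dr pe \<rho> r" and r: "0 < r"
  and kap: "\<kappa> = exp (- s * r - \<bar>s\<bar>) * D0 / real (nat \<lceil>2 / g\<rceil>)" and q: "1 < \<kappa> / 2"
 shows "\<exists>N::nat. \<forall>A c. finite A --> A \<subseteq> {x \<in> Ob. c <= L x & L x < c + 1} --> N <= card A --> 1 / 2 <= pp E pe (%xi. \<exists>a\<in>A. infc a xi)"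
proof -
 define Q where "Q = \<kappa> / 2"
 define C where "C = 4 * real ((Bd \<rho>)\<^sup>2) / \<kappa>"
 have Q: "1 < Q" unfolding Q_def using q .
 have C: "0 <= C" unfolding C_def using q by auto
 define N where "N = nat \<lceil>2 * C * (Q / (Q - 1))\<rceil> + 1"
 show ?thesis
 proof (intro exI[of _ N] allI impI)
  fix A c assume A: "finite A" "A \<subseteq> {x \<in> Ob. c <= L x & L x < c + 1}" "N <= card A"
  have cA: "2 * C * (Q / (Q - 1)) <= real (card A)" "0 < real (card A)" using A(3) unfolding N_def by linarith+
  have AV: "a \<in> V" if "a \<in> A" for a using A(2) that Ob_V by blast
  have half: "1 / 2 <= pr E pe (Ev A c (real j * r))" for j
  proof -
   have "(\<Sum>i<j. C / (Q ^ i * real (card A))) = C / real (card A) * (\<Sum>i<j. (1 / Q) ^ i)"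
    unfolding sum_distrib_left by (intro sum.cong refl) (simp add: power_divide)
   also have "... <= C / real (card A) * (Q / (Q - 1))"
   proof (rule mult_left_mono)
    have "(\<Sum>i<j. (1 / Q) ^ i) = ((1 / Q) ^ j - 1) / (1 / Q - 1)" using Q by (intro geometric_sum) auto
    also have "... = (1 - (1 / Q) ^ j) * (Q / (Q - 1))" using Q by (simp add: field_simps)
    also have "... <= 1 * (Q / (Q - 1))" using Q by (intro mult_right_mono) auto
    finally show "(\<Sum>i<j. (1 / Q) ^ i) <= Q / (Q - 1)" by simp
   qed (use C in simp)
   also have "... <= 1 / 2"
   proof -
    have "C * (Q / (Q - 1)) <= 1 / 2 * real (card A)" using cA(1) by (simp only: mult.assoc)
    then have "C * (Q / (Q - 1)) / real (card A) <= 1 / 2" using cA(2) by (simp only: pos_divide_le_eq)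
    then show ?thesis by (simp only: times_divide_eq_left)
   qed
   finally have "(\<Sum>i<j. C / (Q ^ i * real (card A))) <= 1 / 2" .
   moreover have "1 - (\<Sum>i<j. C / (Q ^ i * real (card A))) <= pr E pe (Ev A c (real j * r))"
    unfolding C_def Q_def using LLN_psi[OF pe D less_imp_le[OF r] kap cA(2) A(1,2) order_refl] .
   ultimately show ?thesis by linarith
  qed
  interpret prob_space "PM E pe" by simp
  define F where "F j = {xi \<in> space (PM E pe). occ (Ev A c (real j * r)) xi}" for j
  have FS: "F j \<in> events" for j unfolding F_def by (rule msD[OF ms_occ[OF countable_E Ev_fam]])
  have dec: "decseq F"
  proof (rule decseq_SucI)
   fix j
   have "Ev A c (real (Suc j) * r) \<subseteq> Ev A c (real j * r)" unfolding Ev_def using r by (fastforce simp: distrib_right)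
   then show "F (Suc j) \<subseteq> F j" unfolding F_def using occ_sub by blast
  qed
  have "(%j. prob (F j)) \<longlonglongrightarrow> prob (\<Inter>j. F j)" using FS dec by (intro finite_Lim_measure_decseq) auto
  moreover have "1 / 2 <= prob (F j)" for j using half[of j] unfolding pp_def F_def .
  ultimately have "1 / 2 <= prob (\<Inter>j. F j)" using LIMSEQ_le_const by blast
  also have "... <= pp E pe (%xi. \<exists>a\<in>A. infc a xi)"
   unfolding pp_def
  proof (rule finite_measure_mono)
   have "ms E (%xi. \<exists>a\<in>A. infc a xi)" by (intro ms_ex countable_finite A(1) ms_infc AV)
   then show "{xi \<in> space (PM E pe). \<exists>a\<in>A. infc a xi} \<in> events" by (rule msD)
   show "(\<Inter>j. F j) \<subseteq> {xi \<in> space (PM E pe). \<exists>a\<in>A. infc a xi}"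
   proof
    fix xi assume w: "xi \<in> (\<Inter>j. F j)"
    then have sp: "xi \<in> space (PM E pe)" and oc: "!!j. occ (Ev A c (real j * r)) xi" unfolding F_def by auto
    have "\<exists>a\<in>A. infc a xi"
    proof (rule ccontr)
     let ?U = "\<Union>a\<in>A. {w \<in> V. occ (pf E V a w) xi}"
     assume "\<not> ?thesis"
     then have fU: "finite ?U" using A(1) unfolding infc_def by auto
     have "\<exists>B. \<forall>w\<in>?U. L w <= B" using finite_imageI[OF fU, of L] by (meson finite_has_maximal imageI Max_ge)
     then obtain B where B: "!!w. w \<in> ?U ==> L w <= B" by blast
     obtain j :: nat where "(B - c) / r < real j" using reals_Archimedean2 by blast
     then have j: "B < c + real j * r" using r by (simp add: pos_divide_less_eq)
     obtain S where S: "S \<in> Ev A c (real j * r)" "\<forall>e\<in>S. xi e" using oc[of j] unfolding occ_def by blast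
     then obtain a b where ab: "a \<in> A" "b \<in> Ob" "c + real j * r <= L b" "S \<in> pf E {y \<in> V. c <= L y & L y <= L b} a b" unfolding Ev_def by blast
     have "S \<in> pf E V a b" by (rule subsetD[OF pf_mono ab(4)]) auto
     then have "occ (pf E V a b) xi" using S(2) unfolding occ_def by blast
     then have "b \<in> ?U" using ab(1) Ob_V[OF ab(2)] by blast
     then show False using B[of b] ab(3) j by simp
    qed
    then show "xi \<in> {xi \<in> space (PM E pe). \<exists>a\<in>A. infc a xi}" using sp by simp
   qed
  qed
  finally show "1 / 2 <= pp E pe (%xi. \<exists>a\<in>A. infc a xi)" .
 qed
qed

lemma far_Ob: "\<exists>x\<in>Ob. L x = L ob + real k" "\<exists>x\<in>Ob. L x = L ob - real k"
proof -
 show "\<exists>x\<in>Ob. L x = L ob + real k" using up_iter ob_Ob by blast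
 obtain x where "x \<in> Ob" "- L x = - L ob + real k" using hg.up_iter[OF neg] ob_Ob by blast
 then show "\<exists>x\<in>Ob. L x = L ob - real k" by (intro bexI[of _ x]) auto
qed

text \<open>The orbit of \<open>ob\<close> under the stabilizer of a vertex \<open>x\<close>, far up
  or far down according to the sign of \<open>s\<close>, has at least \<open>rho x ob\<close>
  elements, and they all have the height of \<open>ob\<close>.\<close>

lemma big_A: assumes "s \<noteq> 0" shows "\<exists>c A. finite A & A \<subseteq> {x \<in> Ob. c <= L x & L x < c + 1} & N <= card A"
proof -
 obtain k :: nat where k: "real N / \<bar>s\<bar> < real k" using reals_Archimedean2 by blast
 then have "real N <= \<bar>s\<bar> * real k" using assms by (simp add: pos_divide_less_eq mult.commute)
 also have "... <= exp (\<bar>s\<bar> * real k)" using exp_ge_add_one_self[of "\<bar>s\<bar> * real k"] by linarith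
 finally have N: "real N <= exp (\<bar>s\<bar> * real k)" .
 have "\<exists>x\<in>Ob. s * (L x - L ob) = \<bar>s\<bar> * real k"
 proof (cases "s > 0")
  case True
  obtain x where "x \<in> Ob" "L x = L ob + real k" using far_Ob(1) by blast
  then show ?thesis using True by (intro bexI[of _ x]) auto
 next
  case False
  obtain x where "x \<in> Ob" "L x = L ob - real k" using far_Ob(2) by blast
  then show ?thesis using False by (intro bexI[of _ x]) auto
 qed
 then obtain x where x: "x \<in> Ob" "s * (L x - L ob) = \<bar>s\<bar> * real k" by blast
 have xV: "x \<in> V" by (rule Ob_V[OF x(1)])
 have "real N <= real (sc x ob) / real (sc ob x)" using N rho_L[OF x(1)] x(2) unfolding rho_def by simp
 also have "... <= real (sc x ob) / 1" using sc_pos[OF ob_V xV] by (intro divide_left_mono) auto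
 finally have "N <= card (sorb x ob)" unfolding sc_def by simp
 moreover have "sorb x ob \<subseteq> {y \<in> Ob. L ob <= L y & L y < L ob + 1}"
 proof
  fix y assume "y \<in> sorb x ob"
  then obtain ga where g: "ga \<in> \<Gamma>" "ga x = x" "y = ga ob" unfolding sorb_def by blast
  have "L y = L ob" using L_inv[OF g(1) ob_V xV] g by simp
  then show "y \<in> {y \<in> Ob. L ob <= L y & L y < L ob + 1}" using Ob_g[OF g(1) ob_Ob] g(3) by simp
 qed
 ultimately show ?thesis using fin_sorb[OF xV ob_V] by blast
qed

text \<open>Ascents by about n, and in \<open>Rmf\<close> descents by about n, that stay between the
  heights of their ends. Their decay rates are \<alpha> and \<kappa>. The start of
  \<open>Rmf\<close> is variable because \<open>Dr_lower\<close> moves it one level down.\<close>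

definition Rwf :: "nat \<Rightarrow> 'v set set set" where
 "Rwf n = (\<Union>b\<in>{b \<in> Ob. real n <= L b - L ob & L b - L ob < real n + 1}. pf E {y \<in> V. L ob <= L y & L y <= L b} ob b)"

definition Rmf :: "'v \<Rightarrow> nat \<Rightarrow> 'v set set set" where
 "Rmf u n = (\<Union>a\<in>{a \<in> Ob. real n <= L u - L a & L u - L a < real n + 1}. pf E {y \<in> V. L a <= L y & L y <= L u} u a)"

lemma Rwf_fam: "Rwf n \<subseteq> fam E" unfolding Rwf_def by (rule UN_least) (rule pth_fam)
lemma Rmf_fam: "Rmf u n \<subseteq> fam E" unfolding Rmf_def by (rule UN_least) (rule pth_fam)

lemma Rw_lower:
 assumes c: "0 < c" "c <= 1"
 shows "\<exists>k. \<forall>pe. inv_pe pe --> (\<forall>e\<in>E. c <= pe e) --> (\<forall>n. c * exp (- (k * real n)) <= pr E pe (Rwf n))"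
proof -
 obtain l where l: "!!k a. a \<in> Ob ==> \<exists>b p. b \<in> Ob & L b = L a + real k & walk E V a b p & length p <= k * l + 1 &
 (\<forall>x\<in>set p. L a <= L x & (x = b \<or> L x <= L b - g))" using up_iter by blast
 show ?thesis
 proof (intro exI[of _ "ln (1 / c) * real l"] allI impI)
  fix pe n assume pe: "inv_pe pe" and pc: "\<forall>e\<in>E. c <= pe e"
  have pc': "c <= pe e & pe e <= 1" if "e \<in> E" for e using pc inv_pe01[OF pe that] that by blast
  obtain b p where b: "b \<in> Ob" "L b = L ob + real n" "walk E V ob b p" "length p <= n * l + 1"
   "!!x. x \<in> set p ==> L ob <= L x & (x = b \<or> L x <= L b - g)" using l[OF ob_Ob] by blast
  have "set p \<subseteq> {y \<in> V. L ob <= L y & L y <= L b}"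
  proof
   fix y assume y: "y \<in> set p"
   then have "y \<in> V" using b(3) unfolding walk_def by blast
   then show "y \<in> {y \<in> V. L ob <= L y & L y <= L b}" using b(5)[OF y] g_pos by auto
  qed
  then have "walk E {y \<in> V. L ob <= L y & L y <= L b} ob b p" using b(3) unfolding walk_def by blast
  from walk_distinct[OF this] obtain q where q: "q \<in> pth E {y \<in> V. L ob <= L y & L y <= L b} ob b" "edgs q \<subseteq> edgs p" unfolding pth_def by blast
  have "edgs q \<in> pf E {y \<in> V. L ob <= L y & L y <= L b} ob b" unfolding pf_def using q(1) by (rule imageI)
  then have eq: "edgs q \<in> Rwf n" unfolding Rwf_def using b(1,2) by (intro UN_I[of b]) auto
  have "c ^ (n * l + 1) * pr E pe {{}} <= pr E pe (Rwf n)"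
  proof (rule pr_ins[OF _ c(2) pc' _ Rwf_fam])
   show "{{}} \<subseteq> fam E" unfolding fam_def by simp
   show "finite (edgs p)" by (rule finite_edgs)
   show "edgs p \<subseteq> E" using b(3) unfolding walk_def by blast
   show "card (edgs p) <= n * l + 1" using card_edgs[of p] b(4) by linarith
   show "\<exists>T\<in>Rwf n. T \<subseteq> edgs p \<union> S" for S using eq q(2) by blast
  qed (use c in auto)
  then have a: "c ^ (n * l + 1) <= pr E pe (Rwf n)" by (simp add: pr_empty)
  have "c ^ (n * l + 1) = c * exp (- (ln (1 / c) * real l * real n))"
  proof -
   have "c ^ (n * l) = exp (ln c) ^ (n * l)" using c by simp
   also have "... = exp (real (n * l) * ln c)" by (rule exp_of_nat_mult[symmetric])
   also have "real (n * l) * ln c = - (ln (1 / c) * real l * real n)" using c by (simp add: ln_div)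
   finally show ?thesis by simp
  qed
  with a show "c * exp (- (ln (1 / c) * real l * real n)) <= pr E pe (Rwf n)" by (simp only:)
 qed
qed

text \<open>An ascent by at least n ends in one of the unit slabs above, and the bounds for the
  slabs form a geometric series.\<close>

lemma R1:
 assumes f': "0 < f'" and K: "0 < K" and R: "!!k. pr E pe (Rwf k) <= K * exp (- f' * real k)"
 shows "\<exists>K'\<ge>1. \<forall>n\<ge>0. TT True pe n <= K' * exp (- f' * n)"
proof -
 define x where "x = exp (- f')"
 have x: "0 < x" "x < 1" unfolding x_def using f' by auto
 have xk: "exp (- f' * real k) = x ^ k" for k unfolding x_def exp_of_nat_mult[symmetric] by (simp add: mult.commute)
 define K' where "K' = max 1 (K / (1 - x) * exp f')"
 show ?thesis
 proof (rule exI[of _ K'], intro conjI allI impI)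
  show "1 <= K'" unfolding K'_def by simp
  fix n :: real assume n: "0 <= n"
  define m where "m = nat \<lfloor>n\<rfloor>"
  have m: "real m <= n" "n < real m + 1" unfolding m_def using n by linarith+
  let ?I = "{k. m <= k}"
  have "ennreal (TT True pe n) <= (\<integral>\<^sup>+k. ennreal (pp E pe (occ (Rwf k))) \<partial>count_space ?I)"
   unfolding TT_def
  proof (rule pp_ex_le_sum)
   show "ms E (occ (Rwf k))" for k by (rule ms_occ[OF countable_E Rwf_fam])
   fix xi assume "occ (Tfam True ob n) xi"
   then obtain S b where b: "b \<in> Ob" "L ob + n <= L b" "S \<in> pf E {y \<in> V. L ob <= L y & L y <= L b} ob b" "\<forall>e\<in>S. xi e"
    unfolding occ_def Tfam_def by auto
   define k where "k = nat \<lfloor>L b - L ob\<rfloor>"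
   have k: "real k <= L b - L ob" "L b - L ob < real k + 1" unfolding k_def using n b(2) by linarith+
   have "S \<in> Rwf k" unfolding Rwf_def using b(1,3) k by blast
   moreover have "m <= k" using k m b(2) by linarith
   ultimately show "\<exists>k\<in>?I. occ (Rwf k) xi" using b(4) unfolding occ_def by blast
  qed simp
  also have "... <= ennreal (K * (x ^ m / (1 - x)))"
  proof (rule nn_le_fin)
   fix X assume X: "finite X" "X \<subseteq> ?I"
   have sm: "summable (%i. x ^ i)" using x by (intro summable_geometric) simp
   have inj: "inj_on (%k. k - m) X" using X(2) by (intro inj_onI) (metis eq_diff_iff mem_Collect_eq subsetD)
   have "(\<Sum>k\<in>X. pr E pe (Rwf k)) <= (\<Sum>k\<in>X. K * (x ^ m * x ^ (k - m)))"
   proof (rule sum_mono)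
    fix k assume "k \<in> X"
    then have "m <= k" using X(2) by blast
    then have "x ^ m * x ^ (k - m) = x ^ k" by (simp add: power_add[symmetric])
    then show "pr E pe (Rwf k) <= K * (x ^ m * x ^ (k - m))" using R[of k] unfolding xk by simp
   qed
   also have "... = K * (x ^ m * (\<Sum>k\<in>X. x ^ (k - m)))" by (simp add: sum_distrib_left)
   also have "(\<Sum>k\<in>X. x ^ (k - m)) = (\<Sum>i\<in>(%k. k - m) ` X. x ^ i)" by (rule sum.reindex_cong[OF inj refl refl, symmetric])
   also have "K * (x ^ m * ...) <= K * (x ^ m * (\<Sum>i. x ^ i))"
    using K x X(1) by (intro mult_left_mono sum_le_suminf[OF sm]) auto
   also have "(\<Sum>i. x ^ i) = 1 / (1 - x)" using x by (intro suminf_geometric) simp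
   finally have "(\<Sum>k\<in>X. pr E pe (Rwf k)) <= K * (x ^ m / (1 - x))" by simp
   then show "(\<Sum>k\<in>X. ennreal (pp E pe (occ (Rwf k)))) <= ennreal (K * (x ^ m / (1 - x)))" by (simp add: pp_nonneg ennreal_leI)
  qed simp
  finally have "TT True pe n <= K * (x ^ m / (1 - x))" using K x by (subst (asm) ennreal_le_iff) auto
  also have "x ^ m <= exp f' * exp (- f' * n)"
  proof -
   have "f' * n <= f' * (real m + 1)" using m(2) f' by (intro mult_left_mono) auto
   then have "- f' * real m <= f' + - f' * n" by (simp add: algebra_simps)
   then show ?thesis unfolding xk[symmetric] exp_add[symmetric] by simp
  qed
  finally have "TT True pe n <= K * (exp f' * exp (- f' * n) / (1 - x))" using K x by (simp add: mult_left_mono divide_right_mono)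
  also have "... = K / (1 - x) * exp f' * exp (- f' * n)" by simp
  also have "... <= K' * exp (- f' * n)" unfolding K'_def by (intro mult_right_mono) auto
  finally show "TT True pe n <= K' * exp (- f' * n)" .
 qed
qed

text \<open>A unit step placed above the descent makes its start a strict top. Finitely many paths
  already carry enough of the probability: they lie in a common ball, which gives
  \<open>\<rho>\<close>, and their probability is continuous in the parameter, so it persists at
  some parameter strictly below \<open>ts\<close>.\<close>

lemma Dr_lower:
 fixes pet :: "real \<Rightarrow> 'v set \<Rightarrow> real"
 assumes c: "0 < c" "c <= 1"
  and P: "!!t. t \<in> {0..1} ==> inv_pe (pet t)" and cont: "!!e. e \<in> E ==> continuous_on {0..1} (%t. pet t e)"
  and ts: "0 < ts" "ts <= 1" "!!e. e \<in> E ==> c <= pet ts e"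
 shows "\<exists>C>0. \<forall>n ta. 0 < pr E (pet ts) (Rmf ob n) --> ta < ts -->
  (\<exists>t0 \<rho>. ta < t0 & 0 < t0 & t0 < ts & C * pr E (pet ts) (Rmf ob n) <= Dr (pet t0) \<rho> (real n + 1))"
proof -
 let ?p = "pet ts"
 have pe: "inv_pe ?p" by (rule P) (use ts(1,2) in auto)
 have pc': "c <= ?p e & ?p e <= 1" if "e \<in> E" for e using ts(3)[OF that] inv_pe01[OF pe that] by blast
 obtain l where l: "!!a. a \<in> Ob ==> \<exists>b p. b \<in> Ob & - L b = - L a + 1 & walk E V a b p & length p <= l &
 (\<forall>x\<in>set p. x = a \<or> x = b \<or> - L a + g <= - L x & - L x <= - L b - g)" using hg.up_step[OF neg] by meson
 obtain o' p where o': "o' \<in> Ob" "L o' = L ob - 1" "walk E V ob o' p" "length p <= l"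
  and p: "!!x. x \<in> set p ==> x = ob \<or> x = o' \<or> L x <= L ob - g & L o' + g <= L x" using l[OF ob_Ob] by force
 obtain ga where g: "ga \<in> \<Gamma>" "ga ob = o'" using Ob_trans[OF ob_Ob o'(1)] by blast
 have Lg: "L (ga y) = L y - 1" if "y \<in> V" for y using L_inv[OF g(1) that ob_V] g(2) o'(2) by simp
 have pV: "set p \<subseteq> V" using o'(3) unfolding walk_def by blast
 show ?thesis
 \<comment> \<open>The factor 1/2 leaves room for passing to finitely many paths and to a smaller
   parameter.\<close>
 proof (rule exI[of _ "c ^ l / 2"], intro conjI allI impI)
  show "0 < c ^ l / 2" using c by simp
  fix n :: nat and ta :: real assume Rpos: "0 < pr E ?p (Rmf ob n)" and ta: "ta < ts"
  define W where "W a = {y \<in> V. L a <= L y & (L y <= L ob - g \<or> y = ob)}" for a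
  define \<S> where "\<S> = (\<Union>a\<in>{a \<in> Ob. real n + 1 <= L ob - L a & L ob - L a < real n + 1 + 1}. pf E (W a) a ob)"
  have Sf: "\<S> \<subseteq> fam E" unfolding \<S>_def by (rule UN_least) (rule pth_fam)
  have "pr E ?p (Rmf ob n) <= pr E ?p (Rmf o' n)"
  proof (rule pr_g_le[OF pe g(1) Rmf_fam Rmf_fam])
   fix S assume "S \<in> Rmf ob n"
   then obtain a where a: "a \<in> Ob" "real n <= L ob - L a" "L ob - L a < real n + 1" "S \<in> pf E {y \<in> V. L a <= L y & L y <= L ob} ob a" unfolding Rmf_def by blast
   have aV: "a \<in> V" by (rule Ob_V[OF a(1)])
   have "(`) ga ` S \<in> pf E (ga ` {y \<in> V. L a <= L y & L y <= L ob}) (ga ob) (ga a)" by (rule pf_g[OF g(1) _ a(4)]) blast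
   also have "ga ` {y \<in> V. L a <= L y & L y <= L ob} = {y \<in> V. L (ga a) <= L y & L y <= L o'}"
    by (rule region_g[OF g(1)]) (use Lg aV o'(2) in auto)
   finally have "(`) ga ` S \<in> pf E {y \<in> V. L (ga a) <= L y & L y <= L o'} o' (ga a)" unfolding g(2) .
   moreover have "ga a \<in> {a \<in> Ob. real n <= L o' - L a & L o' - L a < real n + 1}" using Ob_g[OF g(1) a(1)] Lg[OF aV] a(2,3) o'(2) by simp
   ultimately have "(`) ga ` S \<in> Rmf o' n" unfolding Rmf_def by blast
   then show "\<exists>T\<in>Rmf o' n. T \<subseteq> (`) ga ` S" by blast
  qed
  then have "c ^ l * pr E ?p (Rmf ob n) <= c ^ l * pr E ?p (Rmf o' n)" using c by (intro mult_left_mono) auto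
  also have "... <= pr E ?p \<S>"
  proof (rule pr_ins[OF _ c(2) pc' Rmf_fam Sf])
   show "finite (edgs p)" by (rule finite_edgs)
   show "edgs p \<subseteq> E" using o'(3) unfolding walk_def by blast
   show "card (edgs p) <= l" using card_edgs[of p] o'(4) by linarith
   fix S assume "S \<in> Rmf o' n"
   then obtain a where a: "a \<in> Ob" "real n <= L o' - L a" "L o' - L a < real n + 1" "S \<in> pf E {y \<in> V. L a <= L y & L y <= L o'} o' a" unfolding Rmf_def by blast
   have S: "S \<in> pf E {y \<in> V. L a <= L y & L y <= L o'} a o'" using a(4) by (simp add: pf_sym)
   have La: "L a <= L o'" using a(2) by (meson diff_ge_0_iff_ge of_nat_0_le_iff order_trans)
   have w1: "walk E (W a) a a [a]" unfolding walk_def W_def using Ob_V[OF a(1)] La o'(2) g_le by auto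
   have "set p \<subseteq> W a"
   proof
    fix y assume y: "y \<in> set p"
    show "y \<in> W a" unfolding W_def using p[OF y] pV y La o'(2) g_le g_pos by auto
   qed
   then have w2: "walk E (W a) o' ob (rev p)" using walk_rev[OF o'(3)] unfolding walk_def by simp
   have sub: "{y \<in> V. L a <= L y & L y <= L o'} \<subseteq> W a" unfolding W_def using o'(2) g_le by auto
   obtain T where T: "T \<in> pf E (W a) a ob" "T \<subseteq> (edgs [a] \<union> edgs (rev p)) \<union> S" using pf_ext[OF S w1 w2 sub] by blast
   have "T \<in> \<S>" unfolding \<S>_def using T(1) a(1-3) o'(2) by (intro UN_I[of a]) auto
   then show "\<exists>T\<in>\<S>. T \<subseteq> edgs p \<union> S" using T(2) unfolding edgs_rev by (intro bexI[of _ T]) auto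
  qed (use c in auto)
  finally have "c ^ l * pr E ?p (Rmf ob n) <= pr E ?p \<S>" .
  moreover have "c ^ l / 2 * pr E ?p (Rmf ob n) < c ^ l * pr E ?p (Rmf ob n)" using Rpos c by simp
  ultimately have "c ^ l / 2 * pr E ?p (Rmf ob n) < pr E ?p \<S>" by linarith
  from pr_fin_approx[OF countable_E Sf this] obtain \<T> where T: "\<T> \<subseteq> \<S>" "finite \<T>" "c ^ l / 2 * pr E ?p (Rmf ob n) < pr E ?p \<T>" by blast
  have Tf: "\<T> \<subseteq> fam E" using T(1) Sf by (rule subset_trans)
  note ff = fin_fam[OF T(2) Tf]
  have cn: "continuous_on {0..1} (%t. pr E (pet t) \<T>)"
   by (rule pr_cont_fin[OF countable_E, of "\<Union>\<T>"]) (use ff P inv_pe01 cont in auto)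
  have "\<exists>t0. ta < t0 & 0 < t0 & t0 < ts & c ^ l / 2 * pr E ?p (Rmf ob n) < pr E (pet t0) \<T>"
  proof -
   define \<epsilon> where "\<epsilon> = pr E ?p \<T> - c ^ l / 2 * pr E ?p (Rmf ob n)"
   have e0: "\<epsilon> > 0" unfolding \<epsilon>_def using T(3) by simp
   have tin: "ts \<in> {0..1}" using ts(1,2) by auto
   obtain d where d: "d > 0" "\<forall>t\<in>{0..1}. dist t ts < d --> dist (pr E (pet t) \<T>) (pr E ?p \<T>) < \<epsilon>"
    using cn[unfolded continuous_on_iff, rule_format, OF tin e0] by (elim exE conjE)
   define t0 where "t0 = max (max ((ta + ts) / 2) (ts / 2)) (ts - d / 2)"
   have t0: "ta < t0" "0 < t0" "t0 < ts" "ts - t0 < d" unfolding t0_def using ta ts(1) d(1) by (auto simp: less_max_iff_disj)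
   have "t0 \<in> {0..1}" "dist t0 ts < d" using t0 ts(2) by (auto simp: dist_real_def intro: less_imp_le)
   from bspec[OF d(2) this(1), THEN mp, OF this(2)] have "dist (pr E (pet t0) \<T>) (pr E ?p \<T>) < \<epsilon>" .
   then have "c ^ l / 2 * pr E ?p (Rmf ob n) < pr E (pet t0) \<T>" unfolding \<epsilon>_def dist_real_def by linarith
   then show ?thesis using t0 by blast
  qed
  then obtain t0 where t0: "ta < t0" "0 < t0" "t0 < ts" "c ^ l / 2 * pr E ?p (Rmf ob n) < pr E (pet t0) \<T>" by blast
  have "\<forall>S\<in>\<T>. \<exists>a q. a \<in> Ob & real n + 1 <= L ob - L a & L ob - L a < real n + 1 + 1 & q \<in> pth E (W a) a ob & S = edgs q"
   using T(1) unfolding \<S>_def pf_def by blast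
  then obtain a q where aq: "!!S. S \<in> \<T> ==> a S \<in> Ob & real n + 1 <= L ob - L (a S) & L ob - L (a S) < real n + 1 + 1 & q S \<in> pth E (W (a S)) (a S) ob & S = edgs (q S)" by metis
  \<comment> \<open>A common radius: each vertex of one of the paths is joined to \<open>ob\<close>
    by the remainder of that path.\<close>
  define \<rho> where "\<rho> = (\<Sum>S\<in>\<T>. length (q S))"
  have "pr E (pet t0) \<T> <= Dr (pet t0) \<rho> (real n + 1)"
   unfolding Dr_def
  proof (rule pp_mono)
   show "ms E (%xi. \<exists>a\<in>Ns \<rho> (real n + 1) ob. occ (Kf \<rho> a ob) xi)" by (intro ms_ex ms_Kf countable_finite Ns_fin ob_V)
   fix xi assume "occ \<T> xi"
   then obtain S where S: "S \<in> \<T>" "\<forall>e\<in>S. xi e" unfolding occ_def by blast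
   have A: "a S \<in> Ob" "real n + 1 <= L ob - L (a S)" "L ob - L (a S) < real n + 1 + 1" "q S \<in> pth E (W (a S)) (a S) ob" "S = edgs (q S)" using aq[OF S(1)] by blast+
   have len: "length (q S) <= \<rho>" unfolding \<rho>_def by (rule member_le_sum[OF S(1) _ T(2)]) simp
   have wq: "walk E V (a S) ob (q S)" using A(4) unfolding pth_def walk_def W_def by blast
   have inb: "y \<in> bl ob \<rho>" if y: "y \<in> set (q S)" for y
   proof -
    obtain i where i: "i < length (q S)" "y = q S ! i" using y by (metis in_set_conv_nth)
    have "walk E V y ob (drop i (q S))" using walk_nth(3)[OF wq i(1)] unfolding i(2) .
    then have "ob \<in> bl y \<rho>" unfolding bl_def using len by (intro CollectI exI[of _ "drop i (q S)"]) auto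
    then show ?thesis by (rule bl_sym)
   qed
   have "q S \<in> pth E (Kr \<rho> (a S) ob) (a S) ob" using A(4) inb unfolding pth_def walk_def W_def Kr_def by blast
   then have "occ (Kf \<rho> (a S) ob) xi" unfolding Kf_def pf_def occ_def using S(2) A(5) by auto
   moreover have "a S \<in> Ns \<rho> (real n + 1) ob"
   proof -
    have "q S \<noteq> []" "hd (q S) = a S" using A(4) unfolding pth_def walk_def by auto
    then have "a S \<in> set (q S)" using hd_in_set[of "q S"] by simp
    from inb[OF this] show ?thesis unfolding Ns_def using A(1-3) by simp
   qed
   ultimately show "\<exists>a\<in>Ns \<rho> (real n + 1) ob. occ (Kf \<rho> a ob) xi" by (rule bexI)
  qed
  then show "\<exists>t0 \<rho>. ta < t0 & 0 < t0 & t0 < ts & c ^ l / 2 * pr E ?p (Rmf ob n) <= Dr (pet t0) \<rho> (real n + 1)"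
   using t0 by (intro exI[of _ t0] exI[of _ \<rho>]) auto
 qed
qed

end

text \<open>A finite sum of connection probabilities can be bounded through strictly smaller
  numbers, each of which is already exceeded by finitely many paths.\<close>

lemma sum_lt_approx:
 fixes a h :: "'a \<Rightarrow> real"
 assumes h: "!!w. w \<in> X ==> 0 <= h w" and B: "!!r. (!!w. w \<in> X ==> r w < a w) ==> (\<Sum>w\<in>X. r w * h w) <= B"
 shows "(\<Sum>w\<in>X. a w * h w) <= B"
proof (rule field_le_epsilon)
 fix e :: real assume e: "0 < e"
 define H where "H = (\<Sum>w\<in>X. h w) + 1"
 have H: "0 < H" "(\<Sum>w\<in>X. h w) <= H" unfolding H_def using sum_nonneg[of X h] h by auto
 have "(\<Sum>w\<in>X. (a w - e / H) * h w) <= B" by (rule B) (use e H in simp)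
 moreover have "(\<Sum>w\<in>X. (a w - e / H) * h w) = (\<Sum>w\<in>X. a w * h w) - e / H * (\<Sum>w\<in>X. h w)"
  by (simp add: left_diff_distrib sum_subtractf sum_distrib_left)
 moreover have "e / H * (\<Sum>w\<in>X. h w) <= e / H * H" using e H by (intro mult_left_mono) auto
 ultimately show "(\<Sum>w\<in>X. a w * h w) <= B + e" using H by simp
qed

context gr
begin

lemma cn_finite_witness:
 assumes "r < cn pe V v w"
 shows "\<exists>\<T> \<Lambda>. finite \<T> & \<T> \<subseteq> fam E & r < pr E pe \<T> & finite \<Lambda> & \<Lambda> \<subseteq> V & (\<forall>M. \<Lambda> \<subseteq> M --> \<T> \<subseteq> pf E M v w)"
proof -
 obtain \<T> where T: "\<T> \<subseteq> pf E V v w" "finite \<T>" "r < pr E pe \<T>"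
  using pr_fin_approx[OF countable_E pth_fam assms[unfolded cn_def]] by blast
 have "\<forall>S\<in>\<T>. \<exists>q. q \<in> pth E V v w & S = edgs q" using T(1) unfolding pf_def by blast
 then obtain q where q: "!!S. S \<in> \<T> ==> q S \<in> pth E V v w & S = edgs (q S)" by metis
 let ?L = "\<Union>S\<in>\<T>. set (q S)"
 show ?thesis
 proof (intro exI[of _ \<T>] exI[of _ ?L] conjI allI impI subsetI)
  show "finite \<T>" by fact
  show "S \<in> fam E" if "S \<in> \<T>" for S using that T(1) pth_fam[of E V v w] by (meson subsetD)
  show "r < pr E pe \<T>" by fact
  show "finite ?L" using T(2) by simp
  show "x \<in> V" if xL: "x \<in> ?L" for x
  proof -
   obtain S where "S \<in> \<T>" "x \<in> set (q S)" using xL by (rule UN_E)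
   then show ?thesis using q[of S] unfolding pth_def walk_def by blast
  qed
  show "S \<in> pf E M v w" if M: "?L \<subseteq> M" and S: "S \<in> \<T>" for M S
  proof -
   have "set (q S) \<subseteq> M" using M S by blast
   then have "q S \<in> pth E M v w" using conjunct1[OF q[OF S]] unfolding pth_def walk_def by simp
   then show ?thesis unfolding pf_def using q[OF S] by (intro image_eqI[of _ _ "q S"]) auto
  qed
 qed
qed

end

section \<open>The interval of parameters\<close>

text \<open>The sign of \<open>s\<close> is again left open, because \<open>neg_hgp\<close> reverses
  heights while keeping the parameters.\<close>

locale hgp = hg V \<Gamma> E L s g ob for V :: "'v set" and \<Gamma> and E and L and s g :: real and ob +
 fixes pet :: "real \<Rightarrow> 'v set \<Rightarrow> real"
 assumes P: "t \<in> {0..1} ==> inv_pe (pet t)" and cont: "e \<in> E ==> continuous_on {0..1} (%t. pet t e)"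
  and pmono: "0 <= t ==> t <= t' ==> t' <= 1 ==> e \<in> E ==> pet t e <= pet t' e"
  and p0: "e \<in> E ==> pet 0 e = 0" and p1: "e \<in> E ==> pet 1 e = 1"
  and plow: "0 < t ==> t < 1 ==> \<exists>c>0. \<forall>e\<in>E. c <= pet t e" and s0: "s \<noteq> 0"
begin

lemma neg_hgp: "hgp V \<Gamma> E (%x. - L x) (- s) g ob pet"
proof -
 interpret N: hg V \<Gamma> E "%x. - L x" "- s" g ob by (rule neg)
 show ?thesis by unfold_locales (use P cont pmono p0 p1 plow s0 in auto)
qed

lemma pm: "0 <= t ==> t <= t' ==> t' <= 1 ==> e \<in> E ==> 0 <= pet t e & pet t e <= pet t' e & pet t' e <= 1"
 using pmono[of t t' e] inv_pe01[OF P, of t e] inv_pe01[OF P, of t' e] by auto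

lemma cont_pr: assumes "finite \<T>" "\<T> \<subseteq> fam E" shows "continuous_on {0..1} (%t. pr E (pet t) \<T>)"
 by (rule pr_cont_fin[OF countable_E, of "\<Union>\<T>"]) (use fin_fam[OF assms] P inv_pe01 cont in auto)

lemma half_low: assumes "0 < ts" "ts <= 1" shows "\<exists>c>0. c <= 1 & (\<forall>t e. ts / 2 <= t --> t <= ts --> e \<in> E --> c <= pet t e)"
proof -
 obtain c where c: "c > 0" "!!e. e \<in> E ==> c <= pet (ts / 2) e" using plow[of "ts / 2"] assms by auto
 have "min c 1 <= pet t e" if t: "ts / 2 <= t" "t <= ts" "e \<in> E" for t e
 proof -
  have "pet (ts / 2) e <= pet t e" by (rule pmono) (use t assms in auto)
  then show ?thesis using c(2)[OF t(3)] by linarith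
 qed
 then show ?thesis using c(1) by (intro exI[of _ "min c 1"]) auto
qed

text \<open>Descents by r have probability about exp (- b r), and mass transport contributes exp (-
  s r), so one step of growth multiplies by about exp (- (b + s) r). For any \<beta> above b + s the
  number \<open>D0\<close> is chosen below the true probability of a descent such that the factor is
  exactly exp (- \<beta> r).\<close>

lemma pick:
 assumes ts: "0 < ts" "ts <= 1" and be: "b + s < \<beta>"
  and Hb: "!!b' K. b < b' ==> \<exists>n. pr E (pet ts) (Rmf ob n) > K * exp (- b' * real n)"
 shows "\<exists>t0 \<rho> r D0. ts / 2 < t0 & t0 < ts & 0 < r & 0 < D0 & D0 <= Dr (pet t0) \<rho> r &
  (exp (- s * r - \<bar>s\<bar>) * D0 / real (nat \<lceil>2 / g\<rceil>)) / 2 = exp (- \<beta> * r)"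
proof -
 obtain c where c: "c > 0" "c <= 1" "!!t e. ts / 2 <= t ==> t <= ts ==> e \<in> E ==> c <= pet t e" using half_low[OF ts] by blast
 have cts: "c <= pet ts e" if "e \<in> E" for e by (rule c(3)[OF _ _ that]) (use ts in auto)
 obtain C where C: "C > 0" "!!n ta. 0 < pr E (pet ts) (Rmf ob n) ==> ta < ts ==>
  \<exists>t0 \<rho>. ta < t0 & 0 < t0 & t0 < ts & C * pr E (pet ts) (Rmf ob n) <= Dr (pet t0) \<rho> (real n + 1)"
  using Dr_lower[OF c(1,2) P cont ts cts] by blast
 define m where "m = real (nat \<lceil>2 / g\<rceil>)"
 have m: "m > 0" unfolding m_def using g_pos by simp
 \<comment> \<open>\<open>K\<close> absorbs the number of sublayers, the factor exp (|s|), the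
   constant \<open>C\<close> and the passage from n to n + 1.\<close>
 define K where "K = 2 * m * exp (\<bar>s\<bar> - (\<beta> - s)) / C"
 have K: "K > 0" unfolding K_def using m C(1) by simp
 obtain n where n: "pr E (pet ts) (Rmf ob n) > K * exp (- (\<beta> - s) * real n)" using Hb[of "\<beta> - s" K] be by auto
 have npos: "0 < pr E (pet ts) (Rmf ob n)" by (rule less_trans[OF _ n]) (use K in simp)
 obtain t0 \<rho> where t0: "ts / 2 < t0" "t0 < ts" "C * pr E (pet ts) (Rmf ob n) <= Dr (pet t0) \<rho> (real n + 1)"
  using C(2)[OF npos, of "ts / 2"] ts by auto
 define r where "r = real n + 1"
 define D0 where "D0 = 2 * m * exp (\<bar>s\<bar>) * exp (- (\<beta> - s) * r)"
 have D0: "D0 > 0" unfolding D0_def using m by simp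
 have "D0 = C * (K * exp (- (\<beta> - s) * real n))"
 proof -
  have "exp (\<bar>s\<bar>) * exp (- (\<beta> - s) * r) = exp (\<bar>s\<bar> - (\<beta> - s)) * exp (- (\<beta> - s) * real n)"
   unfolding exp_add[symmetric] r_def by (simp add: algebra_simps)
  then show ?thesis unfolding D0_def K_def using C(1) by simp
 qed
 also have "... <= C * pr E (pet ts) (Rmf ob n)" using n C(1) by (intro mult_left_mono) auto
 finally have 1: "D0 <= Dr (pet t0) \<rho> r" using t0(3) unfolding r_def by linarith
 have "exp (- s * r - \<bar>s\<bar>) * (exp (\<bar>s\<bar>) * exp (- (\<beta> - s) * r)) = exp (- \<beta> * r)" unfolding exp_add[symmetric] by (simp add: algebra_simps)
 then have 2: "(exp (- s * r - \<bar>s\<bar>) * D0 / m) / 2 = exp (- \<beta> * r)" unfolding D0_def using m by simp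
 have "0 < r" unfolding r_def by simp
 then show ?thesis using t0(1,2) D0 1 2 unfolding m_def by blast
qed

text \<open>Here b and f are the rates of descents and ascents. From k vertices of a layer, about ln
  k / (b + s) of additional height can be gained, and an ascent pays exp (- f) per unit of height.
  Because b + s <= f, the tail exponent comes as close to 1 as \<open>bootstrap\<close>
  requires.\<close>

lemma main_bounded:
 assumes ts: "0 < ts" "ts <= 1" and bs: "0 <= b + s" "b + s <= f" "0 < f" "om < f"
  and Hf: "!!f'. f' < f ==> \<exists>K>0. \<forall>n. pr E (pet ts) (Rwf n) <= K * exp (- f' * real n)"
  and Hb: "!!b' K. b < b' ==> \<exists>n. pr E (pet ts) (Rmf ob n) > K * exp (- b' * real n)"
 shows "\<exists>t0 D. 0 < t0 & t0 < ts & (\<forall>t. t0 <= t --> t < ts --> MM (pet t) Pfull < \<top> --> MM (pet t) Pfull <= ennreal D)"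
proof -
 obtain c where c: "c > 0" "c <= 1" "!!t e. ts / 2 <= t ==> t <= ts ==> e \<in> E ==> c <= pet t e" using half_low[OF ts] by blast
 define f1 where "f1 = (f + max om 0) / 2"
 have f1: "0 < f1" "om < f1" "f1 < f" unfolding f1_def using bs(3,4) by (auto simp: max_def)
 obtain \<epsilon> where e: "0 < \<epsilon>" "\<epsilon> < 1" and BS: "!!f' K0 Ct. f1 <= f' ==> f' <= f ==> 1 <= K0 ==> 1 <= Ct ==> (\<exists>D. \<forall>pe. inv_pe pe --> (\<forall>e\<in>E. c <= pe e) -->
  MM pe Pfull < \<top> --> (\<forall>n\<ge>0. TT True pe n <= K0 * exp (- f' * n)) -->
  (\<forall>fl K i X k. 1 <= K --> (\<forall>n\<ge>0. TT fl pe n <= K * exp (- f' * n)) --> finite X --> X \<subseteq> layer i --> 1 <= k -->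
   tl fl pe X k <= Ct * K * exp (- f' * g * real i) * real k powr (- (1 - \<epsilon>))) -->
  MM pe Pfull <= ennreal D)" using bootstrap[OF c(1,2) f1(1,2), of f] by blast
 \<comment> \<open>The slack is used three times, once to lower f and twice to raise b + s: 3 d <=
   \<epsilon> f suffices for (1 - \<epsilon>) (f + 2 d) <= f - d.\<close>
 define d where "d = min (\<epsilon> * f / 3) (f - f1)"
 have d0: "0 < d" "d <= \<epsilon> * f / 3" "d <= f - f1"
  unfolding d_def by (use e(1) bs(3) f1(3) in simp, rule min.cobounded1, rule min.cobounded2)
 then have d: "0 < d" "3 * d <= \<epsilon> * f" "d <= f - f1" by linarith+
 define f' where "f' = f - d"
 have f': "f1 <= f'" "f' <= f" "f' < f" "0 < f'" unfolding f'_def using d f1 by auto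
 define \<beta> where "\<beta> = b + s + 2 * d"
 have be: "b + s < \<beta>" "0 < \<beta>" "\<beta> <= f + 2 * d" unfolding \<beta>_def using d bs by auto
 obtain t0 \<rho> r D0 where pk: "ts / 2 < t0" "t0 < ts" "0 < r" "0 < D0" "D0 <= Dr (pet t0) \<rho> r"
  "(exp (- s * r - \<bar>s\<bar>) * D0 / real (nat \<lceil>2 / g\<rceil>)) / 2 = exp (- \<beta> * r)" using pick[OF ts be(1) Hb] by blast
 define \<kappa> where "\<kappa> = exp (- s * r - \<bar>s\<bar>) * D0 / real (nat \<lceil>2 / g\<rceil>)"
 have k2: "\<kappa> / 2 = exp (- \<beta> * r)" unfolding \<kappa>_def by (rule pk(6))
 have pt0: "inv_pe (pet t0)" by (rule P) (use pk(1,2) ts in auto)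
 have q1: "\<kappa> / 2 < 1" unfolding k2 using be(2) pk(3) by simp
 have expo: "(1 - \<epsilon>) * ln (1 / (\<kappa> / 2)) <= f' * r"
 proof -
  have "ln (1 / (\<kappa> / 2)) = \<beta> * r" unfolding k2 by (simp add: ln_div)
  moreover have "(1 - \<epsilon>) * \<beta> <= f'"
  proof -
   have "(1 - \<epsilon>) * \<beta> <= (1 - \<epsilon>) * (f + 2 * d)" using be(3) e by (intro mult_left_mono) auto
   also have "... = f + 2 * d - \<epsilon> * f - 2 * (\<epsilon> * d)" by (simp add: algebra_simps)
   also have "... <= f'" unfolding f'_def using d e(1) mult_pos_pos[OF e(1) d(1)] by linarith
   finally show ?thesis .
  qed
  ultimately show ?thesis using pk(3) by (simp add: mult.assoc[symmetric] mult_right_mono)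
 qed
 obtain Ct where Ct: "1 <= Ct" and TL: "!!pe. inv_pe pe ==> (\<forall>e\<in>E. pet t0 e <= pe e) ==>
  (\<forall>fl K i X k. 1 <= K --> (\<forall>n\<ge>0. TT fl pe n <= K * exp (- f' * n)) --> finite X --> X \<subseteq> layer i --> 1 <= k -->
   tl fl pe X k <= Ct * K * exp (- f' * g * real i) * real k powr (- (1 - \<epsilon>)))"
  using tail[OF pt0 pk(4,5) less_imp_le[OF pk(3)] \<kappa>_def q1 less_imp_le[OF f'(4)] expo less_imp_le[OF e(1)] e(2)] by blast
 obtain K where K: "K > 0" "!!n. pr E (pet ts) (Rwf n) <= K * exp (- f' * real n)" using Hf[OF f'(3)] by blast
 obtain K0 where K0: "1 <= K0" "!!n. n \<ge> 0 ==> TT True (pet ts) n <= K0 * exp (- f' * n)" using R1[OF f'(4) K] by blast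
 obtain D where D: "!!pe. inv_pe pe ==> (\<forall>e\<in>E. c <= pe e) ==>
  MM pe Pfull < \<top> ==> (\<forall>n\<ge>0. TT True pe n <= K0 * exp (- f' * n)) ==>
  (\<forall>fl K i X k. 1 <= K --> (\<forall>n\<ge>0. TT fl pe n <= K * exp (- f' * n)) --> finite X --> X \<subseteq> layer i --> 1 <= k -->
   tl fl pe X k <= Ct * K * exp (- f' * g * real i) * real k powr (- (1 - \<epsilon>))) ==>
  MM pe Pfull <= ennreal D" using BS[OF f'(1,2) K0(1) Ct] by blast
 show ?thesis
 proof (rule exI[of _ t0], rule exI[of _ D], intro conjI allI impI)
  show "0 < t0" "t0 < ts" using pk(1,2) ts(1) by auto
  fix t assume t: "t0 <= t" "t < ts" and fin: "MM (pet t) Pfull < \<top>"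
  have t01: "0 <= t0" "t <= 1" "0 <= t" using pk(1) t ts by auto
  show "MM (pet t) Pfull <= ennreal D"
  proof (rule D[OF _ _ fin])
   show it: "inv_pe (pet t)" by (rule P) (use t01 in simp)
   show "\<forall>e\<in>E. c <= pet t e" using c(3)[of t] pk(1) t by auto
   show "\<forall>n\<ge>0. TT True (pet t) n <= K0 * exp (- f' * n)"
   proof (intro allI impI)
    fix n :: real assume n: "0 <= n"
    have "TT True (pet t) n <= TT True (pet ts) n" unfolding TT_def
     by (rule pr_mono_pe[OF countable_E Tfam_fam pm]) (use t01 t ts in auto)
    then show "TT True (pet t) n <= K0 * exp (- f' * n)" using K0(2)[OF n] by linarith
   qed
   show "\<forall>fl K i X k. 1 <= K --> (\<forall>n\<ge>0. TT fl (pet t) n <= K * exp (- f' * n)) --> finite X --> X \<subseteq> layer i --> 1 <= k -->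
   tl fl (pet t) X k <= Ct * K * exp (- f' * g * real i) * real k powr (- (1 - \<epsilon>))"
    by (rule TL[OF it]) (use pmono t01 t in auto)
  qed
 qed
qed

text \<open>A negative b + s makes the factor of a growth step larger than 1, and
  \<open>big_A\<close> supplies an initial set as large as \<open>growth\<close> asks for. Some
  vertex of this finite set must then percolate with positive probability.\<close>

lemma main_growth:
 assumes ts: "0 < ts" "ts <= 1" and bs: "b + s < 0"
  and Hb: "!!b' K. b < b' ==> \<exists>n. pr E (pet ts) (Rmf ob n) > K * exp (- b' * real n)"
 shows "\<exists>t0 a. 0 < t0 & t0 < ts & a \<in> V & 0 < pp E (pet t0) (infc a)"
proof -
 define \<beta> where "\<beta> = (b + s) / 2"
 have be: "b + s < \<beta>" "\<beta> < 0" unfolding \<beta>_def using bs by auto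
 obtain t0 \<rho> r D0 where pk: "ts / 2 < t0" "t0 < ts" "0 < r" "0 < D0" "D0 <= Dr (pet t0) \<rho> r"
  "(exp (- s * r - \<bar>s\<bar>) * D0 / real (nat \<lceil>2 / g\<rceil>)) / 2 = exp (- \<beta> * r)" using pick[OF ts be(1) Hb] by blast
 have pt0: "inv_pe (pet t0)" by (rule P) (use pk(1,2) ts in auto)
 have "1 < exp (- \<beta> * r)" using be(2) pk(3) by (simp add: mult_neg_pos)
 then have q1: "1 < (exp (- s * r - \<bar>s\<bar>) * D0 / real (nat \<lceil>2 / g\<rceil>)) / 2" unfolding pk(6) .
 obtain N :: nat where N: "!!A c. finite A ==> A \<subseteq> {x \<in> Ob. c <= L x & L x < c + 1} ==> N <= card A ==> 1 / 2 <= pp E (pet t0) (%xi. \<exists>a\<in>A. infc a xi)"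
  using growth[OF pt0 pk(4,5,3) refl q1] by blast
 obtain c A where A: "finite A" "A \<subseteq> {x \<in> Ob. c <= L x & L x < c + 1}" "N <= card A"
  using big_A[OF s0, of N] by (elim exE conjE)
 have AV: "a \<in> V" if "a \<in> A" for a using that A(2) Ob_V by blast
 have "\<exists>a\<in>A. 0 < pp E (pet t0) (infc a)"
 proof (rule ccontr)
  assume nex: "\<not> ?thesis"
  have z: "pp E (pet t0) (infc a) = 0" if aA: "a \<in> A" for a
  proof -
   have "\<not> 0 < pp E (pet t0) (infc a)" using nex aA by blast
   then show ?thesis using pp_nonneg[of E "pet t0" "infc a"] by linarith
  qed
  have "ennreal (pp E (pet t0) (%xi. \<exists>a\<in>A. infc a xi)) <= (\<integral>\<^sup>+a. ennreal (pp E (pet t0) (infc a)) \<partial>count_space A)"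
   by (rule pp_ex_le_sum[OF countable_finite[OF A(1)] ms_infc[OF AV]])
  also have "... = 0" using z A(1) by (simp add: nn_integral_count_space_finite)
  finally show False using N[OF A] by simp
 qed
 then obtain a where a: "a \<in> A" "0 < pp E (pet t0) (infc a)" by (rule bexE)
 have "0 < t0" using pk(1) ts(1) by linarith
 then show ?thesis using pk(2) AV[OF a(1)] a(2) by (intro exI conjI)
qed

text \<open>Every finite part of the sum is approximated from below by events on finitely many
  edges, whose probabilities are continuous in the parameter.\<close>

lemma closed_left:
 assumes ts: "0 < t0" "t0 < ts" "ts <= 1" and D: "!!t. t0 <= t ==> t < ts ==> MM (pet t) Pfull <= ennreal D" and D0: "0 <= D"
 shows "MM (pet ts) Pfull <= ennreal D"
 unfolding MM_def SM_def
proof (intro SUP_least nn_le_fin[OF countable_V])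
 fix v X assume v: "v \<in> V" and X: "finite X" "X \<subseteq> V"
 have regf: "reg Pfull v w = V" for w unfolding reg_def by simp
 have "(\<Sum>w\<in>X. cn (pet ts) V v w * Th (L w - L v)) <= D"
 proof (rule sum_lt_approx)
  fix r assume r: "!!w. w \<in> X ==> r w < cn (pet ts) V v w"
  have "\<exists>t1. t0 <= t1 & t1 < ts & (\<forall>t. t1 <= t --> t < ts --> r w < cn (pet t) V v w)" if w: "w \<in> X" for w
  proof -
   obtain \<T> \<Lambda> where T: "finite \<T>" "\<T> \<subseteq> fam E" "r w < pr E (pet ts) \<T>" "\<Lambda> \<subseteq> V" "!!M. \<Lambda> \<subseteq> M ==> \<T> \<subseteq> pf E M v w"
    using cn_finite_witness[OF r[OF w]] by blast
   have e0: "pr E (pet ts) \<T> - r w > 0" using T(3) by simp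
   have tin: "ts \<in> {0..1}" using ts by auto
   obtain d where d: "d > 0" "\<forall>t\<in>{0..1}. dist t ts < d --> dist (pr E (pet t) \<T>) (pr E (pet ts) \<T>) < pr E (pet ts) \<T> - r w"
    using cont_pr[OF T(1,2), unfolded continuous_on_iff, rule_format, OF tin e0] by (elim exE conjE)
   show ?thesis
   proof (intro exI[of _ "max t0 (ts - d / 2)"] conjI allI impI)
    fix t assume t: "max t0 (ts - d / 2) <= t" "t < ts"
    have "dist (pr E (pet t) \<T>) (pr E (pet ts) \<T>) < pr E (pet ts) \<T> - r w"
     by (rule bspec[OF d(2), THEN mp]) (use t ts d(1) in \<open>auto simp: dist_real_def\<close>)
    then have "r w < pr E (pet t) \<T>" unfolding dist_real_def by linarith
    also have "... <= cn (pet t) V v w" unfolding cn_def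
     by (rule pr_mono[OF countable_E pth_fam]) (use T(5)[OF T(4)] in blast)
    finally show "r w < cn (pet t) V v w" .
   qed (use ts d(1) in auto)
  qed
  then obtain t1 where t1: "!!w. w \<in> X ==> t0 <= t1 w & t1 w < ts & (\<forall>t. t1 w <= t --> t < ts --> r w < cn (pet t) V v w)" by metis
  define t where "t = Max (insert t0 (t1 ` X))"
  have fi: "finite (insert t0 (t1 ` X))" using X(1) by simp
  have t: "t0 <= t" "!!w. w \<in> X ==> t1 w <= t" unfolding t_def using fi by (auto intro: Max_ge)
  have "t \<in> insert t0 (t1 ` X)" unfolding t_def using fi by (intro Max_in) auto
  then have tts: "t < ts" using ts(2) t1 by auto
  have "(\<Sum>w\<in>X. r w * Th (L w - L v)) <= (\<Sum>w\<in>X. cn (pet t) V v w * Th (L w - L v))"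
   using t1 t(2) tts by (intro sum_mono mult_right_mono less_imp_le) auto
  also have "... <= D"
  proof -
   have "(\<Sum>w\<in>X. ennreal (cn (pet t) V v w * Th (L w - L v))) <= SM (pet t) Pfull v"
    unfolding SM_def regf by (rule sum_le_nn[OF X])
   also have "... <= ennreal D" using SM_le_MM[OF v] D[OF t(1) tts] by (rule order_trans)
   finally have "ennreal (\<Sum>w\<in>X. cn (pet t) V v w * Th (L w - L v)) <= ennreal D" by simp
   then show ?thesis using D0 by (subst (asm) ennreal_le_iff) auto
  qed
  finally show "(\<Sum>w\<in>X. r w * Th (L w - L v)) <= D" .
 qed simp
 then show "(\<Sum>w\<in>X. ennreal (cn (pet ts) (reg Pfull v w) v w * Th (L w - L v))) <= ennreal D"
  unfolding regf by (simp add: ennreal_leI)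
qed

lemma MM_mono_t: assumes "0 <= t" "t <= t'" "t' <= 1" shows "MM (pet t) P' <= MM (pet t') P'"
 unfolding MM_def SM_def
proof (intro SUP_mono' nn_integral_mono ennreal_leI mult_right_mono)
 fix v w
 show "cn (pet t) (reg P' v w) v w <= cn (pet t') (reg P' v w) v w" by (rule cn_mono_pe[OF pm[OF assms]])
qed simp

lemma MM_0: "MM (pet 0) Pfull < \<top>"
proof -
 have "MM (pet 0) Pfull <= 2"
  unfolding MM_def SM_def
 proof (rule SUP_least)
  fix v assume v: "v \<in> V"
  have z: "cn (pet 0) S v w = 0" if "w \<noteq> v" for S w
  proof -
   have "ennreal (cn (pet 0) S v w) <= (\<integral>\<^sup>+e. ennreal (pp E (pet 0) (%xi. xi e)) \<partial>count_space E)"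
    unfolding cn_def
   proof (rule pp_ex_le_sum[OF countable_E ms_coord])
    fix xi assume "occ (pf E S v w) xi"
    then obtain p where p: "walk E S v w p" "\<forall>e\<in>edgs p. xi e" unfolding occ_def pf_def pth_def by blast
    obtain x r' where r': "p = x # r'" using p(1) unfolding walk_def by (cases p) auto
    have "r' \<noteq> []" using p(1) that unfolding r' walk_def by auto
    then obtain y r where "p = x # y # r" using r' by (cases r') auto
    then have "{x, y} \<in> edgs p" by simp
    then show "\<exists>e\<in>E. xi e" using p unfolding walk_def by blast
   qed
   also have "... = (\<integral>\<^sup>+e. 0 \<partial>count_space E)" by (intro nn_integral_cong) (simp add: pp_coord p0)
   finally show ?thesis using cn_nonneg[of "pet 0" S v w] by simp
  qed
  have "(\<integral>\<^sup>+w. ennreal (cn (pet 0) (reg Pfull v w) v w * Th (L w - L v)) \<partial>count_space V) <= (\<integral>\<^sup>+w. 2 * indicator {v} w \<partial>count_space V)"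
  proof (rule nn_integral_mono)
   fix w
   show "ennreal (cn (pet 0) (reg Pfull v w) v w * Th (L w - L v)) <= 2 * indicator {v} w"
   proof (cases "w = v")
    case True
    have "cn (pet 0) (reg Pfull v w) v w * 2 <= 2" by simp
    from ennreal_leI[OF this] show ?thesis using True by simp
   qed (simp add: z)
  qed
  also have "... = 2" using v by (simp add: nn_integral_cmult)
  finally show "(\<integral>\<^sup>+w. ennreal (cn (pet 0) (reg Pfull v w) v w * Th (L w - L v)) \<partial>count_space V) <= 2" .
 qed
 then show ?thesis by (rule le_less_trans) simp
qed

text \<open>With all edges open every connection has probability 1, and infinitely many vertices of
  \<open>Ob\<close> lie at heights where \<open>Th\<close> is at least 1.\<close>

lemma MM_1: "\<not> MM (pet 1) Pfull < \<top>"
proof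
 assume "MM (pet 1) Pfull < \<top>"
 then have "SM (pet 1) Pfull ob < \<top>" using SM_le_MM[OF ob_V] by (rule le_less_trans[rotated])
 then obtain D where D: "SM (pet 1) Pfull ob = ennreal D" "0 <= D" by (metis ennreal_cases less_irrefl infinity_ennreal_def)
 obtain N :: nat where N: "D < real N" using reals_Archimedean2 by blast
 have "\<forall>k::nat. \<exists>x\<in>Ob. s * (L x - L ob) = \<bar>s\<bar> * real k"
 proof
  fix k :: nat
  show "\<exists>x\<in>Ob. s * (L x - L ob) = \<bar>s\<bar> * real k"
  proof (cases "s > 0")
   case True
   obtain x where "x \<in> Ob" "L x = L ob + real k" using far_Ob(1) by blast
   then show ?thesis using True by (intro bexI[of _ x]) auto
  next
   case False
   obtain x where "x \<in> Ob" "L x = L ob - real k" using far_Ob(2) by blast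
   then show ?thesis using False by (intro bexI[of _ x]) auto
  qed
 qed
 then obtain x where x: "!!k::nat. x k \<in> Ob & s * (L (x k) - L ob) = \<bar>s\<bar> * real k" by metis
 have inj: "inj x"
 proof (rule injI)
  fix i j assume "x i = x j"
  then have "\<bar>s\<bar> * real i = \<bar>s\<bar> * real j" using conjunct2[OF x[of i]] conjunct2[OF x[of j]] by (simp only:)
  then show "i = j" using s0 by simp
 qed
 let ?X = "x ` {..<N}"
 have XV: "?X \<subseteq> V" using x Ob_V by blast
 have regf: "reg Pfull v w = V" for v w unfolding reg_def by simp
 have one: "1 <= cn (pet 1) V ob w * Th (L w - L ob)" if w: "w \<in> ?X" for w
 proof -
  have wV: "w \<in> V" using w XV by blast
  obtain p where "walk E V ob w p" using E_conn[OF ob_V wV] by blast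
  from walk_distinct[OF this] obtain q where q: "q \<in> pth E V ob w" unfolding pth_def by blast
  have qE: "edgs q \<subseteq> E" using q unfolding pth_def walk_def by blast
  have "1 ^ card (edgs q) * pr E (pet 1) {{}} <= pr E (pet 1) (pf E V ob w)"
  proof (rule pr_ins[OF _ _ _ _ pth_fam finite_edgs qE order_refl])
   show "{{}} \<subseteq> fam E" unfolding fam_def by simp
   show "\<exists>T\<in>pf E V ob w. T \<subseteq> edgs q \<union> S" for S unfolding pf_def using q by blast
  qed (use p1 in auto)
  then have "1 <= cn (pet 1) V ob w" unfolding cn_def by (simp add: pr_empty)
  moreover have "1 <= Th (L w - L ob)"
  proof -
   obtain k where "w = x k" using w by blast
   then have "0 <= s * (L w - L ob)" using x[of k] by simp
   then have "1 <= exp (1/2 * s * (L w - L ob))" by simp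
   also have "... <= Th (L w - L ob)" by (rule Th_ge) auto
   finally show ?thesis .
  qed
  ultimately show ?thesis using mult_mono[of 1 "cn (pet 1) V ob w" 1 "Th (L w - L ob)"] by simp
 qed
 have "real N = (\<Sum>w\<in>?X. 1)" using card_image[OF inj_on_subset[OF inj], of "{..<N}"] by simp
 also have "... <= (\<Sum>w\<in>?X. cn (pet 1) V ob w * Th (L w - L ob))" by (rule sum_mono) (rule one)
 finally have "ennreal (real N) <= (\<Sum>w\<in>?X. ennreal (cn (pet 1) V ob w * Th (L w - L ob)))" by (simp add: ennreal_leI)
 also have "... <= ennreal D" unfolding D(1)[symmetric] SM_def regf by (rule sum_le_nn[OF _ XV]) simp
 finally show False using N D(2) by (simp add: ennreal_le_iff)
qed

end

section \<open>The finite-volume criterion\<close>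

context gr
begin

lemma bl_mono: "m <= n ==> bl v m \<subseteq> bl v n"
 unfolding bl_def by auto

lemma bl_ext: assumes x: "x \<in> bl v n" and e: "{x, y} \<in> E" shows "y \<in> bl v (Suc n)"
proof -
 obtain p where p: "walk E V v x p" "length p <= Suc n" using x unfolding bl_def by blast
 have "walk E V x y [x, y]" using e edge_V[OF e] unfolding walk_def by simp
 from walk_append[OF p(1) this] have "walk E V v y (p @ [y])" by simp
 then show ?thesis unfolding bl_def using p(2) by (intro CollectI exI[of _ "p @ [y]"]) simp
qed

text \<open>The boundary edges of the ball, oriented outwards.\<close>

definition Bp :: "nat \<Rightarrow> 'v \<Rightarrow> ('v \<times> 'v) set" where
 "Bp n v = {z. fst z \<in> bl v n & snd z \<in> V & snd z \<notin> bl v n & {fst z, snd z} \<in> E}"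

lemma Bp_sub: "Bp n v \<subseteq> Sigma (bl v n) (%x. {w. {x, w} \<in> E})"
 unfolding Bp_def by auto

lemma Bp_fin: assumes "v \<in> V" shows "finite (Bp n v)"
 by (rule finite_subset[OF Bp_sub finite_SigmaI[OF bl_fin[OF assms] nb_fin]]) (use bl_V in blast)

end

context hg
begin

text \<open>The weighted Simon-Lieb functional of a ball, with the probability that the boundary
  edge is open replaced by 1.\<close>

definition phi :: "('v set \<Rightarrow> real) \<Rightarrow> nat \<Rightarrow> 'v \<Rightarrow> real" where
 "phi pe n v = (\<Sum>z\<in>Bp n v. cn pe (bl v n) v (fst z) * Th (L (snd z) - L v))"

lemma phi_g: assumes pe: "inv_pe pe" and g: "ga \<in> \<Gamma>" and v: "v \<in> V" shows "phi pe n (ga v) = phi pe n v"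
proof -
 obtain \<eta> where e: "\<eta> \<in> \<Gamma>" "!!x. x \<in> V ==> \<eta> (ga x) = x & ga (\<eta> x) = x" using g_inv[OF g] by blast
 have sub: "map_prod ga ga z \<in> Bp n (ga v)" if g: "ga \<in> \<Gamma>" and z: "z \<in> Bp n v" and v: "v \<in> V" for ga z v
 proof -
  have z': "fst z \<in> bl v n" "snd z \<in> V" "snd z \<notin> bl v n" "{fst z, snd z} \<in> E" using z unfolding Bp_def by auto
  have f: "fst z \<in> V" using z'(1) bl_V by blast
  show ?thesis unfolding Bp_def mem_Collect_eq fst_map_prod snd_map_prod bl_g[OF g v f] bl_g[OF g v z'(2)]
   using z' gV[OF g z'(2)] E_inv[OF g z'(4)] by blast
 qed
 have gv: "ga v \<in> V" by (rule gV[OF g v])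
 have BV: "fst z \<in> V & snd z \<in> V" if "z \<in> Bp n v" for z v using that bl_V unfolding Bp_def by blast
 have bij: "bij_betw (map_prod ga ga) (Bp n v) (Bp n (ga v))"
 proof (rule bij_betwI[of _ _ _ "map_prod \<eta> \<eta>"])
  show "map_prod ga ga \<in> Bp n v \<rightarrow> Bp n (ga v)" using sub[OF g _ v] by blast
  show "map_prod \<eta> \<eta> \<in> Bp n (ga v) \<rightarrow> Bp n v" using sub[OF e(1) _ gv] e(2)[OF v] by auto
  show "map_prod \<eta> \<eta> (map_prod ga ga z) = z" if "z \<in> Bp n v" for z using BV[OF that] e(2) by (cases z) simp
  show "map_prod ga ga (map_prod \<eta> \<eta> z) = z" if "z \<in> Bp n (ga v)" for z using BV[OF that] e(2) by (cases z) simp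
 qed
 have cnb: "cn pe (bl (ga v) n) (ga v) (ga x) = cn pe (bl v n) v x" if x: "x \<in> V" for x
 proof -
  have b: "bl v n = {x \<in> V. x \<in> bl v n}" for v using bl_V by blast
  have "cn pe {x \<in> V. x \<in> bl (ga v) n} (ga v) (ga x) = cn pe {x \<in> V. x \<in> bl v n} v x"
   by (rule cn_g[OF pe g _ v x]) (rule bl_g[OF g v])
  then show ?thesis using b[of v] b[of "ga v"] by simp
 qed
 have "phi pe n (ga v) = (\<Sum>z\<in>Bp n v. cn pe (bl (ga v) n) (ga v) (fst (map_prod ga ga z)) * Th (L (snd (map_prod ga ga z)) - L (ga v)))"
  unfolding phi_def by (rule sum.reindex_bij_betw[OF bij, symmetric])
 also have "... = phi pe n v" unfolding phi_def
  using BV cnb L_inv[OF g _ v] by (intro sum.cong refl) simp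
 finally show ?thesis .
qed

text \<open>The inner boundaries of balls of different radii are disjoint, so their contributions
  belong to one convergent sum and cannot all be at least \<delta>.\<close>

lemma phi_small:
 assumes v: "v \<in> V" and A: "MM pe Pfull <= ennreal A" "0 <= A" and d: "0 < \<delta>"
 shows "\<exists>n. phi pe n v < \<delta>"
proof (rule ccontr)
 assume "\<not> ?thesis"
 then have big: "\<delta> <= phi pe n v" for n by (simp add: not_less)
 obtain t where t: "t \<ge> 0" "!!x y. {x, y} \<in> E ==> \<bar>L x - L y\<bar> <= t" using lip by blast
 obtain dg where dg: "!!v. v \<in> V ==> card {w. {v, w} \<in> E} <= dg" using deg_bound by blast
 let ?h = "%x. cn pe V v x * Th (L x - L v)"
 define K where "K = real dg * exp (\<bar>s\<bar> * t)"
 have K: "0 <= K" unfolding K_def by simp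
 define Bn where "Bn n = {x \<in> bl v n. \<exists>y\<in>V. y \<notin> bl v n & {x, y} \<in> E}" for n
 have fB: "finite (Bn n)" for n unfolding Bn_def using bl_fin[OF v, of n] by simp
 have BV: "Bn n \<subseteq> V" for n unfolding Bn_def using bl_V by blast
 have hn: "0 <= ?h x" for x by simp
 have one: "phi pe n v <= K * (\<Sum>x\<in>Bn n. ?h x)" for n
 proof -
  have "phi pe n v <= (\<Sum>z\<in>Bp n v. exp (\<bar>s\<bar> * t) * ?h (fst z))"
   unfolding phi_def
  proof (rule sum_mono)
   fix z assume "z \<in> Bp n v"
   then have e: "{fst z, snd z} \<in> E" unfolding Bp_def by simp
   have "Th (L (snd z) - L v) = Th ((L (fst z) - L v) + (L (snd z) - L (fst z)))" by simp
   also have "... <= exp (\<bar>s\<bar> * \<bar>L (snd z) - L (fst z)\<bar>) * Th (L (fst z) - L v)" by (rule Th_lip)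
   also have "... <= exp (\<bar>s\<bar> * t) * Th (L (fst z) - L v)"
    using t(2)[OF e] by (intro mult_right_mono iffD2[OF exp_le_cancel_iff] mult_left_mono) (auto simp: abs_minus_commute)
   finally have "cn pe (bl v n) v (fst z) * Th (L (snd z) - L v) <= cn pe V v (fst z) * (exp (\<bar>s\<bar> * t) * Th (L (fst z) - L v))"
    using cn_mono[OF bl_V, of pe v n v "fst z"] by (intro mult_mono) auto
   then show "cn pe (bl v n) v (fst z) * Th (L (snd z) - L v) <= exp (\<bar>s\<bar> * t) * ?h (fst z)" by (simp only: ac_simps)
  qed
  also have "... <= (\<Sum>z\<in>Sigma (Bn n) (%x. {w. {x, w} \<in> E}). exp (\<bar>s\<bar> * t) * ?h (fst z))"
  proof (rule sum_mono2)
   show "finite (Sigma (Bn n) (%x. {w. {x, w} \<in> E}))" by (rule finite_SigmaI[OF fB nb_fin]) (use BV in blast)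
   show "Bp n v \<subseteq> Sigma (Bn n) (%x. {w. {x, w} \<in> E})" unfolding Bp_def Bn_def by auto
  qed simp
  also have "... = (\<Sum>x\<in>Bn n. \<Sum>y\<in>{w. {x, w} \<in> E}. exp (\<bar>s\<bar> * t) * ?h x)"
   using BV nb_fin by (subst sum.Sigma[OF fB]) (auto simp: split_def)
  also have "... <= (\<Sum>x\<in>Bn n. K * ?h x)"
  proof (rule sum_mono)
   fix x assume "x \<in> Bn n"
   then have "card {w. {x, w} \<in> E} <= dg" using BV dg by blast
   then have "real (card {w. {x, w} \<in> E}) * (exp (\<bar>s\<bar> * t) * ?h x) <= real dg * (exp (\<bar>s\<bar> * t) * ?h x)" by (intro mult_right_mono) auto
   then show "(\<Sum>y\<in>{w. {x, w} \<in> E}. exp (\<bar>s\<bar> * t) * ?h x) <= K * ?h x" unfolding K_def by (simp add: mult.assoc)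
  qed
  finally show ?thesis by (simp only: sum_distrib_left)
 qed
 have disj: "Bn i \<inter> Bn j = {}" if "i < j" for i j
 proof (rule ccontr)
  assume "Bn i \<inter> Bn j \<noteq> {}"
  then obtain x where "x \<in> Bn i" "x \<in> Bn j" by blast
  then obtain y where y: "x \<in> bl v i" "y \<notin> bl v j" "{x, y} \<in> E" unfolding Bn_def by blast
  have "y \<in> bl v (Suc i)" by (rule bl_ext[OF y(1,3)])
  then show False using y(2) bl_mono[of "Suc i" j v] that by auto
 qed
 have SMv: "SM pe Pfull v <= ennreal A" using SM_le_MM[OF v] A(1) by (rule order_trans)
 have regf: "reg Pfull v w = V" for w unfolding reg_def by simp
 obtain N :: nat where N: "K * A / \<delta> < real N" using reals_Archimedean2 by blast
 have "real N * \<delta> = (\<Sum>n<N. \<delta>)" by simp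
 also have "... <= (\<Sum>n<N. K * (\<Sum>x\<in>Bn n. ?h x))" by (rule sum_mono) (rule order_trans[OF big one])
 also have "... = K * (\<Sum>n<N. \<Sum>x\<in>Bn n. ?h x)" by (simp only: sum_distrib_left)
 also have "(\<Sum>n<N. \<Sum>x\<in>Bn n. ?h x) = (\<Sum>x\<in>(\<Union>n<N. Bn n). ?h x)"
 proof (rule sum.UNION_disjoint[symmetric])
  show "\<forall>i\<in>{..<N}. \<forall>j\<in>{..<N}. i \<noteq> j --> Bn i \<inter> Bn j = {}" using disj by (metis Int_commute linorder_neqE_nat)
 qed (use fB in auto)
 also have "K * (\<Sum>x\<in>(\<Union>n<N. Bn n). ?h x) <= K * A"
 proof (rule mult_left_mono[OF _ K])
  have "(\<Sum>x\<in>(\<Union>n<N. Bn n). ennreal (?h x)) <= SM pe Pfull v" unfolding SM_def regf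
   by (rule sum_le_nn) (use fB BV in auto)
  also note SMv
  finally have "ennreal (\<Sum>x\<in>(\<Union>n<N. Bn n). ?h x) <= ennreal A" by simp
  then show "(\<Sum>x\<in>(\<Union>n<N. Bn n). ?h x) <= A" using A(2) by (subst (asm) ennreal_le_iff) auto
 qed
 finally have "real N * \<delta> <= K * A" .
 then show False using N d by (simp add: pos_divide_less_eq)
qed

text \<open>The cut at the first exit from the ball gives S u <= K1 + Sm / 2. It is carried out
  inside a finite set \<open>\<Lambda>\<close>, where the maximum \<open>Sm\<close> is finite and
  can be absorbed; the resulting bound does not depend on \<open>\<Lambda>\<close>.\<close>

lemma finite_criterion:
 assumes pe: "inv_pe pe" and n: "!!v. v \<in> V ==> nv v <= nm & phi pe (nv v) v <= 1 / 2"
 shows "MM pe Pfull < \<top>"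
proof -
 obtain t where t: "t \<ge> 0" "!!x y. {x, y} \<in> E ==> \<bar>L x - L y\<bar> <= t" using lip by blast
 define K1 where "K1 = real (Bd nm) * (exp (\<bar>s\<bar> * (t * (real nm + 1))) * 2)"
 have near: "(\<Sum>w\<in>bl v (nv v). Th (L w - L v)) <= K1" if v: "v \<in> V" for v
 proof -
  have sub: "bl v (nv v) \<subseteq> bl v nm" using bl_mono n[OF v] by blast
  have "(\<Sum>w\<in>bl v (nv v). Th (L w - L v)) <= (\<Sum>w\<in>bl v nm. Th (L w - L v))"
   by (rule sum_mono2[OF bl_fin[OF v] sub]) simp
  also have "... <= (\<Sum>w\<in>bl v nm. exp (\<bar>s\<bar> * (t * (real nm + 1))) * 2)"
  proof (rule sum_mono)
   fix w assume "w \<in> bl v nm"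
   then obtain p where p: "walk E V v w p" "length p <= Suc nm" unfolding bl_def by blast
   have "w \<in> set p" using p(1) last_in_set[of p] unfolding walk_def by auto
   from walk_lip[OF t(2,1) p(1) this] have "\<bar>L w - L v\<bar> <= t * real (length p)" by simp
   also have "... <= t * (real nm + 1)" using p(2) t(1) by (intro mult_left_mono) auto
   finally have "\<bar>s\<bar> * \<bar>L w - L v\<bar> <= \<bar>s\<bar> * (t * (real nm + 1))" by (rule mult_left_mono) simp
   then have e: "exp (\<bar>s\<bar> * \<bar>L w - L v\<bar>) * 2 <= exp (\<bar>s\<bar> * (t * (real nm + 1))) * 2"
    by (intro mult_right_mono iffD2[OF exp_le_cancel_iff]) auto
   have th: "Th (L w - L v) <= exp (\<bar>s\<bar> * \<bar>L w - L v\<bar>) * 2" using Th_lip[of 0 "L w - L v"] by simp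
   show "Th (L w - L v) <= exp (\<bar>s\<bar> * (t * (real nm + 1))) * 2" by (rule order_trans[OF th e])
  qed
  also have "... = real (card (bl v nm)) * (exp (\<bar>s\<bar> * (t * (real nm + 1))) * 2)" by simp
  also have "... <= K1" unfolding K1_def using Bd[OF v, of nm] by (intro mult_right_mono) auto
  finally show ?thesis .
 qed
 have K1: "0 <= K1" unfolding K1_def by simp
 have fin: "(\<Sum>w\<in>\<Lambda>. cn pe \<Lambda> v w * Th (L w - L v)) <= 2 * K1" if La: "finite \<Lambda>" "\<Lambda> \<subseteq> V" "v \<in> \<Lambda>" for \<Lambda> v
 proof -
  define S where "S v = (\<Sum>w\<in>\<Lambda>. cn pe \<Lambda> v w * Th (L w - L v))" for v
  have S0: "0 <= S v" for v unfolding S_def by (intro sum_nonneg) simp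
  define Sm where "Sm = Max (S ` \<Lambda>)"
  have Sm: "S y <= Sm" if "y \<in> \<Lambda>" for y unfolding Sm_def using La(1) that by (intro Max_ge) auto
  have Sm0: "0 <= Sm" using Sm[OF La(3)] S0[of v] by linarith
  have Sm': "S y <= Sm" for y
  proof (cases "y \<in> \<Lambda>")
   case False
   then have "S y = 0" unfolding S_def by (simp add: cn_zero)
   then show ?thesis using Sm0 by simp
  qed (rule Sm)
  have rec: "S u <= K1 + 1 / 2 * Sm" if u: "u \<in> \<Lambda>" for u
  proof -
   have uV: "u \<in> V" using u La(2) by blast
   let ?B = "bl u (nv u)" and ?P = "Bp (nv u) u"
   let ?c = "%z. cn pe ?B u (fst z)"
   have fP: "finite ?P" by (rule Bp_fin[OF uV])
   have far: "cn pe \<Lambda> u w <= (\<Sum>z\<in>?P. ?c z * cn pe \<Lambda> (snd z) w)" if w: "w \<in> \<Lambda> - ?B" for w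
   proof -
    have "ennreal (cn pe \<Lambda> u w) <= (\<integral>\<^sup>+z. ennreal (pr E pe (pf E ?B u (fst z)) * pr E pe (pf E \<Lambda> (snd z) w)) \<partial>count_space ?P)"
     unfolding cn_def[of pe \<Lambda> u w]
    proof (rule pp_le_sum_BK[OF countable_E inv_pe01[OF pe] countable_finite[OF fP] pth_fam pth_fam])
     fix xi assume "occ (pf E \<Lambda> u w) xi"
     then obtain p where p: "p \<in> pth E \<Lambda> u w" "\<forall>e\<in>edgs p. xi e" unfolding occ_def pf_def by blast
     from pth_exit_split[OF p(1) bl_refl[OF uV], of "nv u"] w obtain x y A C where
      xy: "x \<in> ?B \<inter> \<Lambda>" "y \<in> \<Lambda> - ?B" "{x, y} \<in> E" "A \<in> pf E (\<Lambda> \<inter> ?B) u x" "C \<in> pf E \<Lambda> y w" "A \<inter> C = {}" "A \<union> C \<subseteq> edgs p" by blast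
     have A: "A \<in> pf E ?B u x" by (rule subsetD[OF pf_mono xy(4)]) blast
     have z: "(x, y) \<in> ?P" unfolding Bp_def using xy(1-3) La(2) by auto
     have "\<forall>e\<in>A \<union> C. xi e" using xy(7) p(2) by blast
     then have "\<exists>A\<in>pf E ?B u (fst (x, y)). \<exists>C\<in>pf E \<Lambda> (snd (x, y)) w. A \<inter> C = {} & (\<forall>e\<in>A \<union> C. xi e)"
      using A xy(5,6) by (intro bexI[of _ A] bexI[of _ C]) auto
     then show "\<exists>z\<in>?P. \<exists>A\<in>pf E ?B u (fst z). \<exists>C\<in>pf E \<Lambda> (snd z) w. A \<inter> C = {} & (\<forall>e\<in>A \<union> C. xi e)"
      by (rule bexI[OF _ z])
    qed
    also have "... = ennreal (\<Sum>z\<in>?P. ?c z * cn pe \<Lambda> (snd z) w)"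
     unfolding nn_integral_count_space_finite[OF fP] cn_def by (rule sum_ennreal) (simp add: pp_nonneg)
    finally show ?thesis by (subst (asm) ennreal_le_iff) (auto intro: sum_nonneg)
   qed
   have "S u = (\<Sum>w\<in>\<Lambda> \<inter> ?B. cn pe \<Lambda> u w * Th (L w - L u)) + (\<Sum>w\<in>\<Lambda> - ?B. cn pe \<Lambda> u w * Th (L w - L u))"
    unfolding S_def using sum.Int_Diff[OF La(1)] .
   also have "(\<Sum>w\<in>\<Lambda> \<inter> ?B. cn pe \<Lambda> u w * Th (L w - L u)) <= K1"
   proof -
    have "(\<Sum>w\<in>\<Lambda> \<inter> ?B. cn pe \<Lambda> u w * Th (L w - L u)) <= (\<Sum>w\<in>\<Lambda> \<inter> ?B. 1 * Th (L w - L u))"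
     by (intro sum_mono mult_right_mono) auto
    also have "... <= (\<Sum>w\<in>?B. 1 * Th (L w - L u))" by (rule sum_mono2[OF bl_fin[OF uV]]) auto
    finally show ?thesis using near[OF uV] by simp
   qed
   also have "(\<Sum>w\<in>\<Lambda> - ?B. cn pe \<Lambda> u w * Th (L w - L u)) <= (\<Sum>w\<in>\<Lambda> - ?B. \<Sum>z\<in>?P. (?c z * Th (L (snd z) - L u)) * (cn pe \<Lambda> (snd z) w * Th (L w - L (snd z))))"
   proof (rule sum_mono)
    fix w assume w: "w \<in> \<Lambda> - ?B"
    have "cn pe \<Lambda> u w * Th (L w - L u) <= (\<Sum>z\<in>?P. ?c z * cn pe \<Lambda> (snd z) w) * Th (L w - L u)" using far[OF w] by (rule mult_right_mono) simp
    also have "... = (\<Sum>z\<in>?P. ?c z * cn pe \<Lambda> (snd z) w * Th (L w - L u))" by (simp only: sum_distrib_right)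
    also have "... <= (\<Sum>z\<in>?P. (?c z * Th (L (snd z) - L u)) * (cn pe \<Lambda> (snd z) w * Th (L w - L (snd z))))"
    proof (rule sum_mono)
     fix z :: "'v \<times> 'v"
     have "Th (L w - L u) <= Th (L (snd z) - L u) * Th (L w - L (snd z))" using Th_submult[of "L (snd z) - L u" "L w - L (snd z)"] by simp
     then have "(?c z * cn pe \<Lambda> (snd z) w) * Th (L w - L u) <= (?c z * cn pe \<Lambda> (snd z) w) * (Th (L (snd z) - L u) * Th (L w - L (snd z)))"
      by (rule mult_left_mono) simp
     then show "?c z * cn pe \<Lambda> (snd z) w * Th (L w - L u) <= (?c z * Th (L (snd z) - L u)) * (cn pe \<Lambda> (snd z) w * Th (L w - L (snd z)))" by (simp only: ac_simps)
    qed
    finally show "cn pe \<Lambda> u w * Th (L w - L u) <= (\<Sum>z\<in>?P. (?c z * Th (L (snd z) - L u)) * (cn pe \<Lambda> (snd z) w * Th (L w - L (snd z))))" .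
   qed
   also have "... = (\<Sum>z\<in>?P. \<Sum>w\<in>\<Lambda> - ?B. (?c z * Th (L (snd z) - L u)) * (cn pe \<Lambda> (snd z) w * Th (L w - L (snd z))))" by (rule sum.swap)
   also have "... <= (\<Sum>z\<in>?P. (?c z * Th (L (snd z) - L u)) * Sm)"
   proof (rule sum_mono)
    fix z :: "'v \<times> 'v"
    have "(\<Sum>w\<in>\<Lambda> - ?B. cn pe \<Lambda> (snd z) w * Th (L w - L (snd z))) <= S (snd z)" unfolding S_def by (rule sum_mono2[OF La(1)]) auto
    also have "... <= Sm" by (rule Sm')
    finally have "(?c z * Th (L (snd z) - L u)) * (\<Sum>w\<in>\<Lambda> - ?B. cn pe \<Lambda> (snd z) w * Th (L w - L (snd z))) <= (?c z * Th (L (snd z) - L u)) * Sm" by (rule mult_left_mono) simp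
    then show "(\<Sum>w\<in>\<Lambda> - ?B. (?c z * Th (L (snd z) - L u)) * (cn pe \<Lambda> (snd z) w * Th (L w - L (snd z)))) <= (?c z * Th (L (snd z) - L u)) * Sm"
     by (simp only: sum_distrib_left)
   qed
   also have "... = phi pe (nv u) u * Sm" unfolding phi_def by (simp only: sum_distrib_right)
   also have "... <= 1 / 2 * Sm" using n[OF uV] Sm0 by (intro mult_right_mono) auto
   finally show ?thesis by linarith
  qed
  have "Sm \<in> S ` \<Lambda>" unfolding Sm_def using La by (intro Max_in) auto
  then have "Sm <= K1 + 1 / 2 * Sm" using rec by auto
  then have "Sm <= 2 * K1" by linarith
  then show ?thesis using Sm[OF La(3)] unfolding S_def by linarith
 qed
 have "MM pe Pfull <= ennreal (2 * K1)"
  unfolding MM_def SM_def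
 proof (intro SUP_least nn_le_fin[OF countable_V])
  fix v X assume v: "v \<in> V" and X: "finite X" "X \<subseteq> V"
  have regf: "reg Pfull v w = V" for w unfolding reg_def by simp
  have "(\<Sum>w\<in>X. cn pe V v w * Th (L w - L v)) <= 2 * K1"
  proof (rule sum_lt_approx)
   fix r assume r: "!!w. w \<in> X ==> r w < cn pe V v w"
   have "\<forall>w\<in>X. \<exists>\<Lambda>. finite \<Lambda> & \<Lambda> \<subseteq> V & (\<forall>M. \<Lambda> \<subseteq> M --> r w <= cn pe M v w)"
   proof
    fix w assume w: "w \<in> X"
    obtain \<T> \<Lambda> where T: "r w < pr E pe \<T>" "finite \<Lambda>" "\<Lambda> \<subseteq> V" "!!M. \<Lambda> \<subseteq> M ==> \<T> \<subseteq> pf E M v w"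
     using cn_finite_witness[OF r[OF w]] by blast
    have "r w <= cn pe M v w" if M: "\<Lambda> \<subseteq> M" for M
    proof -
     have "pr E pe \<T> <= cn pe M v w" unfolding cn_def
     proof (rule pr_mono[OF countable_E pth_fam])
      fix S assume "S \<in> \<T>"
      then have "S \<in> pf E M v w" using T(4)[OF M] by (rule subsetD[rotated])
      then show "\<exists>U\<in>pf E M v w. U \<subseteq> S" by (rule bexI[rotated]) simp
     qed
     then show ?thesis using T(1) by linarith
    qed
    then show "\<exists>\<Lambda>. finite \<Lambda> & \<Lambda> \<subseteq> V & (\<forall>M. \<Lambda> \<subseteq> M --> r w <= cn pe M v w)" using T(2,3) by blast
   qed
   then obtain F where F: "!!w. w \<in> X ==> finite (F w) & F w \<subseteq> V & (\<forall>M. F w \<subseteq> M --> r w <= cn pe M v w)" by metis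
   define M where "M = insert v (X \<union> (\<Union>w\<in>X. F w))"
   have M: "finite M" "M \<subseteq> V" "v \<in> M" "X \<subseteq> M" unfolding M_def using F X v by auto
   have "(\<Sum>w\<in>X. r w * Th (L w - L v)) <= (\<Sum>w\<in>X. cn pe M v w * Th (L w - L v))"
   proof (intro sum_mono mult_right_mono)
    fix w assume w: "w \<in> X"
    have "F w \<subseteq> M" unfolding M_def using w by blast
    then show "r w <= cn pe M v w" using F[OF w] by blast
   qed simp
   also have "... <= (\<Sum>w\<in>M. cn pe M v w * Th (L w - L v))" by (rule sum_mono2[OF M(1,4)]) simp
   also have "... <= 2 * K1" by (rule fin[OF M(1-3)])
   finally show "(\<Sum>w\<in>X. r w * Th (L w - L v)) <= 2 * K1" .
  qed simp
  then show "(\<Sum>w\<in>X. ennreal (cn pe (reg Pfull v w) v w * Th (L w - L v))) <= ennreal (2 * K1)"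
   unfolding regf by (simp add: ennreal_leI)
 qed
 then show ?thesis by (rule le_less_trans) simp
qed

end

section \<open>The supremum of the parameters with finite weighted susceptibility\<close>

context hgp
begin

text \<open>\<open>phi\<close> involves finitely many edges and is therefore continuous in the
  parameter. By invariance it is enough to check one vertex in each orbit.\<close>

lemma open_sub:
 assumes T: "T \<in> {0..1}" "MM (pet T) Pfull < \<top>"
 shows "\<exists>d>0. \<forall>t\<in>{0..1}. \<bar>t - T\<bar> < d --> MM (pet t) Pfull < \<top>"
proof -
 obtain A where A: "MM (pet T) Pfull <= ennreal A" "1 <= A" using real_MM[OF T(2)] by blast
 obtain R where R: "finite R" "R \<subseteq> V" "!!v. v \<in> V ==> \<exists>r\<in>R. v \<in> orb r" using reps_ex by blast
 have "\<forall>r\<in>R. \<exists>n. phi (pet T) n r < 1 / 2"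
 proof
  fix r assume "r \<in> R"
  then have "r \<in> V" using R(2) by blast
  then show "\<exists>n. phi (pet T) n r < 1 / 2" by (rule phi_small[OF _ A(1)]) (use A(2) in auto)
 qed
 then obtain n where n: "!!r. r \<in> R ==> phi (pet T) (n r) r < 1 / 2" by metis
 have "\<forall>r\<in>R. \<exists>d>0. \<forall>t\<in>{0..1}. \<bar>t - T\<bar> < d --> phi (pet t) (n r) r < 1 / 2"
 proof
  fix r assume r: "r \<in> R"
  then have rV: "r \<in> V" using R(2) by blast
  have c: "continuous_on {0..1} (%t. phi (pet t) (n r) r)"
   unfolding phi_def
  proof (intro continuous_on_sum continuous_on_mult continuous_on_const)
   fix z
   show "continuous_on {0..1} (%t. cn (pet t) (bl r (n r)) r (fst z))"
    unfolding cn_def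
   proof (rule cont_pr)
    have "pf E (bl r (n r)) r (fst z) \<subseteq> Pow (Pow (bl r (n r)))" using pf_edge(2) by blast
    then show "finite (pf E (bl r (n r)) r (fst z))" using bl_fin[OF rV] by (meson finite_Pow_iff finite_subset)
   qed (rule pth_fam)
  qed
  have e0: "0 < 1 / 2 - phi (pet T) (n r) r" using n[OF r] by simp
  obtain d where d: "d > 0" "\<forall>t\<in>{0..1}. dist t T < d --> dist (phi (pet t) (n r) r) (phi (pet T) (n r) r) < 1 / 2 - phi (pet T) (n r) r"
   using c[unfolded continuous_on_iff, rule_format, OF T(1) e0] by (elim exE conjE)
  have "phi (pet t) (n r) r < 1 / 2" if t: "t \<in> {0..1}" "\<bar>t - T\<bar> < d" for t
   using bspec[OF d(2) t(1)] t(2) unfolding dist_real_def by linarith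
  then show "\<exists>d>0. \<forall>t\<in>{0..1}. \<bar>t - T\<bar> < d --> phi (pet t) (n r) r < 1 / 2" using d(1) by blast
 qed
 then obtain d where d: "!!r. r \<in> R ==> d r > 0 & (\<forall>t\<in>{0..1}. \<bar>t - T\<bar> < d r --> phi (pet t) (n r) r < 1 / 2)" by metis
 define dd where "dd = Min (insert 1 (d ` R))"
 have fi: "finite (insert 1 (d ` R))" using R(1) by simp
 have dd: "dd > 0" unfolding dd_def using fi d by (subst Min_gr_iff) auto
 have ddr: "dd <= d r" if "r \<in> R" for r unfolding dd_def using fi that by (intro Min_le) auto
 obtain rr where rr: "!!v. v \<in> V ==> rr v \<in> R & v \<in> orb (rr v)" using R(3) by metis
 show ?thesis
 proof (rule exI[of _ dd], intro conjI dd ballI impI)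
  fix t assume t: "t \<in> {0..1}" "\<bar>t - T\<bar> < dd"
  have it: "inv_pe (pet t)" by (rule P[OF t(1)])
  show "MM (pet t) Pfull < \<top>"
  proof (rule finite_criterion[OF it, of "%v. n (rr v)" "\<Sum>r\<in>R. n r"], rule conjI)
   fix v assume v: "v \<in> V"
   have r: "rr v \<in> R" "v \<in> orb (rr v)" using rr[OF v] by auto
   have rV: "rr v \<in> V" using r(1) R(2) by blast
   show "n (rr v) <= (\<Sum>r\<in>R. n r)" by (rule member_le_sum[OF r(1) _ R(1)]) simp
   obtain ga where g: "ga \<in> \<Gamma>" "ga (rr v) = v" using r(2) unfolding orb_def by (auto elim: imageE)
   have "phi (pet t) (n (rr v)) v = phi (pet t) (n (rr v)) (rr v)" using phi_g[OF it g(1) rV, of "n (rr v)"] unfolding g(2) .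
   also have "... < 1 / 2" using d[OF r(1)] t ddr[OF r(1)] by (meson less_le_trans)
   finally show "phi (pet t) (n (rr v)) v <= 1 / 2" by simp
  qed
 qed
qed

text \<open>If \<kappa> + s <= \<alpha>, a uniform bound below \<open>ts\<close> contradicts
  divergence at \<open>ts\<close>. If \<alpha> < s, the reversed heights lead to growth. In the
  remaining case \<alpha> - s lies between 0 and \<kappa>, and the uniform bound holds for reversed
  heights. Growth without reversal cannot arise, since \<kappa> + s is positive.\<close>

lemma exists_interval: assumes sp: "0 < s"
 shows "\<exists>t1 ts a. 0 < t1 & t1 < ts & ts <= 1 & (\<forall>t. 0 <= t --> t < ts --> MM (pet t) Pfull < \<top>) & a \<in> V & 0 < pp E (pet t1) (infc a)"
proof -
 define T where "T = {t \<in> {0..1}. MM (pet t) Pfull < \<top>}"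
 define ts where "ts = Sup T"
 have bT: "bdd_above T" unfolding T_def by (intro bdd_aboveI[of _ 1]) auto
 have T0: "0 \<in> T" unfolding T_def using MM_0 by simp
 have ts01: "0 <= ts" "ts <= 1" unfolding ts_def using T0 bT by (auto intro: cSup_upper cSup_least simp: T_def)
 have down: "MM (pet t) Pfull < \<top>" if "0 <= t" "t < ts" for t
 proof -
  obtain x where x: "x \<in> T" "t < x" using \<open>t < ts\<close> T0 bT unfolding ts_def by (metis empty_iff less_cSup_iff)
  have "MM (pet t) Pfull <= MM (pet x) Pfull" by (rule MM_mono_t) (use that x in \<open>auto simp: T_def\<close>)
  then show ?thesis using x(1) unfolding T_def by (auto intro: le_less_trans)
 qed
 have notin: "ts \<notin> T"
 proof
  assume tin: "ts \<in> T"
  then have m: "MM (pet ts) Pfull < \<top>" "ts \<in> {0..1}" unfolding T_def by auto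
  have "ts \<noteq> 1" using m(1) MM_1 by auto
  then have t1: "ts < 1" using ts01 by simp
  obtain d where d: "d > 0" "\<forall>t\<in>{0..1}. \<bar>t - ts\<bar> < d --> MM (pet t) Pfull < \<top>" using open_sub[OF m(2,1)] by blast
  define t where "t = min 1 (ts + d / 2)"
  have t: "ts < t" "t \<in> {0..1}" "\<bar>t - ts\<bar> < d" unfolding t_def using d(1) t1 ts01 by (auto simp: min_def)
  then have "t \<in> T" unfolding T_def using d(2) by blast
  then have "t <= ts" unfolding ts_def using bT by (rule cSup_upper)
  then show False using t(1) by simp
 qed
 have tspos: "0 < ts" using notin T0 ts01(1) by (cases "ts = 0") auto
 have ts': "0 < ts" "ts <= 1" using tspos ts01 by auto
 \<comment> \<open>In \<open>N\<close> ascents and descents exchange their roles, and with them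
   \<alpha> and \<kappa>, while the weighted susceptibility stays the same.\<close>
 interpret N: hgp V \<Gamma> E "%x. - L x" "- s" g ob pet by (rule neg_hgp)
 have NRw: "N.Rwf n = Rmf ob n" for n
 proof -
  have "{y \<in> V. - L ob <= - L y & - L y <= - L b} = {y \<in> V. L b <= L y & L y <= L ob}" for b by auto
  moreover have "{b \<in> Ob. real n <= - L b - - L ob & - L b - - L ob < real n + 1} = {a \<in> Ob. real n <= L ob - L a & L ob - L a < real n + 1}" by auto
  ultimately show ?thesis unfolding N.Rwf_def Rmf_def by (simp only:)
 qed
 have NRm: "N.Rmf ob n = Rwf n" for n
 proof -
  have "{y \<in> V. - L b <= - L y & - L y <= - L ob} = {y \<in> V. L ob <= L y & L y <= L b}" for b by auto
  moreover have "{b \<in> Ob. real n <= - L ob - - L b & - L ob - - L b < real n + 1} = {a \<in> Ob. real n <= L a - L ob & L a - L ob < real n + 1}" by auto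
  ultimately show ?thesis unfolding N.Rmf_def Rwf_def by (simp only:)
 qed
 have NMM: "N.MM pe (%a b. True) = MM pe Pfull" for pe
 proof -
  have "N.Th (- L w - - L v) = Th (L w - L v)" for v w unfolding N.Th_def Th_def by (simp add: algebra_simps)
  then show ?thesis unfolding N.MM_def MM_def N.SM_def SM_def N.reg_def reg_def by simp
 qed
 obtain c where c: "c > 0" "c <= 1" "!!t e. ts / 2 <= t ==> t <= ts ==> e \<in> E ==> c <= pet t e" using half_low[OF ts'] by blast
 have its: "inv_pe (pet ts)" by (rule P) (use ts01 in simp)
 have cts: "\<forall>e\<in>E. c <= pet ts e" using c(3)[of ts] ts' by auto
 obtain k1 where k1: "!!n. c * exp (- (k1 * real n)) <= pr E (pet ts) (Rwf n)" using Rw_lower[OF c(1,2)] its cts by blast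
 obtain k2 where k2: "!!n. c * exp (- (k2 * real n)) <= pr E (pet ts) (Rmf ob n)" using N.Rw_lower[OF c(1,2)] its cts unfolding NRw by blast
 obtain \<alpha> where al0: "0 <= \<alpha> & (\<forall>f'<\<alpha>. \<exists>K>0. \<forall>n. pr E (pet ts) (Rwf n) <= K * exp (- f' * real n)) &
  (\<forall>f'>\<alpha>. \<forall>K. \<exists>n. pr E (pet ts) (Rwf n) > K * exp (- f' * real n))"
  using rate_exists[of "%n. pr E (pet ts) (Rwf n)", OF pp_nonneg pp_le_1 c(1) k1] by (rule exE)
 note al = conjunct1[OF al0] conjunct1[OF conjunct2[OF al0], rule_format] conjunct2[OF conjunct2[OF al0], rule_format]
 obtain \<kappa> where ka0: "0 <= \<kappa> & (\<forall>f'<\<kappa>. \<exists>K>0. \<forall>n. pr E (pet ts) (Rmf ob n) <= K * exp (- f' * real n)) &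
  (\<forall>f'>\<kappa>. \<forall>K. \<exists>n. pr E (pet ts) (Rmf ob n) > K * exp (- f' * real n))"
  using rate_exists[of "%n. pr E (pet ts) (Rmf ob n)", OF pp_nonneg pp_le_1 c(1) k2] by (rule exE)
 note ka = conjunct1[OF ka0] conjunct1[OF conjunct2[OF ka0], rule_format] conjunct2[OF conjunct2[OF ka0], rule_format]
 have nobound: False if B: "0 < t0" "t0 < ts" "!!t. t0 <= t ==> t < ts ==> MM (pet t) Pfull < \<top> ==> MM (pet t) Pfull <= ennreal D" for t0 D
 proof -
  have "MM (pet t) Pfull <= ennreal (max 0 D)" if "t0 <= t" "t < ts" for t
   using B(3)[OF that down] that B(1) by (meson ennreal_leI less_imp_le max.cobounded2 order_trans)
  then have "MM (pet ts) Pfull <= ennreal (max 0 D)" by (rule closed_left[OF B(1,2) ts01(2)]) simp_all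
  then have "MM (pet ts) Pfull < \<top>" by (rule le_less_trans) simp
  then show False using notin ts01 unfolding T_def by simp
 qed
 have "\<exists>t0 a. 0 < t0 & t0 < ts & a \<in> V & 0 < pp E (pet t0) (infc a)"
 proof (cases "\<kappa> + s <= \<alpha>")
  case True
  \<comment> \<open>Here \<open>om\<close> is 3s/4, which is less than s and hence less than
    \<kappa> + s.\<close>
  have "om < \<alpha>" "0 < \<alpha>" using True ka(1) sp unfolding om_def max_def by (auto split: if_splits)
  note h = this
  have "\<exists>t0 D. 0 < t0 & t0 < ts & (\<forall>t. t0 <= t --> t < ts --> MM (pet t) Pfull < \<top> --> MM (pet t) Pfull <= ennreal D)"
   by (rule main_bounded[OF ts' _ True h(2,1) al(2) ka(3)]) (use ka(1) sp in simp)
  then obtain t0 D where "0 < t0" "t0 < ts" "!!t. t0 <= t ==> t < ts ==> MM (pet t) Pfull < \<top> ==> MM (pet t) Pfull <= ennreal D" by blast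
  then show ?thesis using nobound by blast
 next
  case F1: False
  show ?thesis
  proof (cases "\<alpha> < s")
   case True
   have "\<alpha> + - s < 0" using True by simp
   then show ?thesis by (rule N.main_growth[OF ts']) (unfold NRm, rule al(3))
  next
   case False
   \<comment> \<open>For reversed heights \<open>om\<close> is - s/4 and therefore negative.\<close>
   have h: "0 <= \<alpha> + - s" "\<alpha> + - s <= \<kappa>" "0 < \<kappa>" "N.om < \<kappa>" using False F1 sp unfolding N.om_def max_def by (auto split: if_splits)
   have "\<exists>t0 D. 0 < t0 & t0 < ts & (\<forall>t. t0 <= t --> t < ts --> N.MM (pet t) (%a b. True) < \<top> --> N.MM (pet t) (%a b. True) <= ennreal D)"
   proof (rule N.main_bounded[OF ts' h])
    show "\<exists>K>0. \<forall>n. pr E (pet ts) (N.Rwf n) <= K * exp (- f' * real n)" if "f' < \<kappa>" for f' unfolding NRw by (rule ka(2)[OF that])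
    show "\<exists>n. K * exp (- b' * real n) < pr E (pet ts) (N.Rmf ob n)" if "\<alpha> < b'" for b' K unfolding NRm by (rule al(3)[OF that])
   qed
   then obtain t0 D where "0 < t0" "t0 < ts" "!!t. t0 <= t ==> t < ts ==> MM (pet t) Pfull < \<top> ==> MM (pet t) Pfull <= ennreal D"
    unfolding NMM by blast
   then show ?thesis using nobound by blast
  qed
 qed
 then show ?thesis using down ts01(2) by blast
qed

end

section \<open>Infinitely many light clusters\<close>

lemma pp_lim_dec:
 assumes Q: "!!n :: nat. ms E (Q n)" and dec: "!!n xi. Q (Suc n) xi ==> Q n xi"
 shows "(%n. pp E pe (Q n)) \<longlonglongrightarrow> pp E pe (%xi. \<forall>n. Q n xi)"
proof -
 interpret prob_space "PM E pe" by simp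
 let ?A = "%n. {xi \<in> space (PM E pe). Q n xi}"
 have "decseq ?A" by (rule decseq_SucI) (use dec in blast)
 moreover have "range ?A \<subseteq> sets (PM E pe)" using msD[OF Q] by blast
 ultimately have "(%n. measure (PM E pe) (?A n)) \<longlonglongrightarrow> measure (PM E pe) (\<Inter>n. ?A n)" by (intro finite_Lim_measure_decseq)
 moreover have "(\<Inter>n. ?A n) = {xi \<in> space (PM E pe). \<forall>n. Q n xi}" by blast
 ultimately show ?thesis unfolding pp_def by simp
qed

text \<open>Continuity from above: for every N the union of the events with index at least N has
  probability at least \<open>\<theta>\<close>.\<close>

lemma pp_limsup_ge:
 assumes Q: "!!n :: nat. ms E (Q n)" and th: "!!n. \<theta> <= pp E pe (Q n)"
 shows "\<theta> <= pp E pe (%xi. \<forall>N. \<exists>n\<in>{N..}. Q n xi)"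
proof (rule LIMSEQ_le_const)
 have m: "ms E (%xi. \<exists>n\<in>{N..}. Q n xi)" for N :: nat by (rule ms_ex[OF countableI_type Q])
 show "(%N. pp E pe (%xi. \<exists>n\<in>{N..}. Q n xi)) \<longlonglongrightarrow> pp E pe (%xi. \<forall>N. \<exists>n\<in>{N..}. Q n xi)"
 proof (rule pp_lim_dec[OF m])
  show "\<exists>n\<in>{N..}. Q n xi" if "\<exists>n\<in>{Suc N..}. Q n xi" for N xi using that by (meson Suc_leD atLeast_iff)
 qed
 have "\<theta> <= pp E pe (%xi. \<exists>n\<in>{N..}. Q n xi)" for N
  by (rule order_trans[OF th[of N] pp_mono[OF m]]) auto
 then show "\<exists>N. \<forall>n\<ge>N. \<theta> <= pp E pe (%xi. \<exists>k\<in>{n..}. Q k xi)" by blast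
qed

text \<open>A cylinder depends on finitely many coordinates, of which the event is independent.
  Cylinders are stable under intersection and generate the sigma-algebra, so the event is
  independent of itself.\<close>

lemma zero_one:
 assumes P: "ms E P" and d: "!!F. finite F ==> F \<subseteq> E ==> dep (E - F) P" and pos: "0 < pp E pe P"
 shows "AE xi in PM E pe. P xi"
proof -
 interpret prob_space "PM E pe" by simp
 let ?c = "%_. count_space (UNIV :: bool set)"
 let ?A = "{xi \<in> space (PM E pe). P xi}" and ?G = "prod_algebra E ?c"
 have A: "?A \<in> events" by (rule msD[OF P])
 have sp: "(\<Pi>\<^sub>E i\<in>E. space (?c i)) = space (PM E pe)" unfolding space_PM by simp
 have ev: "events = sigma_sets (space (PM E pe)) ?G" unfolding sets_PM sets_PiM sp ..
 have ind: "prob (?A \<inter> b) = prob ?A * prob b" if b: "b \<in> ?G" for b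
 proof -
  obtain J X where J: "b = prod_emb E ?c J (Pi\<^sub>E J X)" "finite J" "J \<subseteq> E" using b by (rule prod_algebraE)
  let ?Q = "%xi. \<forall>j\<in>J. xi j \<in> X j"
  have bQ: "b = {xi \<in> space (PM E pe). ?Q xi}" unfolding J(1) prod_emb_def sp by (auto simp: PiE_def Pi_def)
  have "b \<in> events" using b unfolding ev by (rule sigma_sets.Basic)
  then have Q: "ms E ?Q" unfolding bQ ms_def space_PM sets_PM .
  have dQ: "dep J ?Q" unfolding dep_def by simp
  have "pp E pe (%xi. P xi & ?Q xi) = pp E pe P * pp E pe ?Q"
   by (rule pp_indep[OF P d[OF J(2,3)] Q dQ]) (use J(3) in auto)
  moreover have "?A \<inter> b = {xi \<in> space (PM E pe). P xi & ?Q xi}" unfolding bQ by blast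
  ultimately show ?thesis unfolding pp_def bQ by simp
 qed
 have "indep_set {?A} ?G"
 proof (rule indep_setI)
  show "{?A} \<subseteq> events" using A by simp
  show "?G \<subseteq> events" unfolding ev by (auto intro: sigma_sets.Basic)
  show "prob (a \<inter> b) = prob a * prob b" if "a \<in> {?A}" "b \<in> ?G" for a b using ind[OF that(2)] that(1) by simp
 qed
 then have i: "indep_set (sigma_sets (space (PM E pe)) {?A}) (sigma_sets (space (PM E pe)) ?G)"
  by (rule indep_set_sigma_sets) (simp_all add: Int_stable_prod_algebra, simp add: Int_stable_def)
 have "prob (?A \<inter> ?A) = prob ?A * prob ?A"
  by (rule indep_setD[OF i]) (use A in \<open>auto simp: ev[symmetric] intro: sigma_sets.Basic\<close>)
 then have "prob ?A = 1" using pos unfolding pp_def by simp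
 then show ?thesis using AE_prob_1[of ?A] by (auto elim: eventually_mono)
qed

lemma sum_sq_le: fixes h :: "'a \<Rightarrow> real" assumes h: "!!x. x \<in> X ==> 0 <= h x" "finite X"
 shows "(\<Sum>x\<in>X. h x ^ 2) <= (\<Sum>x\<in>X. h x) ^ 2"
proof -
 have "(\<Sum>x\<in>X. h x ^ 2) <= (\<Sum>x\<in>X. h x * (\<Sum>y\<in>X. h y))" unfolding power2_eq_square
  using h by (intro sum_mono mult_left_mono member_le_sum) auto
 then show ?thesis by (simp add: power2_eq_square sum_distrib_right)
qed

context gr
begin

definition cl :: "('v set \<Rightarrow> bool) \<Rightarrow> 'v \<Rightarrow> 'v set" where "cl xi v = {w \<in> V. occ (pf E V v w) xi}"

definition opn :: "('v set \<Rightarrow> bool) \<Rightarrow> ('v \<times> 'v) set" where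
 "opn xi = {(x, y). {x, y} \<in> E & xi {x, y} & x \<in> V & y \<in> V}"

lemma infc_cl: "infc a xi \<longleftrightarrow> infinite (cl xi a)"
 unfolding infc_def cl_def ..

lemma cl_opn: "cl xi v = {w \<in> V. (v, w) \<in> (opn xi)\<^sup>*}"
 unfolding cl_def opn_def using occ_pf[of _ V E v xi] by blast

lemma opn_sym: "(x, y) \<in> (opn xi)\<^sup>* ==> (y, x) \<in> (opn xi)\<^sup>*"
proof -
 have "sym (opn xi)" unfolding sym_def opn_def by (auto simp: insert_commute)
 then show "(x, y) \<in> (opn xi)\<^sup>* ==> (y, x) \<in> (opn xi)\<^sup>*" using sym_rtrancl symD by metis
qed

lemma cl_refl: "v \<in> V ==> v \<in> cl xi v"
 unfolding cl_opn by simp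

lemma clusters_cl: "clusters V (open_edges E xi) = cl xi ` V"
proof -
 have "{u \<in> V. linked (open_edges E xi) v u} = cl xi v" for v
 proof -
  have "occ (pf E V v u) xi \<longleftrightarrow> linked (open_edges E xi) v u" if "u \<in> V" for u by (rule occ_linked[OF that edge_sub])
  then show ?thesis unfolding cl_def by blast
 qed
 then show ?thesis unfolding clusters_def by blast
qed

lemma dep_infc: "dep E (infc a)"
proof -
 have "occ (pf E V a w) xi = occ (pf E V a w) xi'" if "\<forall>e\<in>E. xi e = xi' e" for w and xi xi' :: "'v set \<Rightarrow> bool"
 proof -
  have "\<Union> (pf E V a w) \<subseteq> E" using pth_fam[of E V a w] unfolding fam_def by blast
  from dep_occ[OF this] show ?thesis using that unfolding dep_def by blast
 qed
 note * = this
 show ?thesis unfolding dep_def infc_def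
 proof (intro allI impI)
  fix xi xi' :: "'v set \<Rightarrow> bool" assume a: "\<forall>e\<in>E. xi e = xi' e"
  have "{w \<in> V. occ (pf E V a w) xi} = {w \<in> V. occ (pf E V a w) xi'}" using *[OF a] by simp
  then show "infinite {w \<in> V. occ (pf E V a w) xi} = infinite {w \<in> V. occ (pf E V a w) xi'}" by simp
 qed
qed

text \<open>If a change of the edges in \<open>F\<close> makes the cluster of v finite, the new
  cluster contains an endpoint of an edge of \<open>F\<close>. So v lies in the union
  \<open>Z\<close> of finitely many finite clusters, and an injective sequence leaves
  \<open>Z\<close> eventually.\<close>

lemma dep_limsup_infc:
 assumes y: "inj y" "!!n :: nat. y n \<in> V" and F: "finite F" "F \<subseteq> E"
 shows "dep (E - F) (%xi. \<forall>N. \<exists>n\<in>{N..}. infc (y n) xi)"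
proof -
 have fU: "finite (\<Union>F)"
 proof (rule finite_Union[OF F(1)])
  show "finite e" if "e \<in> F" for e using E_edge[of e] that F(2) by auto
 qed
 have *: "\<exists>n\<in>{N..}. infc (y n) xi'"
  if ag: "!!e. e \<in> E - F ==> xi e = xi' e" and J: "\<forall>N. \<exists>n\<in>{N..}. infc (y n) xi" for xi xi' N
 proof -
  define Z where "Z = (\<Union>u\<in>{u \<in> \<Union>F. finite (cl xi' u)}. cl xi' u)"
  have fZ: "finite Z" unfolding Z_def
  proof (rule finite_UN_I)
   show "finite {u \<in> \<Union>F. finite (cl xi' u)}" by (rule finite_subset[OF _ fU]) blast
  qed simp
  have bad: "v \<in> Z" if v: "v \<in> V" and i: "infc v xi" "\<not> infc v xi'" for v
  proof -
   have "\<exists>u\<in>\<Union>F. u \<in> cl xi' v"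
   proof (rule ccontr)
    assume no: "\<not> ?thesis"
    have "z \<in> cl xi' v" if "(v, z) \<in> (opn xi)\<^sup>*" for z using that
    proof (induction rule: rtrancl_induct)
     case base then show ?case by (rule cl_refl[OF v])
    next
     case (step x z)
     then have xz: "{x, z} \<in> E" "xi {x, z}" "z \<in> V" "x \<in> V" unfolding opn_def by auto
     have "{x, z} \<notin> F" using no step.IH by blast
     then have "xi' {x, z}" using ag[of "{x, z}"] xz by simp
     then have "(x, z) \<in> opn xi'" using xz unfolding opn_def by simp
     then show ?case using step.IH xz(3) unfolding cl_opn by (auto intro: rtrancl_into_rtrancl)
    qed
    then have "cl xi v \<subseteq> cl xi' v" unfolding cl_opn[of xi] by blast
    then show False using i unfolding infc_cl by (auto dest: finite_subset)
   qed
   then obtain u where u: "u \<in> \<Union>F" "u \<in> cl xi' v" by blast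
   have vu: "(v, u) \<in> (opn xi')\<^sup>*" using u(2) unfolding cl_opn by simp
   have "cl xi' u \<subseteq> cl xi' v" unfolding cl_opn using rtrancl_trans[OF vu] by blast
   then have "finite (cl xi' u)" using i(2) unfolding infc_cl by (auto dest: finite_subset)
   moreover have "v \<in> cl xi' u" unfolding cl_opn using v opn_sym[OF vu] by simp
   ultimately show ?thesis unfolding Z_def using u(1) by blast
  qed
  have "finite (y -` Z)" by (rule finite_vimageI[OF fZ y(1)])
  then obtain m where m: "\<forall>n\<in>y -` Z. n < m" using finite_nat_bounded[of "y -` Z"] by auto
  obtain n where n: "n \<in> {max N m..}" "infc (y n) xi" using J by blast
  have "y n \<notin> Z"
  proof
   assume "y n \<in> Z"
   then have "n < m" using m by (meson vimageI2)
   then show False using n(1) by simp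
  qed
  then have "infc (y n) xi'" using bad[OF y(2) n(2)] by blast
  then show ?thesis using n(1) by auto
 qed
 show ?thesis unfolding dep_def
 proof (intro allI impI iffI)
  fix xi xi' N assume "\<forall>e\<in>E - F. xi e = xi' e" "\<forall>N. \<exists>n\<in>{N..}. infc (y n) xi"
  then show "\<exists>n\<in>{N..}. infc (y n) xi'" by (intro *[of xi xi' N]) auto
 next
  fix xi xi' N assume "\<forall>e\<in>E - F. xi e = xi' e" "\<forall>N. \<exists>n\<in>{N..}. infc (y n) xi'"
  then show "\<exists>n\<in>{N..}. infc (y n) xi" by (intro *[of xi' xi N]) auto
 qed
qed

end

context hg
begin

lemma up_seq: assumes a: "a \<in> V"
 shows "\<exists>y. \<forall>k::nat. (\<exists>ga\<in>\<Gamma>. y k = ga a) & y k \<in> V & L (y k) = L a + real k"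
proof -
 have "\<exists>z. (\<exists>ga\<in>\<Gamma>. z = ga a) & z \<in> V & L z = L a + real k" for k
 proof -
  obtain x where x: "x \<in> Ob" "L x = L ob + real k" using far_Ob(1) by blast
  obtain ga where g: "ga \<in> \<Gamma>" "ga ob = x" using Ob_trans[OF ob_Ob x(1)] by blast
  have "L (ga a) - L (ga ob) = L a - L ob" by (rule L_inv[OF g(1) a ob_V])
  then have "L (ga a) = L a + real k" using x(2) g(2) by simp
  then show ?thesis using g(1) gV[OF g(1) a] by blast
 qed
 then show ?thesis by (intro choice allI)
qed

lemma pp_infc_g: assumes pe: "inv_pe pe" and g: "ga \<in> \<Gamma>" and a: "a \<in> V"
 shows "pp E pe (infc a) <= pp E pe (infc (ga a))"
proof -
 have gVV: "ga ` V = V" using g_bij[OF g] unfolding bij_betw_def by blast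
 have "pp E pe (infc a) = pp E pe (%xi. infc a (%e. xi (ga ` e)))"
  by (rule pp_g[OF pe g ms_infc[OF a] dep_infc, symmetric])
 also have "... <= pp E pe (infc (ga a))"
 proof (rule pp_mono[OF ms_infc[OF gV[OF g a]]])
  fix xi assume i: "infc a (%e. xi (ga ` e))"
  have sub: "ga ` cl (%e. xi (ga ` e)) a \<subseteq> cl xi (ga a)"
  proof
   fix z assume "z \<in> ga ` cl (%e. xi (ga ` e)) a"
   then obtain w A where w: "z = ga w" "w \<in> V" "A \<in> pf E V a w" "\<forall>e\<in>A. xi (ga ` e)" unfolding cl_def occ_def by blast
   have "(`) ga ` A \<in> pf E V (ga a) (ga w)" using pf_g[OF g subset_refl w(3)] unfolding gVV .
   then have "occ (pf E V (ga a) (ga w)) xi" unfolding occ_def using w(4) by (intro bexI[of _ "(`) ga ` A"]) auto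
   then show "z \<in> cl xi (ga a)" unfolding cl_def w(1) using gV[OF g w(2)] by simp
  qed
  have "inj_on ga (cl (%e. xi (ga ` e)) a)" by (rule inj_on_subset[OF g_inj[OF g]]) (auto simp: cl_def)
  then show "infc (ga a) xi" using i sub unfolding infc_cl by (meson finite_imageD finite_subset)
 qed
 finally show ?thesis .
qed

text \<open>An infinite cluster has no finite witness. The event is therefore written as a
  decreasing limit of connections to the outside of balls, which have one.\<close>

lemma pp_infc_mono:
 assumes pe: "!!e. e \<in> E ==> 0 <= pe e & pe e <= pe' e & pe' e <= 1" and a: "a \<in> V"
 shows "pp E pe (infc a) <= pp E pe' (infc a)"
proof (rule LIMSEQ_le_const)
 let ?D = "%n. \<Union>w\<in>V - bl a n. pf E V a w"
 have DF: "?D n \<subseteq> fam E" for n by (intro UN_least pth_fam)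
 have m: "ms E (occ (?D n))" for n by (rule ms_occ[OF countable_E DF])
 have oc: "occ (?D n) xi \<longleftrightarrow> (\<exists>w\<in>V - bl a n. occ (pf E V a w) xi)" for n xi unfolding occ_def by blast
 have i: "infc a = (%xi. \<forall>n. occ (?D n) xi)" unfolding oc using infc_iff[OF a] by (intro ext) simp
 show "(%n. pp E pe' (occ (?D n))) \<longlonglongrightarrow> pp E pe' (infc a)" unfolding i
 proof (rule pp_lim_dec[OF m])
  show "occ (?D n) xi" if "occ (?D (Suc n)) xi" for n xi
   using that bl_mono[of n "Suc n" a] unfolding oc by auto
 qed
 have "pp E pe (infc a) <= pp E pe' (occ (?D n))" for n
  by (rule order_trans[OF pp_mono[OF m[of n]] pr_mono_pe[OF countable_E DF pe]]) (auto simp: i)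
 then show "\<exists>N. \<forall>n\<ge>N. pp E pe (infc a) <= pp E pe' (occ (?D n))" by blast
qed

text \<open>The expected sum of the square roots of the weights is at most the weighted
  susceptibility, so this sum is finite almost surely. The sum of the weights themselves is at most
  its square; this is how exponent 1/2 yields lightness.\<close>

lemma cluster_sums_AE:
 assumes M: "MM pe Pfull < \<top>" and v: "v \<in> V"
 shows "AE xi in PM E pe. \<exists>K. \<forall>X. finite X --> X \<subseteq> cl xi v --> (\<Sum>w\<in>X. exp (s * (L w - L v))) <= K"
proof -
 interpret prob_space "PM E pe" by simp
 define h where "h w = exp (1 / 2 * s * (L w - L v))" for w
 define A where "A w = {xi \<in> space (PM E pe). occ (pf E V v w) xi}" for w
 define F where "F n xi = (\<Sum>w\<in>bl v n. ennreal (h w) * indicator (A w) xi)" for n xi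
 have Am: "A w \<in> events" for w unfolding A_def by (rule msD[OF ms_pf])
 have Fm: "F n \<in> borel_measurable (PM E pe)" for n unfolding F_def using Am by measurable
 have h0: "0 <= h w" for w unfolding h_def by simp
 have inc: "incseq F" unfolding F_def
  by (intro incseq_SucI le_funI sum_mono2 bl_fin[OF v] bl_mono) auto
 have int: "(\<integral>\<^sup>+xi. F n xi \<partial>PM E pe) <= SM pe Pfull v" for n
 proof -
  have "(\<integral>\<^sup>+xi. F n xi \<partial>PM E pe) = (\<Sum>w\<in>bl v n. \<integral>\<^sup>+xi. ennreal (h w) * indicator (A w) xi \<partial>PM E pe)"
   unfolding F_def
  proof (rule nn_integral_sum)
   show "(%xi. ennreal (h w) * indicator (A w) xi) \<in> borel_measurable (PM E pe)" for w using Am[of w] by measurable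
  qed
  also have "... = (\<Sum>w\<in>bl v n. ennreal (h w) * emeasure (PM E pe) (A w))"
   by (intro sum.cong refl nn_integral_cmult_indicator Am)
  also have "... <= (\<Sum>w\<in>bl v n. ennreal (cn pe (reg Pfull v w) v w * Th (L w - L v)))"
  proof (rule sum_mono)
   fix w
   have r: "reg Pfull v w = V" unfolding reg_def by simp
   have "ennreal (h w) * emeasure (PM E pe) (A w) = ennreal (h w * cn pe V v w)"
    unfolding emeasure_eq_measure cn_def pp_def A_def using h0[of w] by (simp add: ennreal_mult)
   also have "... <= ennreal (cn pe (reg Pfull v w) v w * Th (L w - L v))" unfolding r
    using Th_ge[of "1 / 2" "L w - L v"] by (intro ennreal_leI, subst mult.commute, intro mult_left_mono) (auto simp: h_def cn_def)
   finally show "ennreal (h w) * emeasure (PM E pe) (A w) <= ennreal (cn pe (reg Pfull v w) v w * Th (L w - L v))" .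
  qed
  also have "... <= SM pe Pfull v" unfolding SM_def by (rule sum_le_nn[OF bl_fin[OF v] bl_V])
  finally show ?thesis .
 qed
 have "(\<integral>\<^sup>+xi. (SUP n. F n xi) \<partial>PM E pe) = (SUP n. \<integral>\<^sup>+xi. F n xi \<partial>PM E pe)"
  by (rule nn_integral_monotone_convergence_SUP[OF inc Fm])
 also have "... <= SM pe Pfull v" by (rule SUP_least) (rule int)
 also have "... < \<top>" using SM_le_MM[OF v, of pe Pfull] M by (rule le_less_trans)
 finally have "(\<integral>\<^sup>+xi. (SUP n. F n xi) \<partial>PM E pe) \<noteq> \<infinity>" by simp
 moreover have "(%xi. SUP n. F n xi) \<in> borel_measurable (PM E pe)" by (rule borel_measurable_SUP[OF countableI_type Fm])
 ultimately have "AE xi in PM E pe. (SUP n. F n xi) \<noteq> \<infinity>" by (intro nn_integral_PInf_AE)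
 moreover have "AE xi in PM E pe. xi \<in> space (PM E pe)" by simp
 ultimately show ?thesis
 proof eventually_elim
  case (elim xi)
  obtain K where K: "0 <= K" "(SUP n. F n xi) = ennreal K" using elim(1) by (cases "SUP n. F n xi") auto
  have "(\<Sum>w\<in>X. exp (s * (L w - L v))) <= K ^ 2" if X: "finite X" "X \<subseteq> cl xi v" for X
  proof -
   have XV: "X \<subseteq> V" using X(2) unfolding cl_def by blast
   have "\<exists>n. w \<in> bl v n" if w: "w \<in> X" for w
   proof -
    obtain p where "walk E V v w p" using E_conn[OF v, of w] w XV by blast
    then have "w \<in> bl v (length p)" unfolding bl_def by (intro CollectI exI[of _ p]) simp
    then show ?thesis ..
   qed
   then obtain f where f: "!!w. w \<in> X ==> w \<in> bl v (f w)" by metis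
   define n where "n = (\<Sum>w\<in>X. f w)"
   have Xb: "X \<subseteq> bl v n"
   proof
    fix w assume w: "w \<in> X"
    have "f w <= n" unfolding n_def by (rule member_le_sum[OF w _ X(1)]) simp
    then show "w \<in> bl v n" using f[OF w] bl_mono by blast
   qed
   have "indicator (A w) xi = (1 :: ennreal)" if "w \<in> X" for w
    using that X(2) elim(2) unfolding cl_def A_def by (auto simp: indicator_def)
   then have "ennreal (\<Sum>w\<in>X. h w) = (\<Sum>w\<in>X. ennreal (h w) * indicator (A w) xi)"
    using h0 by (simp add: sum_ennreal)
   also have "... <= F n xi" unfolding F_def by (rule sum_mono2[OF bl_fin[OF v] Xb]) simp
   also have "... <= ennreal K" unfolding K(2)[symmetric] by (rule SUP_upper) simp
   finally have "(\<Sum>w\<in>X. h w) <= K" using K(1) by (subst (asm) ennreal_le_iff) auto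
   then have "(\<Sum>w\<in>X. h w) ^ 2 <= K ^ 2" by (intro power_mono sum_nonneg h0)
   moreover have "(\<Sum>w\<in>X. h w ^ 2) <= (\<Sum>w\<in>X. h w) ^ 2" by (rule sum_sq_le[OF h0 X(1)])
   moreover have "h w ^ 2 = exp (s * (L w - L v))" for w
    unfolding h_def power2_eq_square exp_add[symmetric] by (simp add: field_simps)
   ultimately show ?thesis by simp
  qed
  then show ?case by blast
 qed
qed

text \<open>\<open>m\<close> stands for the modular function, known here only through its comparison
  with the height.\<close>

lemma light_clusters_AE:
 assumes pe: "inv_pe pe" and M: "MM pe Pfull < \<top>" and sp: "0 < s" and a: "a \<in> V" and th: "0 < pp E pe (infc a)"
  and m: "!!v. v \<in> V ==> \<exists>D. \<forall>w\<in>V. 0 <= m v w & m v w <= D * exp (s * (L w - L v))"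
 shows "AE xi in PM E pe. infinite {C \<in> clusters V (open_edges E xi). infinite C & (\<exists>x\<in>V. (%y. m x y) summable_on C)}"
proof -
 obtain y where y: "!!k::nat. (\<exists>ga\<in>\<Gamma>. y k = ga a) & y k \<in> V & L (y k) = L a + real k" using up_seq[OF a] by blast
 have yV: "y k \<in> V" for k using y by blast
 have inj: "inj y" using y by (intro injI) (metis add_left_cancel of_nat_eq_iff)
 have pI: "pp E pe (infc a) <= pp E pe (infc (y n))" for n using y[of n] pp_infc_g[OF pe _ a] by metis
 have mi: "ms E (infc (y n))" for n by (rule ms_infc[OF yV])
 have "0 < pp E pe (%xi. \<forall>N. \<exists>n\<in>{N..}. infc (y n) xi)"
  using pp_limsup_ge[of E "%n. infc (y n)" "pp E pe (infc a)" pe, OF mi pI] th by linarith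
 moreover have "ms E (%xi. \<forall>N\<in>UNIV. \<exists>n\<in>{N..}. infc (y n) xi)"
  by (rule ms_all[OF countableI_type ms_ex[OF countableI_type mi]])
 ultimately have "AE xi in PM E pe. \<forall>N. \<exists>n\<in>{N..}. infc (y n) xi"
  by (intro zero_one dep_limsup_infc[OF inj yV]) auto
 moreover have "AE xi in PM E pe. \<forall>v\<in>V. \<exists>K. \<forall>X. finite X --> X \<subseteq> cl xi v --> (\<Sum>w\<in>X. exp (s * (L w - L v))) <= K"
  unfolding AE_ball_countable[OF countable_V] using cluster_sums_AE[OF M] by blast
 ultimately show ?thesis
 proof eventually_elim
  case (elim xi)
  have li: "\<exists>x\<in>V. (%y. m x y) summable_on cl xi v" if v: "v \<in> V" for v
  proof (rule bexI[OF _ v])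
   obtain K where K: "!!X. finite X ==> X \<subseteq> cl xi v ==> (\<Sum>w\<in>X. exp (s * (L w - L v))) <= K" using elim(2) v by blast
   obtain D where D: "!!w. w \<in> V ==> 0 <= m v w & m v w <= D * exp (s * (L w - L v))" using m[OF v] by blast
   have clV: "cl xi v \<subseteq> V" unfolding cl_def by blast
   have "(%w. exp (s * (L w - L v))) summable_on cl xi v"
    by (rule nonneg_bdd_above_summable_on) (auto intro!: bdd_aboveI[of _ K] K)
   then have "(%w. D * exp (s * (L w - L v))) summable_on cl xi v" by (rule summable_on_cmult_right)
   then show "(%w. m v w) summable_on cl xi v"
    by (rule summable_on_comparison_test) (use D clV in auto)
  qed
  let ?S = "{C \<in> clusters V (open_edges E xi). infinite C & (\<exists>x\<in>V. (%y. m x y) summable_on C)}"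
  show "infinite ?S"
  proof
   assume fin: "finite ?S"
   let ?I = "{n. infc (y n) xi}"
   have "infinite ?I" unfolding infinite_nat_iff_unbounded_le using elim(1) by auto
   moreover have "(%n. cl xi (y n)) ` ?I \<subseteq> ?S" unfolding clusters_cl using li[OF yV] yV by (auto simp: infc_cl)
   then have "finite ((%n. cl xi (y n)) ` ?I)" using fin by (rule finite_subset)
   \<comment> \<open>One cluster would contain infinitely many of the \<open>y n\<close>; the weight
     of a single one of them with large n exceeds the bound on the whole sum.\<close>
   ultimately obtain n0 where "infinite {n \<in> ?I. cl xi (y n) = cl xi (y n0)}"
    using pigeonhole_infinite[of ?I "%n. cl xi (y n)"] by blast
   note big = this
   obtain K where K: "!!X. finite X ==> X \<subseteq> cl xi (y n0) ==> (\<Sum>w\<in>X. exp (s * (L w - L (y n0)))) <= K" using elim(2) yV[of n0] by blast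
   obtain N :: nat where N: "K / s + real n0 < real N" using reals_Archimedean2 by blast
   obtain n where n: "N <= n" "cl xi (y n) = cl xi (y n0)" using big unfolding infinite_nat_iff_unbounded_le by blast
   have "y n \<in> cl xi (y n0)" using cl_refl[OF yV, of n xi] n(2) by simp
   then have "exp (s * (L (y n) - L (y n0))) <= K" using K[of "{y n}"] by simp
   moreover have "L (y n) - L (y n0) = real n - real n0" using y[of n] y[of n0] by simp
   ultimately have "exp (s * (real n - real n0)) <= K" by simp
   then have "s * (real n - real n0) <= K" using exp_ge_add_one_self[of "s * (real n - real n0)"] by linarith
   moreover have "K / s < real n - real n0" using N n(1) by linarith
   then have "K < s * (real n - real n0)" using sp by (simp add: pos_divide_less_eq mult.commute)
   ultimately show False by simp
  qed
 qed
qed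

lemma susceptibility_at_finite:
 assumes M: "MM pe Pfull < \<top>" and v: "v \<in> V"
  and m: "!!w. w \<in> V ==> 0 <= m w & m w <= D * exp (s * (L w - L v))"
  and c: "!!w. w \<in> V ==> c w = cn pe V w v"
 shows "(\<Sum>\<^sub>\<infinity>w\<in>V. ennreal (c w * m w powr (1 / 2))) < \<top>"
proof -
 have c': "c w = cn pe V v w" if "w \<in> V" for w using c[OF that] pf_sym[of E V w v] unfolding cn_def by simp
 have D: "0 <= D" using m[OF v] by auto
 have one: "ennreal (c w * m w powr (1 / 2)) <= ennreal (D powr (1 / 2)) * ennreal (cn pe (reg Pfull v w) v w * Th (L w - L v))" if w: "w \<in> V" for w
 proof -
  have r: "reg Pfull v w = V" unfolding reg_def by simp
  have "m w powr (1 / 2) <= (D * exp (s * (L w - L v))) powr (1 / 2)" using m[OF w] by (intro powr_mono2) auto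
  also have "... = D powr (1 / 2) * exp (1 / 2 * s * (L w - L v))" using D by (simp add: powr_mult exp_powr_real)
  also have "... <= D powr (1 / 2) * Th (L w - L v)" by (intro mult_left_mono Th_ge) auto
  finally have "c w * m w powr (1 / 2) <= cn pe V v w * (D powr (1 / 2) * Th (L w - L v))"
   unfolding c'[OF w] by (intro mult_left_mono) (auto simp: cn_def)
  also have "... = D powr (1 / 2) * (cn pe V v w * Th (L w - L v))" by simp
  finally have "ennreal (c w * m w powr (1 / 2)) <= ennreal (D powr (1 / 2) * (cn pe V v w * Th (L w - L v)))" by (rule ennreal_leI)
  also have "... = ennreal (D powr (1 / 2)) * ennreal (cn pe V v w * Th (L w - L v))"
   by (rule ennreal_mult) (auto simp: cn_def)
  finally show ?thesis unfolding r .
 qed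
 have "(\<Sum>\<^sub>\<infinity>w\<in>V. ennreal (c w * m w powr (1 / 2))) <= ennreal (D powr (1 / 2)) * SM pe Pfull v"
 proof (rule infsum_le_finite_sums)
  show "(%w. ennreal (c w * m w powr (1 / 2))) summable_on V" by (rule nonneg_summable_on_complete) simp
  fix X assume X: "finite X" "X \<subseteq> V"
  have "(\<Sum>w\<in>X. ennreal (c w * m w powr (1 / 2))) <= (\<Sum>w\<in>X. ennreal (D powr (1 / 2)) * ennreal (cn pe (reg Pfull v w) v w * Th (L w - L v)))"
   using X(2) by (intro sum_mono one) blast
  also have "... <= ennreal (D powr (1 / 2)) * SM pe Pfull v"
   unfolding sum_distrib_left[symmetric] SM_def by (intro mult_left_mono sum_le_nn[OF X]) simp
  finally show "(\<Sum>w\<in>X. ennreal (c w * m w powr (1 / 2))) <= ennreal (D powr (1 / 2)) * SM pe Pfull v" .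
 qed
 also have "... < \<top>" using SM_le_MM[OF v, of pe Pfull] M by (simp add: ennreal_mult_less_top le_less_trans)
 finally show ?thesis .
qed

end

section \<open>From the definitions of the theorem to the locales\<close>

lemma finite_walk_ball:
 assumes nb: "!!v. v \<in> V ==> finite {w. {v, w} \<in> E}"
 shows "v \<in> V ==> finite {w. \<exists>p. walk E V v w p & length p <= Suc n}"
proof (induction n arbitrary: v)
 case 0
 have "{w. \<exists>p. walk E V v w p & length p <= Suc 0} \<subseteq> {v}"
 proof
  fix w assume "w \<in> {w. \<exists>p. walk E V v w p & length p <= Suc 0}"
  then obtain p where "walk E V v w p" "length p <= 1" by auto
  then show "w \<in> {v}" unfolding walk_def by (cases p) auto
 qed
 then show ?case by (rule finite_subset) simp
next
 case (Suc n)
 let ?B = "%v n. {w. \<exists>p. walk E V v w p & length p <= Suc n}"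
 have "?B v (Suc n) \<subseteq> insert v (\<Union>x\<in>{x. {v, x} \<in> E} \<inter> V. ?B x n)"
 proof
  fix w assume "w \<in> ?B v (Suc n)"
  then obtain p where p: "walk E V v w p" "length p <= Suc (Suc n)" by blast
  show "w \<in> insert v (\<Union>x\<in>{x. {v, x} \<in> E} \<inter> V. ?B x n)"
  proof (cases "tl p")
   case Nil
   then have "w = v" using p(1) unfolding walk_def by (cases p) auto
   then show ?thesis by simp
  next
   case (Cons x q)
   then have pq: "p = v # x # q" using p(1) unfolding walk_def by (cases p) auto
   have "walk E V x w (x # q)" "{v, x} \<in> E" "x \<in> V" using p(1) unfolding walk_def pq by auto
   moreover have "length (x # q) <= Suc n" using p(2) unfolding pq by simp
   ultimately show ?thesis by blast
  qed
 qed
 moreover have "finite (insert v (\<Union>x\<in>{x. {v, x} \<in> E} \<inter> V. ?B x n))" using nb[OF Suc.prems] Suc.IH by blast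
 ultimately show ?case by (rule finite_subset)
qed

text \<open>The hypothesis \<open>subgroup \<Gamma> (graph_aut V E)\<close> refers to the operations
  of \<open>graph_aut\<close>; its group structure is what makes inverses in \<open>\<Gamma>\<close>
  act as inverse maps on \<open>V\<close>.\<close>

lemma group_graph_aut: "group (graph_aut V E)"
proof -
 let ?H = "{g \<in> Bij V. \<forall>u\<in>V. \<forall>v\<in>V. {g u, g v} \<in> E \<longleftrightarrow> {u, v} \<in> E}"
 have "subgroup ?H (BijGroup V)"
 proof (rule group.subgroupI[OF group_BijGroup])
  show "?H \<subseteq> carrier (BijGroup V)" unfolding BijGroup_def by auto
  have "(\<lambda>x\<in>V. x) \<in> ?H" using id_Bij by auto
  then show "?H \<noteq> {}" by blast
  fix a assume a: "a \<in> ?H"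
  then have aB: "a \<in> Bij V" by simp
  have i: "a (inv_into V a x) = x" "inv_into V a x \<in> V" if "x \<in> V" for x
   using Bij_inv_into_mem[OF aB that] aB that by (auto simp: Bij_def bij_betw_def f_inv_into_f)
  have "{inv_into V a u, inv_into V a v} \<in> E \<longleftrightarrow> {u, v} \<in> E" if uv: "u \<in> V" "v \<in> V" for u v
  proof -
   have "{a (inv_into V a u), a (inv_into V a v)} \<in> E \<longleftrightarrow> {inv_into V a u, inv_into V a v} \<in> E"
    using a i(2)[OF uv(1)] i(2)[OF uv(2)] by blast
   then show ?thesis unfolding i(1)[OF uv(1)] i(1)[OF uv(2)] by simp
  qed
  then show "m_inv (BijGroup V) a \<in> ?H" unfolding inv_BijGroup[OF aB] using restrict_inv_into_Bij[OF aB] by simp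
  fix b assume b: "b \<in> ?H"
  then have bV: "b x \<in> V" if "x \<in> V" for x using that Bij_imp_funcset[of b V] by auto
  have "a \<otimes>\<^bsub>BijGroup V\<^esub> b = compose V a b" using a b by (simp add: BijGroup_def)
  then show "a \<otimes>\<^bsub>BijGroup V\<^esub> b \<in> ?H" using a b bV compose_Bij[of a V b] by (simp add: compose_eq)
 qed
 then show ?thesis unfolding graph_aut_def by (rule subgroup.subgroup_is_group[OF _ group_BijGroup])
qed

lemma graph_aut_action:
 assumes S: "subgroup \<Gamma> (graph_aut V E)"
 shows "gact V \<Gamma>" and "ga \<in> \<Gamma> ==> u \<in> V ==> v \<in> V ==> {ga u, ga v} \<in> E \<longleftrightarrow> {u, v} \<in> E"
proof -
 let ?G = "graph_aut V E"
 interpret S: subgroup \<Gamma> ?G by (rule S)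
 interpret G: group ?G by (rule group_graph_aut)
 have sub: "ga \<in> Bij V & (\<forall>u\<in>V. \<forall>v\<in>V. {ga u, ga v} \<in> E \<longleftrightarrow> {u, v} \<in> E)" if "ga \<in> \<Gamma>" for ga
  using subsetD[OF S.subset that] unfolding graph_aut_def by simp
 have mu: "(ga \<otimes>\<^bsub>?G\<^esub> \<delta>) x = ga (\<delta> x)" if "ga \<in> \<Gamma>" "\<delta> \<in> \<Gamma>" "x \<in> V" for ga \<delta> x
  using sub[OF that(1)] sub[OF that(2)] that(3) by (simp add: graph_aut_def BijGroup_def compose_eq)
 have on: "one ?G x = x" if "x \<in> V" for x using that by (simp add: graph_aut_def BijGroup_def)
 show "ga \<in> \<Gamma> ==> u \<in> V ==> v \<in> V ==> {ga u, ga v} \<in> E \<longleftrightarrow> {u, v} \<in> E" using sub by blast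
 show "gact V \<Gamma>"
 proof
  show "bij_betw ga V V" if "ga \<in> \<Gamma>" for ga using sub[OF that] unfolding Bij_def by simp
  show "\<exists>ga\<in>\<Gamma>. \<forall>x\<in>V. ga x = x" using S.one_closed on by blast
  show "\<exists>\<eta>\<in>\<Gamma>. \<forall>x\<in>V. \<eta> x = ga (\<delta> x)" if "ga \<in> \<Gamma>" "\<delta> \<in> \<Gamma>" for ga \<delta>
   using S.m_closed[OF that] mu[OF that] by blast
  show "\<exists>\<eta>\<in>\<Gamma>. \<forall>x\<in>V. \<eta> (ga x) = x & ga (\<eta> x) = x" if g: "ga \<in> \<Gamma>" for ga
  proof (rule bexI[of _ "m_inv ?G ga"], intro ballI conjI)
   show i: "m_inv ?G ga \<in> \<Gamma>" by (rule S.m_inv_closed[OF g])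
   have c: "ga \<in> carrier ?G" by (rule S.mem_carrier[OF g])
   fix x assume x: "x \<in> V"
   show "m_inv ?G ga (ga x) = x" using mu[OF i g x] on[OF x] G.l_inv[OF c] by simp
   show "ga (m_inv ?G ga x) = x" using mu[OF g i x] on[OF x] G.r_inv[OF c] by simp
  qed
 qed
qed

theorem theorem1p9:
  fixes V :: "'v set" and E :: "'v set set" and \<Gamma> :: "('v \<Rightarrow> 'v) set"
    and Orb :: "'k::finite \<Rightarrow> 'v set set" and p :: "real \<Rightarrow> real ^ 'k"
  assumes "simple_graph V E"
    and "connected_graph V E"
    and "locally_finite_graph V E"
    and "subgroup \<Gamma> (graph_aut V E)"
    and "quasi_transitive V \<Gamma>"
    and "\<not> unimodular V \<Gamma>"
    and "bij_betw Orb UNIV (edge_orbits V E \<Gamma>)"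
    and "p ` {0..1} \<subseteq> {0..1}"
    and "continuous_on {0..1} p"
    and "mono_on {0..1} p"
    and "p 0 = 0"
    and "p 1 = 1"
    and "\<And>t i. 0 < t \<Longrightarrow> t < 1 \<Longrightarrow> 0 < p t $ i \<and> p t $ i < 1"
  shows "\<exists>I. is_interval I \<and> I \<subseteq> {0<..<1} \<and> (\<exists>a\<in>I. \<exists>b\<in>I. a < b) \<and>
    (\<forall>t\<in>I. AE \<omega> in bond_percolation E Orb (p t).
       \<exists>C\<in>clusters V (open_edges E \<omega>). infinite C) \<and>
    (\<forall>t\<in>I. tilted_susceptibility V E \<Gamma> Orb (p t) (1 / 2) < \<infinity>) \<and>
    (\<forall>t\<in>I. AE \<omega> in bond_percolation E Orb (p t).
       infinite {C \<in> clusters V (open_edges E \<omega>). infinite C \<and> light V E \<Gamma> C})"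
proof -
 have E_edge: "\<exists>u v. e = {u, v} & u \<in> V & v \<in> V & u \<noteq> v" if "e \<in> E" for e
  using assms(1) that unfolding simple_graph_def by blast
 have EV: "u \<in> V & v \<in> V" if "{u, v} \<in> E" for u v using E_edge[OF that] by (auto simp: doubleton_eq_iff)
 interpret gact V \<Gamma> by (rule graph_aut_action(1)[OF assms(4)])
 have EI: "{ga u, ga v} \<in> E" if "ga \<in> \<Gamma>" "{u, v} \<in> E" for ga u v
  using graph_aut_action(2)[OF assms(4) that(1)] EV[OF that(2)] that(2) by blast
 have EI': "ga ` e \<in> E" if "ga \<in> \<Gamma>" "e \<in> E" for ga e using E_edge[OF that(2)] EI[OF that(1)] that(2) by auto
 have nb: "finite {w. {v, w} \<in> E}" if "v \<in> V" for v
  using assms(3) that unfolding locally_finite_graph_def neighbours_def by blast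
 have conn: "\<exists>q. walk E V u v q" if uv: "u \<in> V" "v \<in> V" for u v
 proof -
  have "{(x, y). {x, y} \<in> E} = {(x, y). {x, y} \<in> E & (%_. True) {x, y} & x \<in> V & y \<in> V}" using EV by blast
  moreover have "(u, v) \<in> {(x, y). {x, y} \<in> E}\<^sup>*" using assms(2) uv unfolding connected_graph_def linked_def by blast
  ultimately have "(u, v) \<in> {(x, y). {x, y} \<in> E & (%_. True) {x, y} & x \<in> V & y \<in> V}\<^sup>*" by argo
  from rtrancl_walk[OF this uv(2)] show ?thesis by blast
 qed
 \<comment> \<open>An automorphism that fixes \<open>v\<close> maps a walk from \<open>v\<close> to
   a walk of the same length from \<open>v\<close>, so stabilizer orbits lie in balls, which are
   finite by local finiteness.\<close>
 have fs: "finite (sorb v u)" if vu: "v \<in> V" "u \<in> V" for v u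
 proof -
  obtain q where q: "walk E V v u q" using conn[OF vu] by blast
  have "sorb v u \<subseteq> {w. \<exists>p. walk E V v w p & length p <= Suc (length q)}"
  proof
   fix w assume "w \<in> sorb v u"
   then obtain ga where g: "ga \<in> \<Gamma>" "ga v = v" "w = ga u" unfolding sorb_def by blast
   have "walk E V v w (map ga q)" using q EI'[OF g(1)] gV[OF g(1)] g(2,3)
    unfolding walk_def edgs_map by (auto simp: hd_map last_map)
   then show "w \<in> {w. \<exists>p. walk E V v w p & length p <= Suc (length q)}" by (intro CollectI exI[of _ "map ga q"]) simp
  qed
  then show ?thesis by (rule finite_subset[OF _ finite_walk_ball[OF nb vu(1)]])
 qed
 have vo: "vertex_orbit V \<Gamma> v = orb v" for v unfolding vertex_orbit_def orbit_def orb_def by auto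
 have vos: "vertex_orbits V \<Gamma> = orb ` V" using vo unfolding vertex_orbits_def orbits_def vertex_orbit_def by auto
 have soc: "stab_orbit_card V \<Gamma> v u = sc v u" for v u
  unfolding stab_orbit_card_def vertex_orbit_def orbit_def stab_def stabilizer_def sc_def sorb_def
  by (rule arg_cong[of _ _ card]) auto
 interpret gr V \<Gamma> E
  by unfold_locales (use fs E_edge EI conn nb assms(5) in \<open>auto simp: quasi_transitive_def vos\<close>)
 obtain u0 v0 where uv: "u0 \<in> V" "v0 \<in> V" "orb u0 = orb v0" "sc v0 u0 \<noteq> sc u0 v0"
  using assms(6) unfolding unimodular_def vo soc by blast
 have v0: "v0 \<in> orb u0" using orb_refl[OF uv(2)] uv(3) by simp
 obtain L s b g q where h: "(0::real) < s" "0 < g" "g <= 1" "b \<in> V"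
  "\<forall>ga\<in>\<Gamma>. \<forall>x\<in>V. \<forall>y\<in>V. L (ga x) - L (ga y) = L x - L y"
  "\<forall>x\<in>orb b. rho x b = exp (s * (L x - L b))"
  "walk E V b (last q) q & last q \<in> orb b & L (last q) = L b + 1 &
   (\<forall>x\<in>set q. x = b \<or> x = last q \<or> L b + g <= L x & L x <= L b + 1 - g)"
  using height_exists[OF uv(1) v0 uv(4)] by (elim exE conjE) blast
 define pet where "pet t e = p t $ (THE i. e \<in> Orb i)" for t e
 have bp: "bond_percolation E Orb (p t) = PM E (pet t)" for t unfolding bond_percolation_def PM_def pet_def ..
 define eo where "eo e = (%ga. ga ` e) ` \<Gamma>" for e :: "'v set"
 have eo_orbit: "orbit (perm_group V \<Gamma>) (%g e. g ` e) e = eo e" for e unfolding orbit_def eo_def by auto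
 have eo_step: "eo (ga ` e) \<subseteq> eo e" if g: "ga \<in> \<Gamma>" and e: "e \<in> E" for ga e
 proof
  fix x assume "x \<in> eo (ga ` e)"
  then obtain \<delta> where d: "\<delta> \<in> \<Gamma>" "x = \<delta> ` ga ` e" unfolding eo_def by blast
  obtain \<eta> where n: "\<eta> \<in> \<Gamma>" "\<forall>x\<in>V. \<eta> x = \<delta> (ga x)" using g_comp[OF d(1) g] by blast
  have "x = \<eta> ` e" unfolding d(2) image_image using n(2) edge_sub[OF e] by (intro image_cong) auto
  then show "x \<in> eo e" unfolding eo_def using n(1) by blast
 qed
 have eo_inv: "eo (ga ` e) = eo e" if g: "ga \<in> \<Gamma>" and e: "e \<in> E" for ga e
 proof
  obtain \<eta> where n: "\<eta> \<in> \<Gamma>" "\<forall>x\<in>V. \<eta> (ga x) = x & ga (\<eta> x) = x" using g_inv[OF g] by blast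
  have "\<eta> ` ga ` e = (%x. x) ` e" unfolding image_image using n(2) edge_sub[OF e] by (intro image_cong) auto
  then show "eo e \<subseteq> eo (ga ` e)" using eo_step[OF n(1) EI'[OF g e]] by simp
 qed (rule eo_step[OF g e])
 have eo_refl: "e \<in> eo e" if e: "e \<in> E" for e
 proof -
  obtain ga where g: "ga \<in> \<Gamma>" "\<forall>x\<in>V. ga x = x" using g_id by blast
  have "ga ` e = (%x. x) ` e" using g(2) edge_sub[OF e] by (intro image_cong) auto
  then show ?thesis unfolding eo_def using g(1) by (intro image_eqI[of _ _ ga]) auto
 qed
 \<comment> \<open>The index selected by the definite description in \<open>bond_percolation\<close>
   is determined by the orbit of the edge; hence the edge parameters are invariant under
   \<open>\<Gamma>\<close>.\<close>
 have idx: "e \<in> Orb i \<longleftrightarrow> Orb i = eo e" if e: "e \<in> E" for e i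
 proof
  assume i: "e \<in> Orb i"
  have "Orb i \<in> edge_orbits V E \<Gamma>" using assms(7) unfolding bij_betw_def by blast
  then obtain f where f: "f \<in> E" "Orb i = eo f" unfolding edge_orbits_def orbits_def eo_orbit by blast
  then obtain ga where "ga \<in> \<Gamma>" "e = ga ` f" using i unfolding eo_def by blast
  then show "Orb i = eo e" using eo_inv f by simp
 qed (use eo_refl[OF e] in simp)
 have pb: "0 <= p t $ i & p t $ i <= 1" if "t \<in> {0..1}" for t i
 proof -
  have "p t \<in> {0..1}" using assms(8) that by blast
  then show ?thesis by (simp add: less_eq_vec_def)
 qed
 interpret P: hgp V \<Gamma> E L s g b pet
 proof unfold_locales
  show "L (ga x) - L (ga y) = L x - L y" if "ga \<in> \<Gamma>" "x \<in> V" "y \<in> V" for ga x y using h(5) that by blast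
  show "\<exists>p. walk E V b (last p) p & last p \<in> orb b & L (last p) = L b + 1 &
   (\<forall>x\<in>set p. x = b \<or> x = last p \<or> L b + g <= L x & L x <= L b + 1 - g)" using h(7) by (rule exI[of _ q])
  show "inv_pe (pet t)" if "t \<in> {0..1}" for t
   unfolding inv_pe_def
  proof (intro ballI conjI)
   fix e assume e: "e \<in> E"
   show "0 <= pet t e" "pet t e <= 1" using pb[OF that] unfolding pet_def by auto
   fix ga assume g: "ga \<in> \<Gamma>"
   have "ga ` e \<in> Orb i \<longleftrightarrow> e \<in> Orb i" for i unfolding idx[OF e] idx[OF EI'[OF g e]] eo_inv[OF g e] ..
   then show "pet t (ga ` e) = pet t e" unfolding pet_def by simp
  qed
  show "continuous_on {0..1} (%t. pet t e)" for e
   unfolding pet_def by (intro continuous_on_component assms(9))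
  show "pet t e <= pet t' e" if "0 <= t" "t <= t'" "t' <= 1" for t t' e
  proof -
   have "p t <= p t'" using assms(10) that by (auto simp: mono_on_def)
   then show ?thesis unfolding pet_def by (simp add: less_eq_vec_def)
  qed
  show "pet 0 e = 0" "pet 1 e = 1" for e unfolding pet_def by (simp_all add: assms(11,12))
  show "\<exists>c>0. \<forall>e\<in>E. c <= pet t e" if t: "0 < t" "t < 1" for t
  proof (intro exI[of _ "Min (range (%i. p t $ i))"] conjI ballI)
   show "0 < Min (range (%i. p t $ i))" using assms(13)[OF t] by (subst Min_gr_iff) auto
   show "Min (range (%i. p t $ i)) <= pet t e" for e unfolding pet_def by (rule Min_le) auto
  qed
 qed (use h in auto)
 have mu0: "0 <= mu V E \<Gamma> C" for C unfolding mu_def by (intro divide_nonneg_nonneg sum_nonneg) auto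
 \<comment> \<open>The comparison rests on \<open>mu\<close> being nonnegative and on the number of
   orbits being finite. If the weight of the orbit of \<open>v\<close> were 0, both sides would be
   0, since division by 0 yields 0.\<close>
 have mod: "\<exists>D. \<forall>w\<in>V. 0 <= modular V E \<Gamma> v w & modular V E \<Gamma> v w <= D * exp (s * (L w - L v))" if v: "v \<in> V" for v
 proof -
  obtain C where C: "0 < C" "!!y v. y \<in> V ==> v \<in> V ==> rho y v <= C * exp (s * (L y - L v))" using P.rho_bound by blast
  define Mm where "Mm = (\<Sum>D\<in>orb ` V. mu V E \<Gamma> D)"
  have "0 <= modular V E \<Gamma> v w & modular V E \<Gamma> v w <= (Mm / mu V E \<Gamma> (orb v) * C) * exp (s * (L w - L v))" if w: "w \<in> V" for w
  proof -
   have e: "modular V E \<Gamma> v w = mu V E \<Gamma> (orb w) / mu V E \<Gamma> (orb v) * rho w v"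
    unfolding modular_def vo soc rho_def by simp
   have "mu V E \<Gamma> (orb w) <= Mm" unfolding Mm_def by (rule member_le_sum) (use w mu0 orb_fin in auto)
   then have "mu V E \<Gamma> (orb w) / mu V E \<Gamma> (orb v) <= Mm / mu V E \<Gamma> (orb v)" by (intro divide_right_mono mu0)
   then have "modular V E \<Gamma> v w <= Mm / mu V E \<Gamma> (orb v) * (C * exp (s * (L w - L v)))"
    unfolding e using C(2)[OF w v] rho_pos[OF w v] mu0[of "orb w"] mu0[of "orb v"]
    by (intro mult_mono) (auto intro: order_trans[OF divide_nonneg_nonneg])
   moreover have "0 <= modular V E \<Gamma> v w" unfolding e using rho_pos[OF w v] mu0 by (intro mult_nonneg_nonneg divide_nonneg_nonneg) auto
   ultimately show ?thesis by (simp add: mult.assoc)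
  qed
  then show ?thesis by blast
 qed
 obtain t1 ts a where I: "0 < t1" "t1 < ts" "ts <= 1" "!!t. 0 <= t ==> t < ts ==> P.MM (pet t) (%a b. True) < \<infinity>"
  "a \<in> V" "0 < pp E (pet t1) (infc a)" using P.exists_interval[OF h(1)] by (auto simp: infinity_ennreal_def)
 have light_AE: "AE xi in bond_percolation E Orb (p t). infinite {C \<in> clusters V (open_edges E xi). infinite C & light V E \<Gamma> C}"
  if t: "t \<in> {t1<..<ts}" for t
  unfolding bp light_def
 proof (rule P.light_clusters_AE[OF P.P _ h(1) I(5) _ mod])
  show t01: "t \<in> {0..1}" using t I by auto
  show "P.MM (pet t) (%a b. True) < \<top>" using I(4)[of t] t I(1) by (simp add: infinity_ennreal_def)
  have "pp E (pet t1) (infc a) <= pp E (pet t) (infc a)"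
  proof (rule P.pp_infc_mono[OF _ I(5)])
   fix e assume e: "e \<in> E"
   show "0 <= pet t1 e & pet t1 e <= pet t e & pet t e <= 1"
    using P.pmono[OF _ _ _ e, of t1 t] pb[of t1] pb[of t] t I by (auto simp: pet_def)
  qed
  then show "0 < pp E (pet t) (infc a)" using I(6) by simp
 qed
 have tilt: "tilted_susceptibility V E \<Gamma> Orb (p t) (1 / 2) < \<infinity>" if t: "t \<in> {t1<..<ts}" for t
 proof -
  have M: "P.MM (pet t) (%a b. True) < \<top>" using I(4)[of t] t I(1) by (simp add: infinity_ennreal_def)
  have at: "tilted_susceptibility_at V E \<Gamma> Orb (p t) (1 / 2) v < \<top>" if v: "v \<in> V" for v
  proof -
   obtain D where D: "!!w. w \<in> V ==> 0 <= modular V E \<Gamma> v w & modular V E \<Gamma> v w <= D * exp (s * (L w - L v))" using mod[OF v] by blast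
   show ?thesis unfolding tilted_susceptibility_at_def
   proof (rule P.susceptibility_at_finite[OF M v D])
    show "connection_prob E Orb (p t) w v = cn (pet t) V w v" for w
    proof -
     have "occ (pf E V w v) xi = linked (open_edges E xi) w v" for xi by (rule occ_linked[OF v edge_sub])
     then show ?thesis unfolding connection_prob_def bp cn_def pp_def by simp
    qed
   qed
  qed
  have "rep C \<in> V" if "C \<in> orb ` V" for C
  proof -
   have "C \<noteq> {}" "C \<subseteq> V" using that orb_refl orb_sub by auto
   then show ?thesis unfolding rep_def using some_in_eq by blast
  qed
  then have "\<forall>C\<in>orb ` V. ennreal (mu V E \<Gamma> C) * tilted_susceptibility_at V E \<Gamma> Orb (p t) (1 / 2) (rep C) < \<top>"
   using at by (simp add: ennreal_mult_less_top)
  then show ?thesis unfolding tilted_susceptibility_def vos infinity_ennreal_def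
   using orb_fin by (simp add: ennreal_sum_less_top)
 qed
 show ?thesis
 proof (intro exI[of _ "{t1<..<ts}"] conjI ballI)
  show "\<exists>a\<in>{t1<..<ts}. \<exists>b\<in>{t1<..<ts}. a < b"
  proof (intro bexI)
   show "(2 * t1 + ts) / 3 < (t1 + 2 * ts) / 3" using I(2) by simp
  qed (use I(2) in auto)
  show "AE xi in bond_percolation E Orb (p t). \<exists>C\<in>clusters V (open_edges E xi). infinite C" if "t \<in> {t1<..<ts}" for t
   using light_AE[OF that]
  proof eventually_elim
   case (elim xi)
   then have "{C \<in> clusters V (open_edges E xi). infinite C & light V E \<Gamma> C} \<noteq> {}" by force
   then show ?case by blast
  qed
 qed (use I tilt light_AE in auto)
qed

end
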